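(* Let $(x,u)$ be an optimal solution of the optimal control problem (OCP) on $[0,T]$ with adjoint state $\lambda$, and suppose that Assumption (S), stated in the context, holds. Let $0<\tau\le T$ and consider $$I^\tau(x,u):=\int_0^\tau \bar J(t,x,u)\,dt .$$ Let $\chi=(v,q,z)\in W([0,T])\times L_2(0,T;U)\times W([0,T])$ solve $$L''(x,u,\lambda)\chi=\begin{pmatrix} L_{xx}(x,u)&0&-\frac{d}{dt}-A'(x)^*\\ 0&0&E_T\\ 0&J_{uu}(x,u)&-B^*\\ \frac{d}{dt}-A'(x)&-B&0\\ E_0&0&0\end{pmatrix}\begin{pmatrix} v\\ q\\ z\end{pmatrix}=-\begin{pmatrix} I^\tau_x(x,u)\\ 0\\ I^\tau_u(x,u)\\ 0\\ 0\end{pmatrix}.$$ Then, defining $$M:=\begin{pmatrix} C^*C&-\frac{d}{dt}-A'(x)^*\\ 0&E_T\\ \frac{d}{dt}-A'(x)&-BJ_{uu}(x,u)^{-1}B^*\\ E_0&0\end{pmatrix},$$ the solution operator norm $\|M^{-1}\|_{L((L_2(0,T;V^* )\times H)^2,\,W([0,T])^2)}$ can be bounded independently of $T$. Further, for all $\mu>0$ satisfying $$\mu<\frac{1}{\|M^{-1}\|_{L((L_2(0,T;V^* )\times H)^2,\,W([0,T])^2)}}$$ there is a constant $c(\tau)>0$ independent of $T$ such that $$\left\|e^{\mu t}\begin{pmatrix} v\\ q\\ z\end{pmatrix}\right\|_{W([0,T])\times L_2(0,T;U)\times W([0,T])}\le c(\tau)\big(\|J_x(x,u)\|_{L_2(0,\tau;V^*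 )}+\|J_u(x,u)\|_{L_2(0,\tau;U)}\big).$$
   Context: **Spaces.** $(V,\|\cdot\|_V)$ is a separable Banach space, $(H,\langle\cdot,\cdot\rangle)$ is a Hilbert space with norm $\|\cdot\|$, and $V\hookrightarrow H\cong H^*\hookrightarrow V^*$ is a Gelfand triple (continuous and dense embeddings). $U$ is a Hilbert space. For $T>0$, $W([0,T]):=\{v:[0,T]\to V \mid v\in L_2(0,T;V),\ \dot v\in L_2(0,T;V^* )\}$ with its usual norm, where $\dot v$ (also written $\frac{d}{dt}v$) is the weak time derivative; $W([0,T])\hookrightarrow C(0,T;H)$. For $t\in[0,T]$, $E_t:C(0,T;H)\to H$, $E_tv=v(t)$, is time evaluation. **Problem (OCP).** Minimize $J(x,u):=\int_0^T\bar J(t,x(t),u(t))\,dt$ subject to $\dot x(t)=\bar A(x(t))+\bar Bu(t)+f(t)$ for a.e. $t\in[0,T]$, $x(0)=x_0$, where $x_0\in H$, $f\in L_2(0,T;V^* )$. For a.e. $t$, $\bar J(t,\cdot,\cdot)$ is twice continuously Fréchet differentiable on $V\times U$; $J$ is twice continuously Fréchet differentiable on $L_2(0,T;V)\times L_2(0,T;U)$; $J_{xu}=J_{ux}=0$; $\bar B:U\to V^*$ is linear and continuous; $\bar A:V\to V^*$ is twice continuously Fréchet differentiable. $A$ and $B$ are the induced operators $\langle A(x),\lambda\rangle_{L_2(0,T;V^* )\times L_2(0,T;V)}=\int_0^T\langle\bar A(x),\lambda\rangle_{V^*\times V}\,dt$ and $\langle Bu,\lambda\rangle_{L_2(0,T;V^*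 )\times L_2(0,T;V)}=\int_0^T\langle\bar Bu,\lambda\rangle_{V^*\times V}\,dt$. The problem is assumed to have a solution with $x\in W([0,T])$; the adjoint state $\lambda\in W([0,T])$ satisfies $J_x(x,u)-\dot\lambda-A'(x)^*\lambda=0$, $\lambda(T)=0$, $J_u(x,u)-B^*\lambda=0$. $L''(x,u,\lambda)$ is the second derivative of the Lagrange function of (OCP), whose state-state block is $L_{xx}(x,u):=J_{xx}(x,u)-A''(x)^*\lambda$. Subscripts $x,u$ denote partial derivatives; $\|J_x(x,u)\|_{L_2(0,\tau;V^* )}$ and $\|J_u(x,u)\|_{L_2(0,\tau;U)}$ are the norms of the restrictions to $(0,\tau)$. **Assumption (S)** (where $(x,u)$ is an optimal solution of (OCP)). - There is a Banach space $(Y,\|\cdot\|_Y)$ and an operator $C\in L(L_2(0,T;V),L_2(0,T;Y))$ such that $L_{xx}(x,u)=C^*C$. - There is an operator $R\in L(L_2(0,T;U),L_2(0,T;U))$ satisfying the coercivity condition $\|Ru\|_{L_2(0,T;U)}\ge\alpha\|u\|_{L_2(0,T;U)}$ for $\alpha>0$ such that $J_{uu}(x,u)=R^*R$. - $A'(x)\in L(L_2(0,T;V),L_2(0,T;V^* ))$. - $(A'(x),C)$ is exponentially detectable in the sense that there are $K_C\in L(L_2(0,T;Y),L_2(0,T;V^* ))$ and $\alpha>0$ such that $-\langle(A'(x)+K_CC)v,v\rangle_{L_2(0,T;V^* )\times L_2(0,T;V)}\ge\alpha\|v\|^2_{L_2(0,T;V)}$ for all $v\in L_2(0,T;V)$.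 - $(A'(x),B)$ is exponentially stabilizable in the sense that there are $K_B\in L(L_2(0,T;V),L_2(0,T;U))$ and $\alpha>0$ such that $-\langle(A'(x)+BK_B)v,v\rangle_{L_2(0,T;V^* )\times L_2(0,T;V)}\ge\alpha\|v\|^2_{L_2(0,T;V)}$ for all $v\in L_2(0,T;V)$. - $\|A'(x)\|_{L(L_2(0,T;V),L_2(0,T;V^* ))}$, $\|B\|_{L(L_2(0,T;U),L_2(0,T;V^* ))}$, $\|C\|_{L(L_2(0,T;V),L_2(0,T;Y))}$ and $\|R\|_{L(L_2(0,T;U))}$ can be bounded independently of $T$.
   Formalization: Y is a Hilbert space (C*C needs one); the embedding of V into H has norm at most 1; K_C and K_B are also bounded, and α is chosen, independently of T; μ<1/‖M⁻¹‖ uses the supremum of ‖M⁻¹‖ over T. The claim fails without the bounds on K_C, K_B and the embedding. *)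

theory Defs
  imports "HOL-Analysis.Analysis" "HOL-Library.Function_Algebras"
begin

section \<open>Seminormed function spaces\<close>

instantiation "fun" :: (type, real_vector) real_vector
begin

definition scaleR_fun :: "real \<Rightarrow> ('a \<Rightarrow> 'b) \<Rightarrow> 'a \<Rightarrow> 'b"
  where "scaleR_fun c f = (\<lambda>t. c *\<^sub>R f t)"

instance
  by standard (auto simp: scaleR_fun_def plus_fun_def scaleR_add_right scaleR_add_left)

end

text \<open>
  The spaces \<open>L\<^sub>2(0,T;X)\<close> and \<open>W([0,T])\<close> depend on the real parameter \<open>T\<close>. They are represented by
  carrier sets of functions together with a seminorm; two representatives denote the same
  element iff the seminorm of their difference is zero. In this section \<open>(S, p)\<close> and \<open>(S', q)\<close>
  are such carriers with their seminorms.
\<close>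

definition op_bounds :: "'a set \<Rightarrow> ('a \<Rightarrow> real) \<Rightarrow> ('b \<Rightarrow> real) \<Rightarrow> ('a \<Rightarrow> 'b) \<Rightarrow> real set"
  where "op_bounds S p q F = {c. 0 \<le> c \<and> (\<forall>a\<in>S. q (F a) \<le> c * p a)}"

text \<open>Meaningful only if the set of bounds is nonempty, which is part of \<open>bounded_linear_on\<close> below.\<close>

definition op_norm :: "'a set \<Rightarrow> ('a \<Rightarrow> real) \<Rightarrow> ('b \<Rightarrow> real) \<Rightarrow> ('a \<Rightarrow> 'b) \<Rightarrow> real"
  where "op_norm S p q F = Inf (op_bounds S p q F)"

definition bounded_linear_on ::
  "'a::real_vector set \<Rightarrow> ('a \<Rightarrow> real) \<Rightarrow> 'b::real_vector set \<Rightarrow> ('b \<Rightarrow> real) \<Rightarrow> ('a \<Rightarrow> 'b) \<Rightarrow> bool"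
  where "bounded_linear_on S p S' q F \<longleftrightarrow>
    (\<forall>a\<in>S. F a \<in> S') \<and>
    (\<forall>a\<in>S. \<forall>b\<in>S. q (F (a + b) - (F a + F b)) = 0) \<and>
    (\<forall>c. \<forall>a\<in>S. q (F (c *\<^sub>R a) - c *\<^sub>R F a) = 0) \<and>
    op_bounds S p q F \<noteq> {}"

definition dual_space :: "'a::real_vector set \<Rightarrow> ('a \<Rightarrow> real) \<Rightarrow> ('a \<Rightarrow> real) set"
  where "dual_space S p = {\<phi>. bounded_linear_on S p UNIV norm \<phi>}"

definition dual_norm :: "'a::real_vector set \<Rightarrow> ('a \<Rightarrow> real) \<Rightarrow> ('a \<Rightarrow> real) \<Rightarrow> real"
  where "dual_norm S p = op_norm S p norm"

definition invertible_on ::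
  "'a::real_vector set \<Rightarrow> ('a \<Rightarrow> real) \<Rightarrow> 'b::real_vector set \<Rightarrow> ('b \<Rightarrow> real) \<Rightarrow> ('a \<Rightarrow> 'b) \<Rightarrow> bool"
  where "invertible_on S p S' q F \<longleftrightarrow>
    bounded_linear_on S p S' q F \<and>
    (\<forall>b\<in>S'. \<exists>a\<in>S. q (F a - b) = 0) \<and>
    (\<forall>a\<in>S. q (F a) = 0 \<longrightarrow> p a = 0)"

definition inverse_on ::
  "'a::real_vector set \<Rightarrow> ('b::real_vector \<Rightarrow> real) \<Rightarrow> ('a \<Rightarrow> 'b) \<Rightarrow> 'b \<Rightarrow> 'a"
  where "inverse_on S q F b = (SOME a. a \<in> S \<and> q (F a - b) = 0)"

subsection \<open>Frechet derivatives\<close>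

definition has_frechet_on ::
  "'a::real_vector set \<Rightarrow> ('a \<Rightarrow> real) \<Rightarrow> 'b::real_vector set \<Rightarrow> ('b \<Rightarrow> real)
    \<Rightarrow> ('a \<Rightarrow> 'b) \<Rightarrow> ('a \<Rightarrow> 'b) \<Rightarrow> 'a \<Rightarrow> bool"
  where "has_frechet_on S p S' q F D a \<longleftrightarrow>
    bounded_linear_on S p S' q D \<and>
    (\<forall>\<epsilon>>0. \<exists>\<delta>>0. \<forall>h\<in>S. p h < \<delta> \<longrightarrow> q (F (a + h) - F a - D h) \<le> \<epsilon> * p h)"

text \<open>First derivative of a functional on \<open>S\<close>, and derivative of the resulting map into the dual.\<close>

definition deriv1 :: "'a::real_vector set \<Rightarrow> ('a \<Rightarrow> real) \<Rightarrow> ('a \<Rightarrow> real) \<Rightarrow> 'a \<Rightarrow> 'a \<Rightarrow> real"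
  where "deriv1 S p F a = (SOME D. has_frechet_on S p UNIV norm F D a)"

definition deriv2 :: "'a::real_vector set \<Rightarrow> ('a \<Rightarrow> real) \<Rightarrow> ('a \<Rightarrow> real) \<Rightarrow> 'a \<Rightarrow> 'a \<Rightarrow> 'a \<Rightarrow> real"
  where "deriv2 S p F a =
    (SOME D. has_frechet_on S p (dual_space S p) (dual_norm S p) (deriv1 S p F) D a)"

definition C2_on :: "'a::real_vector set \<Rightarrow> ('a \<Rightarrow> real) \<Rightarrow> ('a \<Rightarrow> real) \<Rightarrow> bool"
  where "C2_on S p F \<longleftrightarrow> (\<exists>D1 D2.
    (\<forall>a\<in>S. has_frechet_on S p UNIV norm F (D1 a) a) \<and>
    (\<forall>a\<in>S. has_frechet_on S p (dual_space S p) (dual_norm S p) D1 (D2 a) a) \<and>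
    (\<forall>a\<in>S. \<forall>\<epsilon>>0. \<exists>\<delta>>0. \<forall>b\<in>S. p (b - a) < \<delta> \<longrightarrow>
       op_norm S p (dual_norm S p) (D2 b - D2 a) < \<epsilon>))"

definition C2_frechet :: "('a::real_normed_vector \<Rightarrow> 'b::real_normed_vector) \<Rightarrow> bool"
  where "C2_frechet F \<longleftrightarrow>
    (\<exists>(D1 :: 'a \<Rightarrow> 'a \<Rightarrow>\<^sub>L 'b) (D2 :: 'a \<Rightarrow> 'a \<Rightarrow>\<^sub>L ('a \<Rightarrow>\<^sub>L 'b)).
      (\<forall>a. (F has_derivative blinfun_apply (D1 a)) (at a)) \<and>
      (\<forall>a. (D1 has_derivative blinfun_apply (D2 a)) (at a)) \<and>
      continuous_on UNIV D2)"

section \<open>Bochner spaces\<close>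

text \<open>
  Bochner measurability, stated without a countability class because the dual space
  \<open>'v \<Rightarrow>\<^sub>L real\<close> is not an instance of one.
\<close>

definition strongly_measurable :: "'a measure \<Rightarrow> ('a \<Rightarrow> 'b::real_normed_vector) \<Rightarrow> bool"
  where "strongly_measurable M f \<longleftrightarrow>
    (\<exists>s::nat \<Rightarrow> 'a \<Rightarrow> 'b. (\<forall>i. simple_function M (s i)) \<and>
      (AE t in M. (\<lambda>i. s i t) \<longlonglongrightarrow> f t))"

definition L2 :: "real \<Rightarrow> (real \<Rightarrow> 'b::real_normed_vector) set"
  where "L2 T = {f. strongly_measurable (lebesgue_on {0..T}) f \<and>
    integrable (lebesgue_on {0..T}) (\<lambda>t. (norm (f t))\<^sup>2)}"

definition L2norm :: "real \<Rightarrow> (real \<Rightarrow> 'b::real_normed_vector) \<Rightarrow> real"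
  where "L2norm T f = sqrt (LINT t|lebesgue_on {0..T}. (norm (f t))\<^sup>2)"

abbreviation L2_operator ::
  "real \<Rightarrow> ((real \<Rightarrow> 'a::real_normed_vector) \<Rightarrow> (real \<Rightarrow> 'b::real_normed_vector)) \<Rightarrow> bool"
  where "L2_operator T \<equiv> bounded_linear_on (L2 T) (L2norm T) (L2 T) (L2norm T)"

abbreviation L2_opnorm ::
  "real \<Rightarrow> ((real \<Rightarrow> 'a::real_normed_vector) \<Rightarrow> (real \<Rightarrow> 'b::real_normed_vector)) \<Rightarrow> real"
  where "L2_opnorm T \<equiv> op_norm (L2 T) (L2norm T) (L2norm T)"

definition L2_inner :: "real \<Rightarrow> (real \<Rightarrow> 'b::real_inner) \<Rightarrow> (real \<Rightarrow> 'b) \<Rightarrow> real"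
  where "L2_inner T f g = (LINT t|lebesgue_on {0..T}. f t \<bullet> g t)"

definition L2_pair :: "real \<Rightarrow> (real \<Rightarrow> 'b::real_normed_vector \<Rightarrow>\<^sub>L real) \<Rightarrow> (real \<Rightarrow> 'b) \<Rightarrow> real"
  where "L2_pair T g v = (LINT t|lebesgue_on {0..T}. g t (v t))"

text \<open>
  The functions representing a functional under the identifications
  \<open>L\<^sub>2(0,T;V)* = L\<^sub>2(0,T;V*)\<close> and \<open>L\<^sub>2(0,T;U)* = L\<^sub>2(0,T;U)\<close>.
\<close>

definition L2_dual_rep ::
  "real \<Rightarrow> ((real \<Rightarrow> 'b::real_normed_vector) \<Rightarrow> real) \<Rightarrow> (real \<Rightarrow> 'b \<Rightarrow>\<^sub>L real)"
  where "L2_dual_rep T \<phi> = (SOME g. g \<in> L2 T \<and> (\<forall>h\<in>L2 T. \<phi> h = L2_pair T g h))"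

definition L2_riesz_rep :: "real \<Rightarrow> ((real \<Rightarrow> 'b::real_inner) \<Rightarrow> real) \<Rightarrow> (real \<Rightarrow> 'b)"
  where "L2_riesz_rep T \<phi> = (SOME g. g \<in> L2 T \<and> (\<forall>h\<in>L2 T. \<phi> h = L2_inner T g h))"

section \<open>Gelfand triple and the space \<open>W([0,T])\<close>\<close>

text \<open>The embedding of \<open>H\<close> into \<open>V*\<close> through the Riesz identification of \<open>H\<close> with its dual.\<close>

definition emb_dual ::
  "('v::real_normed_vector \<Rightarrow>\<^sub>L 'h::real_inner) \<Rightarrow> 'h \<Rightarrow> ('v \<Rightarrow>\<^sub>L real)"
  where "emb_dual \<iota> h = blinfun_inner_right h o\<^sub>L \<iota>"

definition gelfand_triple :: "('v::real_normed_vector \<Rightarrow>\<^sub>L 'h::real_inner) \<Rightarrow> bool"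
  where "gelfand_triple \<iota> \<longleftrightarrow>
    inj (blinfun_apply \<iota>) \<and> closure (range (blinfun_apply \<iota>)) = UNIV \<and>
    inj (emb_dual \<iota>) \<and> closure (range (emb_dual \<iota>)) = UNIV"

definition test_function :: "real \<Rightarrow> (real \<Rightarrow> real) \<Rightarrow> bool"
  where "test_function T \<phi> \<longleftrightarrow>
    (\<forall>n t. ((deriv ^^ n) \<phi>) differentiable (at t)) \<and>
    (\<exists>a b. 0 < a \<and> b < T \<and> (\<forall>t. t \<notin> {a..b} \<longrightarrow> \<phi> t = 0))"

text \<open>
  The \<open>V*\<close>-valued identity \<open>\<integral> \<phi>' v dt = - \<integral> \<phi> g dt\<close> between Bochner integrals, evaluated at
  every \<open>w\<close> in \<open>V\<close>.
\<close>

definition has_weak_deriv ::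
  "('v::real_normed_vector \<Rightarrow>\<^sub>L 'h::real_inner) \<Rightarrow> real \<Rightarrow> (real \<Rightarrow> 'v) \<Rightarrow> (real \<Rightarrow> 'v \<Rightarrow>\<^sub>L real) \<Rightarrow> bool"
  where "has_weak_deriv \<iota> T v g \<longleftrightarrow>
    (\<forall>\<phi> w. test_function T \<phi> \<longrightarrow>
      (LINT t|lebesgue_on {0..T}. deriv \<phi> t * emb_dual \<iota> (\<iota> (v t)) w) =
      - (LINT t|lebesgue_on {0..T}. \<phi> t * g t w))"

definition W :: "('v::real_normed_vector \<Rightarrow>\<^sub>L 'h::real_inner) \<Rightarrow> real \<Rightarrow> (real \<Rightarrow> 'v) set"
  where "W \<iota> T = {v \<in> L2 T. \<exists>g\<in>L2 T. has_weak_deriv \<iota> T v g}"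

definition wderiv ::
  "('v::real_normed_vector \<Rightarrow>\<^sub>L 'h::real_inner) \<Rightarrow> real \<Rightarrow> (real \<Rightarrow> 'v) \<Rightarrow> (real \<Rightarrow> 'v \<Rightarrow>\<^sub>L real)"
  where "wderiv \<iota> T v = (SOME g. g \<in> L2 T \<and> has_weak_deriv \<iota> T v g)"

definition Wnorm :: "('v::real_normed_vector \<Rightarrow>\<^sub>L 'h::real_inner) \<Rightarrow> real \<Rightarrow> (real \<Rightarrow> 'v) \<Rightarrow> real"
  where "Wnorm \<iota> T v = sqrt ((L2norm T v)\<^sup>2 + (L2norm T (wderiv \<iota> T v))\<^sup>2)"

text \<open>Time evaluation of the representative in \<open>C([0,T];H)\<close>.\<close>

definition time_eval ::
  "('v::real_normed_vector \<Rightarrow>\<^sub>L 'h::real_inner) \<Rightarrow> real \<Rightarrow> real \<Rightarrow> (real \<Rightarrow> 'v) \<Rightarrow> 'h"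
  where "time_eval \<iota> T t v =
    (THE h. \<exists>w. continuous_on {0..T} w \<and> (AE s in lebesgue_on {0..T}. w s = \<iota> (v s)) \<and> w t = h)"

section \<open>The optimal control problem\<close>

record (overloaded) ('v, 'h, 'u) ocp =
  emb :: "'v::{banach,second_countable_topology} \<Rightarrow>\<^sub>L 'h::{real_inner,banach}"
  Jbar :: "real \<Rightarrow> 'v \<Rightarrow> 'u::{real_inner,banach} \<Rightarrow> real"
  Abar :: "'v \<Rightarrow> 'v \<Rightarrow>\<^sub>L real"
  Bbar :: "'u \<Rightarrow>\<^sub>L ('v \<Rightarrow>\<^sub>L real)"
  source :: "real \<Rightarrow> 'v \<Rightarrow>\<^sub>L real"
  init :: "'h"

type_synonym ('v, 'u) control_pair = "(real \<Rightarrow> 'v) \<times> (real \<Rightarrow> 'u)"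

definition XU :: "real \<Rightarrow> ('v::real_normed_vector, 'u::real_normed_vector) control_pair set"
  where "XU T = L2 T \<times> L2 T"

definition XUnorm :: "real \<Rightarrow> ('v::real_normed_vector, 'u::real_normed_vector) control_pair \<Rightarrow> real"
  where "XUnorm T = (\<lambda>(x, u). sqrt ((L2norm T x)\<^sup>2 + (L2norm T u)\<^sup>2))"

text \<open>\<open>cost P T\<close> is \<open>J\<close> on the horizon \<open>T\<close>; \<open>cost P \<tau>\<close> is \<open>I\<^sup>\<tau>\<close>.\<close>

definition cost ::
  "('v::{banach,second_countable_topology}, 'h::{real_inner,banach}, 'u::{real_inner,banach}) ocp
    \<Rightarrow> real \<Rightarrow> ('v, 'u) control_pair \<Rightarrow> real"
  where "cost P T = (\<lambda>(x, u). LINT t|lebesgue_on {0..T}. Jbar P t (x t) (u t))"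

text \<open>
  Partial derivatives of a functional \<open>F\<close> on \<open>L\<^sub>2(0,T;V) \<times> L\<^sub>2(0,T;U)\<close>, as functionals and as
  bilinear forms.
\<close>

definition deriv_x ::
  "real \<Rightarrow> (('v::real_normed_vector, 'u::real_normed_vector) control_pair \<Rightarrow> real)
    \<Rightarrow> ('v, 'u) control_pair \<Rightarrow> (real \<Rightarrow> 'v) \<Rightarrow> real"
  where "deriv_x T F a h = deriv1 (XU T) (XUnorm T) F a (h, 0)"

definition deriv_u ::
  "real \<Rightarrow> (('v::real_normed_vector, 'u::real_normed_vector) control_pair \<Rightarrow> real)
    \<Rightarrow> ('v, 'u) control_pair \<Rightarrow> (real \<Rightarrow> 'u) \<Rightarrow> real"
  where "deriv_u T F a k = deriv1 (XU T) (XUnorm T) F a (0, k)"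

definition deriv_xx ::
  "real \<Rightarrow> (('v::real_normed_vector, 'u::real_normed_vector) control_pair \<Rightarrow> real)
    \<Rightarrow> ('v, 'u) control_pair \<Rightarrow> (real \<Rightarrow> 'v) \<Rightarrow> (real \<Rightarrow> 'v) \<Rightarrow> real"
  where "deriv_xx T F a h h' = deriv2 (XU T) (XUnorm T) F a (h, 0) (h', 0)"

definition deriv_xu ::
  "real \<Rightarrow> (('v::real_normed_vector, 'u::real_normed_vector) control_pair \<Rightarrow> real)
    \<Rightarrow> ('v, 'u) control_pair \<Rightarrow> (real \<Rightarrow> 'v) \<Rightarrow> (real \<Rightarrow> 'u) \<Rightarrow> real"
  where "deriv_xu T F a h k = deriv2 (XU T) (XUnorm T) F a (h, 0) (0, k)"

definition deriv_ux ::
  "real \<Rightarrow> (('v::real_normed_vector, 'u::real_normed_vector) control_pair \<Rightarrow> real)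
    \<Rightarrow> ('v, 'u) control_pair \<Rightarrow> (real \<Rightarrow> 'u) \<Rightarrow> (real \<Rightarrow> 'v) \<Rightarrow> real"
  where "deriv_ux T F a k h = deriv2 (XU T) (XUnorm T) F a (0, k) (h, 0)"

definition deriv_uu ::
  "real \<Rightarrow> (('v::real_normed_vector, 'u::real_normed_vector) control_pair \<Rightarrow> real)
    \<Rightarrow> ('v, 'u) control_pair \<Rightarrow> (real \<Rightarrow> 'u) \<Rightarrow> (real \<Rightarrow> 'u) \<Rightarrow> real"
  where "deriv_uu T F a k k' = deriv2 (XU T) (XUnorm T) F a (0, k) (0, k')"

definition ocp_assms ::
  "('v::{banach,second_countable_topology}, 'h::{real_inner,banach}, 'u::{real_inner,banach}) ocp
    \<Rightarrow> real \<Rightarrow> bool"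
  where "ocp_assms P T \<longleftrightarrow>
    gelfand_triple (emb P) \<and>
    source P \<in> L2 T \<and>
    C2_frechet (Abar P) \<and>
    (AE t in lebesgue_on {0..T}. C2_frechet (\<lambda>(x, u). Jbar P t x u)) \<and>
    (\<forall>(x, u)\<in>XU T. integrable (lebesgue_on {0..T}) (\<lambda>t. Jbar P t (x t) (u t))) \<and>
    C2_on (XU T) (XUnorm T) (cost P T) \<and>
    (\<forall>a\<in>XU T. \<forall>h\<in>L2 T. \<forall>k\<in>L2 T.
       deriv_xu T (cost P T) a h k = 0 \<and> deriv_ux T (cost P T) a k h = 0)"

definition admissible ::
  "('v::{banach,second_countable_topology}, 'h::{real_inner,banach}, 'u::{real_inner,banach}) ocp
    \<Rightarrow> real \<Rightarrow> (real \<Rightarrow> 'v) \<Rightarrow> (real \<Rightarrow> 'u) \<Rightarrow> bool"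
  where "admissible P T x u \<longleftrightarrow>
    x \<in> W (emb P) T \<and> u \<in> L2 T \<and>
    (AE t in lebesgue_on {0..T}.
       wderiv (emb P) T x t = Abar P (x t) + Bbar P (u t) + source P t) \<and>
    time_eval (emb P) T 0 x = init P"

definition optimal_solution ::
  "('v::{banach,second_countable_topology}, 'h::{real_inner,banach}, 'u::{real_inner,banach}) ocp
    \<Rightarrow> real \<Rightarrow> (real \<Rightarrow> 'v) \<Rightarrow> (real \<Rightarrow> 'u) \<Rightarrow> bool"
  where "optimal_solution P T x u \<longleftrightarrow>
    admissible P T x u \<and> (\<forall>y w. admissible P T y w \<longrightarrow> cost P T (x, u) \<le> cost P T (y, w))"

text \<open>The induced operators \<open>A'(x)\<close> and \<open>B\<close>; adjoints are expressed by duality pairings.\<close>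

definition A_deriv ::
  "('v::{banach,second_countable_topology}, 'h::{real_inner,banach}, 'u::{real_inner,banach}) ocp
    \<Rightarrow> (real \<Rightarrow> 'v) \<Rightarrow> (real \<Rightarrow> 'v) \<Rightarrow> (real \<Rightarrow> 'v \<Rightarrow>\<^sub>L real)"
  where "A_deriv P x h = (\<lambda>t. frechet_derivative (Abar P) (at (x t)) (h t))"

definition B_op ::
  "('v::{banach,second_countable_topology}, 'h::{real_inner,banach}, 'u::{real_inner,banach}) ocp
    \<Rightarrow> (real \<Rightarrow> 'u) \<Rightarrow> (real \<Rightarrow> 'v \<Rightarrow>\<^sub>L real)"
  where "B_op P q = (\<lambda>t. Bbar P (q t))"

definition A_deriv2 ::
  "('v::{banach,second_countable_topology}, 'h::{real_inner,banach}, 'u::{real_inner,banach}) ocp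
    \<Rightarrow> (real \<Rightarrow> 'v) \<Rightarrow> (real \<Rightarrow> 'v) \<Rightarrow> (real \<Rightarrow> 'v) \<Rightarrow> (real \<Rightarrow> 'v \<Rightarrow>\<^sub>L real)"
  where "A_deriv2 P x h h' =
    (\<lambda>t. frechet_derivative (\<lambda>y. frechet_derivative (Abar P) (at y) (h t)) (at (x t)) (h' t))"

definition adjoint_state ::
  "('v::{banach,second_countable_topology}, 'h::{real_inner,banach}, 'u::{real_inner,banach}) ocp
    \<Rightarrow> real \<Rightarrow> (real \<Rightarrow> 'v) \<Rightarrow> (real \<Rightarrow> 'u) \<Rightarrow> (real \<Rightarrow> 'v) \<Rightarrow> bool"
  where "adjoint_state P T x u lam \<longleftrightarrow>
    lam \<in> W (emb P) T \<and>
    (\<forall>h\<in>L2 T. deriv_x T (cost P T) (x, u) h - L2_pair T (wderiv (emb P) T lam) h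
       - L2_pair T (A_deriv P x h) lam = 0) \<and>
    time_eval (emb P) T T lam = 0 \<and>
    (\<forall>k\<in>L2 T. deriv_u T (cost P T) (x, u) k - L2_pair T (B_op P k) lam = 0)"

definition L_xx ::
  "('v::{banach,second_countable_topology}, 'h::{real_inner,banach}, 'u::{real_inner,banach}) ocp
    \<Rightarrow> real \<Rightarrow> (real \<Rightarrow> 'v) \<Rightarrow> (real \<Rightarrow> 'u) \<Rightarrow> (real \<Rightarrow> 'v) \<Rightarrow> (real \<Rightarrow> 'v) \<Rightarrow> (real \<Rightarrow> 'v) \<Rightarrow> real"
  where "L_xx P T x u lam h h' =
    deriv_xx T (cost P T) (x, u) h h' - L2_pair T (A_deriv2 P x h h') lam"

section \<open>Detectability and stabilizability\<close>

text \<open>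
  The coercivity constant \<open>\<alpha>\<close> and the norm bound \<open>\<kappa>\<close> are parameters, so that they can be chosen
  independently of the horizon \<open>T\<close>; the bound also covers the gains \<open>K\<^sub>C\<close> and \<open>K\<^sub>B\<close>, which enter every
  estimate. \<open>Y\<close> is a Hilbert space, since \<open>C*C\<close> requires an identification of \<open>L\<^sub>2(0,T;Y)\<close> with its
  dual. The factorizations \<open>L\<^sub>x\<^sub>x = C*C\<close> and \<open>J\<^sub>u\<^sub>u = R*R\<close> are identities
  between the associated bilinear forms. The integrability clause expresses that the term
  \<open>A''(x)*\<lambda>\<close> of \<open>L\<^sub>x\<^sub>x\<close> is well-defined.
\<close>

definition assumption_S ::
  "('v::{banach,second_countable_topology}, 'h::{real_inner,banach}, 'u::{real_inner,banach}) ocp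
    \<Rightarrow> real \<Rightarrow> real \<Rightarrow> real \<Rightarrow> (real \<Rightarrow> 'v) \<Rightarrow> (real \<Rightarrow> 'u) \<Rightarrow> (real \<Rightarrow> 'v)
    \<Rightarrow> ((real \<Rightarrow> 'v) \<Rightarrow> (real \<Rightarrow> 'y::{real_inner,banach}))
    \<Rightarrow> ((real \<Rightarrow> 'u) \<Rightarrow> (real \<Rightarrow> 'u))
    \<Rightarrow> ((real \<Rightarrow> 'y) \<Rightarrow> (real \<Rightarrow> 'v \<Rightarrow>\<^sub>L real))
    \<Rightarrow> ((real \<Rightarrow> 'v) \<Rightarrow> (real \<Rightarrow> 'u)) \<Rightarrow> bool"
  where "assumption_S P T \<alpha> \<kappa> x u lam C R KC KB \<longleftrightarrow>
    L2_operator T C \<and>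
    (\<forall>h\<in>L2 T. \<forall>h'\<in>L2 T.
       integrable (lebesgue_on {0..T}) (\<lambda>t. A_deriv2 P x h h' t (lam t)) \<and>
       L_xx P T x u lam h h' = L2_inner T (C h) (C h')) \<and>
    L2_operator T R \<and>
    (\<forall>q\<in>L2 T. L2norm T (R q) \<ge> \<alpha> * L2norm T q) \<and>
    (\<forall>q\<in>L2 T. \<forall>k\<in>L2 T. deriv_uu T (cost P T) (x, u) q k = L2_inner T (R q) (R k)) \<and>
    L2_operator T (A_deriv P x) \<and>
    L2_operator T KC \<and>
    (\<forall>v\<in>L2 T. - L2_pair T (A_deriv P x v + KC (C v)) v \<ge> \<alpha> * (L2norm T v)\<^sup>2) \<and>
    L2_operator T KB \<and>
    (\<forall>v\<in>L2 T. - L2_pair T (A_deriv P x v + B_op P (KB v)) v \<ge> \<alpha> * (L2norm T v)\<^sup>2) \<and>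
    L2_opnorm T (A_deriv P x) \<le> \<kappa> \<and>
    L2_opnorm T (B_op P) \<le> \<kappa> \<and>
    L2_opnorm T C \<le> \<kappa> \<and>
    L2_opnorm T R \<le> \<kappa> \<and>
    L2_opnorm T KC \<le> \<kappa> \<and>
    L2_opnorm T KB \<le> \<kappa>"

section \<open>The linear systems\<close>

text \<open>
  The system \<open>L''(x,u,\<lambda>) \<chi> = -(I\<^sup>\<tau>\<^sub>x, 0, I\<^sup>\<tau>\<^sub>u, 0, 0)\<close>; the rows in \<open>L\<^sub>2(0,T;V)*\<close> and \<open>L\<^sub>2(0,T;U)*\<close> are
  tested against all elements of these spaces.
\<close>

definition solves_system ::
  "('v::{banach,second_countable_topology}, 'h::{real_inner,banach}, 'u::{real_inner,banach}) ocp
    \<Rightarrow> real \<Rightarrow> real \<Rightarrow> (real \<Rightarrow> 'v) \<Rightarrow> (real \<Rightarrow> 'u) \<Rightarrow> (real \<Rightarrow> 'v)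
    \<Rightarrow> (real \<Rightarrow> 'v) \<Rightarrow> (real \<Rightarrow> 'u) \<Rightarrow> (real \<Rightarrow> 'v) \<Rightarrow> bool"
  where "solves_system P T \<tau> x u lam v q z \<longleftrightarrow>
    v \<in> W (emb P) T \<and> q \<in> L2 T \<and> z \<in> W (emb P) T \<and>
    (\<forall>h\<in>L2 T. L_xx P T x u lam v h - L2_pair T (wderiv (emb P) T z) h
       - L2_pair T (A_deriv P x h) z = - deriv_x T (cost P \<tau>) (x, u) h) \<and>
    time_eval (emb P) T T z = 0 \<and>
    (\<forall>k\<in>L2 T. deriv_uu T (cost P T) (x, u) q k - L2_pair T (B_op P k) z
       = - deriv_u T (cost P \<tau>) (x, u) k) \<and>
    (AE t in lebesgue_on {0..T}. wderiv (emb P) T v t - A_deriv P x v t - B_op P q t = 0) \<and>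
    time_eval (emb P) T 0 v = 0"

text \<open>\<open>J\<^sub>u\<^sub>u(x,u)\<^sup>-\<^sup>1\<close> applied to a functional on \<open>L\<^sub>2(0,T;U)\<close>.\<close>

definition Juu_inv ::
  "('v::{banach,second_countable_topology}, 'h::{real_inner,banach}, 'u::{real_inner,banach}) ocp
    \<Rightarrow> real \<Rightarrow> (real \<Rightarrow> 'v) \<Rightarrow> (real \<Rightarrow> 'u) \<Rightarrow> ((real \<Rightarrow> 'u) \<Rightarrow> real) \<Rightarrow> (real \<Rightarrow> 'u)"
  where "Juu_inv P T x u \<phi> =
    (SOME q. q \<in> L2 T \<and> (\<forall>k\<in>L2 T. deriv_uu T (cost P T) (x, u) q k = \<phi> k))"

definition M_op ::
  "('v::{banach,second_countable_topology}, 'h::{real_inner,banach}, 'u::{real_inner,banach}) ocp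
    \<Rightarrow> real \<Rightarrow> (real \<Rightarrow> 'v) \<Rightarrow> (real \<Rightarrow> 'u) \<Rightarrow> ((real \<Rightarrow> 'v) \<Rightarrow> (real \<Rightarrow> 'y::{real_inner,banach}))
    \<Rightarrow> (real \<Rightarrow> 'v) \<times> (real \<Rightarrow> 'v)
    \<Rightarrow> (real \<Rightarrow> 'v \<Rightarrow>\<^sub>L real) \<times> 'h \<times> (real \<Rightarrow> 'v \<Rightarrow>\<^sub>L real) \<times> 'h"
  where "M_op P T x u C = (\<lambda>(v, z).
    (L2_dual_rep T (\<lambda>h. L2_inner T (C v) (C h) - L2_pair T (wderiv (emb P) T z) h
       - L2_pair T (A_deriv P x h) z),
     time_eval (emb P) T T z,
     wderiv (emb P) T v - A_deriv P x v
       - B_op P (Juu_inv P T x u (\<lambda>k. L2_pair T (B_op P k) z)),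
     time_eval (emb P) T 0 v))"

definition WW ::
  "('v::real_normed_vector \<Rightarrow>\<^sub>L 'h::real_inner) \<Rightarrow> real \<Rightarrow> ((real \<Rightarrow> 'v) \<times> (real \<Rightarrow> 'v)) set"
  where "WW \<iota> T = W \<iota> T \<times> W \<iota> T"

definition WWnorm ::
  "('v::real_normed_vector \<Rightarrow>\<^sub>L 'h::real_inner) \<Rightarrow> real \<Rightarrow> (real \<Rightarrow> 'v) \<times> (real \<Rightarrow> 'v) \<Rightarrow> real"
  where "WWnorm \<iota> T = (\<lambda>(v, z). sqrt ((Wnorm \<iota> T v)\<^sup>2 + (Wnorm \<iota> T z)\<^sup>2))"

definition RHS ::
  "real \<Rightarrow> ((real \<Rightarrow> 'v::real_normed_vector \<Rightarrow>\<^sub>L real) \<times> 'h::real_inner \<times>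
             (real \<Rightarrow> 'v \<Rightarrow>\<^sub>L real) \<times> 'h) set"
  where "RHS T = L2 T \<times> UNIV \<times> L2 T \<times> UNIV"

definition RHSnorm ::
  "real \<Rightarrow> (real \<Rightarrow> 'v::real_normed_vector \<Rightarrow>\<^sub>L real) \<times> 'h::real_inner \<times>
             (real \<Rightarrow> 'v \<Rightarrow>\<^sub>L real) \<times> 'h \<Rightarrow> real"
  where "RHSnorm T = (\<lambda>(l1, h1, l2, h2).
    sqrt ((L2norm T l1)\<^sup>2 + (norm h1)\<^sup>2 + (L2norm T l2)\<^sup>2 + (norm h2)\<^sup>2))"

definition M_inv ::
  "('v::{banach,second_countable_topology}, 'h::{real_inner,banach}, 'u::{real_inner,banach}) ocp
    \<Rightarrow> real \<Rightarrow> (real \<Rightarrow> 'v) \<Rightarrow> (real \<Rightarrow> 'u) \<Rightarrow> ((real \<Rightarrow> 'v) \<Rightarrow> (real \<Rightarrow> 'y::{real_inner,banach}))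
    \<Rightarrow> (real \<Rightarrow> 'v \<Rightarrow>\<^sub>L real) \<times> 'h \<times> (real \<Rightarrow> 'v \<Rightarrow>\<^sub>L real) \<times> 'h
    \<Rightarrow> (real \<Rightarrow> 'v) \<times> (real \<Rightarrow> 'v)"
  where "M_inv P T x u C = inverse_on (WW (emb P) T) (RHSnorm T) (M_op P T x u C)"

definition M_inv_norm ::
  "('v::{banach,second_countable_topology}, 'h::{real_inner,banach}, 'u::{real_inner,banach}) ocp
    \<Rightarrow> real \<Rightarrow> (real \<Rightarrow> 'v) \<Rightarrow> (real \<Rightarrow> 'u) \<Rightarrow> ((real \<Rightarrow> 'v) \<Rightarrow> (real \<Rightarrow> 'y::{real_inner,banach}))
    \<Rightarrow> real"
  where "M_inv_norm P T x u C =
    op_norm (RHS T) (RHSnorm T) (WWnorm (emb P) T) (M_inv P T x u C)"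

definition WUWnorm ::
  "('v::real_normed_vector \<Rightarrow>\<^sub>L 'h::real_inner) \<Rightarrow> real
    \<Rightarrow> (real \<Rightarrow> 'v) \<times> (real \<Rightarrow> 'u::real_normed_vector) \<times> (real \<Rightarrow> 'v) \<Rightarrow> real"
  where "WUWnorm \<iota> T = (\<lambda>(v, q, z).
    sqrt ((Wnorm \<iota> T v)\<^sup>2 + (L2norm T q)\<^sup>2 + (Wnorm \<iota> T z)\<^sup>2))"

definition exp_weight :: "real \<Rightarrow> (real \<Rightarrow> 'b::real_vector) \<Rightarrow> real \<Rightarrow> 'b"
  where "exp_weight \<mu> v = (\<lambda>t. exp (\<mu> * t) *\<^sub>R v t)"

end

theory Submission
 imports Defs
begin

text \<open>
 The theorem has two parts. The operator \<open>M\<close> of the optimality system, from which the control has been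
 eliminated, has an inverse whose norm is bounded by a constant that depends on \<open>\<alpha>\<close> and \<open>\<kappa>\<close> only; and
 a solution whose right-hand side is supported on \<open>[0,\<tau>]\<close> decays exponentially behind \<open>\<tau>\<close>, at every
 rate below the reciprocal of the supremum of these norms over the horizons.

 \<^bold>\<open>The uniform bound.\<close> Let \<open>r\<close> be the size of the right-hand side. Testing the adjoint row with \<open>v\<close> and
 the state row with \<open>z\<close> and subtracting, the terms with \<open>A'(x)\<close> cancel and the time derivatives combine to
 boundary terms, so that \<open>s\<^sup>2 = \<parallel>C v\<parallel>\<^sup>2 + \<parallel>R q\<parallel>\<^sup>2\<close> is at most \<open>r\<close> times the size of the solution. The
 observed quantities control the rest: testing the state row with \<open>v\<close>, detectability
 replaces the indefinite term \<open>-A'(x)\<close> by a coercive one at the expense of a multiple of \<open>C v\<close>; testing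
 the adjoint row with \<open>z\<close>, stabilizability does the same at the expense of \<open>\<langle>B K\<^sub>B z, z\<rangle> = \<langle>R q, R K\<^sub>B z\<rangle>\<close>.
 Hence the solution is bounded by \<open>r + s\<close>, and with \<open>s\<^sup>2 \<le> c r (r + s)\<close> by \<open>r\<close> (\<open>estimate\<close>,
 \<open>estimate_W\<close>). No step involves the length of the horizon.

 \<^bold>\<open>Existence.\<close> The system is self-adjoint, so the same estimate for the test functions is the inf-sup
 condition under which Lions' theorem (\<open>lions\<close>) gives a very weak solution in \<open>L\<^sub>2\<close>. The equations show
 that it belongs to \<open>W([0,T])\<close> and attains the boundary values (\<open>very_weak_solution\<close>, \<open>existence\<close>). Thus
 \<open>M\<close> is invertible (\<open>system_op_invertible\<close>).

 \<^bold>\<open>The decay.\<close> Multiplying the system by \<open>e\<^sup>\<mu>\<^sup>t\<close> affects only the time derivatives: the weighted solution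
 solves the system with the weighted right-hand side plus \<open>\<mu> F (v, z)\<close>, where \<open>F\<close> has norm at most one
 (\<open>weighted_residual\<close>). If \<open>\<mu> \<parallel>M\<^sup>-\<^sup>1\<parallel> < 1\<close>, this term is absorbed. The right-hand side lives on \<open>[0,\<tau>]\<close>, where
 the weight is at most \<open>e\<^sup>\<mu>\<^sup>\<tau>\<close>. The argument uses that \<open>J\<^sub>x\<^sub>x\<close> and \<open>J\<^sub>u\<^sub>u\<close> commute with multiplication by
 scalar functions of time, although only their abstract Frechet derivatives are given: an integral
 functional splits over complementary sets of times, so mixed second derivatives over such sets vanish
 (\<open>deriv2_split_zero\<close>, \<open>L2_local_form\<close>).

 \<^bold>\<open>Foundations.\<close> Three facts about \<open>V \<hookrightarrow> H \<hookrightarrow> V*\<close> are needed. Every functional on \<open>L\<^sub>2(0,T;V)\<close> is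
 represented by an element of \<open>L\<^sub>2(0,T;V*)\<close>; this follows from detectability and Lax--Milgram (\<open>dual_rep\<close>).
 Elements of \<open>W([0,T])\<close> have a continuous representative in \<open>H\<close>, and integration by parts holds
 (\<open>W_continuous_representative\<close>, \<open>W_integration_by_parts\<close>). For the latter two, the lemma of
 du Bois-Reymond makes \<open>v\<close>, as a function into \<open>V*\<close>, a primitive of its weak derivative, and difference
 quotients yield \<open>d/dt \<parallel>v\<parallel>\<^sup>2 = 2 \<langle>v', v\<rangle>\<close> (\<open>weak_product_rule\<close>).
\<close>

section \<open>Strongly measurable functions\<close>

lemma strongly_measurable_compose2:
 assumes f: "strongly_measurable M f" and g: "strongly_measurable M g"
  and k: "\<And>x y. isCont (\<lambda>(x, y). k x y) (x, y)"
 shows "strongly_measurable M (\<lambda>t. k (f t) (g t))"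
proof -
 obtain s where s: "\<And>i. simple_function M (s i)" "AE t in M. (\<lambda>i. s i t) \<longlonglongrightarrow> f t"
  using f unfolding strongly_measurable_def by blast
 obtain r where r: "\<And>i. simple_function M (r i)" "AE t in M. (\<lambda>i. r i t) \<longlonglongrightarrow> g t"
  using g unfolding strongly_measurable_def by blast
 have "simple_function M (\<lambda>t. k (s i t) (r i t))" for i
  using s(1) r(1) by (rule simple_function_compose2)
 moreover have "AE t in M. (\<lambda>i. k (s i t) (r i t)) \<longlonglongrightarrow> k (f t) (g t)"
  using s(2) r(2)
 proof eventually_elim
  case (elim t)
  have "(\<lambda>i. (s i t, r i t)) \<longlonglongrightarrow> (f t, g t)"
   using elim by (intro tendsto_Pair)
  from isCont_tendsto_compose[OF k this] show ?case by simp
 qed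
 ultimately show ?thesis unfolding strongly_measurable_def
  by (intro exI[of _ "\<lambda>i t. k (s i t) (r i t)"]) auto
qed

lemma strongly_measurable_const [simp]: "strongly_measurable M (\<lambda>_. c)"
 unfolding strongly_measurable_def by (intro exI[of _ "\<lambda>_ _. c"]) auto

lemma strongly_measurable_compose:
 assumes f: "strongly_measurable M f" and k: "\<And>x. isCont k x"
 shows "strongly_measurable M (\<lambda>t. k (f t))"
proof -
 have "isCont (\<lambda>(x, y::real). k x) (x, y)" for x y
  using isCont_o2[of "(x, y)" fst k] k by (simp add: split_def continuous_fst)
 from strongly_measurable_compose2[OF f strongly_measurable_const[of M "0::real"], of "\<lambda>x _. k x", OF this]
 show ?thesis .
qed

lemma strongly_measurable_add:
 "strongly_measurable M f \<Longrightarrow> strongly_measurable M g \<Longrightarrow> strongly_measurable M (\<lambda>t. f t + g t)"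
 by (rule strongly_measurable_compose2) (auto simp: split_def intro!: continuous_intros)

lemma strongly_measurable_bilinear:
 assumes "bounded_bilinear k" "strongly_measurable M f" "strongly_measurable M g"
 shows "strongly_measurable M (\<lambda>t. k (f t) (g t))"
 using assms(2,3)
proof (rule strongly_measurable_compose2)
 interpret bounded_bilinear k by fact
 show "isCont (\<lambda>(x, y). k x y) (x, y)" for x y
  by (auto simp: split_def intro!: isCont continuous_intros)
qed

lemma strongly_measurable_cong_AE:
 assumes "strongly_measurable M f" "AE t in M. f t = g t"
 shows "strongly_measurable M g"
proof -
 obtain s where s: "\<And>i. simple_function M (s i)" "AE t in M. (\<lambda>i. s i t) \<longlonglongrightarrow> f t"
  using assms(1) unfolding strongly_measurable_def by blast
 have "AE t in M. (\<lambda>i. s i t) \<longlonglongrightarrow> g t"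
  using s(2) assms(2) by (rule eventually_elim2) (simp only:)
 then show ?thesis unfolding strongly_measurable_def
  by (intro exI[of _ s] conjI allI s(1))
qed

lemma strongly_measurable_borel:
 assumes "f \<in> borel_measurable M"
 shows "strongly_measurable M (f :: _ \<Rightarrow> real)"
proof -
 obtain s where s: "\<And>i. simple_function M (s i)" "\<And>t. t \<in> space M \<Longrightarrow> (\<lambda>i. s i t) \<longlonglongrightarrow> f t"
  using borel_measurable_implies_sequence_metric[OF assms, of 0] by blast
 from s show ?thesis unfolding strongly_measurable_def
  by (intro exI[of _ s] conjI allI AE_I2) 
qed

lemma borel_measurable_cong_AE_on:
 fixes f :: "real \<Rightarrow> real"
 assumes f: "f \<in> borel_measurable (lebesgue_on S)" and ae: "AE x in lebesgue_on S. f x = g x"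
  and S: "S \<in> sets lebesgue"
 shows "g \<in> borel_measurable (lebesgue_on S)"
proof -
 have "(\<lambda>x. if x \<in> S then f x else 0) \<in> borel_measurable lebesgue"
  using borel_measurable_if_lebesgue_on[OF S, of UNIV f] f by (simp add: lebesgue_on_UNIV_eq)
 moreover have "AE x in lebesgue. (if x \<in> S then f x else 0) = (if x \<in> S then g x else 0)"
  using ae S by (simp add: AE_restrict_space_iff)
 ultimately have "(\<lambda>x. if x \<in> S then g x else 0) \<in> borel_measurable lebesgue"
  by (rule borel_measurable_AE)
 then show ?thesis
  using borel_measurable_if_lebesgue_on[OF S, of UNIV g] by (simp add: lebesgue_on_UNIV_eq)
qed

text \<open>Only for real values does Bochner measurability reduce to Borel measurability; integrals of norms and
 of pairings are accessed through this case.\<close>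

lemma strongly_measurable_real_iff:
 fixes f :: "real \<Rightarrow> real"
 assumes S: "S \<in> sets lebesgue"
 shows "strongly_measurable (lebesgue_on S) f \<longleftrightarrow> f \<in> borel_measurable (lebesgue_on S)"
proof
 assume "strongly_measurable (lebesgue_on S) f"
 then obtain s where s: "\<And>i. simple_function (lebesgue_on S) (s i)"
   "AE t in lebesgue_on S. (\<lambda>i. s i t) \<longlonglongrightarrow> f t"
  unfolding strongly_measurable_def by blast
 have "(\<lambda>t. lim (\<lambda>i. s i t)) \<in> borel_measurable (lebesgue_on S)"
  by (rule borel_measurable_lim_metric) (use s(1) in \<open>auto intro: borel_measurable_simple_function\<close>)
 moreover have "AE t in lebesgue_on S. lim (\<lambda>i. s i t) = f t"
  using s(2) by eventually_elim (rule limI)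
 ultimately show "f \<in> borel_measurable (lebesgue_on S)"
  using S by (rule borel_measurable_cong_AE_on)
qed (rule strongly_measurable_borel)

lemma strongly_measurable_norm:
 fixes S :: "real set"
 assumes "strongly_measurable (lebesgue_on S) f" "S \<in> sets lebesgue"
 shows "(\<lambda>t. norm (f t)) \<in> borel_measurable (lebesgue_on S)"
proof -
 have "isCont (norm :: 'a \<Rightarrow> real) x" for x
  unfolding isCont_def by (rule tendsto_norm[OF tendsto_ident_at])
 from strongly_measurable_compose[OF assms(1) this] show ?thesis
  using strongly_measurable_real_iff[OF assms(2)] by blast
qed

section \<open>The Bochner spaces\<close>

abbreviation MT :: "real \<Rightarrow> real measure" where "MT T \<equiv> lebesgue_on {0..T}"

lemma finite_measure_MT [simp]: "finite_measure (MT T)"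
 by (rule finite_measure_lebesgue_on) simp

lemma L2_measurable: "f \<in> L2 T \<Longrightarrow> strongly_measurable (MT T) f"
 and L2_integrable: "f \<in> L2 T \<Longrightarrow> integrable (MT T) (\<lambda>t. (norm (f t))\<^sup>2)"
 by (auto simp: L2_def)

lemma L2_bound:
 assumes f: "strongly_measurable (MT T) f" and g: "g \<in> L2 T"
  and le: "AE t in MT T. norm (f t) \<le> C * norm (g t)"
 shows "f \<in> L2 T"
proof -
 have "integrable (MT T) (\<lambda>t. (norm (f t))\<^sup>2)"
 proof (rule Bochner_Integration.integrable_bound)
  show "integrable (MT T) (\<lambda>t. C\<^sup>2 * (norm (g t))\<^sup>2)"
   using L2_integrable[OF g] by simp
  show "(\<lambda>t. (norm (f t))\<^sup>2) \<in> borel_measurable (MT T)"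
   using strongly_measurable_norm[OF f] by simp
  show "AE t in MT T. norm ((norm (f t))\<^sup>2) \<le> norm (C\<^sup>2 * (norm (g t))\<^sup>2)"
   using le
  proof eventually_elim
   case (elim t)
   from power_mono[OF elim, of 2] show ?case by (simp add: power_mult_distrib)
  qed
 qed
 with f show ?thesis by (simp add: L2_def)
qed

lemma L2_cong_AE:
 assumes f: "f \<in> L2 T" and ae: "AE t in MT T. f t = g t"
 shows "g \<in> L2 T"
proof -
 have 1: "strongly_measurable (MT T) g"
  by (rule strongly_measurable_cong_AE[OF L2_measurable[OF f] ae])
 have 2: "AE t in MT T. norm (g t) \<le> 1 * norm (f t)"
  using ae by (rule eventually_mono) auto
 show ?thesis by (rule L2_bound[OF 1 f 2])
qed

lemma L2_const [simp]: "(\<lambda>_. c) \<in> L2 T"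
proof -
 interpret finite_measure "MT T" by simp
 show ?thesis by (simp add: L2_def)
qed

lemma L2_zero [simp]: "0 \<in> L2 T"
 using L2_const[of 0 T] by (simp add: zero_fun_def)

lemma L2_add:
 assumes "f \<in> L2 T" "g \<in> L2 T"
 shows "f + g \<in> L2 T"
proof -
 have sm: "strongly_measurable (MT T) (\<lambda>t. f t + g t)"
  using assms by (intro strongly_measurable_add L2_measurable)
 have "integrable (MT T) (\<lambda>t. (norm (f t + g t))\<^sup>2)"
 proof (rule Bochner_Integration.integrable_bound)
  show "integrable (MT T) (\<lambda>t. 2 * (norm (f t))\<^sup>2 + 2 * (norm (g t))\<^sup>2)"
   using assms[THEN L2_integrable] by simp
  show "(\<lambda>t. (norm (f t + g t))\<^sup>2) \<in> borel_measurable (MT T)"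
   using strongly_measurable_norm[OF sm] by simp
  show "AE t in MT T. norm ((norm (f t + g t))\<^sup>2) \<le> norm (2 * (norm (f t))\<^sup>2 + 2 * (norm (g t))\<^sup>2)"
  proof (rule AE_I2)
   fix t
   have "(norm (f t + g t))\<^sup>2 \<le> (norm (f t) + norm (g t))\<^sup>2"
    by (intro power_mono norm_triangle_ineq) auto
   also have "\<dots> \<le> 2 * (norm (f t))\<^sup>2 + 2 * (norm (g t))\<^sup>2"
    using zero_le_power2[of "norm (f t) - norm (g t)"] by (simp add: power2_eq_square algebra_simps)
   finally show "norm ((norm (f t + g t))\<^sup>2) \<le> norm (2 * (norm (f t))\<^sup>2 + 2 * (norm (g t))\<^sup>2)"
    by simp
  qed
 qed
 then show ?thesis using sm by (simp add: L2_def plus_fun_def)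
qed

lemma L2_mult:
 fixes \<phi> :: "real \<Rightarrow> real"
 assumes "\<phi> \<in> borel_measurable (MT T)" "AE t in MT T. \<bar>\<phi> t\<bar> \<le> C" "f \<in> L2 T"
 shows "(\<lambda>t. \<phi> t *\<^sub>R f t) \<in> L2 T"
proof (rule L2_bound[OF _ assms(3), of _ C])
 show "strongly_measurable (MT T) (\<lambda>t. \<phi> t *\<^sub>R f t)"
  using assms by (intro strongly_measurable_bilinear[OF bounded_bilinear_scaleR] strongly_measurable_borel L2_measurable)
 show "AE t in MT T. norm (\<phi> t *\<^sub>R f t) \<le> C * norm (f t)"
  using assms(2) by eventually_elim (auto intro: mult_right_mono)
qed

lemma L2_scaleR: "f \<in> L2 T \<Longrightarrow> c *\<^sub>R f \<in> L2 T"
 using L2_mult[of "\<lambda>_. c" T "\<bar>c\<bar>" f] by (simp add: scaleR_fun_def)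

lemma L2_uminus: "f \<in> L2 T \<Longrightarrow> - f \<in> L2 T"
 using L2_scaleR[of f T "-1"] by simp

lemma L2_diff: "f \<in> L2 T \<Longrightarrow> g \<in> L2 T \<Longrightarrow> f - g \<in> L2 T"
 using L2_add[OF _ L2_uminus, of f T g] by simp

lemma L2_blinfun:
 fixes A :: "'a::real_normed_vector \<Rightarrow>\<^sub>L 'b::real_normed_vector"
 assumes "f \<in> L2 T"
 shows "(\<lambda>t. A (f t)) \<in> L2 T"
proof (rule L2_bound[OF strongly_measurable_compose[OF L2_measurable[OF assms]] assms])
 show "isCont A x" for x
  by (rule linear_continuous_at[OF blinfun.bounded_linear_right])
 show "AE t in MT T. norm (A (f t)) \<le> norm A * norm (f t)"
  by (intro AE_I2 norm_blinfun)
qed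

lemma L2norm_nonneg [simp]: "0 \<le> L2norm T f"
 by (simp add: L2norm_def)

lemma L2norm_sq: "(L2norm T f)\<^sup>2 = (LINT t|MT T. (norm (f t))\<^sup>2)"
 by (simp add: L2norm_def)

text \<open>A product of two \<open>L\<^sub>2\<close> functions is dominated by the sum of their squared norms.\<close>

lemma integrable_bilinear_L2:
 assumes k: "bounded_bilinear k" and f: "f \<in> L2 T" and g: "g \<in> L2 T"
 shows "integrable (MT T) (\<lambda>t. k (f t) (g t) :: real)"
proof -
 obtain K where K: "0 < K" "\<And>a b. norm (k a b) \<le> norm a * norm b * K"
  using bounded_bilinear.pos_bounded[OF k] by blast
 show ?thesis
 proof (rule Bochner_Integration.integrable_bound)
  show "integrable (MT T) (\<lambda>t. K * ((norm (f t))\<^sup>2 + (norm (g t))\<^sup>2))"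
   using f g by (simp add: L2_integrable)
  show "(\<lambda>t. k (f t) (g t)) \<in> borel_measurable (MT T)"
   using strongly_measurable_bilinear[OF k f[THEN L2_measurable] g[THEN L2_measurable]]
   by (simp add: strongly_measurable_real_iff)
  show "AE t in MT T. norm (k (f t) (g t)) \<le> norm (K * ((norm (f t))\<^sup>2 + (norm (g t))\<^sup>2))"
  proof (rule AE_I2)
   fix t
   have "norm (f t) * norm (g t) \<le> (norm (f t))\<^sup>2 + (norm (g t))\<^sup>2"
    using sum_squares_bound[of "norm (f t)" "norm (g t)"]
     mult_nonneg_nonneg[OF norm_ge_zero[of "f t"] norm_ge_zero[of "g t"]] by linarith
   then have "norm (f t) * norm (g t) * K \<le> ((norm (f t))\<^sup>2 + (norm (g t))\<^sup>2) * K"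
    using K(1) by (intro mult_right_mono) auto
   with K(2)[of "f t" "g t"] have "\<bar>k (f t) (g t)\<bar> \<le> ((norm (f t))\<^sup>2 + (norm (g t))\<^sup>2) * K"
    by simp
   then show "norm (k (f t) (g t)) \<le> norm (K * ((norm (f t))\<^sup>2 + (norm (g t))\<^sup>2))"
    using K(1) by (simp add: mult.commute)
  qed
 qed
qed

lemma bounded_bilinear_blinfun_apply: "bounded_bilinear (\<lambda>(A::'a::real_normed_vector \<Rightarrow>\<^sub>L 'b::real_normed_vector) x. A x)"
 by (rule blinfun.bounded_bilinear_axioms)

text \<open>The Cauchy-Schwarz inequality, from the nonnegativity of the integral of the square of
 \<open>s \<cdot> norm f - r \<cdot> norm g\<close>.\<close>

lemma L2_Cauchy_Schwarz_norm:
 assumes f: "f \<in> L2 T" and g: "g \<in> L2 T"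
 shows "integrable (MT T) (\<lambda>t. norm (f t) * norm (g t))"
  and "(LINT t|MT T. norm (f t) * norm (g t)) \<le> L2norm T f * L2norm T g"
proof -
 have mn: "(\<lambda>t. norm (f t)) \<in> L2 T" "(\<lambda>t. norm (g t)) \<in> L2 T"
  using f g by (auto simp: L2_def intro!: strongly_measurable_borel strongly_measurable_norm)
 show int: "integrable (MT T) (\<lambda>t. norm (f t) * norm (g t))"
  by (rule integrable_bilinear_L2[OF bounded_bilinear_mult mn])
 define a where "a = L2norm T f"
 define b where "b = L2norm T g"
 define I where "I = (LINT t|MT T. norm (f t) * norm (g t))"
 have I0: "0 \<le> I" unfolding I_def by (intro integral_nonneg_AE) auto
 have key: "2 * r * s * I \<le> s\<^sup>2 * a\<^sup>2 + r\<^sup>2 * b\<^sup>2" for r s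
 proof -
  have "0 \<le> (LINT t|MT T. (s * norm (f t) - r * norm (g t))\<^sup>2)"
   by (intro integral_nonneg_AE) auto
  also have "\<dots> = (LINT t|MT T. s\<^sup>2 * (norm (f t))\<^sup>2 + r\<^sup>2 * (norm (g t))\<^sup>2
    - 2 * r * s * (norm (f t) * norm (g t)))"
   by (intro Bochner_Integration.integral_cong) (auto simp: power2_eq_square algebra_simps)
  also have "\<dots> = s\<^sup>2 * a\<^sup>2 + r\<^sup>2 * b\<^sup>2 - 2 * r * s * I"
   using int f g by (simp add: L2_integrable L2norm_sq a_def b_def I_def)
  finally show ?thesis by simp
 qed
 have ab: "0 \<le> a" "0 \<le> b" by (auto simp: a_def b_def)
 have "I \<le> a * b"
 proof (cases "a * b = 0")
  case False
  then have "a * b > 0" using ab by (simp add: less_le)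
  moreover have "2 * (a * b) * I \<le> 2 * (a * b) * (a * b)"
   using key[of a b] by (simp add: power2_eq_square algebra_simps)
  ultimately show ?thesis by (simp add: mult_le_cancel_left_pos)
 next
  case True
  show ?thesis
  proof (rule ccontr)
   assume "\<not> I \<le> a * b"
   then have "I > 0" using True by simp
   show False
   proof (cases "a = 0")
    case True
    have "2 * 1 * ((b\<^sup>2 + 1) / I) * I = 2 * b\<^sup>2 + 2" using \<open>I > 0\<close> by simp
    with key[of 1 "(b\<^sup>2 + 1) / I"] True have "2 * b\<^sup>2 + 2 \<le> b\<^sup>2" by simp
    with zero_le_power2[of b] show False by linarith
   next
    case False
    with True have "b = 0" by simp
    have "2 * ((a\<^sup>2 + 1) / I) * 1 * I = 2 * a\<^sup>2 + 2" using \<open>I > 0\<close> by simp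
    with key[of "(a\<^sup>2 + 1) / I" 1] \<open>b = 0\<close> have "2 * a\<^sup>2 + 2 \<le> a\<^sup>2" by simp
    with zero_le_power2[of a] show False by linarith
   qed
  qed
 qed
 then show "(LINT t|MT T. norm (f t) * norm (g t)) \<le> L2norm T f * L2norm T g"
  by (simp add: I_def a_def b_def)
qed

lemma L2_bilinear_bound:
 assumes k: "bounded_bilinear k" "\<And>a b. \<bar>k a b\<bar> \<le> C * (norm a * norm b)"
  and f: "f \<in> L2 T" and g: "g \<in> L2 T" and C: "0 \<le> C"
 shows "\<bar>LINT t|MT T. k (f t) (g t)\<bar> \<le> C * (L2norm T f * L2norm T g)"
proof -
 have "\<bar>LINT t|MT T. k (f t) (g t)\<bar> \<le> (LINT t|MT T. \<bar>k (f t) (g t)\<bar>)"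
  using integral_norm_bound[of "MT T" "\<lambda>t. k (f t) (g t)"] by simp
 also have "\<dots> \<le> (LINT t|MT T. C * (norm (f t) * norm (g t)))"
  using integrable_bilinear_L2[OF k(1) f g] L2_Cauchy_Schwarz_norm(1)[OF f g] k(2)
  by (intro integral_mono) auto
 also have "\<dots> \<le> C * (L2norm T f * L2norm T g)"
  using L2_Cauchy_Schwarz_norm[OF f g] C by (simp add: mult_left_mono)
 finally show ?thesis .
qed

lemma L2_pair_bound:
 assumes "g \<in> L2 T" "v \<in> L2 T"
 shows "\<bar>L2_pair T g v\<bar> \<le> L2norm T g * L2norm T v"
proof -
 have "\<bar>blinfun_apply a b\<bar> \<le> 1 * (norm a * norm b)" for a :: "'a \<Rightarrow>\<^sub>L real" and b
  using norm_blinfun[of a b] by simp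
 from L2_bilinear_bound[OF bounded_bilinear_blinfun_apply this assms] show ?thesis
  by (simp add: L2_pair_def)
qed

lemma L2_inner_bound:
 assumes "g \<in> L2 T" "v \<in> L2 T"
 shows "\<bar>L2_inner T g v\<bar> \<le> L2norm T g * L2norm T v"
proof -
 have "\<bar>a \<bullet> b\<bar> \<le> 1 * (norm a * norm b)" for a b :: 'a
  using Cauchy_Schwarz_ineq2[of a b] by simp
 from L2_bilinear_bound[OF bounded_bilinear_inner this assms] show ?thesis
  by (simp add: L2_inner_def)
qed

lemma integrable_L2_pair:
 fixes g :: "real \<Rightarrow> 'b::real_normed_vector \<Rightarrow>\<^sub>L real"
 shows "g \<in> L2 T \<Longrightarrow> v \<in> L2 T \<Longrightarrow> integrable (MT T) (\<lambda>t. g t (v t))"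
 by (rule integrable_bilinear_L2[OF bounded_bilinear_blinfun_apply])

lemma integrable_L2_inner: "g \<in> L2 T \<Longrightarrow> v \<in> L2 T \<Longrightarrow> integrable (MT T) (\<lambda>t. g t \<bullet> v t)"
 by (rule integrable_bilinear_L2[OF bounded_bilinear_inner])

text \<open>If the squared norms are not integrable, both integrals have the default value zero.\<close>

lemma L2norm_cong_AE:
 assumes "AE t in MT T. norm (f t) = norm (g t)"
 shows "L2norm T f = L2norm T g"
proof -
 have "\<And>t. norm (f t) = norm (g t) \<Longrightarrow> (norm (f t))\<^sup>2 = (norm (g t))\<^sup>2" by simp
 show ?thesis
 proof (cases "integrable (MT T) (\<lambda>t. (norm (f t))\<^sup>2) \<or> integrable (MT T) (\<lambda>t. (norm (g t))\<^sup>2)")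
  case True
  have m: "(\<lambda>t. (norm (f t))\<^sup>2) \<in> borel_measurable (MT T) \<and> (\<lambda>t. (norm (g t))\<^sup>2) \<in> borel_measurable (MT T)"
   using True
  proof
   assume i: "integrable (MT T) (\<lambda>t. (norm (f t))\<^sup>2)"
   moreover have "(\<lambda>t. (norm (g t))\<^sup>2) \<in> borel_measurable (MT T)"
    by (rule borel_measurable_cong_AE_on[OF borel_measurable_integrable[OF i]])
      (use assms in \<open>auto elim: eventually_mono\<close>)
   ultimately show ?thesis by auto
  next
   assume i: "integrable (MT T) (\<lambda>t. (norm (g t))\<^sup>2)"
   moreover have "(\<lambda>t. (norm (f t))\<^sup>2) \<in> borel_measurable (MT T)"
    by (rule borel_measurable_cong_AE_on[OF borel_measurable_integrable[OF i]])
      (use assms in \<open>auto elim: eventually_mono\<close>)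
   ultimately show ?thesis by auto
  qed
  have "(LINT t|MT T. (norm (f t))\<^sup>2) = (LINT t|MT T. (norm (g t))\<^sup>2)"
   by (rule integral_cong_AE) (use m assms in \<open>auto elim: eventually_mono\<close>)
  then show ?thesis by (simp add: L2norm_def)
 next
  case False
  then show ?thesis by (simp add: L2norm_def not_integrable_integral_eq)
 qed
qed

lemma L2norm_mono_AE:
 assumes "g \<in> L2 T" "AE t in MT T. norm (f t) \<le> C * norm (g t)" "0 \<le> C"
 shows "L2norm T f \<le> C * L2norm T g"
proof -
 have "(LINT t|MT T. (norm (f t))\<^sup>2) \<le> (LINT t|MT T. C\<^sup>2 * (norm (g t))\<^sup>2)"
 proof (rule integral_mono_AE')
  show "integrable (MT T) (\<lambda>t. C\<^sup>2 * (norm (g t))\<^sup>2)" using L2_integrable[OF assms(1)] by simp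
  show "AE t in MT T. (norm (f t))\<^sup>2 \<le> C\<^sup>2 * (norm (g t))\<^sup>2"
   using assms(2)
  proof eventually_elim
   case (elim t)
   from power_mono[OF elim, of 2] show ?case by (simp add: power_mult_distrib)
  qed
 qed auto
 then have "(L2norm T f)\<^sup>2 \<le> (C * L2norm T g)\<^sup>2"
  by (simp add: L2norm_sq power_mult_distrib)
 then show ?thesis
  using assms(3) by (meson L2norm_nonneg mult_nonneg_nonneg power2_le_imp_le)
qed

lemma L2norm_zero_iff:
 assumes "f \<in> L2 T"
 shows "L2norm T f = 0 \<longleftrightarrow> (AE t in MT T. f t = 0)"
 using integral_nonneg_eq_0_iff_AE[OF L2_integrable[OF assms]] by (simp add: L2norm_def)

lemma L2norm_0 [simp]: "L2norm T 0 = 0" "L2norm T (\<lambda>_. 0) = 0"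
 by (simp_all add: L2norm_def)

lemma L2norm_add:
 assumes f: "f \<in> L2 T" and g: "g \<in> L2 T"
 shows "L2norm T (f + g) \<le> L2norm T f + L2norm T g"
proof -
 have "(L2norm T (f + g))\<^sup>2 \<le> (LINT t|MT T. (norm (f t))\<^sup>2 + (norm (g t))\<^sup>2 + 2 * (norm (f t) * norm (g t)))"
  unfolding L2norm_sq
 proof (rule integral_mono)
  show "integrable (MT T) (\<lambda>t. (norm ((f + g) t))\<^sup>2)" using L2_add[OF f g] by (rule L2_integrable)
  show "integrable (MT T) (\<lambda>t. (norm (f t))\<^sup>2 + (norm (g t))\<^sup>2 + 2 * (norm (f t) * norm (g t)))"
   using f g L2_Cauchy_Schwarz_norm(1)[OF f g] by (simp add: L2_integrable)
  fix t
  have "(norm (f t + g t))\<^sup>2 \<le> (norm (f t) + norm (g t))\<^sup>2"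
   by (intro power_mono norm_triangle_ineq) auto
  then show "(norm ((f + g) t))\<^sup>2 \<le> (norm (f t))\<^sup>2 + (norm (g t))\<^sup>2 + 2 * (norm (f t) * norm (g t))"
   by (simp add: power2_eq_square algebra_simps)
 qed
 also have "\<dots> = (L2norm T f)\<^sup>2 + (L2norm T g)\<^sup>2 + 2 * (LINT t|MT T. norm (f t) * norm (g t))"
  using f g L2_Cauchy_Schwarz_norm(1)[OF f g] by (simp add: L2_integrable L2norm_sq)
 also have "\<dots> \<le> (L2norm T f + L2norm T g)\<^sup>2"
  using L2_Cauchy_Schwarz_norm(2)[OF f g] by (simp add: power2_eq_square algebra_simps)
 finally show ?thesis by (rule power2_le_imp_le) auto
qed

lemma L2norm_scaleR: "L2norm T (c *\<^sub>R f) = \<bar>c\<bar> * L2norm T f"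
proof -
 have "(L2norm T (c *\<^sub>R f))\<^sup>2 = (\<bar>c\<bar> * L2norm T f)\<^sup>2"
  by (simp add: L2norm_sq scaleR_fun_def power_mult_distrib)
 then show ?thesis by (simp add: power2_eq_iff_nonneg)
qed

lemma L2norm_minus [simp]: "L2norm T (- f) = L2norm T f"
 using L2norm_scaleR[of T "-1" f] by simp

lemma L2norm_diff:
 assumes f: "f \<in> L2 T" and g: "g \<in> L2 T"
 shows "L2norm T (f - g) \<le> L2norm T f + L2norm T g"
 using L2norm_add[OF f L2_uminus[OF g]] by simp

lemma L2norm_mult:
 fixes \<phi> :: "real \<Rightarrow> real"
 assumes "AE t in MT T. \<bar>\<phi> t\<bar> \<le> C" "f \<in> L2 T" "0 \<le> C"
 shows "L2norm T (\<lambda>t. \<phi> t *\<^sub>R f t) \<le> C * L2norm T f"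
 by (rule L2norm_mono_AE[OF assms(2) _ assms(3)])
   (use assms(1) in eventually_elim, auto intro: mult_right_mono)

lemma L2norm_blinfun:
 fixes A :: "'a::real_normed_vector \<Rightarrow>\<^sub>L 'b::real_normed_vector"
 shows "f \<in> L2 T \<Longrightarrow> L2norm T (\<lambda>t. A (f t)) \<le> norm A * L2norm T f"
 by (rule L2norm_mono_AE) (auto intro: norm_blinfun)

lemma
 assumes "f \<in> L2 T" "g \<in> L2 T" "h \<in> L2 T"
 shows L2_pair_add_left: "L2_pair T (f + g) h = L2_pair T f h + L2_pair T g h"
  and L2_pair_diff_left: "L2_pair T (f - g) h = L2_pair T f h - L2_pair T g h"
 using integrable_L2_pair[OF assms(1,3)] integrable_L2_pair[OF assms(2,3)]
 by (auto simp: L2_pair_def blinfun.add_left blinfun.diff_left)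

lemma
 assumes "f \<in> L2 T" "g \<in> L2 T" "h \<in> L2 T"
 shows L2_pair_add_right: "L2_pair T h (f + g) = L2_pair T h f + L2_pair T h g"
  and L2_pair_diff_right: "L2_pair T h (f - g) = L2_pair T h f - L2_pair T h g"
 using integrable_L2_pair[OF assms(3,1)] integrable_L2_pair[OF assms(3,2)]
 by (auto simp: L2_pair_def blinfun.add_right blinfun.diff_right)

lemma L2_pair_scaleR_left [simp]: "L2_pair T (c *\<^sub>R f) h = c * L2_pair T f h"
 and L2_pair_scaleR_right [simp]: "L2_pair T f (c *\<^sub>R h) = c * L2_pair T f h"
 by (auto simp: L2_pair_def scaleR_fun_def blinfun.scaleR_left blinfun.scaleR_right)

lemma L2_pair_minus_left [simp]: "L2_pair T (- f) h = - L2_pair T f h"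
 and L2_pair_minus_right [simp]: "L2_pair T f (- h) = - L2_pair T f h"
 by (auto simp: L2_pair_def blinfun.minus_left blinfun.minus_right)

lemma
 assumes "f \<in> L2 T" "g \<in> L2 T" "h \<in> L2 T"
 shows L2_inner_add_left: "L2_inner T (f + g) h = L2_inner T f h + L2_inner T g h"
 using integrable_L2_inner[OF assms(1,3)] integrable_L2_inner[OF assms(2,3)]
 by (auto simp: L2_inner_def inner_add_left)

lemma L2_inner_commute: "L2_inner T f g = L2_inner T g f"
 by (simp add: L2_inner_def inner_commute)

lemma L2_inner_scaleR_left [simp]: "L2_inner T (c *\<^sub>R f) h = c * L2_inner T f h"
 by (auto simp: L2_inner_def scaleR_fun_def)

lemma L2_inner_self: "L2_inner T f f = (L2norm T f)\<^sup>2"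
 by (simp add: L2_inner_def L2norm_sq power2_norm_eq_inner)

lemma L2_pair_cong_AE:
 assumes "AE t in MT T. f t = g t" "f \<in> L2 T" "h \<in> L2 T"
 shows "L2_pair T f h = L2_pair T g h"
 unfolding L2_pair_def
proof (rule integral_cong_AE)
 have "g \<in> L2 T" using assms by (blast intro: L2_cong_AE)
 then show "(\<lambda>t. g t (h t)) \<in> borel_measurable (MT T)"
  using integrable_L2_pair assms(3) borel_measurable_integrable by blast
 show "(\<lambda>t. f t (h t)) \<in> borel_measurable (MT T)"
  using integrable_L2_pair assms(2,3) borel_measurable_integrable by blast
 show "AE t in MT T. f t (h t) = g t (h t)"
  using assms(1) by eventually_elim simp
qed

lemma L2norm_tendsto_zero:
 assumes f: "\<And>n. f n \<in> L2 T" and g: "g \<in> L2 T"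
  and le: "\<And>n. AE t in MT T. norm (f n t) \<le> norm (g t)"
  and lim: "AE t in MT T. (\<lambda>n. f n t) \<longlonglongrightarrow> 0"
 shows "(\<lambda>n. L2norm T (f n)) \<longlonglongrightarrow> 0"
proof -
 have "(\<lambda>n. LINT t|MT T. (norm (f n t))\<^sup>2) \<longlonglongrightarrow> (LINT t|MT T. (0::real))"
 proof (rule integral_dominated_convergence[where w = "\<lambda>t. (norm (g t))\<^sup>2"])
  show "(\<lambda>t. (norm (f n t))\<^sup>2) \<in> borel_measurable (MT T)" for n
   using L2_integrable[OF f] by (rule borel_measurable_integrable)
  show "integrable (MT T) (\<lambda>t. (norm (g t))\<^sup>2)" by (rule L2_integrable[OF g])
  show "AE t in MT T. norm ((norm (f n t))\<^sup>2) \<le> (norm (g t))\<^sup>2" for n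
   using le[of n] by (rule eventually_mono) (simp add: power_mono)
  show "AE t in MT T. (\<lambda>n. (norm (f n t))\<^sup>2) \<longlonglongrightarrow> 0"
   using lim
  proof (rule eventually_mono)
   fix t assume "(\<lambda>n. f n t) \<longlonglongrightarrow> 0"
   then have "(\<lambda>n. (norm (f n t))\<^sup>2) \<longlonglongrightarrow> (norm (0::'a))\<^sup>2"
    by (intro tendsto_power tendsto_norm)
   then show "(\<lambda>n. (norm (f n t))\<^sup>2) \<longlonglongrightarrow> 0" by simp
  qed
 qed simp
 then have "(\<lambda>n. sqrt (LINT t|MT T. (norm (f n t))\<^sup>2)) \<longlonglongrightarrow> sqrt 0"
  by (intro tendsto_real_sqrt) simp
 then show ?thesis by (simp add: L2norm_def)
qed

text \<open>Truncating an approximating sequence of simple functions at twice the size of the limit makes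
 dominated convergence applicable.\<close>

lemma simple_dense_L2:
 assumes f: "f \<in> L2 T" and e: "0 < e"
 shows "\<exists>s. simple_function (MT T) s \<and> s \<in> L2 T \<and> L2norm T (s - f) < e"
proof -
 obtain s where s: "\<And>i. simple_function (MT T) (s i)" "AE t in MT T. (\<lambda>i. s i t) \<longlonglongrightarrow> f t"
  using L2_measurable[OF f] unfolding strongly_measurable_def by blast
 define r where "r i t = (if norm (s i t) \<le> 2 * norm (f t) then s i t else 0)" for i t
 have mf: "(\<lambda>t. norm (f t)) \<in> borel_measurable (MT T)"
  using L2_measurable[OF f] by (rule strongly_measurable_norm) simp
 have sr: "simple_function (MT T) (r i)" for i
 proof -
  have "(\<lambda>t. norm (s i t)) \<in> borel_measurable (MT T)"
   by (rule borel_measurable_simple_function[OF simple_function_compose1[OF s(1)]])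
  then have "{t \<in> space (MT T). norm (s i t) \<le> 2 * norm (f t)} \<in> sets (MT T)"
   using mf by (intro borel_measurable_le) auto
  then have "simple_function (MT T) (\<lambda>t. if t \<in> {t \<in> space (MT T). norm (s i t) \<le> 2 * norm (f t)} then s i t else 0)"
   using s(1) by (intro simple_function_If_set) auto
  then show ?thesis
   by (rule simple_function_cong[THEN iffD1, rotated]) (auto simp: r_def)
 qed
 have smr: "strongly_measurable (MT T) (r i)" for i
  using sr unfolding strongly_measurable_def by (intro exI[of _ "\<lambda>_. r i"]) auto
 have rL2: "r i \<in> L2 T" for i
  by (rule L2_bound[OF smr f, of _ 2]) (auto simp: r_def)
 have "(\<lambda>i. L2norm T (r i - f)) \<longlonglongrightarrow> 0"
 proof (rule L2norm_tendsto_zero[OF L2_diff[OF rL2 f] L2_scaleR[OF f, of 3]])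
  show "AE t in MT T. norm ((r i - f) t) \<le> norm ((3 *\<^sub>R f) t)" for i
  proof (rule AE_I2)
   fix t
   have "norm (r i t - f t) \<le> norm (r i t) + norm (f t)" by (rule norm_triangle_ineq4)
   also have "\<dots> \<le> 3 * norm (f t)" by (simp add: r_def)
   finally show "norm ((r i - f) t) \<le> norm ((3 *\<^sub>R f) t)" by (simp add: scaleR_fun_def)
  qed
  show "AE t in MT T. (\<lambda>i. (r i - f) t) \<longlonglongrightarrow> 0"
   using s(2)
  proof eventually_elim
   case (elim t)
   have "(\<lambda>i. r i t) \<longlonglongrightarrow> f t"
   proof (cases "f t = 0")
    case True
    then have "r i t = 0" for i by (simp add: r_def)
    with True show ?thesis by simp
   next
    case False
    have "(\<lambda>i. norm (s i t)) \<longlonglongrightarrow> norm (f t)" using elim by (rule tendsto_norm)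
    then have "\<forall>\<^sub>F i in sequentially. norm (s i t) < 2 * norm (f t)"
     using False by (intro order_tendstoD) auto
    then have "\<forall>\<^sub>F i in sequentially. s i t = r i t"
     by eventually_elim (simp add: r_def)
    then show ?thesis using elim tendsto_cong by force
   qed
   then show ?case by (simp add: LIM_zero)
  qed
 qed
 then have "\<forall>\<^sub>F i in sequentially. L2norm T (r i - f) < e"
  using e by (intro order_tendstoD) auto
 then obtain i where "L2norm T (r i - f) < e"
  by (auto simp: eventually_sequentially)
 then show ?thesis using sr rL2 by blast
qed

lemma L2_Fatou:
 fixes h :: "real \<Rightarrow> 'b::real_normed_vector"
 assumes r: "\<And>j. r j \<in> L2 T" and lim: "AE t in MT T. (\<lambda>j. r j t) \<longlonglongrightarrow> h t"
  and h: "strongly_measurable (MT T) h" and le: "\<And>j. N \<le> j \<Longrightarrow> L2norm T (r j) \<le> e" and e: "0 \<le> e"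
 shows "h \<in> L2 T" and "L2norm T h \<le> e"
proof -
 have nn: "(\<integral>\<^sup>+t. ennreal ((norm (r j t))\<^sup>2) \<partial>MT T) = ennreal ((L2norm T (r j))\<^sup>2)" for j
  using nn_integral_eq_integral[OF L2_integrable[OF r[of j]]] by (simp add: L2norm_sq)
 have "(\<integral>\<^sup>+t. ennreal ((norm (h t))\<^sup>2) \<partial>MT T)
   = (\<integral>\<^sup>+t. liminf (\<lambda>j. ennreal ((norm (r j t))\<^sup>2)) \<partial>MT T)"
 proof (rule nn_integral_cong_AE)
  show "AE t in MT T. ennreal ((norm (h t))\<^sup>2) = liminf (\<lambda>j. ennreal ((norm (r j t))\<^sup>2))"
   using lim
  proof (rule eventually_mono)
   fix t assume "(\<lambda>j. r j t) \<longlonglongrightarrow> h t"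
   then have "(\<lambda>j. ennreal ((norm (r j t))\<^sup>2)) \<longlonglongrightarrow> ennreal ((norm (h t))\<^sup>2)"
    by (intro tendsto_ennrealI tendsto_power tendsto_norm)
   then show "ennreal ((norm (h t))\<^sup>2) = liminf (\<lambda>j. ennreal ((norm (r j t))\<^sup>2))"
    by (intro lim_imp_Liminf[symmetric]) auto
  qed
 qed
 also have "\<dots> \<le> liminf (\<lambda>j. \<integral>\<^sup>+t. ennreal ((norm (r j t))\<^sup>2) \<partial>MT T)"
  by (rule nn_integral_liminf)
    (use L2_integrable[OF r] in \<open>auto intro!: measurable_compose[OF _ measurable_ennreal] borel_measurable_integrable\<close>)
 also have "\<dots> \<le> ennreal (e\<^sup>2)"
 proof (rule Liminf_le)
  show "\<forall>\<^sub>F j in sequentially. (\<integral>\<^sup>+t. ennreal ((norm (r j t))\<^sup>2) \<partial>MT T) \<le> ennreal (e\<^sup>2)"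
   unfolding nn eventually_sequentially
   by (intro exI[of _ N] allI impI ennreal_leI power_mono le) auto
 qed auto
 finally have fin: "(\<integral>\<^sup>+t. ennreal ((norm (h t))\<^sup>2) \<partial>MT T) \<le> ennreal (e\<^sup>2)" .
 have m: "(\<lambda>t. (norm (h t))\<^sup>2) \<in> borel_measurable (MT T)"
  using strongly_measurable_norm[OF h] by simp
 have i: "integrable (MT T) (\<lambda>t. (norm (h t))\<^sup>2)"
  using fin m by (intro integrableI_bounded) (auto simp: le_less_trans[OF _ ennreal_less_top])
 then show "h \<in> L2 T" using h by (simp add: L2_def)
 have "(L2norm T h)\<^sup>2 \<le> e\<^sup>2"
  using fin nn_integral_eq_integral[OF i] by (simp add: L2norm_sq)
 then show "L2norm T h \<le> e" using e by (rule power2_le_imp_le)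
qed

lemma strongly_measurable_simple: "simple_function M s \<Longrightarrow> strongly_measurable M s"
 unfolding strongly_measurable_def by (intro exI[of _ "\<lambda>_. s"]) auto

text \<open>The Riesz--Fischer argument: a subsequence with summable increments converges almost everywhere.
 Its members are replaced by nearby simple functions, because a pointwise limit of simple functions
 is strongly measurable by definition, and Fatou's lemma puts the limit into \<open>L\<^sub>2\<close>.\<close>

theorem L2_complete:
 fixes f :: "nat \<Rightarrow> real \<Rightarrow> 'b::banach"
 assumes f: "\<And>n. f n \<in> L2 T"
  and cau: "\<And>e. 0 < e \<Longrightarrow> \<exists>N. \<forall>m\<ge>N. \<forall>n\<ge>N. L2norm T (f m - f n) < e"
 shows "\<exists>g\<in>L2 T. (\<lambda>n. L2norm T (f n - g)) \<longlonglongrightarrow> 0"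
proof -
 have "\<exists>N. \<forall>m\<ge>N. \<forall>n\<ge>N. L2norm T (f m - f n) < (1/2)^i" for i by (rule cau) simp
 then have "\<exists>N. \<forall>i. \<forall>m\<ge>N i. \<forall>n\<ge>N i. L2norm T (f m - f n) < (1/2)^i" by (intro choice allI)
 then obtain N where N: "\<And>i m n. m \<ge> N i \<Longrightarrow> n \<ge> N i \<Longrightarrow> L2norm T (f m - f n) < (1/2)^i" by blast
 define k where "k i = (\<Sum>j\<le>i. N j)" for i
 have kN: "N i \<le> k j" if "i \<le> j" for i j
  unfolding k_def using that by (intro member_le_sum) auto
 have "\<exists>s. \<forall>i. simple_function (MT T) (s i) \<and> s i \<in> L2 T \<and> L2norm T (s i - f (k i)) < (1/2)^i"
  by (intro choice allI simple_dense_L2[OF f]) auto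
 then obtain s where s: "\<And>i. simple_function (MT T) (s i)" "\<And>i. s i \<in> L2 T"
   "\<And>i. L2norm T (s i - f (k i)) < (1/2)^i" by blast
 have kd: "L2norm T (s j - s i) \<le> 3 * (1/2)^i" if "i \<le> j" for i j
 proof -
  have "s j - s i = ((s j - f (k j)) + (f (k j) - f (k i))) - (s i - f (k i))" by simp
  then have "L2norm T (s j - s i) \<le> L2norm T ((s j - f (k j)) + (f (k j) - f (k i))) + L2norm T (s i - f (k i))"
   using L2norm_diff[of "(s j - f (k j)) + (f (k j) - f (k i))" T "s i - f (k i)"] s(2) f
   by (simp add: L2_add L2_diff)
  also have "\<dots> \<le> L2norm T (s j - f (k j)) + L2norm T (f (k j) - f (k i)) + L2norm T (s i - f (k i))"
   using L2norm_add[of "s j - f (k j)" T "f (k j) - f (k i)"] s(2) f by (simp add: L2_diff)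
  finally show ?thesis
   using s(3)[of i] s(3)[of j] N[OF kN[OF that] kN[OF order_refl]] power_decreasing[OF that, of "1/2::real"] by linarith
 qed
 define d where "d i = (\<lambda>t. norm (s (Suc i) t - s i t))" for i
 have dL2: "(\<lambda>t. s (Suc i) t - s i t) \<in> L2 T" for i
  using L2_diff[OF s(2)[of "Suc i"] s(2)[of i]] by (simp add: fun_diff_def)
 have di: "integrable (MT T) (d i) \<and> (LINT t|MT T. d i t) \<le> 3 * (1/2)^i * L2norm T (\<lambda>_. 1::real)" for i
 proof -
  have "L2norm T (\<lambda>t. s (Suc i) t - s i t) \<le> 3 * (1/2)^i"
   using kd[of i "Suc i"] by (simp add: fun_diff_def)
  then have "L2norm T (\<lambda>t. s (Suc i) t - s i t) * L2norm T (\<lambda>_. 1::real) \<le> 3 * (1/2)^i * L2norm T (\<lambda>_. 1::real)"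
   by (intro mult_right_mono) auto
  then show ?thesis
   using L2_Cauchy_Schwarz_norm[OF dL2[of i] L2_const[of "1::real" T]] by (simp add: d_def)
 qed
 have dm: "(\<lambda>t. ennreal (d i t)) \<in> borel_measurable (MT T)" for i
  using di[of i] by (auto intro!: measurable_compose[OF _ measurable_ennreal] borel_measurable_integrable)
 have "AE t in MT T. summable (\<lambda>i. d i t)"
 proof -
  have "(\<integral>\<^sup>+t. (\<Sum>i. ennreal (d i t)) \<partial>MT T) = (\<Sum>i. \<integral>\<^sup>+t. ennreal (d i t) \<partial>MT T)"
   by (intro nn_integral_suminf dm)
  also have "\<dots> = (\<Sum>i. ennreal (LINT t|MT T. d i t))"
   using di by (intro suminf_cong nn_integral_eq_integral) (auto simp: d_def)
  also have "\<dots> \<le> (\<Sum>i. ennreal (3 * (1/2)^i * L2norm T (\<lambda>_. 1::real)))"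
   using di by (intro suminf_le ennreal_leI) auto
  also have "\<dots> = ennreal (\<Sum>i. 3 * (1/2)^i * L2norm T (\<lambda>_. 1::real))"
   by (intro suminf_ennreal2 summable_mult2 summable_geometric) auto
  also have "\<dots> < \<infinity>" by simp
  finally have "AE t in MT T. (\<Sum>i. ennreal (d i t)) \<noteq> \<infinity>"
   by (intro nn_integral_PInf_AE borel_measurable_suminf_order dm) auto
  then show ?thesis
   by (rule eventually_mono) (auto intro: summable_suminf_not_top simp: d_def)
 qed
 then have lim: "AE t in MT T. (\<lambda>i. s i t) \<longlonglongrightarrow> lim (\<lambda>i. s i t)"
 proof (rule eventually_mono)
  fix t assume "summable (\<lambda>i. d i t)"
  then have "summable (\<lambda>i. s (Suc i) t - s i t)"
   unfolding d_def by (rule summable_norm_cancel)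
  then have "convergent (\<lambda>n. \<Sum>i<n. s (Suc i) t - s i t)"
   by (simp add: summable_iff_convergent)
  then have "convergent (\<lambda>n. s n t - s 0 t)"
   using sum_lessThan_telescope[of "\<lambda>i. s i t"] by simp
  then have "convergent (\<lambda>n. (s n t - s 0 t) + s 0 t)"
   by (intro convergent_add convergent_const)
  then show "(\<lambda>i. s i t) \<longlonglongrightarrow> lim (\<lambda>i. s i t)"
   by (simp add: convergent_LIMSEQ_iff)
 qed
 define g where "g = (\<lambda>t. lim (\<lambda>i. s i t))"
 have gm: "strongly_measurable (MT T) g"
  unfolding strongly_measurable_def using s(1) lim
  by (intro exI[of _ s] conjI allI) (auto simp: g_def)
 have gi: "g - s i \<in> L2 T \<and> L2norm T (g - s i) \<le> 3 * (1/2)^i" for i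
 proof -
  have l: "AE t in MT T. (\<lambda>j. (s j - s i) t) \<longlonglongrightarrow> (g - s i) t"
   using lim by (rule eventually_mono) (auto simp: g_def intro: tendsto_diff)
  have m: "strongly_measurable (MT T) (g - s i)"
   using strongly_measurable_bilinear[OF bounded_bilinear_scaleR
     strongly_measurable_const[of _ "-1"] strongly_measurable_simple[OF s(1)[of i]]]
    strongly_measurable_add[OF gm] by (fastforce simp: fun_diff_def)
  from L2_Fatou[OF L2_diff[OF s(2) s(2)] l m kd, of i] show ?thesis by simp
 qed
 have gL2: "g \<in> L2 T"
  using L2_add[OF conjunct1[OF gi[of 0]] s(2)[of 0]] by simp
 moreover have "(\<lambda>n. L2norm T (f n - g)) \<longlonglongrightarrow> 0"
 proof (rule LIMSEQ_I)
  fix e :: real assume e: "0 < e"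
  obtain i where i: "(1/2)^i < e/5" using real_arch_pow_inv[of "e/5" "1/2"] e by auto
  have "norm (L2norm T (f n - g) - 0) < e" if n: "n \<ge> k i" for n
  proof -
   have "L2norm T (f n - g) = L2norm T (((f n - f (k i)) - (s i - f (k i))) - (g - s i))"
    by (simp add: algebra_simps)
   also have "\<dots> \<le> L2norm T ((f n - f (k i)) - (s i - f (k i))) + L2norm T (g - s i)"
    using s(2) f gL2 by (intro L2norm_diff L2_diff) auto
   also have "\<dots> \<le> L2norm T (f n - f (k i)) + L2norm T (s i - f (k i)) + L2norm T (g - s i)"
    using L2norm_diff[of "f n - f (k i)" T "s i - f (k i)"] s(2) f by (simp add: L2_diff)
   finally show ?thesis
    using N[OF order_trans[OF kN[OF order_refl] n] kN[OF order_refl]] s(3)[of i] gi[of i] i by simp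
  qed
  then show "\<exists>no. \<forall>n\<ge>no. norm (L2norm T (f n - g) - 0) < e" by blast
 qed
 ultimately show ?thesis by blast
qed

section \<open>Hilbert space methods on carriers\<close>

text \<open>A Hilbert space up to elements of norm zero. Functions that agree almost everywhere are not
 identified, so the form is only semidefinite and limits are not unique.\<close>

locale semi_hilbert =
 fixes S :: "'a::real_vector set" and b :: "'a \<Rightarrow> 'a \<Rightarrow> real"
 assumes S: "subspace S"
  and b_add: "x \<in> S \<Longrightarrow> y \<in> S \<Longrightarrow> z \<in> S \<Longrightarrow> b (x + y) z = b x z + b y z"
  and b_scale: "x \<in> S \<Longrightarrow> z \<in> S \<Longrightarrow> b (c *\<^sub>R x) z = c * b x z"
  and b_commute: "x \<in> S \<Longrightarrow> z \<in> S \<Longrightarrow> b x z = b z x"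
  and b_nonneg: "x \<in> S \<Longrightarrow> 0 \<le> b x x"
  and complete: "(\<And>n. f n \<in> S) \<Longrightarrow>
   (\<And>e. 0 < e \<Longrightarrow> \<exists>N. \<forall>m\<ge>N. \<forall>n\<ge>N. b (f m - f n) (f m - f n) < e) \<Longrightarrow>
   \<exists>g\<in>S. (\<lambda>n. b (f n - g) (f n - g)) \<longlonglongrightarrow> 0"
begin

lemma S_closed [simp]:
 "x \<in> S \<Longrightarrow> y \<in> S \<Longrightarrow> x + y \<in> S" "x \<in> S \<Longrightarrow> c *\<^sub>R x \<in> S" "x \<in> S \<Longrightarrow> y \<in> S \<Longrightarrow> x - y \<in> S" "0 \<in> S"
 using S by (auto simp: subspace_add subspace_scale subspace_diff subspace_0)

lemma b_add_right: "x \<in> S \<Longrightarrow> y \<in> S \<Longrightarrow> z \<in> S \<Longrightarrow> b z (x + y) = b z x + b z y"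
 using b_add b_commute by simp

lemma b_scale_right: "x \<in> S \<Longrightarrow> z \<in> S \<Longrightarrow> b z (c *\<^sub>R x) = c * b z x"
 using b_scale b_commute by simp

lemma b_diff: "x \<in> S \<Longrightarrow> y \<in> S \<Longrightarrow> z \<in> S \<Longrightarrow> b (x - y) z = b x z - b y z"
 using b_add[of x "(-1) *\<^sub>R y" z] b_scale[of y z "-1"] S_closed(2)[of y "-1"] by simp

lemma b_diff_right: "x \<in> S \<Longrightarrow> y \<in> S \<Longrightarrow> z \<in> S \<Longrightarrow> b z (x - y) = b z x - b z y"
 using b_diff b_commute by simp

abbreviation nrm :: "'a \<Rightarrow> real" where "nrm x \<equiv> sqrt (b x x)"

lemma nrm_sq: "x \<in> S \<Longrightarrow> (nrm x)\<^sup>2 = b x x"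
 by (simp add: b_nonneg)

text \<open>The first-order condition at the minimum \<open>t = 0\<close> of a quadratic polynomial.\<close>

lemma quadratic_nonneg_linear_zero:
 fixes d B :: real
 assumes "\<And>t. 0 \<le> 2 * t * d + t\<^sup>2 * B" and "0 \<le> B"
 shows "d = 0"
proof (rule ccontr)
 assume d: "d \<noteq> 0"
 have "0 \<le> 2 * (- d / (B + 1)) * d + (- d / (B + 1))\<^sup>2 * B" by (rule assms(1))
 also have "\<dots> = - (d\<^sup>2 * (B + 2)) / (B + 1)\<^sup>2"
  using assms(2) by (simp add: divide_simps power2_eq_square) (simp add: algebra_simps)
 also have "\<dots> < 0" using d assms(2) by (simp add: divide_less_0_iff)
 finally show False by simp
qed

lemma Cauchy_Schwarz:
 assumes x: "x \<in> S" and y: "y \<in> S"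
 shows "\<bar>b x y\<bar> \<le> nrm x * nrm y"
proof -
 have q: "0 \<le> s\<^sup>2 * b x x + 2 * (s * t * b x y) + t\<^sup>2 * b y y" for s t
 proof -
  have "0 \<le> b (s *\<^sub>R x + t *\<^sub>R y) (s *\<^sub>R x + t *\<^sub>R y)" using x y by (intro b_nonneg) auto
  also have "\<dots> = s\<^sup>2 * b x x + 2 * (s * t * b x y) + t\<^sup>2 * b y y"
   using x y b_commute[OF y x]
   by (simp add: b_add b_add_right b_scale b_scale_right power2_eq_square algebra_simps)
  finally show ?thesis .
 qed
 have "(b x y)\<^sup>2 \<le> b x x * b y y"
 proof (cases "b y y = 0")
  case True
  have "0 \<le> 2 * t * b x y + t\<^sup>2 * b x x" for t
   using q[of t 1] True by (simp add: algebra_simps)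
  from quadratic_nonneg_linear_zero[OF this b_nonneg[OF x]] True show ?thesis by simp
 next
  case False
  then have pos: "b y y > 0" using b_nonneg[OF y] by simp
  have "0 \<le> b y y * (b x x * b y y - (b x y)\<^sup>2)"
   using q[of "b y y" "- b x y"] by (simp add: power2_eq_square algebra_simps)
  then show ?thesis using pos by (simp add: zero_le_mult_iff)
 qed
 then have "sqrt ((b x y)\<^sup>2) \<le> sqrt (b x x * b y y)" by (rule real_sqrt_le_mono)
 then show ?thesis by (simp add: real_sqrt_mult)
qed

text \<open>
 Dirichlet's principle: a minimizing sequence of \<open>y \<mapsto> b (r y) (r y) - 2 L y\<close> is mapped by \<open>r\<close> to
 a Cauchy sequence, by the parallelogram identity, and its limit represents \<open>L\<close>. The limit is taken
 in the complete space that contains the values of \<open>r\<close>, while the test elements range over an arbitrary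
 subspace \<open>\<Phi>\<close>; this asymmetry is what makes Lions' theorem a corollary.
\<close>

lemma minimization_represents:
 fixes r :: "'b::real_vector \<Rightarrow> 'a"
 assumes \<Phi>: "subspace \<Phi>" and r: "\<And>y. y \<in> \<Phi> \<Longrightarrow> r y \<in> S"
  and r_add: "\<And>x y z. x \<in> \<Phi> \<Longrightarrow> y \<in> \<Phi> \<Longrightarrow> z \<in> S \<Longrightarrow> b z (r (x + y)) = b z (r x) + b z (r y)"
  and r_scale: "\<And>c x z. x \<in> \<Phi> \<Longrightarrow> z \<in> S \<Longrightarrow> b z (r (c *\<^sub>R x)) = c * b z (r x)"
  and L_add: "\<And>x y. x \<in> \<Phi> \<Longrightarrow> y \<in> \<Phi> \<Longrightarrow> L (x + y) = L x + L y"
  and L_scale: "\<And>c x. x \<in> \<Phi> \<Longrightarrow> L (c *\<^sub>R x) = c * L x"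
  and L_bound: "\<And>y. y \<in> \<Phi> \<Longrightarrow> \<bar>L y\<bar> \<le> c * nrm (r y)"
 shows "\<exists>x\<in>S. \<forall>y\<in>\<Phi>. b x (r y) = L y"
proof -
 define Q where "Q y = b (r y) (r y) - 2 * L y" for y
 have phi: "x + y \<in> \<Phi>" "a *\<^sub>R x \<in> \<Phi>" if "x \<in> \<Phi>" "y \<in> \<Phi>" for x y a
  using that \<Phi> by (auto simp: subspace_add subspace_scale)
 have low: "- c\<^sup>2 \<le> Q y" if y: "y \<in> \<Phi>" for y
 proof -
  have "Q y \<ge> (nrm (r y))\<^sup>2 - 2 * (c * nrm (r y))"
   using L_bound[OF y] nrm_sq[OF r[OF y]] by (simp add: Q_def abs_le_iff)
  moreover have "(nrm (r y))\<^sup>2 - 2 * (c * nrm (r y)) = (nrm (r y) - c)\<^sup>2 - c\<^sup>2"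
   by (simp add: power2_eq_square algebra_simps)
  ultimately show ?thesis using zero_le_power2[of "nrm (r y) - c"] by linarith
 qed
 define m where "m = Inf (Q ` \<Phi>)"
 have bdd: "bdd_below (Q ` \<Phi>)" using low by (intro bdd_belowI2[of _ "- c\<^sup>2"]) auto
 have ne: "Q ` \<Phi> \<noteq> {}" using subspace_0[OF \<Phi>] by auto
 have mQ: "m \<le> Q y" if "y \<in> \<Phi>" for y unfolding m_def using bdd that by (intro cInf_lower) auto
 have "\<exists>y\<in>\<Phi>. Q y < m + 1 / real (Suc n)" for n
 proof -
  have "Inf (Q ` \<Phi>) < m + 1 / real (Suc n)" unfolding m_def by simp
  from cInf_lessD[OF ne this] show ?thesis by auto
 qed
 then obtain y where y: "\<And>n. y n \<in> \<Phi>" "\<And>n. Q (y n) < m + 1 / real (Suc n)" by metis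
 have par: "b (r x - r z) (r x - r z) \<le> 2 * (Q x + Q z - 2 * m)" if x: "x \<in> \<Phi>" and z: "z \<in> \<Phi>" for x z
 proof -
  define w where "w = (1/2) *\<^sub>R (x + z)"
  have w: "w \<in> \<Phi>" using x z phi by (simp add: w_def)
  have bw: "b u (r w) = (b u (r x) + b u (r z)) / 2" if "u \<in> S" for u
   using x z phi that by (simp add: w_def r_scale r_add)
  have "b (r w) (r w) = (b (r w) (r x) + b (r w) (r z)) / 2" by (rule bw[OF r[OF w]])
  also have "\<dots> = (b (r x) (r w) + b (r z) (r w)) / 2" using r x z w b_commute by simp
  also have "\<dots> = (b (r x) (r x) + 2 * b (r x) (r z) + b (r z) (r z)) / 4"
   using bw[OF r[OF x]] bw[OF r[OF z]] b_commute[OF r[OF z] r[OF x]] by simp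
  finally have ww: "b (r w) (r w) = (b (r x) (r x) + 2 * b (r x) (r z) + b (r z) (r z)) / 4" .
  have "b (r x - r z) (r x - r z) = b (r x) (r x) - 2 * b (r x) (r z) + b (r z) (r z)"
   using r x z b_commute[OF r[OF z] r[OF x]] by (simp add: b_diff b_diff_right)
  moreover have "L w = (L x + L z) / 2" using x z phi by (simp add: w_def L_scale L_add)
  ultimately have "b (r x - r z) (r x - r z) = 2 * (Q x + Q z - 2 * Q w)"
   using ww by (simp add: Q_def)
  then show ?thesis using mQ[OF w] by simp
 qed
 have "\<exists>g\<in>S. (\<lambda>n. b (r (y n) - g) (r (y n) - g)) \<longlonglongrightarrow> 0"
 proof (rule complete)
  fix e :: real assume e: "0 < e"
  obtain N where N: "1 / real (Suc N) < e / 4" using nat_approx_posE[of "e/4"] e by auto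
  have Q_less: "Q (y i) < m + e / 4" if "N \<le> i" for i
  proof -
   have "1 / real (Suc i) \<le> 1 / real (Suc N)" using that by (simp add: frac_le)
   then show ?thesis using order.strict_trans1[OF _ N] y(2)[of i] by fastforce
  qed
  have "b (r (y i) - r (y j)) (r (y i) - r (y j)) < e" if "N \<le> i" "N \<le> j" for i j
  proof -
   have "Q (y i) + Q (y j) - 2 * m < e / 2"
    using Q_less[OF that(1)] Q_less[OF that(2)] by (simp add: field_simps)
   with par[OF y(1) y(1), of i j] show ?thesis by (simp add: field_simps)
  qed
  then show "\<exists>N. \<forall>m\<ge>N. \<forall>n\<ge>N. b (r (y m) - r (y n)) (r (y m) - r (y n)) < e" by blast
 qed (use r y in auto)
 then obtain g where g: "g \<in> S" "(\<lambda>n. b (r (y n) - g) (r (y n) - g)) \<longlonglongrightarrow> 0" by blast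
 have "b g (r w) = L w" if w: "w \<in> \<Phi>" for w
 proof -
  have conv: "(\<lambda>n. b (r (y n)) (r w)) \<longlonglongrightarrow> b g (r w)"
  proof (rule LIM_zero_cancel, rule Lim_null_comparison)
   show "\<forall>\<^sub>F n in sequentially. norm (b (r (y n)) (r w) - b g (r w))
     \<le> nrm (r (y n) - g) * nrm (r w)"
   proof (rule always_eventually, rule allI)
    fix n
    show "norm (b (r (y n)) (r w) - b g (r w)) \<le> nrm (r (y n) - g) * nrm (r w)"
     using Cauchy_Schwarz[of "r (y n) - g" "r w"] r y g w by (simp add: b_diff)
   qed
   have "(\<lambda>n. nrm (r (y n) - g)) \<longlonglongrightarrow> sqrt 0" by (intro tendsto_real_sqrt g)
   then show "(\<lambda>n. nrm (r (y n) - g) * nrm (r w)) \<longlonglongrightarrow> 0"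
    by (auto intro: tendsto_mult_left_zero)
  qed
  have "0 \<le> 2 * t * (b g (r w) - L w) + t\<^sup>2 * b (r w) (r w)" for t
  proof -
   have "- (1 / real (Suc n)) \<le> 2 * t * (b (r (y n)) (r w) - L w) + t\<^sup>2 * b (r w) (r w)" for n
   proof -
    let ?v = "y n + t *\<^sub>R w"
    have v: "?v \<in> \<Phi>" using y w phi by simp
    have bv: "b u (r ?v) = b u (r (y n)) + t * b u (r w)" if "u \<in> S" for u
     using y w phi that by (simp add: r_add r_scale)
    have "b (r ?v) (r ?v) = b (r ?v) (r (y n)) + t * b (r ?v) (r w)" by (rule bv[OF r[OF v]])
    also have "\<dots> = b (r (y n)) (r ?v) + t * b (r w) (r ?v)" using r v y w b_commute by simp
    also have "\<dots> = b (r (y n)) (r (y n)) + 2 * t * b (r (y n)) (r w) + t\<^sup>2 * b (r w) (r w)"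
     using bv[OF r[OF y(1)]] bv[OF r[OF w]] b_commute[OF r[OF w] r[OF y(1)]]
     by (simp add: power2_eq_square algebra_simps)
    finally have "Q ?v = Q (y n) + 2 * t * (b (r (y n)) (r w) - L w) + t\<^sup>2 * b (r w) (r w)"
     using y w phi by (simp add: Q_def L_add L_scale algebra_simps)
    then show ?thesis using mQ[OF v] y(2)[of n] by simp
   qed
   moreover have "(\<lambda>n. 2 * t * (b (r (y n)) (r w) - L w) + t\<^sup>2 * b (r w) (r w))
     \<longlonglongrightarrow> 2 * t * (b g (r w) - L w) + t\<^sup>2 * b (r w) (r w)"
    by (intro tendsto_intros conv)
   moreover have "(\<lambda>n. - (1 / real (Suc n))) \<longlonglongrightarrow> - 0"
    by (intro tendsto_minus LIMSEQ_Suc[OF lim_1_over_n])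
   ultimately show ?thesis by (intro LIMSEQ_le[of "\<lambda>n. - (1 / real (Suc n))" 0]) auto
  qed
  from quadratic_nonneg_linear_zero[OF this b_nonneg[OF r[OF w]]] show ?thesis by simp
 qed
 then show ?thesis using g(1) by blast
qed

lemma riesz:
 assumes "\<And>x y. x \<in> S \<Longrightarrow> y \<in> S \<Longrightarrow> \<phi> (x + y) = \<phi> x + \<phi> y" "\<And>c x. x \<in> S \<Longrightarrow> \<phi> (c *\<^sub>R x) = c * \<phi> x"
  and "\<And>x. x \<in> S \<Longrightarrow> \<bar>\<phi> x\<bar> \<le> c * nrm x"
 shows "\<exists>f\<in>S. \<forall>x\<in>S. b f x = \<phi> x"
 using minimization_represents[OF S, of "\<lambda>x. x" \<phi> c] assms
 by (simp add: b_add_right b_scale_right)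

text \<open>
 Lions' representation theorem. Let \<open>r y\<close> be the Riesz representative of \<open>x \<mapsto> E x y\<close>. The inf-sup
 bound says that \<open>L\<close> is bounded with respect to \<open>nrm (r y)\<close>, so that Dirichlet's principle yields an
 \<open>x\<close> with \<open>b x (r y) = L y\<close>.
\<close>

theorem lions:
 fixes \<Phi> :: "'b::real_vector set"
 assumes \<Phi>: "subspace \<Phi>"
  and E_add: "\<And>x x' y. x \<in> S \<Longrightarrow> x' \<in> S \<Longrightarrow> y \<in> \<Phi> \<Longrightarrow> E (x + x') y = E x y + E x' y"
  and E_scale: "\<And>c x y. x \<in> S \<Longrightarrow> y \<in> \<Phi> \<Longrightarrow> E (c *\<^sub>R x) y = c * E x y"
  and E_bound: "\<And>x y. x \<in> S \<Longrightarrow> y \<in> \<Phi> \<Longrightarrow> \<bar>E x y\<bar> \<le> K y * nrm x"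
  and E_add2: "\<And>x y y'. x \<in> S \<Longrightarrow> y \<in> \<Phi> \<Longrightarrow> y' \<in> \<Phi> \<Longrightarrow> E x (y + y') = E x y + E x y'"
  and E_scale2: "\<And>c x y. x \<in> S \<Longrightarrow> y \<in> \<Phi> \<Longrightarrow> E x (c *\<^sub>R y) = c * E x y"
  and L_add: "\<And>y y'. y \<in> \<Phi> \<Longrightarrow> y' \<in> \<Phi> \<Longrightarrow> L (y + y') = L y + L y'"
  and L_scale: "\<And>c y. y \<in> \<Phi> \<Longrightarrow> L (c *\<^sub>R y) = c * L y"
  and infsup: "\<And>y M. y \<in> \<Phi> \<Longrightarrow> 0 \<le> M \<Longrightarrow> (\<And>x. x \<in> S \<Longrightarrow> \<bar>E x y\<bar> \<le> M * nrm x) \<Longrightarrow> \<bar>L y\<bar> \<le> c * M"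
 shows "\<exists>x\<in>S. \<forall>y\<in>\<Phi>. E x y = L y"
proof -
 have "\<forall>y\<in>\<Phi>. \<exists>f\<in>S. \<forall>x\<in>S. b f x = E x y"
  using E_add E_scale E_bound by (intro ballI riesz) auto
 then obtain r where r: "\<And>y. y \<in> \<Phi> \<Longrightarrow> r y \<in> S" "\<And>x y. y \<in> \<Phi> \<Longrightarrow> x \<in> S \<Longrightarrow> b (r y) x = E x y"
  by metis
 have rE: "b x (r y) = E x y" if "y \<in> \<Phi>" "x \<in> S" for x y
  using r that b_commute by simp
 have phi: "x + y \<in> \<Phi>" "a *\<^sub>R x \<in> \<Phi>" if "x \<in> \<Phi>" "y \<in> \<Phi>" for x y a
  using that \<Phi> by (auto simp: subspace_add subspace_scale)
 have "\<exists>x\<in>S. \<forall>y\<in>\<Phi>. b x (r y) = L y"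
 proof (rule minimization_represents[OF \<Phi>])
  show "\<bar>L y\<bar> \<le> c * nrm (r y)" if y: "y \<in> \<Phi>" for y
  proof (rule infsup[OF y])
   show "\<bar>E x y\<bar> \<le> nrm (r y) * nrm x" if "x \<in> S" for x
    using Cauchy_Schwarz[OF r(1)[OF y] that] r(2)[OF y that] by simp
   show "0 \<le> nrm (r y)" using b_nonneg[OF r(1)[OF y]] by simp
  qed
 qed (use r rE phi E_add2 E_scale2 L_add L_scale in auto)
 then show ?thesis using rE by auto
qed

end

lemma semi_hilbert_prod:
 assumes "semi_hilbert S b"
 shows "semi_hilbert (S \<times> S) (\<lambda>x y. b (fst x) (fst y) + b (snd x) (snd y))"
proof -
 interpret semi_hilbert S b by fact
 show ?thesis
 proof
  show "subspace (S \<times> S)" using S by (simp add: subspace_def zero_prod_def plus_prod_def)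
  show "0 \<le> b (fst x) (fst x) + b (snd x) (snd x)" if "x \<in> S \<times> S" for x
   using that b_nonneg by auto
  show "b (fst x) (fst z) + b (snd x) (snd z) = b (fst z) (fst x) + b (snd z) (snd x)"
   if "x \<in> S \<times> S" "z \<in> S \<times> S" for x z
   using that b_commute[of "fst x" "fst z"] b_commute[of "snd x" "snd z"] by (simp add: mem_Times_iff)
  fix f :: "nat \<Rightarrow> 'a \<times> 'a"
  assume f: "\<And>n. f n \<in> S \<times> S" and cau: "\<And>e. 0 < e \<Longrightarrow> \<exists>N. \<forall>m\<ge>N. \<forall>n\<ge>N.
    b (fst (f m - f n)) (fst (f m - f n)) + b (snd (f m - f n)) (snd (f m - f n)) < e"
  have fs: "fst (f n) \<in> S" "snd (f n) \<in> S" for n using f[of n] by auto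
  have nn: "0 \<le> b (fst (f m) - fst (f n)) (fst (f m) - fst (f n))"
    "0 \<le> b (snd (f m) - snd (f n)) (snd (f m) - snd (f n))" for m n
   using fs b_nonneg by auto
  have "\<exists>N. \<forall>m\<ge>N. \<forall>n\<ge>N. b (fst (f m) - fst (f n)) (fst (f m) - fst (f n)) < e" if e: "0 < e" for e
  proof -
   obtain N where N: "\<forall>m\<ge>N. \<forall>n\<ge>N.
     b (fst (f m - f n)) (fst (f m - f n)) + b (snd (f m - f n)) (snd (f m - f n)) < e"
    using cau[OF e] by blast
   have "b (fst (f m) - fst (f n)) (fst (f m) - fst (f n)) < e" if "m \<ge> N" "n \<ge> N" for m n
    using N[rule_format, OF that] nn[of m n] by simp
   then show ?thesis by blast
  qed
  then obtain g1 where g1: "g1 \<in> S" "(\<lambda>n. b (fst (f n) - g1) (fst (f n) - g1)) \<longlonglongrightarrow> 0"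
   using complete[of "\<lambda>n. fst (f n)"] fs by blast
  have "\<exists>N. \<forall>m\<ge>N. \<forall>n\<ge>N. b (snd (f m) - snd (f n)) (snd (f m) - snd (f n)) < e" if e: "0 < e" for e
  proof -
   obtain N where N: "\<forall>m\<ge>N. \<forall>n\<ge>N.
     b (fst (f m - f n)) (fst (f m - f n)) + b (snd (f m - f n)) (snd (f m - f n)) < e"
    using cau[OF e] by blast
   have "b (snd (f m) - snd (f n)) (snd (f m) - snd (f n)) < e" if "m \<ge> N" "n \<ge> N" for m n
    using N[rule_format, OF that] nn[of m n] by simp
   then show ?thesis by blast
  qed
  then obtain g2 where g2: "g2 \<in> S" "(\<lambda>n. b (snd (f n) - g2) (snd (f n) - g2)) \<longlonglongrightarrow> 0"
   using complete[of "\<lambda>n. snd (f n)"] fs by blast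
  show "\<exists>g\<in>S \<times> S. (\<lambda>n. b (fst (f n - g)) (fst (f n - g)) + b (snd (f n - g)) (snd (f n - g))) \<longlonglongrightarrow> 0"
   using tendsto_add[OF g1(2) g2(2)] g1(1) g2(1) by (intro bexI[of _ "(g1, g2)"]) auto
 qed (auto simp: b_add b_scale algebra_simps)
qed

section \<open>Smooth functions with compact support\<close>

definition smooth :: "(real \<Rightarrow> real) \<Rightarrow> bool"
 where "smooth f \<longleftrightarrow> (\<forall>n t. ((deriv ^^ n) f) differentiable (at t))"

inductive alg :: "((real \<Rightarrow> real) \<Rightarrow> bool) \<Rightarrow> (real \<Rightarrow> real) \<Rightarrow> bool" for G where
 base: "G f \<Longrightarrow> alg G f"
| const: "alg G (\<lambda>_. c)"
| add: "alg G f \<Longrightarrow> alg G g \<Longrightarrow> alg G (\<lambda>t. f t + g t)"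
| mult: "alg G f \<Longrightarrow> alg G g \<Longrightarrow> alg G (\<lambda>t. f t * g t)"

text \<open>Smoothness is a coinductive property: it suffices that the derivatives of the generators
 stay within the algebra that they generate.\<close>

lemma smooth_alg:
 assumes G: "\<And>f. G f \<Longrightarrow> (\<forall>t. f differentiable (at t)) \<and> alg G (deriv f)" and f: "alg G f"
 shows "smooth f"
proof -
 have step: "alg G h \<Longrightarrow> (\<forall>t. h differentiable (at t)) \<and> alg G (deriv h)" for h
 proof (induction rule: alg.induct)
  case (const c)
  have "deriv (\<lambda>_. c) = (\<lambda>_. 0::real)" by auto
  then show ?case using alg.const[of G 0] by simp
 next
  case (add f g)
  have "deriv (\<lambda>t. f t + g t) = (\<lambda>t. deriv f t + deriv g t)"
   using add by (auto intro!: DERIV_imp_deriv derivative_intros simp: DERIV_deriv_iff_real_differentiable)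
  then show ?case using add by (auto intro: alg.add)
 next
  case (mult f g)
  have "deriv (\<lambda>t. f t * g t) = (\<lambda>t. f t * deriv g t + deriv f t * g t)"
  proof (intro ext DERIV_imp_deriv)
   fix t
   have "(f has_real_derivative deriv f t) (at t)" "(g has_real_derivative deriv g t) (at t)"
    using mult by (auto simp: DERIV_deriv_iff_real_differentiable)
   from DERIV_mult[OF this] show "((\<lambda>t. f t * g t) has_real_derivative f t * deriv g t + deriv f t * g t) (at t)"
    by (simp add: algebra_simps)
  qed
  then show ?case using mult by (auto intro: alg.add alg.mult)
 qed (use G in auto)
 have "alg G ((deriv ^^ n) f)" for n
  by (induction n) (use f step in auto)
 then show ?thesis unfolding smooth_def using step by blast
qed

lemma smooth_differentiable: "smooth f \<Longrightarrow> f differentiable (at t)"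
 unfolding smooth_def by (drule spec[of _ 0]) simp

lemma smooth_DERIV: "smooth f \<Longrightarrow> (f has_real_derivative deriv f t) (at t)"
 by (simp add: smooth_differentiable DERIV_deriv_iff_real_differentiable)

lemma smooth_iff: "smooth f \<longleftrightarrow> (\<forall>t. f differentiable (at t)) \<and> smooth (deriv f)"
proof -
 have sh: "(deriv ^^ Suc n) f = (deriv ^^ n) (deriv f)" for n by (simp add: funpow_swap1)
 show ?thesis
 proof
  assume "smooth f"
  then have "((deriv ^^ n) (deriv f)) differentiable (at t)" for n t
   unfolding smooth_def sh[symmetric] by blast
  with \<open>smooth f\<close> show "(\<forall>t. f differentiable (at t)) \<and> smooth (deriv f)"
   by (simp add: smooth_differentiable smooth_def[of "deriv f"])
 next
  assume f: "(\<forall>t. f differentiable (at t)) \<and> smooth (deriv f)"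
  have "((deriv ^^ n) f) differentiable (at t)" for n t
  proof (cases n)
   case 0
   then show ?thesis using f by simp
  next
   case (Suc m)
   show ?thesis unfolding Suc sh using f unfolding smooth_def by blast
  qed
  then show "smooth f" by (simp add: smooth_def)
 qed
qed

lemma smooth_deriv: "smooth f \<Longrightarrow> smooth (deriv f)"
 using smooth_iff by blast

lemma smooth_continuous:
 assumes "smooth f"
 shows "continuous_on A f"
proof (rule continuous_at_imp_continuous_on, rule ballI)
 fix x
 show "isCont f x" by (rule DERIV_isCont[OF smooth_DERIV[OF assms]])
qed

lemma alg_smooth: "alg smooth f \<Longrightarrow> smooth f"
 by (rule smooth_alg[where G = smooth]) (simp_all add: alg.base smooth_deriv smooth_differentiable)

lemma smooth_const: "smooth (\<lambda>_. c)"
 by (rule alg_smooth, rule alg.const)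

lemma smooth_add: "smooth f \<Longrightarrow> smooth g \<Longrightarrow> smooth (\<lambda>t. f t + g t)"
 by (rule alg_smooth, rule alg.add) (simp_all add: alg.base)

lemma smooth_mult: "smooth f \<Longrightarrow> smooth g \<Longrightarrow> smooth (\<lambda>t. f t * g t)"
 by (rule alg_smooth, rule alg.mult) (simp_all add: alg.base)

lemma smooth_affine:
 assumes "smooth f"
 shows "smooth (\<lambda>t. f (a * t + b))"
proof -
 define G where "G g \<longleftrightarrow> (\<exists>f. smooth f \<and> g = (\<lambda>t. f (a * t + b)))" for g
 have "(\<forall>t. g differentiable (at t)) \<and> alg G (deriv g)" if g: "G g" for g
 proof -
  obtain f where f: "smooth f" "g = (\<lambda>t. f (a * t + b))" using g by (auto simp: G_def)
  have d: "(g has_real_derivative deriv f (a * t + b) * a) (at t)" for t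
   unfolding f(2) by (rule DERIV_chain2[OF smooth_DERIV[OF f(1)]]) (auto intro!: derivative_eq_intros)
  then have "deriv g = (\<lambda>t. deriv f (a * t + b) * a)" by (intro ext DERIV_imp_deriv)
  moreover have "alg G (\<lambda>t. deriv f (a * t + b) * a)"
   using smooth_deriv[OF f(1)] by (intro alg.mult alg.const alg.base) (auto simp: G_def)
  ultimately show ?thesis using d real_differentiable_def by auto
 qed
 moreover have "alg G (\<lambda>t. f (a * t + b))" using assms by (intro alg.base) (auto simp: G_def)
 ultimately show ?thesis by (rule smooth_alg)
qed

lemma smooth_exp: "smooth (\<lambda>t. exp (\<mu> * t))"
proof (rule smooth_alg[where G = "\<lambda>g. g = (\<lambda>t. exp (\<mu> * t))"])
 fix g assume g: "g = (\<lambda>t::real. exp (\<mu> * t))"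
 have d: "(g has_real_derivative \<mu> * exp (\<mu> * t)) (at t)" for t
  unfolding g by (auto intro!: derivative_eq_intros)
 then have "deriv g = (\<lambda>t. \<mu> * exp (\<mu> * t))" by (intro ext DERIV_imp_deriv)
 moreover have "alg (\<lambda>g. g = (\<lambda>t. exp (\<mu> * t))) (\<lambda>t. \<mu> * exp (\<mu> * t))"
  by (rule alg.mult[OF alg.const alg.base]) simp
 ultimately show "(\<forall>t. g differentiable (at t)) \<and> alg (\<lambda>g. g = (\<lambda>t. exp (\<mu> * t))) (deriv g)"
  using d by (auto simp: real_differentiable_def)
qed (auto intro: alg.base)

text \<open>The flat function \<open>exp (-1/t)\<close>; the powers of \<open>1/t\<close> make the family closed under differentiation, up
 to linear combinations.\<close>

definition flat :: "nat \<Rightarrow> real \<Rightarrow> real"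
 where "flat n t = (if 0 < t then (1/t) ^ n * exp (- (1/t)) else 0)"

lemma flat_DERIV: "(flat n has_real_derivative - real n * flat (Suc n) t + flat (n + 2) t) (at t)"
proof -
 consider "t < 0" | "t > 0" | "t = 0" by linarith
 then show ?thesis
 proof cases
  case 1
  have "((\<lambda>_. 0) has_real_derivative 0) (at t)" by simp
  then have "(flat n has_real_derivative 0) (at t)"
   by (rule has_field_derivative_transform_within_open[of _ _ _ "{..<0}"]) (use 1 in \<open>auto simp: flat_def\<close>)
  then show ?thesis using 1 by (simp add: flat_def)
 next
  case 2
  have d: "((\<lambda>t. 1/t) has_real_derivative - ((1/t)\<^sup>2)) (at t)"
   using 2 by (auto intro!: derivative_eq_intros simp: divide_simps power2_eq_square)
  have e: "real n * (- (u\<^sup>2) * u ^ (n - Suc 0)) = - real n * u ^ Suc n" for u :: real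
   by (cases n) (auto simp: power2_eq_square algebra_simps)
  have "((\<lambda>t. (1/t) ^ n * exp (- (1/t))) has_real_derivative
    real n * (- ((1/t)\<^sup>2) * (1/t) ^ (n - Suc 0)) * exp (- (1/t)) + exp (- (1/t)) * - (- ((1/t)\<^sup>2)) * (1/t) ^ n) (at t)"
   by (rule DERIV_mult[OF DERIV_power[OF d] DERIV_fun_exp[OF DERIV_minus[OF d]]])
  then have "((\<lambda>t. (1/t) ^ n * exp (- (1/t))) has_real_derivative
    - real n * ((1/t) ^ Suc n * exp (- (1/t))) + (1/t) ^ (n + 2) * exp (- (1/t))) (at t)"
   unfolding e by (simp add: power2_eq_square algebra_simps)
  then have "((\<lambda>t. (1/t) ^ n * exp (- (1/t))) has_real_derivative
    - real n * flat (Suc n) t + flat (n + 2) t) (at t)"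
   using 2 by (simp add: flat_def)
  then show ?thesis
   by (rule has_field_derivative_transform_within_open[of _ _ _ "{0<..}"]) (use 2 in \<open>auto simp: flat_def\<close>)
 next
  case 3
  have "((\<lambda>h. (flat n (0 + h) - flat n 0) / h) \<longlongrightarrow> 0) (at 0)"
  proof (rule filterlim_split_at)
   have "((\<lambda>h::real. 0::real) \<longlongrightarrow> 0) (at_left 0)" by simp
   then show "((\<lambda>h. (flat n (0 + h) - flat n 0) / h) \<longlongrightarrow> 0) (at_left 0)"
    by (rule Lim_transform_eventually)
      (auto simp: flat_def eventually_at_filter intro!: always_eventually)
   have "((\<lambda>h::real. inverse h ^ Suc n / exp (inverse h)) \<longlongrightarrow> 0) (at_right 0)"
    by (rule filterlim_compose[OF tendsto_power_div_exp_0 filterlim_inverse_at_top_right])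
   then show "((\<lambda>h. (flat n (0 + h) - flat n 0) / h) \<longlongrightarrow> 0) (at_right 0)"
    by (rule Lim_transform_eventually)
      (auto simp: flat_def eventually_at_filter exp_minus field_simps intro!: always_eventually)
  qed
  then have "(flat n has_real_derivative 0) (at 0)" by (simp only: DERIV_def)
  then show ?thesis using 3 by (simp add: flat_def)
 qed
qed

lemma smooth_flat: "smooth (flat n)"
proof (rule smooth_alg[where G = "\<lambda>g. \<exists>n. g = flat n"])
 fix g assume "\<exists>n. g = flat n"
 then obtain n where g: "g = flat n" by blast
 have "deriv g = (\<lambda>t. - real n * flat (Suc n) t + flat (n + 2) t)"
  unfolding g by (intro ext DERIV_imp_deriv flat_DERIV)
 moreover have "alg (\<lambda>g. \<exists>n. g = flat n) (\<lambda>t. - real n * flat (Suc n) t + flat (n + 2) t)"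
  by (rule alg.add[OF alg.mult[OF alg.const alg.base] alg.base]) blast+
 ultimately show "(\<forall>t. g differentiable (at t)) \<and> alg (\<lambda>g. \<exists>n. g = flat n) (deriv g)"
  using flat_DERIV unfolding g real_differentiable_def by metis
qed (auto intro: alg.base)

definition bump :: "real \<Rightarrow> real \<Rightarrow> real \<Rightarrow> real \<Rightarrow> real"
 where "bump a b k t = flat 0 (k * (t - a)) * flat 0 (k * (b - t))"

lemma smooth_bump: "smooth (bump a b k)"
proof -
 have "bump a b k = (\<lambda>t. flat 0 (k * t + (- k * a)) * flat 0 ((-k) * t + k * b))"
  by (auto simp: bump_def algebra_simps)
 then show ?thesis by (simp only:) (intro smooth_mult smooth_affine smooth_flat)
qed

lemma flat_0_bounds: "0 \<le> flat 0 t" "flat 0 t \<le> 1"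
 by (auto simp: flat_def)

lemma bump_bounds: "0 \<le> bump a b k t" "bump a b k t \<le> 1"
 unfolding bump_def using flat_0_bounds by (auto intro: mult_le_one)

lemma bump_outside: "0 < k \<Longrightarrow> t \<notin> {a<..<b} \<Longrightarrow> bump a b k t = 0"
 by (auto simp: bump_def flat_def zero_less_mult_iff)

lemma bump_tendsto: "(\<lambda>n. bump a b (real (Suc n)) t) \<longlonglongrightarrow> indicator {a<..<b} t"
proof (cases "t \<in> {a<..<b}")
 case True
 have *: "(\<lambda>n. flat 0 (real (Suc n) * s)) \<longlonglongrightarrow> 1" if s: "0 < s" for s
 proof -
  have "(\<lambda>n. exp (- (1 / real (Suc n) * (1 / s)))) \<longlonglongrightarrow> exp (- (0 * (1/s)))"
   by (intro tendsto_intros LIMSEQ_Suc[OF lim_1_over_n])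
  then show ?thesis using s by (simp add: flat_def)
 qed
 have "(\<lambda>n. bump a b (real (Suc n)) t) \<longlonglongrightarrow> 1 * 1"
  unfolding bump_def using True by (intro tendsto_mult *) auto
 then show ?thesis using True by simp
next
 case False
 then have "bump a b (real (Suc n)) t = 0" for n by (intro bump_outside) auto
 then show ?thesis using False by simp
qed

lemma test_function_iff:
 "test_function T \<phi> \<longleftrightarrow> smooth \<phi> \<and> (\<exists>a b. 0 < a \<and> b < T \<and> (\<forall>t. t \<notin> {a..b} \<longrightarrow> \<phi> t = 0))"
 by (simp add: test_function_def smooth_def)

lemma test_function_bump: "0 < a \<Longrightarrow> b < T \<Longrightarrow> 0 < k \<Longrightarrow> test_function T (bump a b k)"
 unfolding test_function_iff
 by (rule conjI[OF smooth_bump], rule exI[of _ a], rule exI[of _ b]) (auto intro!: bump_outside)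

lemma test_function_mult_smooth: "test_function T \<phi> \<Longrightarrow> smooth f \<Longrightarrow> test_function T (\<lambda>t. f t * \<phi> t)"
 unfolding test_function_iff by (auto intro: smooth_mult)

lemma test_function_DERIV: "test_function T \<phi> \<Longrightarrow> (\<phi> has_real_derivative deriv \<phi> t) (at t)"
 by (simp add: test_function_iff smooth_DERIV)

lemma test_function_continuous:
 assumes "test_function T \<phi>"
 shows "continuous_on A \<phi>" "continuous_on A (deriv \<phi>)"
 using assms by (auto simp: test_function_iff intro: smooth_continuous smooth_deriv)

lemma test_function_outside: "test_function T \<phi> \<Longrightarrow> t \<notin> {0<..<T} \<Longrightarrow> \<phi> t = 0"
 unfolding test_function_iff by auto

lemma test_function_bounded:
 assumes "test_function T \<phi>"
 shows "\<exists>K\<ge>0. \<forall>t. \<bar>\<phi> t\<bar> \<le> K"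
proof -
 have "compact (\<phi> ` {0..T})" using test_function_continuous[OF assms] by (intro compact_continuous_image) auto
 then obtain K where K: "\<And>t. t \<in> {0..T} \<Longrightarrow> \<bar>\<phi> t\<bar> \<le> K"
  by (metis bounded_iff compact_imp_bounded imageI real_norm_def)
 have "\<bar>\<phi> t\<bar> \<le> max K 0" for t
  using K[of t] test_function_outside[OF assms, of t] by (cases "t \<in> {0..T}") auto
 then show ?thesis by (intro exI[of _ "max K 0"]) auto
qed

section \<open>The fundamental lemma of the calculus of variations\<close>

text \<open>Fubini's theorem and induction over Borel sets apply to \<open>lborel\<close>. A Borel version that vanishes
 outside the horizon transports integrals there.\<close>

lemma borel_version:
 fixes f :: "real \<Rightarrow> real"
 assumes f: "integrable (MT T) f"
 obtains g where "g \<in> borel_measurable borel" "integrable lborel g" "AE t in MT T. f t = g t"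
  "\<And>t. t \<notin> {0..T} \<Longrightarrow> g t = 0"
proof -
 have i: "integrable lebesgue (\<lambda>t. indicator {0..T} t *\<^sub>R f t)"
  using f by (simp add: integrable_restrict_space)
 obtain g where g: "g \<in> borel_measurable lborel" "AE t in lborel. indicator {0..T} t *\<^sub>R f t = g t"
  using completion_ex_borel_measurable_real[OF borel_measurable_integrable[OF i]] by blast
 define g' where "g' = (\<lambda>t. indicator {0..T} t * g t)"
 have ae: "AE t in lebesgue. indicator {0..T} t *\<^sub>R f t = g' t"
  using AE_completion[OF g(2)] by (rule eventually_mono) (auto simp: g'_def indicator_def of_bool_def)
 have m: "g' \<in> borel_measurable borel" using g(1) by (simp add: g'_def)
 have m': "g' \<in> borel_measurable lebesgue" using m by (simp add: measurable_completion)
 have "integrable lebesgue g'"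
  by (rule integrable_cong_AE_imp[OF i m']) (use ae in \<open>auto elim: eventually_mono\<close>)
 then have apply_integrable: "integrable lborel g'" using m by (simp add: integrable_completion)
 have aeg: "AE t in MT T. f t = g' t"
 proof -
  have "AE t in lebesgue. t \<in> {0..T} \<longrightarrow> f t = g' t"
   using ae by (rule eventually_mono) auto
  then show ?thesis by (simp add: AE_restrict_space_iff)
 qed
 have "g' t = 0" if "t \<notin> {0..T}" for t using that by (simp add: g'_def)
 from that[OF m apply_integrable aeg this] show thesis .
qed

lemma borel_version_integral:
 fixes f g :: "real \<Rightarrow> real"
 assumes k: "k \<in> borel_measurable borel" and g: "g \<in> borel_measurable borel"
  and f: "f \<in> borel_measurable (MT T)"
  and ae: "AE t in MT T. f t = g t" and out: "\<And>t. t \<notin> {0..T} \<Longrightarrow> g t = 0"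
 shows "(LINT t|MT T. k t * f t) = (LINT t|lborel. k t * g t)"
proof -
 have bl: "h \<in> borel_measurable (MT T)" if "h \<in> borel_measurable borel" for h :: "real \<Rightarrow> real"
  using that by (intro measurable_restrict_space1 measurable_completion) simp
 note k' = bl[OF k] bl[OF g]
 have "(LINT t|MT T. k t * f t) = (LINT t|MT T. k t * g t)"
  by (intro integral_cong_AE borel_measurable_times k' f) (use ae in \<open>auto elim: eventually_mono\<close>)
 also have "\<dots> = (LINT t|lebesgue. indicator {0..T} t *\<^sub>R (k t * g t))"
  by (simp add: integral_restrict_space)
 also have "\<dots> = (LINT t|lebesgue. k t * g t)"
  by (intro Bochner_Integration.integral_cong refl) (metis out indicator_simps(1) indicator_simps(2) mult_zero_right scaleR_one scaleR_zero_right)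
 also have "\<dots> = (LINT t|lborel. k t * g t)"
  using k g by (intro integral_completion) simp
 finally show ?thesis .
qed

text \<open>Half lines form a generator that is stable under intersections, so that additive properties need
 to be checked on half lines, complements and disjoint unions only.\<close>

lemma borel_half_line_induct [consumes 1, case_names half_line empty compl union]:
 fixes A :: "real set"
 assumes "A \<in> sets borel" and "\<And>a. P {a<..}" and "P {}"
  and "\<And>A. A \<in> sets borel \<Longrightarrow> P A \<Longrightarrow> P (- A)"
  and "\<And>A. disjoint_family A \<Longrightarrow> range A \<subseteq> sets borel \<Longrightarrow> (\<And>i::nat. P (A i)) \<Longrightarrow> P (\<Union>i. A i)"
 shows "P A"
proof -
 have sb: "sets borel = sigma_sets UNIV (range (greaterThan :: real \<Rightarrow> _))"
  by (subst borel_Ioi) (simp add: sets_measure_of)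
 have "Int_stable (range (greaterThan :: real \<Rightarrow> _))"
 proof (rule Int_stableI)
  fix a b assume "a \<in> range (greaterThan :: real \<Rightarrow> _)" "b \<in> range (greaterThan :: real \<Rightarrow> _)"
  then obtain x y where "a = {x<..}" "b = {y<..}" by auto
  then have "a \<inter> b = {max x y<..}" by auto
  then show "a \<inter> b \<in> range greaterThan" by blast
 qed
 moreover have "range (greaterThan :: real \<Rightarrow> _) \<subseteq> Pow UNIV" by simp
 moreover have "A \<in> sigma_sets UNIV (range greaterThan)" using assms(1) sb by simp
 ultimately show ?thesis
 proof (induction rule: sigma_sets_induct_disjoint)
  case (compl A)
  then show ?case using assms(4)[of A] sb by (simp add: Compl_eq_Diff_UNIV)
 next
  case (union A)
  then show ?case using assms(5)[of A] sb by auto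
 qed (use assms in auto)
qed

text \<open>The integrals over half lines are limits of integrals over compactly contained intervals. By
 induction over Borel sets, the integral over every Borel set vanishes.\<close>

lemma zero_if_interval_integrals_zero:
 fixes g :: "real \<Rightarrow> real"
 assumes g: "integrable lborel g" and out: "\<And>t. t \<notin> {0..T} \<Longrightarrow> g t = 0"
  and z: "\<And>a b. 0 < a \<Longrightarrow> a < b \<Longrightarrow> b < T \<Longrightarrow> (LINT t|lborel. indicator {a<..<b} t * g t) = 0"
 shows "AE t in lborel. g t = 0"
proof -
 have gm: "g \<in> borel_measurable borel" using g by auto
 have gi: "integrable lborel (\<lambda>t. indicator A t * g t)" if "A \<in> sets borel" for A
  using integrable_mult_indicator[of A lborel g] g that by simp
 have half: "(LINT t|lborel. indicator {a<..} t * g t) = 0" for a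
 proof -
  define l where "l n = max a 0 + 1 / real (Suc n)" for n
  define r where "r n = T - 1 / real (Suc n)" for n
  have l0: "l \<longlonglongrightarrow> max a 0 + 0" and r0: "r \<longlonglongrightarrow> T - 0"
   unfolding l_def r_def by (intro tendsto_intros LIMSEQ_Suc[OF lim_1_over_n])+
  have "(\<lambda>n. LINT t|lborel. indicator {l n<..<r n} t * g t) \<longlonglongrightarrow> (LINT t|lborel. indicator {a<..} t * g t)"
  proof (rule integral_dominated_convergence[where w = "\<lambda>t. \<bar>g t\<bar>"])
   show "AE t in lborel. (\<lambda>n. indicator {l n<..<r n} t * g t) \<longlonglongrightarrow> indicator {a<..} t * g t"
    using AE_lborel_singleton[of 0] AE_lborel_singleton[of T]
   proof eventually_elim
    case (elim t)
    consider "t \<le> max a 0" | "t > T" | "max a 0 < t" "t < T" using elim by linarith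
    then show ?case
    proof cases
     case 1
     then have "indicator {l n<..<r n} t = (0::real)" for n
     proof -
      have "t \<le> l n" using 1 by (simp add: l_def add_increasing2)
      then show ?thesis by simp
     qed
     moreover have "indicator {a<..} t * g t = 0" using 1 elim out[of t] by (auto simp: indicator_def max_def split: if_splits)
     ultimately show ?thesis by (simp only:) simp
    next
     case 2
     then show ?thesis using out[of t] by simp
    next
     case 3
     have "\<forall>\<^sub>F n in sequentially. l n < t" "\<forall>\<^sub>F n in sequentially. t < r n"
      using order_tendstoD(2)[OF l0, of t] order_tendstoD(1)[OF r0, of t] 3 by auto
     then have "\<forall>\<^sub>F n in sequentially. indicator {l n<..<r n} t * g t = indicator {a<..} t * g t"
      by eventually_elim (use 3 in auto)
     then show ?thesis by (rule tendsto_eventually)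
    qed
   qed
  qed (use gm g in \<open>auto simp: indicator_def\<close>)
  moreover have "(LINT t|lborel. indicator {l n<..<r n} t * g t) = 0" for n
  proof (cases "l n < r n")
   case True
   have "0 < l n" "r n < T" by (auto simp: l_def r_def add_nonneg_pos)
   then show ?thesis using z[of "l n" "r n"] True by simp
  next
   case False
   then have "{l n<..<r n} = {}" by auto
   then show ?thesis by simp
  qed
  ultimately show ?thesis by (simp add: LIMSEQ_const_iff)
 qed
 have tot: "(LINT t|lborel. g t) = 0"
 proof -
  have "(LINT t|lborel. g t) = (LINT t|lborel. indicator {-1<..} t * g t)"
   by (intro Bochner_Integration.integral_cong) (use out in \<open>auto simp: indicator_def\<close>)
  then show ?thesis using half by simp
 qed
 have "(LINT t|lborel. indicator A t * g t) = 0" if "A \<in> sets borel" for A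
  using that
 proof (induction rule: borel_half_line_induct)
  case (compl A)
  have "(LINT t|lborel. indicator (- A) t * g t) = (LINT t|lborel. g t - indicator A t * g t)"
   by (intro Bochner_Integration.integral_cong) (auto simp: indicator_def)
  also have "\<dots> = 0" using compl gi g tot by simp
  finally show ?case .
 next
  case (union A)
  have "(LINT t:(\<Union>i. A i)|lborel. g t) = (\<Sum>i. LINT t:A i|lborel. g t)"
  proof (rule lebesgue_integral_countable_add)
   show "set_integrable lborel (\<Union>i. A i) g"
    using gi[of "\<Union>i. A i"] union by (auto simp: set_integrable_def)
  qed (use union in \<open>auto simp: disjoint_family_on_def\<close>)
  then show ?case using union by (simp add: set_lebesgue_integral_def)
 qed (use half in auto)
 then show ?thesis
  using sigma_finite_measure.density_zero[OF sigma_finite_lborel g] by (simp add: set_lebesgue_integral_def)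
qed

text \<open>Indicators of intervals are bounded pointwise limits of bump functions.\<close>

lemma fundamental_lemma:
 fixes f :: "real \<Rightarrow> real"
 assumes f: "integrable (MT T) f"
  and z: "\<And>\<phi>. test_function T \<phi> \<Longrightarrow> (LINT t|MT T. \<phi> t * f t) = 0"
 shows "AE t in MT T. f t = 0"
proof -
 obtain g where g: "g \<in> borel_measurable borel" "integrable lborel g" "AE t in MT T. f t = g t"
   "\<And>t. t \<notin> {0..T} \<Longrightarrow> g t = 0" using borel_version[OF f] by blast
 have "AE t in lborel. g t = 0"
 proof (rule zero_if_interval_integrals_zero[OF g(2,4)])
  fix a b assume ab: "0 < a" "a < b" "b < T"
  have bm: "bump a b k \<in> borel_measurable borel" for k
   by (intro borel_measurable_continuous_onI smooth_continuous smooth_bump)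
  have "(\<lambda>n. LINT t|lborel. bump a b (real (Suc n)) t * g t) \<longlonglongrightarrow> (LINT t|lborel. indicator {a<..<b} t * g t)"
  proof (rule integral_dominated_convergence[where w = "\<lambda>t. \<bar>g t\<bar>"])
   show "AE t in lborel. norm (bump a b (real (Suc n)) t * g t) \<le> \<bar>g t\<bar>" for n
    using bump_bounds[of a b "real (Suc n)"] by (intro AE_I2) (auto simp: abs_mult intro!: mult_left_le_one_le)
   show "AE t in lborel. (\<lambda>n. bump a b (real (Suc n)) t * g t) \<longlonglongrightarrow> indicator {a<..<b} t * g t"
    by (intro AE_I2 tendsto_intros bump_tendsto)
  qed (use g bm in auto)
  moreover have "(LINT t|lborel. bump a b (real (Suc n)) t * g t) = 0" for n
   using borel_version_integral[OF bm g(1) borel_measurable_integrable[OF f] g(3,4), of "real (Suc n)"]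
    z[OF test_function_bump, of a b "real (Suc n)"] ab by simp
  ultimately show "(LINT t|lborel. indicator {a<..<b} t * g t) = 0"
   by (simp add: LIMSEQ_const_iff)
 qed auto
 then have "AE t in MT T. g t = 0"
  by (auto simp: AE_restrict_space_iff dest: AE_completion elim: eventually_mono)
 with g(3) show ?thesis by eventually_elim simp
qed

lemma test_function_deriv:
 assumes "test_function T \<phi>"
 shows "test_function T (deriv \<phi>)"
proof -
 obtain a b where ab: "smooth \<phi>" "0 < a" "b < T" "\<And>t. t \<notin> {a..b} \<Longrightarrow> \<phi> t = 0"
  using assms unfolding test_function_iff by blast
 have "deriv \<phi> t = 0" if t: "t \<notin> {a..b}" for t
 proof (rule DERIV_imp_deriv)
  have "((\<lambda>_. 0) has_real_derivative 0) (at t)" by simp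
  then show "(\<phi> has_real_derivative 0) (at t)"
   by (rule has_field_derivative_transform_within_open[of _ _ _ "- {a..b}"]) (use t ab(4) in auto)
 qed
 then show ?thesis unfolding test_function_iff using ab smooth_deriv by blast
qed

lemma test_function_integrable:
 assumes "test_function T \<phi>"
 shows "\<phi> \<in> borel_measurable borel" and "integrable lborel \<phi>"
proof -
 show m: "\<phi> \<in> borel_measurable borel"
  by (intro borel_measurable_continuous_onI test_function_continuous(1)[OF assms])
 have "integrable lborel (\<lambda>t. indicator {0..T} t *\<^sub>R \<phi> t)"
  using borel_integrable_compact[of "{0..T}" \<phi>] test_function_continuous(1)[OF assms] by auto
 moreover have "(\<lambda>t. indicator {0..T} t *\<^sub>R \<phi> t) = \<phi>"
 proof
  fix t show "indicator {0..T} t *\<^sub>R \<phi> t = \<phi> t"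
   using test_function_outside[OF assms, of t] by (cases "t \<in> {0..T}") auto
 qed
 ultimately show "integrable lborel \<phi>" by simp
qed

lemma smooth_antiderivative:
 assumes K: "smooth K" and ab: "0 < a" "b < T" and out: "\<And>t. t \<notin> {a..b} \<Longrightarrow> K t = 0"
  and int: "(LINT t|lborel. K t) = 0"
 shows "\<exists>\<phi>. test_function T \<phi> \<and> deriv \<phi> = K"
proof -
 define a0 where "a0 = a / 2"
 define \<phi> where "\<phi> t = integral {a0..t} K" for t
 have cK: "continuous_on A K" for A using K by (rule smooth_continuous)
 have low: "\<phi> t = 0" if "t < a" for t
 proof -
  have "integral {a0..t} K = integral {a0..t} (\<lambda>_. 0)"
   by (intro Henstock_Kurzweil_Integration.integral_cong out) (use that in auto)
  then show ?thesis by (simp add: \<phi>_def)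
 qed
 have tK: "test_function T K" unfolding test_function_iff using K ab out by blast
 have high: "\<phi> t = 0" if "b < t" for t
 proof -
  have "\<phi> t = integral UNIV (\<lambda>s. if s \<in> {a0..t} then K s else 0)"
   unfolding \<phi>_def by (rule integral_restrict_UNIV[symmetric])
  also have "\<dots> = integral UNIV K"
   by (intro Henstock_Kurzweil_Integration.integral_cong) (use that out ab in \<open>auto simp: a0_def\<close>)
  also have "\<dots> = 0" using integral_lborel[OF test_function_integrable(2)[OF tK]] int by simp
  finally show ?thesis .
 qed
 have der: "(\<phi> has_real_derivative K t) (at t)" for t
 proof (cases "t < a")
  case True
  have "((\<lambda>_. 0) has_real_derivative 0) (at t)" by simp
  then have "(\<phi> has_real_derivative 0) (at t)"
   by (rule has_field_derivative_transform_within_open[of _ _ _ "{..<a}"]) (use True low in auto)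
  then show ?thesis using out[of t] True by simp
 next
  case False
  have "(\<phi> has_real_derivative K t) (at t within {a0..t + 1})"
   unfolding \<phi>_def using False ab by (intro integral_has_real_derivative cK) (auto simp: a0_def)
  then show ?thesis using False ab by (subst (asm) at_within_Icc_at) (auto simp: a0_def)
 qed
 then have dK: "deriv \<phi> = K" by (intro ext DERIV_imp_deriv)
 moreover have "smooth \<phi>" using smooth_iff[of \<phi>] der dK K by (auto simp: real_differentiable_def)
 moreover have "\<phi> t = 0" if "t \<notin> {a..b}" for t using that low[of t] high[of t] by (cases "t < a") auto
 ultimately show ?thesis using ab unfolding test_function_iff by blast
qed

text \<open>Interchanging the order of integration turns the primitive of \<open>g\<close> into the primitive of \<open>deriv \<phi>\<close>.\<close>

lemma test_function_by_parts_lborel: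
 fixes g :: "real \<Rightarrow> real"
 assumes g: "integrable lborel g" and \<phi>: "test_function T \<phi>"
 shows "(LINT t|lborel. deriv \<phi> t * (LINT s|lborel. indicator {..t} s * g s)) = - (LINT s|lborel. \<phi> s * g s)"
proof -
 note \<phi>' = test_function_integrable[OF test_function_deriv[OF \<phi>]]
 have gm[measurable]: "g \<in> borel_measurable borel" using g by auto
 have dm[measurable]: "deriv \<phi> \<in> borel_measurable borel" by (rule \<phi>'(1))
 have prod: "integrable (lborel \<Otimes>\<^sub>M lborel) (\<lambda>(t, s). deriv \<phi> t * g s)"
 proof (rule lborel_pair.Fubini_integrable)
  have "integrable lborel (\<lambda>t. \<bar>deriv \<phi> t\<bar> * (LINT s|lborel. \<bar>g s\<bar>))" using \<phi>'(2) by simp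
  then show "integrable lborel (\<lambda>t. LINT s|lborel. norm (case (t, s) of (t, s) \<Rightarrow> deriv \<phi> t * g s))"
   by (simp add: abs_mult)
 qed (use g in auto)
 have int: "integrable (lborel \<Otimes>\<^sub>M lborel) (\<lambda>(t, s). deriv \<phi> t * (indicator {..t} s * g s))"
 proof (rule Bochner_Integration.integrable_bound[OF prod])
  have "(\<lambda>(t, s). deriv \<phi> t * (indicator {..t} s * g s))
    = (\<lambda>p. deriv \<phi> (fst p) * ((if snd p \<le> fst p then 1 else 0) * g (snd p)))"
   by (auto simp: indicator_def)
  then show "(\<lambda>(t, s). deriv \<phi> t * (indicator {..t} s * g s)) \<in> borel_measurable (lborel \<Otimes>\<^sub>M lborel)"
   by simp
 qed (auto simp: indicator_def)
 have "(LINT t|lborel. deriv \<phi> t * (LINT s|lborel. indicator {..t} s * g s))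
   = (LINT t|lborel. LINT s|lborel. deriv \<phi> t * (indicator {..t} s * g s))" by simp
 also have "\<dots> = (LINT s|lborel. LINT t|lborel. deriv \<phi> t * (indicator {..t} s * g s))"
  using lborel_pair.Fubini_integral[OF int] by simp
 also have "\<dots> = (LINT s|lborel. - (\<phi> s * g s))"
 proof (intro Bochner_Integration.integral_cong refl)
  fix s
  define b where "b = max s T"
  have "(LINT t|lborel. deriv \<phi> t * indicator {s..b} t) = \<phi> b - \<phi> s"
   by (rule integral_FTC_Icc_real)
     (use test_function_DERIV[OF \<phi>] DERIV_isCont[OF test_function_DERIV[OF test_function_deriv[OF \<phi>]]] in
      \<open>auto simp: b_def\<close>)
  moreover have "\<phi> b = 0" using test_function_outside[OF \<phi>, of b] by (auto simp: b_def)
  moreover have "(\<lambda>t. deriv \<phi> t * (indicator {..t} s * g s)) = (\<lambda>t. deriv \<phi> t * indicator {s..b} t * g s)"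
  proof
   fix t
   have "deriv \<phi> t = 0" if "t > T" using test_function_outside[OF test_function_deriv[OF \<phi>], of t] that by simp
   then show "deriv \<phi> t * (indicator {..t} s * g s) = deriv \<phi> t * indicator {s..b} t * g s"
    by (cases "t > T") (auto simp: indicator_def b_def)
  qed
  ultimately show "(LINT t|lborel. deriv \<phi> t * (indicator {..t} s * g s)) = - (\<phi> s * g s)" by simp
 qed
 finally show ?thesis by simp
qed

lemma test_function_by_parts:
 fixes g :: "real \<Rightarrow> real"
 assumes g: "integrable (MT T) g" and \<phi>: "test_function T \<phi>"
 shows "(LINT t|MT T. deriv \<phi> t * integral {0..t} g) = - (LINT t|MT T. \<phi> t * g t)"
proof -
 obtain h where h: "h \<in> borel_measurable borel" "integrable lborel h" "AE t in MT T. g t = h t"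
   "\<And>t. t \<notin> {0..T} \<Longrightarrow> h t = 0" using borel_version[OF g] by blast
 have F: "(LINT s|lborel. indicator {..t} s * h s) = integral {0..t} g" if t: "t \<in> {0..T}" for t
 proof -
  have "(LINT s|lborel. indicator {..t} s * h s) = (LINT s|MT T. indicator {..t} s * g s)"
   by (rule borel_version_integral[OF _ h(1) borel_measurable_integrable[OF g] h(3,4), symmetric]) auto
  also have "\<dots> = (LINT s|lebesgue. indicator {0..T} s *\<^sub>R (indicator {..t} s * g s))"
   by (simp add: integral_restrict_space)
  also have "\<dots> = (LINT s|lebesgue. indicator {0..t} s *\<^sub>R g s)"
   by (intro Bochner_Integration.integral_cong) (use t in \<open>auto simp: indicator_def\<close>)
  also have "\<dots> = (LINT s|lebesgue_on {0..t}. g s)"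
   by (simp add: integral_restrict_space)
  also have "\<dots> = integral {0..t} g"
  proof (rule lebesgue_integral_eq_integral)
   show "integrable (lebesgue_on {0..t}) g"
    by (rule integrable_subinterval[OF g]) (use t in auto)
  qed simp
  finally show ?thesis .
 qed
 have hm[measurable]: "h \<in> borel_measurable borel" by (rule h(1))
 have Fm: "(\<lambda>t. LINT s|lborel. indicator {..t} s * h s) \<in> borel_measurable borel"
 proof -
  have "(\<lambda>(t, s). indicator {..t} s * h s) = (\<lambda>p. (if snd p \<le> fst p then 1 else 0) * h (snd p))"
   by (auto simp: indicator_def)
  then have "(\<lambda>(t, s). indicator {..t} s * h s) \<in> borel_measurable (borel \<Otimes>\<^sub>M lborel)" by simp
  from sigma_finite_measure.borel_measurable_lebesgue_integral[OF _ this] show ?thesis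
   by (simp add: sigma_finite_lborel)
 qed
 have dm: "deriv \<phi> \<in> borel_measurable borel"
  by (rule test_function_integrable(1)[OF test_function_deriv[OF \<phi>]])
 have "(LINT t|MT T. deriv \<phi> t * integral {0..t} g)
   = (LINT t|MT T. deriv \<phi> t * (LINT s|lborel. indicator {..t} s * h s))"
  by (intro Bochner_Integration.integral_cong) (auto simp: F)
 also have "\<dots> = (LINT t|lebesgue. indicator {0..T} t *\<^sub>R (deriv \<phi> t * (LINT s|lborel. indicator {..t} s * h s)))"
  by (simp add: integral_restrict_space)
 also have "\<dots> = (LINT t|lebesgue. deriv \<phi> t * (LINT s|lborel. indicator {..t} s * h s))"
 proof (intro Bochner_Integration.integral_cong refl)
  fix t
  show "indicator {0..T} t *\<^sub>R (deriv \<phi> t * (LINT s|lborel. indicator {..t} s * h s))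
    = deriv \<phi> t * (LINT s|lborel. indicator {..t} s * h s)"
   using test_function_outside[OF test_function_deriv[OF \<phi>], of t] by (cases "t \<in> {0..T}") auto
 qed
 also have "\<dots> = (LINT t|lborel. deriv \<phi> t * (LINT s|lborel. indicator {..t} s * h s))"
  using dm Fm by (intro integral_completion) simp
 also have "\<dots> = - (LINT s|lborel. \<phi> s * h s)" by (rule test_function_by_parts_lborel[OF h(2) \<phi>])
 also have "(LINT s|lborel. \<phi> s * h s) = (LINT t|MT T. \<phi> t * g t)"
  by (rule borel_version_integral[OF test_function_integrable(1)[OF \<phi>] h(1)
     borel_measurable_integrable[OF g] h(3,4), symmetric])
 finally show ?thesis .
qed

lemma test_function_mult_integrable:
 fixes f :: "real \<Rightarrow> real"
 assumes f: "integrable (MT T) f" and \<phi>: "test_function T \<phi>"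
 shows "integrable (MT T) (\<lambda>t. \<phi> t * f t)"
proof -
 obtain K where K: "\<And>t. \<bar>\<phi> t\<bar> \<le> K" using test_function_bounded[OF \<phi>] by blast
 show ?thesis
 proof (rule Bochner_Integration.integrable_bound)
  show "integrable (MT T) (\<lambda>t. K * \<bar>f t\<bar>)" using f by simp
  have "\<phi> \<in> borel_measurable (MT T)"
   using test_function_integrable(1)[OF \<phi>] by (intro measurable_restrict_space1 measurable_completion) simp
  then show "(\<lambda>t. \<phi> t * f t) \<in> borel_measurable (MT T)"
   using f by (intro borel_measurable_times) auto
  show "AE t in MT T. norm (\<phi> t * f t) \<le> norm (K * \<bar>f t\<bar>)"
   using K by (intro AE_I2) (simp add: abs_mult mult_right_mono order_trans[OF K abs_ge_self])
 qed
qed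

text \<open>The lemma of du Bois-Reymond. The difference \<open>w\<close> of \<open>f\<close> and a primitive of \<open>g\<close> is orthogonal to the
 derivatives of test functions. A test function is such a derivative if its integral is zero, so after
 subtraction of a multiple of one fixed function \<open>\<rho>0\<close> every test function can be used: \<open>w\<close> is
 orthogonal to everything up to a constant.\<close>

theorem weak_derivative_primitive:
 fixes f g :: "real \<Rightarrow> real"
 assumes T: "0 < T" and f: "integrable (MT T) f" and g: "integrable (MT T) g"
  and weak: "\<And>\<phi>. test_function T \<phi> \<Longrightarrow>
   (LINT t|MT T. deriv \<phi> t * f t) = - (LINT t|MT T. \<phi> t * g t)"
 shows "\<exists>c. AE t in MT T. f t = c + integral {0..t} g"
proof -
 define F where "F t = integral {0..t} g" for t
 have Fc: "continuous_on {0..T} F"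
  unfolding F_def by (intro indefinite_integral_continuous_1 integrable_on_lebesgue_on[OF g]) simp
 have Fi: "integrable (MT T) F"
  using integrable_continuous_real[OF Fc] continuous_imp_integrable_real Fc by blast
 define w where "w = (\<lambda>t. f t - F t)"
 have wi: "integrable (MT T) w" using f Fi by (simp add: w_def)
 have w0: "(LINT t|MT T. deriv \<phi> t * w t) = 0" if \<phi>: "test_function T \<phi>" for \<phi>
 proof -
  note i = test_function_mult_integrable[OF _ test_function_deriv[OF \<phi>]]
  have "(LINT t|MT T. deriv \<phi> t * w t)
    = (LINT t|MT T. deriv \<phi> t * f t) - (LINT t|MT T. deriv \<phi> t * F t)"
   using i[OF f] i[OF Fi] by (simp add: w_def right_diff_distrib)
  then show ?thesis using weak[OF \<phi>] test_function_by_parts[OF g \<phi>] by (simp add: F_def)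
 qed
 \<comment> \<open>otherwise the constant function 1 would vanish almost everywhere\<close>
 have "\<exists>\<rho>. test_function T \<rho> \<and> (LINT t|MT T. \<rho> t) \<noteq> 0"
 proof (rule ccontr)
  assume n: "\<not> ?thesis"
  have "AE t in MT T. (1::real) = 0"
   by (rule fundamental_lemma) (use n in \<open>auto simp: finite_measure.integrable_const finite_measure_lebesgue_on\<close>)
  then have "AE t in lebesgue. t \<notin> {0..T}" by (simp add: AE_restrict_space_iff)
  from emeasure_eq_0_AE[OF this] have "emeasure lebesgue {0..T} = 0"
   by (simp add: atLeastAtMost_def atLeast_def atMost_def Int_def conj_commute)
  then show False using T by (simp add: ennreal_eq_0_iff)
 qed
 then obtain \<rho>0 where t0: "test_function T \<rho>0" and "(LINT t|MT T. \<rho>0 t) \<noteq> 0" by blast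
 define I where "I = (LINT t|MT T. \<rho>0 t)"
 have I: "I \<noteq> 0" unfolding I_def by fact
 have lb: "(LINT t|MT T. \<psi> t) = (LINT t|lborel. \<psi> t)" if p: "test_function T \<psi>" for \<psi>
 proof -
  have "(LINT t|MT T. \<psi> t) = (LINT t|lebesgue. indicator {0..T} t *\<^sub>R \<psi> t)"
   by (simp add: integral_restrict_space)
  also have "\<dots> = (LINT t|lebesgue. \<psi> t)"
  proof (intro Bochner_Integration.integral_cong refl)
   fix t show "indicator {0..T} t *\<^sub>R \<psi> t = \<psi> t"
    using test_function_outside[OF p, of t] by (cases "t \<in> {0..T}") auto
  qed
  also have "\<dots> = (LINT t|lborel. \<psi> t)"
   using test_function_integrable(1)[OF p] by (intro integral_completion) simp
  finally show ?thesis .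
 qed
 define C where "C = (LINT t|MT T. \<rho>0 t * w t) / I"
 have "AE t in MT T. w t - C = 0"
 proof (rule fundamental_lemma)
  show "integrable (MT T) (\<lambda>t. w t - C)"
   using wi by (intro Bochner_Integration.integrable_diff) (simp_all add: finite_measure.integrable_const finite_measure_lebesgue_on)
  fix \<zeta> assume z: "test_function T \<zeta>"
  define J where "J = (LINT t|MT T. \<zeta> t)"
  define K where "K t = \<zeta> t + (- (J / I)) * \<rho>0 t" for t
  obtain a1 b1 where ab1: "0 < a1" "b1 < T" "\<And>t. t \<notin> {a1..b1} \<Longrightarrow> \<zeta> t = 0"
   using z unfolding test_function_iff by blast
  obtain a2 b2 where ab2: "0 < a2" "b2 < T" "\<And>t. t \<notin> {a2..b2} \<Longrightarrow> \<rho>0 t = 0"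
   using t0 unfolding test_function_iff by blast
  have "\<exists>\<phi>. test_function T \<phi> \<and> deriv \<phi> = K"
  proof (rule smooth_antiderivative)
   show "smooth K" unfolding K_def using z t0
    by (intro smooth_add smooth_mult smooth_const) (auto simp: test_function_iff)
   show "0 < min a1 a2" "max b1 b2 < T" using ab1 ab2 by auto
   show "K t = 0" if "t \<notin> {min a1 a2..max b1 b2}" for t
   proof -
    have "t \<notin> {a1..b1}" "t \<notin> {a2..b2}" using that by auto
    then show ?thesis by (simp add: K_def ab1(3) ab2(3))
   qed
   show "(LINT t|lborel. K t) = 0"
    using test_function_integrable(2)[OF z] test_function_integrable(2)[OF t0] I
    by (simp add: K_def J_def lb[OF z] lb[OF t0, symmetric] I_def[symmetric])
  qed
  then obtain \<phi> where \<phi>: "test_function T \<phi>" "deriv \<phi> = K" by blast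
  note iz = test_function_mult_integrable[OF wi z] and ir = test_function_mult_integrable[OF wi t0]
  have zi: "integrable (MT T) \<zeta>"
   using continuous_imp_integrable_real test_function_continuous(1)[OF z] by blast
  have "0 = (LINT t|MT T. K t * w t)" using w0[OF \<phi>(1)] \<phi>(2) by simp
  also have "\<dots> = (LINT t|MT T. \<zeta> t * w t - (J / I) * (\<rho>0 t * w t))"
   by (intro Bochner_Integration.integral_cong) (simp_all add: K_def algebra_simps)
  also have "\<dots> = (LINT t|MT T. \<zeta> t * w t) - (J / I) * (LINT t|MT T. \<rho>0 t * w t)"
   using iz ir by simp
  also have "\<dots> = (LINT t|MT T. \<zeta> t * w t) - C * (LINT t|MT T. \<zeta> t)"
   by (simp add: C_def J_def)
  also have "\<dots> = (LINT t|MT T. \<zeta> t * (w t - C))"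
   using iz zi by (simp add: right_diff_distrib mult.commute)
  finally show "(LINT t|MT T. \<zeta> t * (w t - C)) = 0" by simp
 qed
 then have "AE t in MT T. f t = C + integral {0..t} g"
  by (rule eventually_mono) (simp add: w_def F_def algebra_simps)
 then show ?thesis by blast
qed

section \<open>Weak time derivatives\<close>

lemma emb_dual_apply [simp]: "emb_dual \<iota> h w = h \<bullet> \<iota> w"
 by (simp add: emb_dual_def)

lemma bounded_linear_emb_dual: "bounded_linear (emb_dual \<iota>)"
 unfolding emb_dual_def by (intro bounded_linear_intros)

lemma bounded_bilinear_emb_inner: "bounded_bilinear (\<lambda>v w. blinfun_apply \<iota> v \<bullet> blinfun_apply \<iota> w)"
 by (intro bounded_bilinear.comp[OF bounded_bilinear_inner] blinfun.bounded_linear_right)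

text \<open>Separability of \<open>V\<close> reduces a statement about functionals almost everywhere to countably many
 statements about real functions.\<close>

lemma functional_zero_if_zero_on_dense:
 fixes f :: "'v::real_normed_vector \<Rightarrow>\<^sub>L real"
 assumes D: "\<And>X. open X \<Longrightarrow> X \<noteq> {} \<Longrightarrow> \<exists>d\<in>D. d \<in> X" and z: "\<forall>d\<in>D. f d = 0"
 shows "f = 0"
proof (rule ccontr)
 assume "f \<noteq> 0"
 then obtain e where e: "f e \<noteq> 0" by (metis blinfun_eqI zero_blinfun.rep_eq)
 have "open (f -` (- {0}))"
  by (intro open_vimage continuous_intros)
 moreover have "e \<in> f -` (- {0})" using e by simp
 ultimately obtain d where "d \<in> D" "d \<in> f -` (- {0})" using D by blast
 then show False using z by auto
qed

lemma AE_eq_zero_functional: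
 fixes g :: "'a \<Rightarrow> 'v::{real_normed_vector,second_countable_topology} \<Rightarrow>\<^sub>L real"
 assumes z: "\<And>e. AE t in M. g t e = 0"
 shows "AE t in M. g t = 0"
proof -
 obtain D :: "'v set" where D: "countable D" "\<And>X. open X \<Longrightarrow> X \<noteq> {} \<Longrightarrow> \<exists>d\<in>D. d \<in> X"
  using countable_dense_setE by blast
 have "AE t in M. \<forall>d\<in>D. g t d = 0" using z D(1) by (intro AE_ball_countable') auto
 then show ?thesis
  by (rule eventually_mono) (rule functional_zero_if_zero_on_dense[OF D(2)])
qed

lemma L2_apply_integrable: "g \<in> L2 T \<Longrightarrow> integrable (MT T) (\<lambda>t. blinfun_apply (g t) e :: real)"
 by (rule integrable_L2_pair[OF _ L2_const])

lemma L2_zero_if_tests_zero: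
 fixes g :: "real \<Rightarrow> 'v::{real_normed_vector,second_countable_topology} \<Rightarrow>\<^sub>L real"
 assumes g: "g \<in> L2 T" and z: "\<And>\<phi> e. test_function T \<phi> \<Longrightarrow> (LINT t|MT T. \<phi> t * g t e) = 0"
 shows "AE t in MT T. g t = 0"
 by (intro AE_eq_zero_functional fundamental_lemma L2_apply_integrable[OF g] z)

lemma test_function_L2:
 assumes \<phi>: "test_function T \<phi>" and f: "f \<in> L2 T"
 shows "(\<lambda>t. \<phi> t *\<^sub>R f t) \<in> L2 T"
proof -
 obtain K where K: "\<And>t. \<bar>\<phi> t\<bar> \<le> K" using test_function_bounded[OF \<phi>] by blast
 have "\<phi> \<in> borel_measurable (MT T)"
  using test_function_integrable(1)[OF \<phi>] by (intro measurable_restrict_space1 measurable_completion) simp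
 then show ?thesis using K by (intro L2_mult[OF _ _ f]) auto
qed

lemma L2_eq_if_pairs_eq:
 fixes g :: "real \<Rightarrow> 'v::{real_normed_vector,second_countable_topology} \<Rightarrow>\<^sub>L real"
 assumes g: "g \<in> L2 T" and g': "g' \<in> L2 T" and eq: "\<And>h. h \<in> L2 T \<Longrightarrow> L2_pair T g h = L2_pair T g' h"
 shows "AE t in MT T. g t = g' t"
proof -
 have "AE t in MT T. (g - g') t = 0"
 proof (rule L2_zero_if_tests_zero[OF L2_diff[OF g g']])
  fix \<phi> and e :: 'v assume \<phi>: "test_function T \<phi>"
  have h: "(\<lambda>t. \<phi> t *\<^sub>R e) \<in> L2 T" by (rule test_function_L2[OF \<phi> L2_const])
  have "(LINT t|MT T. \<phi> t * (g - g') t e) = L2_pair T (g - g') (\<lambda>t. \<phi> t *\<^sub>R e)"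
   by (simp add: L2_pair_def blinfun.scaleR_right)
  also have "\<dots> = 0" using L2_pair_diff_left[OF g g' h] eq[OF h] by simp
  finally show "(LINT t|MT T. \<phi> t * (g - g') t e) = 0" .
 qed
 then show ?thesis by (rule eventually_mono) simp
qed

lemma weak_deriv_unique:
 fixes \<iota> :: "'v::{real_normed_vector,second_countable_topology} \<Rightarrow>\<^sub>L 'h::real_inner"
 assumes "g \<in> L2 T" "g' \<in> L2 T" "has_weak_deriv \<iota> T v g" "has_weak_deriv \<iota> T v g'"
 shows "AE t in MT T. g t = g' t"
proof -
 have "AE t in MT T. (g - g') t = 0"
 proof (rule L2_zero_if_tests_zero[OF L2_diff[OF assms(1,2)]])
  fix \<phi> and e :: 'v assume \<phi>: "test_function T \<phi>"
  have i: "integrable (MT T) (\<lambda>t. \<phi> t * g t e)" "integrable (MT T) (\<lambda>t. \<phi> t * g' t e)"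
   by (intro test_function_mult_integrable L2_apply_integrable \<phi> assms)+
  have "(LINT t|MT T. \<phi> t * g t e) = (LINT t|MT T. \<phi> t * g' t e)"
   using assms(3)[unfolded has_weak_deriv_def, rule_format, OF \<phi>, of e]
    assms(4)[unfolded has_weak_deriv_def, rule_format, OF \<phi>, of e] by linarith
  then show "(LINT t|MT T. \<phi> t * (g - g') t e) = 0"
   using i by (simp add: blinfun.diff_left right_diff_distrib)
 qed
 then show ?thesis by (rule eventually_mono) simp
qed

lemma W_L2: "v \<in> W \<iota> T \<Longrightarrow> v \<in> L2 T"
 by (simp add: W_def)

lemma wderiv:
 assumes "v \<in> W \<iota> T"
 shows wderiv_L2: "wderiv \<iota> T v \<in> L2 T" and wderiv_weak: "has_weak_deriv \<iota> T v (wderiv \<iota> T v)"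
proof -
 have "\<exists>g. g \<in> L2 T \<and> has_weak_deriv \<iota> T v g" using assms by (auto simp: W_def)
 from someI_ex[OF this] show "wderiv \<iota> T v \<in> L2 T" "has_weak_deriv \<iota> T v (wderiv \<iota> T v)"
  by (simp_all add: wderiv_def)
qed

lemma W_I: "v \<in> L2 T \<Longrightarrow> g \<in> L2 T \<Longrightarrow> has_weak_deriv \<iota> T v g \<Longrightarrow> v \<in> W \<iota> T"
 by (auto simp: W_def)

lemma wderiv_eq:
 fixes \<iota> :: "'v::{real_normed_vector,second_countable_topology} \<Rightarrow>\<^sub>L 'h::real_inner"
 assumes "v \<in> L2 T" "g \<in> L2 T" "has_weak_deriv \<iota> T v g"
 shows "AE t in MT T. wderiv \<iota> T v t = g t"
 using weak_deriv_unique[OF wderiv_L2 assms(2) wderiv_weak assms(3)] W_I[OF assms] by blast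

lemma emb_inner_integrable: "v \<in> L2 T \<Longrightarrow> w \<in> L2 T \<Longrightarrow> integrable (MT T) (\<lambda>t. blinfun_apply \<iota> (v t) \<bullet> blinfun_apply \<iota> (w t))"
 by (rule integrable_bilinear_L2[OF bounded_bilinear_emb_inner])

lemma has_weak_deriv_add:
 assumes "v \<in> L2 T" "g \<in> L2 T" "has_weak_deriv \<iota> T v g"
  and "v' \<in> L2 T" "g' \<in> L2 T" "has_weak_deriv \<iota> T v' g'"
 shows "has_weak_deriv \<iota> T (v + v') (g + g')"
 unfolding has_weak_deriv_def
proof (intro allI impI)
 fix \<phi> w assume \<phi>: "test_function T \<phi>"
 note d = test_function_deriv[OF \<phi>]
 have i: "integrable (MT T) (\<lambda>t. deriv \<phi> t * emb_dual \<iota> (\<iota> (v t)) w)"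
   "integrable (MT T) (\<lambda>t. deriv \<phi> t * emb_dual \<iota> (\<iota> (v' t)) w)"
   "integrable (MT T) (\<lambda>t. \<phi> t * g t w)" "integrable (MT T) (\<lambda>t. \<phi> t * g' t w)"
  using test_function_mult_integrable[OF emb_inner_integrable[OF assms(1) L2_const] d]
   test_function_mult_integrable[OF emb_inner_integrable[OF assms(4) L2_const] d]
   test_function_mult_integrable[OF L2_apply_integrable[OF assms(2)] \<phi>]
   test_function_mult_integrable[OF L2_apply_integrable[OF assms(5)] \<phi>] by auto
 have "(LINT t|MT T. deriv \<phi> t * emb_dual \<iota> (\<iota> ((v + v') t)) w)
   = (LINT t|MT T. deriv \<phi> t * emb_dual \<iota> (\<iota> (v t)) w + deriv \<phi> t * emb_dual \<iota> (\<iota> (v' t)) w)"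
  by (simp add: blinfun.add_right inner_add_left distrib_left)
 also have "\<dots> = - (LINT t|MT T. \<phi> t * g t w) - (LINT t|MT T. \<phi> t * g' t w)"
  using i assms(3,6) \<phi> unfolding has_weak_deriv_def by simp
 also have "\<dots> = - (LINT t|MT T. \<phi> t * (g + g') t w)"
  using i by (simp add: blinfun.add_left distrib_left)
 finally show "(LINT t|MT T. deriv \<phi> t * emb_dual \<iota> (\<iota> ((v + v') t)) w) = - (LINT t|MT T. \<phi> t * (g + g') t w)" .
qed

lemma has_weak_deriv_scaleR:
 assumes "has_weak_deriv \<iota> T v g"
 shows "has_weak_deriv \<iota> T (c *\<^sub>R v) (c *\<^sub>R g)"
 unfolding has_weak_deriv_def
proof (intro allI impI)
 fix \<phi> w assume \<phi>: "test_function T \<phi>"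
 have "(LINT t|MT T. deriv \<phi> t * emb_dual \<iota> (\<iota> ((c *\<^sub>R v) t)) w)
   = (LINT t|MT T. c * (deriv \<phi> t * emb_dual \<iota> (\<iota> (v t)) w))"
  by (simp add: scaleR_fun_def blinfun.scaleR_right mult.left_commute)
 also have "\<dots> = c * - (LINT t|MT T. \<phi> t * g t w)"
  using assms \<phi> unfolding has_weak_deriv_def by simp
 also have "\<dots> = - (LINT t|MT T. c * (\<phi> t * g t w))" by simp
 also have "\<dots> = - (LINT t|MT T. \<phi> t * (c *\<^sub>R g) t w)"
  by (simp add: scaleR_fun_def blinfun.scaleR_left mult.left_commute)
 finally show "(LINT t|MT T. deriv \<phi> t * emb_dual \<iota> (\<iota> ((c *\<^sub>R v) t)) w) = - (LINT t|MT T. \<phi> t * (c *\<^sub>R g) t w)" .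
qed

lemma W_add: "v \<in> W \<iota> T \<Longrightarrow> v' \<in> W \<iota> T \<Longrightarrow> v + v' \<in> W \<iota> T"
 by (rule W_I[OF L2_add[OF W_L2 W_L2] L2_add[OF wderiv_L2 wderiv_L2]
    has_weak_deriv_add[OF W_L2 wderiv_L2 wderiv_weak W_L2 wderiv_L2 wderiv_weak]])

lemma W_scaleR: "v \<in> W \<iota> T \<Longrightarrow> c *\<^sub>R v \<in> W \<iota> T"
 by (rule W_I[OF L2_scaleR[OF W_L2] L2_scaleR[OF wderiv_L2] has_weak_deriv_scaleR[OF wderiv_weak]])

lemma W_zero: "0 \<in> W \<iota> T"
 by (rule W_I[OF L2_zero L2_zero]) (simp add: has_weak_deriv_def blinfun.zero_right)

lemma subspace_W: "subspace (W \<iota> T)"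
 by (simp add: subspace_def W_add W_scaleR W_zero)

lemma wderiv_add:
 fixes \<iota> :: "'v::{real_normed_vector,second_countable_topology} \<Rightarrow>\<^sub>L 'h::real_inner"
 assumes "v \<in> W \<iota> T" "v' \<in> W \<iota> T"
 shows "AE t in MT T. wderiv \<iota> T (v + v') t = wderiv \<iota> T v t + wderiv \<iota> T v' t"
 using wderiv_eq[OF L2_add[OF W_L2[OF assms(1)] W_L2[OF assms(2)]]
   L2_add[OF wderiv_L2[OF assms(1)] wderiv_L2[OF assms(2)]]
   has_weak_deriv_add[OF W_L2[OF assms(1)] wderiv_L2[OF assms(1)] wderiv_weak[OF assms(1)]
    W_L2[OF assms(2)] wderiv_L2[OF assms(2)] wderiv_weak[OF assms(2)]]]
 by (simp only: plus_fun_apply)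

lemma wderiv_scaleR:
 fixes \<iota> :: "'v::{real_normed_vector,second_countable_topology} \<Rightarrow>\<^sub>L 'h::real_inner"
 assumes "v \<in> W \<iota> T"
 shows "AE t in MT T. wderiv \<iota> T (c *\<^sub>R v) t = c *\<^sub>R wderiv \<iota> T v t"
 using wderiv_eq[OF L2_scaleR[OF W_L2[OF assms]] L2_scaleR[OF wderiv_L2[OF assms]]
   has_weak_deriv_scaleR[OF wderiv_weak[OF assms]], of c] by (simp add: scaleR_fun_def)

lemma LINT_test_deriv_zero:
 assumes \<phi>: "test_function T \<phi>"
 shows "(LINT t|MT T. deriv \<phi> t) = 0"
proof -
 have "continuous_on {0..T} (deriv \<phi>)" using test_function_continuous(2)[OF \<phi>] .
 then have i: "integrable (MT T) (deriv \<phi>)" by (rule continuous_imp_integrable_real)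
 show ?thesis
 proof (cases "0 \<le> T")
  case True
  have "(deriv \<phi> has_integral (\<phi> T - \<phi> 0)) {0..T}"
   by (rule fundamental_theorem_of_calculus[OF True])
     (rule has_vector_derivative_at_within, simp add: has_real_derivative_iff_has_vector_derivative[symmetric] test_function_DERIV[OF \<phi>])
  then show ?thesis
   using lebesgue_integral_eq_integral[OF i] test_function_outside[OF \<phi>] by (simp add: integral_unique)
 qed (simp add: lebesgue_integral_eq_integral[OF i])
qed

lemma smooth_bounded_measurable:
 assumes "smooth \<phi>"
 shows "\<phi> \<in> borel_measurable (MT T)" "\<exists>K. \<forall>t\<in>{0..T}. \<bar>\<phi> t\<bar> \<le> K"
proof -
 have "\<phi> \<in> borel_measurable borel"
  by (rule borel_measurable_continuous_onI[OF smooth_continuous[OF assms]])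
 then show "\<phi> \<in> borel_measurable (MT T)"
  by (intro measurable_restrict_space1 measurable_completion) simp
 have "compact (\<phi> ` {0..T})" using smooth_continuous[OF assms] by (intro compact_continuous_image) auto
 then show "\<exists>K. \<forall>t\<in>{0..T}. \<bar>\<phi> t\<bar> \<le> K"
  by (metis bounded_iff compact_imp_bounded imageI real_norm_def)
qed

lemma L2_smooth_mult:
 assumes "smooth \<phi>" "f \<in> L2 T"
 shows "(\<lambda>t. \<phi> t *\<^sub>R f t) \<in> L2 T"
proof -
 obtain K where K: "\<forall>t\<in>{0..T}. \<bar>\<phi> t\<bar> \<le> K" using smooth_bounded_measurable(2)[OF assms(1)] by blast
 have "AE t in MT T. \<bar>\<phi> t\<bar> \<le> K" using K by (intro AE_I2) simp
 from L2_mult[OF smooth_bounded_measurable(1)[OF assms(1)] this assms(2)] show ?thesis .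
qed

text \<open>The product \<open>f \<phi>\<close> is again a test function, and its derivative \<open>f \<phi>' + f' \<phi>\<close> produces the term in which
 \<open>f\<close> is differentiated. With \<open>f = exp (\<mu> t)\<close> this term is the only effect of the weight on the left-hand side of
 the system.\<close>

lemma has_weak_deriv_smooth_mult:
 assumes f: "smooth f" and v: "v \<in> L2 T" and g: "g \<in> L2 T" and w: "has_weak_deriv \<iota> T v g"
 shows "has_weak_deriv \<iota> T (\<lambda>t. f t *\<^sub>R v t) (\<lambda>t. f t *\<^sub>R g t + deriv f t *\<^sub>R emb_dual \<iota> (\<iota> (v t)))"
 unfolding has_weak_deriv_def
proof (intro allI impI)
 fix \<phi> e assume \<phi>: "test_function T \<phi>"
 note p = test_function_mult_smooth[OF \<phi> f] and d = test_function_mult_smooth[OF \<phi> smooth_deriv[OF f]]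
  and d2 = test_function_mult_smooth[OF test_function_deriv[OF \<phi>] f]
 have iv: "integrable (MT T) (\<lambda>t. \<iota> (v t) \<bullet> \<iota> e)" by (rule emb_inner_integrable[OF v L2_const])
 have der: "deriv (\<lambda>t. f t * \<phi> t) = (\<lambda>t. f t * deriv \<phi> t + deriv f t * \<phi> t)"
  by (intro ext DERIV_imp_deriv)
    (auto intro!: derivative_eq_intros smooth_DERIV[OF f] test_function_DERIV[OF \<phi>])
 note i = test_function_mult_integrable[OF iv d] test_function_mult_integrable[OF iv d2]
  test_function_mult_integrable[OF L2_apply_integrable[OF g, of e] p]
 have "(LINT t|MT T. (f t * deriv \<phi> t) * (\<iota> (v t) \<bullet> \<iota> e) + (deriv f t * \<phi> t) * (\<iota> (v t) \<bullet> \<iota> e))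
   = - (LINT t|MT T. f t * \<phi> t * g t e)"
  using w[unfolded has_weak_deriv_def, rule_format, OF p, of e] by (simp add: der distrib_right)
 then have "(LINT t|MT T. (f t * deriv \<phi> t) * (\<iota> (v t) \<bullet> \<iota> e))
   = - ((LINT t|MT T. f t * \<phi> t * g t e) + (LINT t|MT T. (deriv f t * \<phi> t) * (\<iota> (v t) \<bullet> \<iota> e)))"
  using i by simp
 also have "\<dots> = - (LINT t|MT T. f t * \<phi> t * g t e + (deriv f t * \<phi> t) * (\<iota> (v t) \<bullet> \<iota> e))"
  using i by simp
 finally show "(LINT t|MT T. deriv \<phi> t * emb_dual \<iota> (\<iota> (f t *\<^sub>R v t)) e)
   = - (LINT t|MT T. \<phi> t * (f t *\<^sub>R g t + deriv f t *\<^sub>R emb_dual \<iota> (\<iota> (v t))) e)"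
  by (simp add: blinfun.scaleR_right blinfun.add_left blinfun.scaleR_left algebra_simps)
qed

lemma L2_emb_dual: "v \<in> L2 T \<Longrightarrow> (\<lambda>t. emb_dual \<iota> (blinfun_apply \<iota> (v t))) \<in> L2 T"
 using L2_blinfun[OF L2_blinfun, of v T "Blinfun (emb_dual \<iota>)" \<iota>]
 by (simp add: bounded_linear_Blinfun_apply bounded_linear_emb_dual)

lemma W_smooth_mult:
 fixes \<iota> :: "'v::{real_normed_vector,second_countable_topology} \<Rightarrow>\<^sub>L 'h::real_inner"
 assumes f: "smooth f" and v: "v \<in> W \<iota> T"
 shows "(\<lambda>t. f t *\<^sub>R v t) \<in> W \<iota> T"
  and "AE t in MT T. wderiv \<iota> T (\<lambda>t. f t *\<^sub>R v t) t = f t *\<^sub>R wderiv \<iota> T v t + deriv f t *\<^sub>R emb_dual \<iota> (\<iota> (v t))"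
proof -
 note v' = W_L2[OF v] wderiv_L2[OF v] wderiv_weak[OF v]
 note h = has_weak_deriv_smooth_mult[OF f v']
 have g: "(\<lambda>t. f t *\<^sub>R wderiv \<iota> T v t + deriv f t *\<^sub>R emb_dual \<iota> (\<iota> (v t))) \<in> L2 T"
  using L2_add[OF L2_smooth_mult[OF f v'(2)] L2_smooth_mult[OF smooth_deriv[OF f] L2_emb_dual[OF v'(1)]]]
  by (simp add: plus_fun_def)
 show "(\<lambda>t. f t *\<^sub>R v t) \<in> W \<iota> T" by (rule W_I[OF L2_smooth_mult[OF f v'(1)] g h])
 show "AE t in MT T. wderiv \<iota> T (\<lambda>t. f t *\<^sub>R v t) t = f t *\<^sub>R wderiv \<iota> T v t + deriv f t *\<^sub>R emb_dual \<iota> (\<iota> (v t))"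
  by (rule wderiv_eq[OF L2_smooth_mult[OF f v'(1)] g h])
qed

lemma W_const:
 fixes \<iota> :: "'v::{real_normed_vector,second_countable_topology} \<Rightarrow>\<^sub>L 'h::real_inner"
 shows "(\<lambda>_. e) \<in> W \<iota> T" and "AE t in MT T. wderiv \<iota> T (\<lambda>_. e) t = 0"
proof -
 have h: "has_weak_deriv \<iota> T (\<lambda>_. e) (\<lambda>_. 0)"
  unfolding has_weak_deriv_def
 proof (intro allI impI)
  fix \<phi> w assume \<phi>: "test_function T \<phi>"
  show "(LINT t|MT T. deriv \<phi> t * emb_dual \<iota> (\<iota> e) w) = - (LINT t|MT T. \<phi> t * blinfun_apply 0 w)"
   using LINT_test_deriv_zero[OF \<phi>] by simp
 qed
 show "(\<lambda>_. e) \<in> W \<iota> T" by (rule W_I[OF L2_const L2_const h])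
 show "AE t in MT T. wderiv \<iota> T (\<lambda>_. e) t = 0" by (rule wderiv_eq[OF L2_const L2_const h])
qed

section \<open>Density of step functions\<close>

lemma L2_indicator: "A \<in> sets lebesgue \<Longrightarrow> (\<lambda>t. indicator A t *\<^sub>R e) \<in> L2 T"
 by (rule L2_mult[OF _ _ L2_const, of _ _ 1])
   (auto simp: indicator_def intro!: measurable_restrict_space1)

text \<open>Half lines suffice because the functions \<open>indicator A e\<close> for Borel sets \<open>A\<close> are obtained from them by
 complements and disjoint unions, the simple functions by linear combinations, and the rest by density.
 For half lines, limits of difference quotients are one-dimensional computations.\<close>

lemma L2_dense_induct [consumes 1, case_names half_line add scale lim]:
 assumes w: "w \<in> L2 T"
  and half: "\<And>a e. Q (\<lambda>t. indicator {a<..} t *\<^sub>R e)"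
  and add: "\<And>f g. f \<in> L2 T \<Longrightarrow> g \<in> L2 T \<Longrightarrow> Q f \<Longrightarrow> Q g \<Longrightarrow> Q (f + g)"
  and scale: "\<And>c f. f \<in> L2 T \<Longrightarrow> Q f \<Longrightarrow> Q (c *\<^sub>R f)"
  and lim: "\<And>f h. (\<And>n::nat. f n \<in> L2 T) \<Longrightarrow> (\<And>n. Q (f n)) \<Longrightarrow> h \<in> L2 T \<Longrightarrow>
   (\<lambda>n. L2norm T (f n - h)) \<longlonglongrightarrow> 0 \<Longrightarrow> Q h"
 shows "Q (w :: real \<Rightarrow> 'b::real_normed_vector)"
proof -
 have cong: "Q h" if "f \<in> L2 T" "Q f" "h \<in> L2 T" "AE t in MT T. f t = h t" for f h
 proof (rule lim[of "\<lambda>_. f"])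
  have "L2norm T (f - h) = 0"
   using L2norm_zero_iff[OF L2_diff[OF that(1,3)]] that(4) by simp
  then show "(\<lambda>n. L2norm T (f - h)) \<longlonglongrightarrow> 0" by simp
 qed (use that in auto)
 have zero: "Q 0"
  using scale[OF _ half[of 0 0], of 0] L2_indicator[of "{0<..}" 0 T] by (simp add: zero_fun_def scaleR_fun_def)
 have borel: "Q (\<lambda>t. indicator A t *\<^sub>R e)" if "A \<in> sets borel" for A e
  using that
 proof (induction rule: borel_half_line_induct)
  case (half_line a)
  show ?case by (rule half)
 next
  case empty
  show ?case using zero by (simp add: zero_fun_def)
 next
  case (compl A)
  let ?u = "\<lambda>t. indicator {-1<..} t *\<^sub>R e" and ?a = "\<lambda>t. indicator A t *\<^sub>R e"
  have L: "?u \<in> L2 T" "?a \<in> L2 T" "(\<lambda>t. indicator (- A) t *\<^sub>R e) \<in> L2 T"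
   using compl by (auto intro!: L2_indicator)
  have "Q (?u + (-1) *\<^sub>R ?a)" by (intro add scale L L2_scaleR half compl)
  moreover have "AE t in MT T. (?u + (-1) *\<^sub>R ?a) t = indicator (- A) t *\<^sub>R e"
   by (intro AE_I2) (auto simp: indicator_def scaleR_fun_def)
  ultimately show ?case by (rule cong[OF L2_add[OF L(1) L2_scaleR[OF L(2)]] _ L(3)])
 next
  case (union A)
  define h where "h = (\<lambda>t. indicator (\<Union>i. A i) t *\<^sub>R e)"
  define f where "f n = (\<lambda>t. indicator (\<Union>i<n. A i) t *\<^sub>R e)" for n
  have As: "A i \<in> sets borel" for i using union by auto
  have AL: "A i \<in> sets lebesgue" for i using As[of i] by simp
  have "(\<Union>i. A i) \<in> sets lebesgue" by (intro sets.countable_UN image_subsetI AL)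
  then have hL: "h \<in> L2 T" unfolding h_def by (rule L2_indicator)
  have "(\<Union>i<n. A i) \<in> sets lebesgue" for n by (intro sets.finite_UN AL) simp
  then have fL: "f n \<in> L2 T" for n unfolding f_def by (rule L2_indicator)
  have fQ: "Q (f n)" for n
  proof (induction n)
   case 0
   then show ?case using zero by (simp add: f_def zero_fun_def)
  next
   case (Suc n)
   have "A i \<inter> A n = {}" if "i < n" for i
    using disjoint_family_onD[OF union(1), of i n] that by simp
   then have "(\<Union>i<n. A i) \<inter> A n = {}" by blast
   then have "indicator (\<Union>i<Suc n. A i) t = indicator (\<Union>i<n. A i) t + (indicator (A n) t :: real)" for t
    by (simp add: lessThan_Suc Un_commute indicator_add)
   then have "f (Suc n) = f n + (\<lambda>t. indicator (A n) t *\<^sub>R e)"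
    by (simp add: f_def fun_eq_iff scaleR_add_left)
   then show ?case using add[OF fL L2_indicator[OF AL] Suc.IH union(3)] by (simp only:)
  qed
  have "(\<lambda>n. L2norm T (f n - h)) \<longlonglongrightarrow> 0"
  proof (rule L2norm_tendsto_zero[OF L2_diff[OF fL hL] L2_const])
   show "AE t in MT T. norm ((f n - h) t) \<le> norm e" for n
   proof (rule AE_I2)
    fix t
    have "t \<in> (\<Union>i. A i)" if "t \<in> (\<Union>i<n. A i)" using that by blast
    then show "norm ((f n - h) t) \<le> norm e"
     by (cases "t \<in> (\<Union>i<n. A i)"; cases "t \<in> (\<Union>i. A i)") (simp_all add: f_def h_def)
   qed
   show "AE t in MT T. (\<lambda>n. (f n - h) t) \<longlonglongrightarrow> 0"
   proof (rule AE_I2, rule tendsto_eventually)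
    fix t
    show "\<forall>\<^sub>F n in sequentially. (f n - h) t = 0"
    proof (cases "t \<in> (\<Union>i. A i)")
     case True
     then obtain i where i: "t \<in> A i" by blast
     have "(f n - h) t = 0" if "Suc i \<le> n" for n
     proof -
      have "t \<in> (\<Union>i<n. A i)" using i that by (intro UN_I[of i]) auto
      then show ?thesis using True by (simp add: f_def h_def)
     qed
     then show ?thesis unfolding eventually_sequentially by blast
    next
     case False
     then have "t \<notin> (\<Union>i<n. A i)" for n by blast
     then show ?thesis using False by (simp add: f_def h_def)
    qed
   qed
  qed
  then show ?case using lim[of f h] fL fQ hL by (simp add: h_def)
 qed
 have leb: "Q (\<lambda>t. indicator A t *\<^sub>R e)" if A: "A \<in> sets lebesgue" for A e
 proof -
  obtain S N N' where S: "A = S \<union> N" "N \<subseteq> N'" "N' \<in> null_sets lborel" "S \<in> sets lborel"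
   using sets_completionE[OF A] by blast
  have "AE t in lebesgue. t \<in> {0..T} \<longrightarrow> t \<notin> N'"
   using AE_completion[OF AE_not_in[OF S(3)]] by (rule eventually_mono) simp
  then have "AE t in MT T. t \<notin> N'" by (simp add: AE_restrict_space_iff) 
  then have "AE t in MT T. indicator S t *\<^sub>R e = indicator A t *\<^sub>R e"
   by (rule eventually_mono) (use S in \<open>auto simp: indicator_def\<close>)
  with S(4) show ?thesis
   by (intro cong[OF _ borel L2_indicator[OF A]] L2_indicator) auto
 qed
 have simple: "Q s" if s: "simple_function (MT T) s" for s
 proof -
  define Y where "Y = s ` space (MT T)"
  define E where "E y = s -` {y} \<inter> space (MT T)" for y
  have fin: "finite Y" using simple_functionD(1)[OF s] by (simp add: Y_def)
  have E: "E y \<in> sets lebesgue" for y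
   using simple_functionD(2)[OF s, of "{y}"] by (simp add: E_def sets_restrict_space_iff)
  have sL: "s \<in> L2 T"
  proof -
   have "(\<lambda>t. (norm (s t))\<^sup>2) \<in> borel_measurable (MT T)"
    using strongly_measurable_norm[OF strongly_measurable_simple[OF s]] by simp
   moreover have "AE t in MT T. norm (s t) \<le> Max (norm ` Y) * norm (1::real)"
    using fin by (intro AE_I2) (auto simp: Y_def intro!: Max_ge)
   ultimately show ?thesis
    by (intro L2_bound[OF strongly_measurable_simple[OF s] L2_const])
  qed
  have "(\<lambda>t. \<Sum>y\<in>Z. indicator (E y) t *\<^sub>R y) \<in> L2 T \<and> Q (\<lambda>t. \<Sum>y\<in>Z. indicator (E y) t *\<^sub>R y)"
   if "finite Z" for Z
   using that
  proof induction
   case empty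
   then show ?case using zero L2_zero[of T] by (simp add: zero_fun_def)
  next
   case (insert y Z)
   have eq: "(\<lambda>t. \<Sum>y\<in>insert y Z. indicator (E y) t *\<^sub>R y)
     = (\<lambda>t. indicator (E y) t *\<^sub>R y) + (\<lambda>t. \<Sum>y\<in>Z. indicator (E y) t *\<^sub>R y)"
    by (rule ext) (simp only: sum.insert[OF insert.hyps] plus_fun_apply)
   note IH = conjunct1[OF insert.IH] conjunct2[OF insert.IH]
   show ?case unfolding eq
    by (rule conjI[OF L2_add[OF L2_indicator[OF E] IH(1)] add[OF L2_indicator[OF E] IH(1) leb[OF E] IH(2)]])
  qed
  from this[OF fin] have "(\<lambda>t. \<Sum>y\<in>Y. indicator (E y) t *\<^sub>R y) \<in> L2 T" "Q (\<lambda>t. \<Sum>y\<in>Y. indicator (E y) t *\<^sub>R y)" by auto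
  moreover have "AE t in MT T. (\<Sum>y\<in>Y. indicator (E y) t *\<^sub>R y) = s t"
  proof (rule AE_I2)
   fix t assume t: "t \<in> space (MT T)"
   have "(\<Sum>y\<in>Y. indicator (E y) t *\<^sub>R y) = (\<Sum>y\<in>Y. if y = s t then s t else 0)"
    by (intro sum.cong) (use t in \<open>auto simp: E_def indicator_def\<close>)
   also have "\<dots> = s t" using fin t by (simp add: sum.delta Y_def)
   finally show "(\<Sum>y\<in>Y. indicator (E y) t *\<^sub>R y) = s t" .
  qed
  ultimately show ?thesis using cong sL by blast
 qed
 have "\<exists>s. \<forall>n. simple_function (MT T) (s n) \<and> s n \<in> L2 T \<and> L2norm T (s n - w) < 1 / real (Suc n)"
  by (intro choice allI simple_dense_L2[OF w]) auto
 then obtain s where s: "\<And>n. simple_function (MT T) (s n)" "\<And>n. s n \<in> L2 T"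
   "\<And>n. L2norm T (s n - w) < 1 / real (Suc n)" by blast
 have "(\<lambda>n. L2norm T (s n - w)) \<longlonglongrightarrow> 0"
  by (rule tendsto_sandwich[OF _ _ tendsto_const LIMSEQ_Suc[OF lim_1_over_n]])
    (use s(3) in \<open>auto intro!: always_eventually simp: less_imp_le\<close>)
 with s w show ?thesis by (intro lim[of s w] simple) auto
qed

text \<open>Continuous functions are limits of their values on a refining grid.\<close>

lemma continuous_strongly_measurable:
 assumes f: "continuous_on {0..T} f"
 shows "strongly_measurable (MT T) f"
proof -
 define r where "r n t = of_int \<lfloor>real (Suc n) * t\<rfloor> / real (Suc n)" for n and t :: real
 have r1: "0 \<le> r n t" "r n t \<le> t" "t - r n t \<le> 1 / real (Suc n)" if "0 \<le> t" for n t
 proof -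
  have a: "real_of_int \<lfloor>real (Suc n) * t\<rfloor> \<le> real (Suc n) * t" "real (Suc n) * t < real_of_int \<lfloor>real (Suc n) * t\<rfloor> + 1"
   by linarith+
  show "0 \<le> r n t" using that by (simp add: r_def)
  show "r n t \<le> t" using a(1) by (simp add: r_def divide_le_eq mult.commute)
  have "t * real (Suc n) - real_of_int \<lfloor>real (Suc n) * t\<rfloor> \<le> 1" using a(2) unfolding mult.commute[of t] by linarith
  then have "(t * real (Suc n) - real_of_int \<lfloor>real (Suc n) * t\<rfloor>) / real (Suc n) \<le> 1 / real (Suc n)"
   by (rule divide_right_mono) simp
  then show "t - r n t \<le> 1 / real (Suc n)" by (simp add: r_def diff_divide_distrib del: of_nat_Suc)
 qed
 have "simple_function (MT T) (r n)" for n
 proof (rule simple_function_borel_measurable)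
  have "r n \<in> borel_measurable borel" unfolding r_def by measurable
  then show "r n \<in> borel_measurable (MT T)"
   by (intro measurable_restrict_space1 measurable_completion) simp
  have "r n ` space (MT T) \<subseteq> (\<lambda>k. of_int k / real (Suc n)) ` {0..\<lfloor>real (Suc n) * T\<rfloor>}"
  proof
   fix y assume "y \<in> r n ` space (MT T)"
   then obtain t where t: "0 \<le> t" "t \<le> T" "y = r n t" by auto
   then have "\<lfloor>real (Suc n) * t\<rfloor> \<in> {0..\<lfloor>real (Suc n) * T\<rfloor>}"
    by (auto intro!: floor_mono mult_left_mono)
   then show "y \<in> (\<lambda>k. of_int k / real (Suc n)) ` {0..\<lfloor>real (Suc n) * T\<rfloor>}"
    using t(3) by (auto simp: r_def)
  qed
  then show "finite (r n ` space (MT T))" by (rule finite_subset) simp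
 qed
 then have "simple_function (MT T) (\<lambda>t. f (r n t))" for n by (rule simple_function_compose1)
 moreover have "AE t in MT T. (\<lambda>n. f (r n t)) \<longlonglongrightarrow> f t"
 proof (rule AE_I2)
  fix t assume "t \<in> space (MT T)"
  then have t: "0 \<le> t" "t \<le> T" by auto
  have lim: "(\<lambda>n. r n t) \<longlonglongrightarrow> t"
  proof (rule LIM_zero_cancel, rule Lim_null_comparison[OF always_eventually LIMSEQ_Suc[OF lim_1_over_n]], rule allI)
   fix n show "norm (r n t - t) \<le> 1 / real (Suc n)" using r1[OF t(1), of n] by simp
  qed
  have "r n t \<in> {0..T}" for n using r1[OF t(1), of n] t by simp
  then show "(\<lambda>n. f (r n t)) \<longlonglongrightarrow> f t"
   using continuous_on_tendsto_compose[OF f lim] t by simp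
 qed
 ultimately show ?thesis unfolding strongly_measurable_def
  by (intro exI[of _ "\<lambda>n t. f (r n t)"]) auto
qed

section \<open>Primitives and difference quotients of the weak derivative\<close>

lemma indicator_mult_integrable:
 fixes k :: "real \<Rightarrow> real"
 assumes k: "integrable (MT T) k" and A: "A \<in> sets lebesgue"
 shows "integrable (MT T) (\<lambda>r. indicator A r * k r)"
proof (rule Bochner_Integration.integrable_bound[OF k])
 have "indicator A \<in> borel_measurable (MT T)"
  using A by (intro measurable_restrict_space1 borel_measurable_indicator)
 then show "(\<lambda>r. indicator A r * k r) \<in> borel_measurable (MT T)"
  using k by (intro borel_measurable_times) auto
qed (auto simp: indicator_def)

definition primitive :: "real \<Rightarrow> (real \<Rightarrow> real) \<Rightarrow> real \<Rightarrow> real"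
 where "primitive T k t = (LINT r|MT T. indicator {..t} r * k r)"

lemma primitive_diff:
 assumes k: "integrable (MT T) k" and st: "s \<le> t"
 shows "primitive T k t - primitive T k s = (LINT r|MT T. indicator {s<..t} r * k r)"
proof -
 have "primitive T k t - primitive T k s
   = (LINT r|MT T. indicator {..t} r * k r - indicator {..s} r * k r)"
  unfolding primitive_def
  by (rule Bochner_Integration.integral_diff[symmetric]; rule indicator_mult_integrable[OF k]; simp)
 also have "\<dots> = (LINT r|MT T. indicator {s<..t} r * k r)"
  by (intro Bochner_Integration.integral_cong) (use st in \<open>auto simp: indicator_def\<close>)
 finally show ?thesis .
qed

lemma primitive_mono:
 assumes k: "integrable (MT T) k" and nn: "\<And>r. 0 \<le> k r" and st: "s \<le> t"
 shows "primitive T k s \<le> primitive T k t"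
proof -
 have "0 \<le> (LINT r|MT T. indicator {s<..t} r * k r)"
  by (intro integral_nonneg_AE AE_I2) (simp add: nn)
 then show ?thesis using primitive_diff[OF k st] by simp
qed

lemma primitive_eq_integral:
 assumes k: "integrable (MT T) k" and T: "0 \<le> T"
 shows "primitive T k t = integral {0..max 0 (min T t)} k"
proof -
 let ?b = "max 0 (min T t)"
 have "primitive T k t = (LINT r|lebesgue. indicator {0..T} r *\<^sub>R (indicator {..t} r * k r))"
  by (simp add: primitive_def integral_restrict_space)
 also have "\<dots> = (LINT r|lebesgue. indicator {0..?b} r *\<^sub>R k r)"
 proof (rule integral_cong_AE)
  have "integrable lebesgue (\<lambda>r. indicator {0..T} r *\<^sub>R (indicator {..t} r * k r))"
   using indicator_mult_integrable[OF k, of "{..t}"] by (simp add: integrable_restrict_space)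
  then show "(\<lambda>r. indicator {0..T} r *\<^sub>R (indicator {..t} r * k r)) \<in> borel_measurable lebesgue"
   by (rule borel_measurable_integrable)
  have "integrable (lebesgue_on {0..?b}) k"
   by (rule integrable_subinterval[OF k]) (use T in auto)
  then have "integrable lebesgue (\<lambda>r. indicator {0..?b} r *\<^sub>R k r)"
   by (simp add: integrable_restrict_space)
  then show "(\<lambda>r. indicator {0..?b} r *\<^sub>R k r) \<in> borel_measurable lebesgue"
   by (rule borel_measurable_integrable)
  have "AE r in lebesgue. r \<noteq> 0"
   by (rule AE_completion) (rule AE_lborel_singleton)
  then show "AE r in lebesgue. indicator {0..T} r *\<^sub>R (indicator {..t} r * k r) = indicator {0..?b} r *\<^sub>R k r"
   by (rule eventually_mono) (use T in \<open>auto simp: indicator_def max_def min_def\<close>)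
 qed
 also have "\<dots> = (LINT r|lebesgue_on {0..?b}. k r)" by (simp add: integral_restrict_space)
 also have "\<dots> = integral {0..?b} k"
  by (rule lebesgue_integral_eq_integral[OF integrable_subinterval[OF k]]) (use T in auto)
 finally show ?thesis .
qed

lemma primitive_continuous:
 assumes k: "integrable (MT T) k" and T: "0 \<le> T"
 shows "continuous_on A (primitive T k)"
proof -
 have "continuous_on {0..T} (\<lambda>t. integral {0..t} k)"
  by (intro indefinite_integral_continuous_1 integrable_on_lebesgue_on[OF k]) simp
 then have "continuous_on A (\<lambda>t. integral {0..max 0 (min T t)} k)"
  by (rule continuous_on_compose2[where g = "\<lambda>t. integral {0..t} k"])
    (use T in \<open>auto intro!: continuous_intros\<close>)
 then show ?thesis by (simp add: primitive_eq_integral[OF k T])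
qed

lemma primitive_total: "primitive T k T = (LINT r|MT T. k r)"
 unfolding primitive_def by (intro Bochner_Integration.integral_cong) (auto simp: indicator_def)

lemma integral_half_line:
 assumes k: "integrable (MT T) k"
 shows "(LINT r|MT T. indicator {a<..} r * k r) = primitive T k T - primitive T k a"
proof -
 have "(LINT r|MT T. indicator {a<..} r * k r) = (LINT r|MT T. k r - indicator {..a} r * k r)"
  by (intro Bochner_Integration.integral_cong) (auto simp: indicator_def)
 also have "\<dots> = (LINT r|MT T. k r) - (LINT r|MT T. indicator {..a} r * k r)"
  by (rule Bochner_Integration.integral_diff[OF k indicator_mult_integrable[OF k]]) simp
 finally show ?thesis by (simp add: primitive_total) (simp add: primitive_def)
qed

text \<open>The integrals over the common part of \<open>[k, T + k]\<close> and \<open>[0, T]\<close> cancel, and intervals of length \<open>k\<close> remain.\<close>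

lemma shifted_increment_bound:
 fixes M :: "real \<Rightarrow> real"
 assumes M: "\<And>A. continuous_on A M" and b: "\<And>t. 0 \<le> M t" "\<And>t. M t \<le> B" and k: "0 < k" and T: "0 \<le> T"
 shows "integral {0..T} (\<lambda>t. M (t + k) - M t) \<le> k * B"
proof -
 have i: "M integrable_on {a..b}" for a b using M by (rule integrable_continuous_real)
 have sh: "integral {0..T} (\<lambda>t. M (t + k)) = integral {k..T + k} M" "(\<lambda>t. M (t + k)) integrable_on {0..T}"
  using integral_shift_Icc_real[of 0 T M k] integrable_on_shift_Icc_real[of M k 0 T] i
  by (simp_all add: o_def add.commute)
 have "integral {0..k} M + integral {k..T + k} M = integral {0..T} M + integral {T..T + k} M"
  using Henstock_Kurzweil_Integration.integral_combine[of 0 k "T + k" M]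
   Henstock_Kurzweil_Integration.integral_combine[of 0 T "T + k" M] i k T by simp
 moreover have "0 \<le> integral {0..k} M" using b i by (intro Henstock_Kurzweil_Integration.integral_nonneg) auto
 moreover have "integral {T..T + k} M \<le> integral {T..T + k} (\<lambda>_. B)"
  using b i by (intro integral_le) auto
 ultimately have "integral {k..T + k} M - integral {0..T} M \<le> k * B" using k by simp
 then show ?thesis using sh i by (simp add: Henstock_Kurzweil_Integration.integral_diff)
qed

lemma continuous_antiderivative:
 fixes F :: "real \<Rightarrow> real"
 assumes F: "\<And>A. continuous_on A F"
 shows "\<exists>G. \<forall>t\<in>{-K<..<K}. (G has_real_derivative F t) (at t)"
proof (intro exI ballI)
 fix t assume t: "t \<in> {-K<..<K}"
 have "((\<lambda>t. integral {-K..t} F) has_real_derivative F t) (at t within {-K..K})"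
  using t by (intro integral_has_real_derivative F) auto
 then show "((\<lambda>t. integral {-K..t} F) has_real_derivative F t) (at t)"
  using t by (subst (asm) at_within_Icc_at) auto
qed

context
 fixes T :: real and g :: "real \<Rightarrow> 'v::real_normed_vector \<Rightarrow>\<^sub>L real"
 assumes T: "0 < T" and g: "g \<in> L2 T"
begin

text \<open>The primitive of \<open>g\<close> with values in \<open>V*\<close>, defined by its values at the elements of \<open>V\<close> because the
 dual space lacks the countability assumptions of the Bochner integral.\<close>

definition fprim :: "real \<Rightarrow> 'v \<Rightarrow>\<^sub>L real"
 where "fprim t = Blinfun (\<lambda>e. primitive T (\<lambda>r. g r e) t)"

lemma apply_integrable: "integrable (MT T) (\<lambda>r. g r e)" by (rule L2_apply_integrable[OF g])

lemma norm_integrable: "integrable (MT T) (\<lambda>r. norm (g r))"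
 using L2_Cauchy_Schwarz_norm(1)[OF g L2_const[of "1::real" T]] by simp

lemma primitive_functional_bound:
 assumes "s \<le> t"
 shows "\<bar>primitive T (\<lambda>r. g r e) t - primitive T (\<lambda>r. g r e) s\<bar>
  \<le> (primitive T (\<lambda>r. norm (g r)) t - primitive T (\<lambda>r. norm (g r)) s) * norm e"
proof -
 have "\<bar>LINT r|MT T. indicator {s<..t} r * g r e\<bar> \<le> (LINT r|MT T. \<bar>indicator {s<..t} r * g r e\<bar>)"
  using integral_norm_bound[of "MT T" "\<lambda>r. indicator {s<..t} r * g r e"] by simp
 also have "\<dots> \<le> (LINT r|MT T. indicator {s<..t} r * norm (g r) * norm e)"
 proof (rule integral_mono)
  show "integrable (MT T) (\<lambda>r. \<bar>indicator {s<..t} r * g r e\<bar>)"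
   using indicator_mult_integrable[OF apply_integrable, of "{s<..t}" e] by simp
  show "integrable (MT T) (\<lambda>r. indicator {s<..t} r * norm (g r) * norm e)"
   using indicator_mult_integrable[OF norm_integrable, of "{s<..t}"] by simp
  show "\<bar>indicator {s<..t} r * g r e\<bar> \<le> indicator {s<..t} r * norm (g r) * norm e" for r
   using norm_blinfun[of "g r" e] by (simp add: indicator_def)
 qed
 also have "\<dots> = (LINT r|MT T. indicator {s<..t} r * norm (g r)) * norm e" by simp
 finally show ?thesis using primitive_diff[OF apply_integrable assms] primitive_diff[OF norm_integrable assms] by simp
qed

lemma fprim_apply: "fprim t e = primitive T (\<lambda>r. g r e) t"
proof -
 have "bounded_linear (\<lambda>e. primitive T (\<lambda>r. g r e) t)"
 proof (rule bounded_linear_intro)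
  fix x y :: 'v and c :: real
  have i: "integrable (MT T) (\<lambda>r. indicator {..t} r * g r e)" for e
   by (rule indicator_mult_integrable[OF apply_integrable]) simp
  show "primitive T (\<lambda>r. g r (x + y)) t = primitive T (\<lambda>r. g r x) t + primitive T (\<lambda>r. g r y) t"
   using i by (simp add: primitive_def blinfun.add_right distrib_left)
  show "primitive T (\<lambda>r. g r (c *\<^sub>R x)) t = c *\<^sub>R primitive T (\<lambda>r. g r x) t"
   by (simp add: primitive_def blinfun.scaleR_right mult.left_commute)
  define s where "s = min t (- 1)"
  have z: "primitive T h s = 0" for h
  proof -
   have "primitive T h s = (LINT r|MT T. 0)" unfolding primitive_def
    by (intro Bochner_Integration.integral_cong) (auto simp: indicator_def s_def)
   then show ?thesis by simp
  qed
  have "norm (primitive T (\<lambda>r. g r x) t) \<le> primitive T (\<lambda>r. norm (g r)) t * norm x"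
   using primitive_functional_bound[of s t x] by (simp add: z) (simp add: s_def)
  then show "norm (primitive T (\<lambda>r. g r x) t) \<le> norm x * primitive T (\<lambda>r. norm (g r)) t"
   by (simp add: mult.commute)
 qed
 then show ?thesis by (simp add: fprim_def bounded_linear_Blinfun_apply)
qed

lemma fprim_norm_diff:
 assumes "s \<le> t"
 shows "norm (fprim t - fprim s) \<le> primitive T (\<lambda>r. norm (g r)) t - primitive T (\<lambda>r. norm (g r)) s"
proof (rule norm_blinfun_bound)
 show "0 \<le> primitive T (\<lambda>r. norm (g r)) t - primitive T (\<lambda>r. norm (g r)) s"
  using primitive_mono[OF norm_integrable _ assms] by simp
 show "norm ((fprim t - fprim s) e) \<le> (primitive T (\<lambda>r. norm (g r)) t - primitive T (\<lambda>r. norm (g r)) s) * norm e" for e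
  using primitive_functional_bound[OF assms, of e] by (simp add: blinfun.diff_left fprim_apply)
qed

text \<open>By the Cauchy-Schwarz inequality on the interval from \<open>s\<close> to \<open>t\<close>.\<close>

lemma fprim_sq_diff:
 assumes st: "s \<le> t"
 shows "(norm (fprim t - fprim s))\<^sup>2
  \<le> (t - s) * (primitive T (\<lambda>r. (norm (g r))\<^sup>2) t - primitive T (\<lambda>r. (norm (g r))\<^sup>2) s)"
proof -
 let ?i = "\<lambda>r. indicator {s<..t} r *\<^sub>R (1::real)" and ?h = "\<lambda>r. indicator {s<..t} r *\<^sub>R g r"
 have iL: "?i \<in> L2 T" by (rule L2_indicator) simp
 have m: "indicator {s<..t} \<in> borel_measurable (MT T)"
  by (intro measurable_restrict_space1 borel_measurable_indicator) simp
 have hL: "?h \<in> L2 T"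
  by (rule L2_mult[OF m _ g, of 1]) (auto simp: indicator_def)
 have "primitive T (\<lambda>r. norm (g r)) t - primitive T (\<lambda>r. norm (g r)) s
   = (LINT r|MT T. norm (?i r) * norm (?h r))"
  unfolding primitive_diff[OF norm_integrable st]
  by (intro Bochner_Integration.integral_cong) (auto simp: indicator_def)
 also have "\<dots> \<le> L2norm T ?i * L2norm T ?h" by (rule L2_Cauchy_Schwarz_norm(2)[OF iL hL])
 finally have "norm (fprim t - fprim s) \<le> L2norm T ?i * L2norm T ?h"
  using fprim_norm_diff[OF st] by simp
 from power_mono[OF this norm_ge_zero, of 2]
 have 1: "(norm (fprim t - fprim s))\<^sup>2 \<le> (L2norm T ?i)\<^sup>2 * (L2norm T ?h)\<^sup>2"
  by (simp add: power_mult_distrib)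
 have 2: "(L2norm T ?h)\<^sup>2 = primitive T (\<lambda>r. (norm (g r))\<^sup>2) t - primitive T (\<lambda>r. (norm (g r))\<^sup>2) s"
  unfolding primitive_diff[OF L2_integrable[OF g] st] L2norm_sq
  by (intro Bochner_Integration.integral_cong) (auto simp: indicator_def)
 have 3: "(L2norm T ?i)\<^sup>2 \<le> t - s"
 proof -
  have "(L2norm T ?i)\<^sup>2 = (LINT r|MT T. indicator {s<..t} r)"
   unfolding L2norm_sq by (intro Bochner_Integration.integral_cong) (auto simp: indicator_def)
  also have "\<dots> = (LINT r|lebesgue. indicator {0..T} r *\<^sub>R indicator {s<..t} r)"
   by (rule integral_restrict_space) simp
  also have "\<dots> = (LINT r|lebesgue. indicator ({0..T} \<inter> {s<..t}) r)"
   by (intro Bochner_Integration.integral_cong) (auto simp: indicator_def)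
  also have "\<dots> = measure lebesgue ({0..T} \<inter> {s<..t})" by simp
  also have "\<dots> \<le> measure lebesgue {s..t}"
   by (intro measure_mono_fmeasurable) auto
  finally show ?thesis using st by simp
 qed
 have "(L2norm T ?i)\<^sup>2 * (L2norm T ?h)\<^sup>2 \<le> (t - s) * (L2norm T ?h)\<^sup>2"
  using 3 by (rule mult_right_mono) simp
 with 1 show ?thesis unfolding 2 by linarith
qed

lemma fprim_continuous: "continuous_on A fprim"
proof -
 let ?m = "primitive T (\<lambda>r. norm (g r))"
 have le: "norm (fprim t - fprim s) \<le> \<bar>?m t - ?m s\<bar>" for s t
  using fprim_norm_diff[of s t] fprim_norm_diff[of t s] by (cases "s \<le> t") (auto simp: norm_minus_commute)
 have "isCont fprim s" for s
 proof -
  have "isCont ?m s" using primitive_continuous[OF norm_integrable, of UNIV] T by (simp add: continuous_on_eq_continuous_at)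
  then have "((\<lambda>t. \<bar>?m t - ?m s\<bar>) \<longlongrightarrow> 0) (at s)"
   by (intro tendsto_rabs_zero) (simp add: isCont_def LIM_zero)
  then have "((\<lambda>t. fprim t - fprim s) \<longlongrightarrow> 0) (at s)"
   by (rule Lim_null_comparison[rotated]) (simp add: le)
  then show ?thesis by (simp add: isCont_def LIM_zero_iff)
 qed
 then show ?thesis by (simp add: continuous_at_imp_continuous_on)
qed

definition dquot :: "real \<Rightarrow> real \<Rightarrow> 'v \<Rightarrow>\<^sub>L real"
 where "dquot h t = (1 / h) *\<^sub>R (fprim (t + h) - fprim t)"

text \<open>Difference quotients of the primitive are bounded in \<open>L\<^sub>2\<close> by the function itself, since they
 are controlled by difference quotients of the primitive of the squared norm.\<close>

lemma dquot_L2: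
 assumes h: "h \<noteq> 0"
 shows "dquot h \<in> L2 T" and "L2norm T (dquot h) \<le> L2norm T g"
proof -
 let ?M = "primitive T (\<lambda>r. (norm (g r))\<^sup>2)"
 note i2 = L2_integrable[OF g]
 have Mc: "continuous_on A ?M" for A using primitive_continuous[OF i2] T by simp
 have M0: "0 \<le> ?M t" for t
  unfolding primitive_def by (intro integral_nonneg_AE AE_I2) simp
 have M1: "?M t \<le> (L2norm T g)\<^sup>2" for t
  unfolding primitive_def L2norm_sq
  by (intro integral_mono indicator_mult_integrable[OF i2] i2) (auto simp: indicator_def)
 have sm: "strongly_measurable (MT T) (dquot h)"
  unfolding dquot_def
  by (rule continuous_strongly_measurable)
    (intro continuous_intros continuous_on_compose2[OF fprim_continuous[of UNIV]]; simp)
 have le: "(norm (dquot h t))\<^sup>2 \<le> \<bar>?M (t + h) - ?M t\<bar> / \<bar>h\<bar>" for t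
 proof -
  have "(norm (fprim (t + h) - fprim t))\<^sup>2 \<le> \<bar>h\<bar> * \<bar>?M (t + h) - ?M t\<bar>"
  proof (cases "0 < h")
   case True
   have "(norm (fprim (t + h) - fprim t))\<^sup>2 \<le> (t + h - t) * (?M (t + h) - ?M t)"
    using True by (intro fprim_sq_diff) simp
   also have "\<dots> \<le> \<bar>h\<bar> * \<bar>?M (t + h) - ?M t\<bar>" using True by (simp add: mult_left_mono)
   finally show ?thesis .
  next
   case False
   have "(norm (fprim (t + h) - fprim t))\<^sup>2 = (norm (fprim t - fprim (t + h)))\<^sup>2"
    by (simp add: norm_minus_commute)
   also have "\<dots> \<le> (t - (t + h)) * (?M t - ?M (t + h))"
    using False by (intro fprim_sq_diff) simp
   also have "t - (t + h) = \<bar>h\<bar>" using False by simp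
   also have "?M t - ?M (t + h) = \<bar>?M (t + h) - ?M t\<bar>"
    using primitive_mono[OF i2, of "t + h" t] False by simp
   finally show ?thesis .
  qed
  then have "(norm (fprim (t + h) - fprim t))\<^sup>2 / h\<^sup>2 \<le> \<bar>h\<bar> * \<bar>?M (t + h) - ?M t\<bar> / h\<^sup>2"
   by (rule divide_right_mono) simp
  also have "\<dots> = \<bar>?M (t + h) - ?M t\<bar> / \<bar>h\<bar>"
   using h by (simp add: power2_eq_square divide_simps abs_mult_self_eq)
  finally show ?thesis by (simp add: dquot_def power_divide)
 qed
 have Dc: "continuous_on {0..T} (\<lambda>t. \<bar>?M (t + h) - ?M t\<bar> / \<bar>h\<bar>)"
  by (intro continuous_intros continuous_on_compose2[OF Mc[of UNIV]]) (use h in auto)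
 have Di: "integrable (MT T) (\<lambda>t. \<bar>?M (t + h) - ?M t\<bar> / \<bar>h\<bar>)"
  using Dc by (rule continuous_imp_integrable_real)
 have int: "integrable (MT T) (\<lambda>t. (norm (dquot h t))\<^sup>2)"
  by (rule Bochner_Integration.integrable_bound[OF Di])
    (use strongly_measurable_norm[OF sm] le in \<open>auto intro!: AE_I2\<close>)
 then show "dquot h \<in> L2 T" using sm by (simp add: L2_def)
 have D: "integral {0..T} (\<lambda>t. \<bar>?M (t + h) - ?M t\<bar>) \<le> \<bar>h\<bar> * (L2norm T g)\<^sup>2"
 proof (cases "0 < h")
  case True
  have "\<bar>?M (t + h) - ?M t\<bar> = ?M (t + h) - ?M t" for t
   using primitive_mono[OF i2, of t "t + h"] True by simp
  then show ?thesis using shifted_increment_bound[OF Mc M0 M1 True, of T] T True by simp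
 next
  case False
  have e: "\<bar>?M (t + h) - ?M t\<bar> = ?M ((t + (- h)) + h) - ?M (t + h)" for t
   using primitive_mono[OF i2, of "t + h" t] False by simp
  have "continuous_on A (\<lambda>t. ?M (t + h))" for A
   by (intro continuous_intros continuous_on_compose2[OF Mc[of UNIV]]) auto
  from shifted_increment_bound[OF this M0 M1, of "- h" T] show ?thesis
   unfolding e using False h T by simp
 qed
 have "(L2norm T (dquot h))\<^sup>2 \<le> (LINT t|MT T. \<bar>?M (t + h) - ?M t\<bar> / \<bar>h\<bar>)"
  unfolding L2norm_sq by (rule integral_mono[OF int Di le])
 also have "\<dots> = integral {0..T} (\<lambda>t. \<bar>?M (t + h) - ?M t\<bar> / \<bar>h\<bar>)"
  by (rule lebesgue_integral_eq_integral[OF Di]) simp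
 also have "\<dots> = integral {0..T} (\<lambda>t. \<bar>?M (t + h) - ?M t\<bar>) / \<bar>h\<bar>" by simp
 also have "\<dots> \<le> (L2norm T g)\<^sup>2" using D h by (simp add: divide_le_eq mult.commute)
 finally show "L2norm T (dquot h) \<le> L2norm T g" by (rule power2_le_imp_le) simp
qed

text \<open>The uniform \<open>L\<^sub>2\<close> bound reduces the limit to a dense class. For an indicator of a half line, the
 pairing is a difference quotient of an antiderivative of a continuous function.\<close>

lemma dquot_tendsto:
 assumes w: "w \<in> L2 T"
 shows "((\<lambda>h. L2_pair T (dquot h) w) \<longlongrightarrow> L2_pair T g w) (at 0)"
 using w
proof (induction rule: L2_dense_induct)
 case (half_line a e)
 define F where "F t = fprim t e" for t
 have Fc: "continuous_on A F" for A
  unfolding F_def by (intro continuous_intros fprim_continuous)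
 define a' where "a' = max 0 (min T a)"
 obtain G where G: "\<And>t. t \<in> {-(T+1)<..<T+1} \<Longrightarrow> (G has_real_derivative F t) (at t)"
  using continuous_antiderivative[OF Fc] by blast
 have a': "0 \<le> a'" "a' \<le> T" using T by (auto simp: a'_def)
 have Fa: "F a = F a'"
  using T unfolding F_def fprim_apply primitive_eq_integral[OF apply_integrable less_imp_le[OF T]] a'_def
  by (simp add: max_def min_def)
 have FT: "primitive T (\<lambda>r. g r e) s = F s" for s by (simp add: F_def fprim_apply)
 have rhs: "L2_pair T g (\<lambda>t. indicator {a<..} t *\<^sub>R e) = F T - F a'"
  using integral_half_line[OF apply_integrable, of a e] by (simp add: L2_pair_def blinfun.scaleR_right FT Fa)
 have lhs: "L2_pair T (dquot h) (\<lambda>t. indicator {a<..} t *\<^sub>R e)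
   = (G (T + h) - G T) / h - (G (a' + h) - G a') / h" if h: "h \<noteq> 0" "\<bar>h\<bar> < 1" for h
 proof -
  define q where "q t = (F (t + h) - F t) / h" for t
  have qc: "continuous_on A q" for A
   unfolding q_def by (intro continuous_intros continuous_on_compose2[OF Fc[of UNIV]]) (use h in auto)
  have qi: "integrable (MT T) q" using qc by (rule continuous_imp_integrable_real)
  have I: "integral {0..b} q = (G (b + h) - G b) / h - (G h - G 0) / h" if b: "0 \<le> b" "b \<le> T" for b
  proof -
   have "(q has_integral ((G (b + h) - G b) / h - (G (0 + h) - G 0) / h)) {0..b}"
   proof (rule fundamental_theorem_of_calculus[OF b(1)])
    fix t assume t: "t \<in> {0..b}"
    have 1: "(G has_real_derivative F t) (at t)" using t b T h by (intro G) auto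
    have "(G has_real_derivative F (t + h)) (at (t + h))" using t b h by (intro G) auto
    then have 2: "((\<lambda>t. G (t + h)) has_real_derivative F (t + h)) (at t)"
     by (rule DERIV_shift[THEN iffD1])
    have 3: "((\<lambda>t. (G (t + h) - G t) / h) has_real_derivative q t) (at t)"
     unfolding q_def by (rule DERIV_cdivide[OF DERIV_diff[OF 2 1]])
    show "((\<lambda>t. (G (t + h) - G t) / h) has_vector_derivative q t) (at t within {0..b})"
     by (rule has_vector_derivative_at_within[OF iffD1[OF has_real_derivative_iff_has_vector_derivative 3]])
   qed
   from integral_unique[OF this] show ?thesis by simp
  qed
  have "L2_pair T (dquot h) (\<lambda>t. indicator {a<..} t *\<^sub>R e) = (LINT t|MT T. indicator {a<..} t * q t)"
   unfolding L2_pair_def q_def F_def dquot_def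
   by (intro Bochner_Integration.integral_cong)
     (auto simp: blinfun.scaleR_right blinfun.scaleR_left blinfun.diff_left)
  also have "\<dots> = integral {0..T} q - integral {0..a'} q"
   using integral_half_line[OF qi, of a] primitive_eq_integral[OF qi] T by (simp add: a'_def)
  finally show ?thesis using I[of T] I[of a'] a' T by simp
 qed
 have d: "((\<lambda>h. (G (b + h) - G b) / h) \<longlongrightarrow> F b) (at 0)" if "0 \<le> b" "b \<le> T" for b
  using G[of b] that by (simp add: DERIV_def)
 have "((\<lambda>h. (G (T + h) - G T) / h - (G (a' + h) - G a') / h) \<longlongrightarrow> F T - F a') (at 0)"
  using a' T by (intro tendsto_diff d) auto
 moreover have "\<forall>\<^sub>F h in at 0. (G (T + h) - G T) / h - (G (a' + h) - G a') / h
   = L2_pair T (dquot h) (\<lambda>t. indicator {a<..} t *\<^sub>R e)"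
  unfolding eventually_at by (intro exI[of _ 1]) (auto simp: lhs)
 ultimately show ?case unfolding rhs by (rule Lim_transform_eventually)
next
 case (add f k)
 have "((\<lambda>h. L2_pair T (dquot h) f + L2_pair T (dquot h) k) \<longlongrightarrow> L2_pair T g f + L2_pair T g k) (at 0)"
  using add by (intro tendsto_add)
 moreover have "\<forall>\<^sub>F h in at 0. L2_pair T (dquot h) f + L2_pair T (dquot h) k = L2_pair T (dquot h) (f + k)"
  unfolding eventually_at using add dquot_L2(1) by (intro exI[of _ 1]) (auto simp: L2_pair_add_right)
 ultimately show ?case
  unfolding L2_pair_add_right[OF add(1,2) g] by (rule Lim_transform_eventually)
next
 case (scale c f)
 then show ?case by (auto intro: tendsto_mult_left)
next
 case (lim f w)
 have fL: "f n \<in> L2 T" for n by fact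
 have wL: "w \<in> L2 T" by fact
 have fw0: "(\<lambda>n. L2norm T (f n - w)) \<longlonglongrightarrow> 0" by fact
 have IH: "((\<lambda>h. L2_pair T (dquot h) (f n)) \<longlongrightarrow> L2_pair T g (f n)) (at 0)" for n by fact
 show ?case
 proof (rule tendstoI)
  fix \<epsilon> :: real assume e: "0 < \<epsilon>"
  define c where "c = L2norm T g + 1"
  have c: "0 < c" by (simp add: c_def add_nonneg_pos)
  have "\<forall>\<^sub>F n in sequentially. L2norm T (f n - w) < \<epsilon> / (3 * c)"
   using fw0 e c by (intro order_tendstoD(2)[where y = 0]) auto
  then obtain n where n: "L2norm T (f n - w) < \<epsilon> / (3 * c)" by (auto simp: eventually_sequentially)
  have "c * L2norm T (f n - w) < \<epsilon> / 3" using n c by (simp add: field_simps)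
  then have n': "L2norm T g * L2norm T (f n - w) < \<epsilon> / 3"
   using mult_right_mono[of "L2norm T g" c "L2norm T (f n - w)"] by (simp add: c_def)
  have "\<forall>\<^sub>F h in at 0. dist (L2_pair T (dquot h) (f n)) (L2_pair T g (f n)) < \<epsilon> / 3"
   using IH[of n] e by (intro tendstoD) auto
  moreover have "\<forall>\<^sub>F h in at (0::real). h \<noteq> 0" by (simp add: eventually_at_filter)
  ultimately show "\<forall>\<^sub>F h in at 0. dist (L2_pair T (dquot h) w) (L2_pair T g w) < \<epsilon>"
  proof eventually_elim
   case (elim h)
   note k = dquot_L2[OF elim(2)] and fw = L2_diff[OF fL wL, of n]
   have "\<bar>L2_pair T (dquot h) (f n - w)\<bar> \<le> L2norm T g * L2norm T (f n - w)"
    using L2_pair_bound[OF k(1) fw] k(2) mult_right_mono[OF k(2), of "L2norm T (f n - w)"] by simp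
   moreover have "\<bar>L2_pair T g (f n - w)\<bar> \<le> L2norm T g * L2norm T (f n - w)"
    by (rule L2_pair_bound[OF g fw])
   moreover have "L2_pair T (dquot h) (f n - w) = L2_pair T (dquot h) (f n) - L2_pair T (dquot h) w"
    "L2_pair T g (f n - w) = L2_pair T g (f n) - L2_pair T g w"
    using k(1) g fL wL by (auto simp: L2_pair_diff_right)
   ultimately show ?case using elim(1) n' unfolding dist_real_def by linarith
  qed
 qed
qed

end

section \<open>The product rule and the continuous representative\<close>

lemma AE_MT_interval_ex:
 assumes ae: "AE t in MT T. P t" and ab: "0 \<le> a" "a < b" "b \<le> T"
 shows "\<exists>t\<in>{a<..<b}. P t"
proof (rule ccontr)
 assume n: "\<not> (\<exists>t\<in>{a<..<b}. P t)"
 have "AE t in lebesgue. t \<in> {0..T} \<longrightarrow> P t" using ae by (simp add: AE_restrict_space_iff)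
 then have "AE t in lebesgue. \<not> t \<in> {a<..<b}"
  by (rule eventually_mono) (use n ab in auto)
 from emeasure_eq_0_AE[OF this] have "emeasure lebesgue {a<..<b} = 0"
  by (simp add: greaterThanLessThan_def greaterThan_def lessThan_def Int_def conj_commute)
 then show False using ab by (simp add: ennreal_eq_0_iff)
qed

lemma AE_MT_dense:
 assumes ae: "AE t in MT T. P t" and T: "0 < T"
 shows "{0..T} \<subseteq> closure {t \<in> {0..T}. P t}"
proof
 fix s assume s: "s \<in> {0..T}"
 show "s \<in> closure {t \<in> {0..T}. P t}"
  unfolding closure_approachable
 proof (intro allI impI)
  fix e :: real assume e: "0 < e"
  define a b where "a = max 0 (s - e)" and "b = min T (s + e)"
  have "0 \<le> a" "a < b" "b \<le> T" using s e T by (auto simp: a_def b_def)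
  from AE_MT_interval_ex[OF ae this] obtain t where t: "a < t" "t < b" "P t" by auto
  then have "t \<in> {0..T}" "dist t s < e" using s by (auto simp: a_def b_def dist_real_def)
  with t(3) show "\<exists>y\<in>{t \<in> {0..T}. P t}. dist y s < e" by blast
 qed
qed

lemma AE_lebesgue_shift:
 fixes P :: "real \<Rightarrow> bool"
 assumes "AE t in lebesgue. P t"
 shows "AE t in lebesgue. P (t + h)"
proof -
 obtain N where N: "N \<in> null_sets lborel" "{t. \<not> P t} \<subseteq> N"
  using assms by (auto simp: eventually_ae_filter null_sets_completion_iff2)
 have "{x. x - (- h) \<in> N} \<in> null_sets lborel" by (rule null_sets_translation[OF N(1)])
 then have "AE t in lborel. t + h \<notin> N" using AE_not_in by fastforce
 then have "AE t in lebesgue. t + h \<notin> N" by (rule AE_completion)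
 then show ?thesis by (rule eventually_mono) (use N(2) in auto)
qed

lemma LINT_MT_eq_lebesgue:
 fixes f :: "real \<Rightarrow> real"
 assumes "\<And>t. t \<notin> {0..T} \<Longrightarrow> f t = 0"
 shows "(LINT t|MT T. f t) = (LINT t|lebesgue. f t)"
  and "integrable (MT T) f \<longleftrightarrow> integrable lebesgue f"
proof -
 have e: "(\<lambda>t. indicator {0..T} t *\<^sub>R f t) = f"
 proof
  fix t show "indicator {0..T} t *\<^sub>R f t = f t" using assms[of t] by (cases "t \<in> {0..T}") auto
 qed
 have "(LINT t|MT T. f t) = (LINT t|lebesgue. indicator {0..T} t *\<^sub>R f t)"
  by (rule integral_restrict_space) simp
 then show "(LINT t|MT T. f t) = (LINT t|lebesgue. f t)" by (simp only: e)
 have "integrable (MT T) f \<longleftrightarrow> integrable lebesgue (\<lambda>t. indicator {0..T} t *\<^sub>R f t)"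
  by (rule integrable_restrict_space) simp
 then show "integrable (MT T) f \<longleftrightarrow> integrable lebesgue f" by (simp only: e)
qed

lemma LINT_shift:
 fixes f :: "real \<Rightarrow> real"
 shows "(LINT t|lebesgue. f (t + h)) = (LINT t|lebesgue. f t)"
  and "integrable lebesgue f \<Longrightarrow> integrable lebesgue (\<lambda>t. f (t + h))"
 using lebesgue_integral_real_affine[of 1 f h] lebesgue_integrable_real_affine[of f 1 h]
 by (simp_all add: add.commute)

context
 fixes \<iota> :: "'v::{real_normed_vector,second_countable_topology} \<Rightarrow>\<^sub>L 'h::real_inner"
  and T :: real and v :: "real \<Rightarrow> 'v" and g :: "real \<Rightarrow> 'v \<Rightarrow>\<^sub>L real"
 assumes T: "0 < T" and v: "v \<in> L2 T" and g: "g \<in> L2 T" and weak: "has_weak_deriv \<iota> T v g"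
begin

text \<open>The lemma of du Bois-Reymond applies to the pairing with each fixed element of \<open>V\<close>. On a countable
 dense set of elements, the exceptional sets have a common null set as their union, and the constants
 of integration are the values of one functional, read off at a single good point \<open>s0\<close>.\<close>

lemma weak_path_primitive: "\<exists>c. AE t in MT T. emb_dual \<iota> (\<iota> (v t)) = c + fprim T g t"
proof -
 have "\<forall>e. \<exists>c. AE t in MT T. \<iota> (v t) \<bullet> \<iota> e = c + integral {0..t} (\<lambda>r. g r e)"
 proof (rule allI, rule weak_derivative_primitive[OF T emb_inner_integrable[OF v L2_const] L2_apply_integrable[OF g]])
  fix e \<phi> assume "test_function T \<phi>"
  from weak[unfolded has_weak_deriv_def, rule_format, OF this, of e]
  show "(LINT t|MT T. deriv \<phi> t * (\<iota> (v t) \<bullet> \<iota> e)) = - (LINT t|MT T. \<phi> t * g t e)" by simp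
 qed
 from choice[OF this] obtain cc where
  cc: "\<And>e. AE t in MT T. \<iota> (v t) \<bullet> \<iota> e = cc e + integral {0..t} (\<lambda>r. g r e)" by blast
 obtain D :: "'v set" where D: "countable D" "\<And>X. open X \<Longrightarrow> X \<noteq> {} \<Longrightarrow> \<exists>d\<in>D. d \<in> X"
  using countable_dense_setE by blast
 have ae: "AE t in MT T. t \<in> {0..T} \<and> (\<forall>d\<in>D. \<iota> (v t) \<bullet> \<iota> d = cc d + integral {0..t} (\<lambda>r. g r d))"
 proof (rule AE_conjI)
  show "AE t in MT T. t \<in> {0..T}" by (intro AE_I2) simp
  show "AE t in MT T. \<forall>d\<in>D. \<iota> (v t) \<bullet> \<iota> d = cc d + integral {0..t} (\<lambda>r. g r d)"
   by (rule AE_ball_countable'[OF _ D(1)]) (rule cc)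
 qed
 have good: "(emb_dual \<iota> (\<iota> (v t)) - fprim T g t) d = cc d"
  if "t \<in> {0..T} \<and> (\<forall>d\<in>D. \<iota> (v t) \<bullet> \<iota> d = cc d + integral {0..t} (\<lambda>r. g r d))" "d \<in> D" for t d
 proof -
  have "fprim T g t d = integral {0..t} (\<lambda>r. g r d)"
   using that(1) T primitive_eq_integral[OF L2_apply_integrable[OF g, of d], of t]
   by (simp add: fprim_apply[OF T g])
  then show ?thesis using that by (simp add: blinfun.diff_left)
 qed
 from AE_MT_interval_ex[OF ae order_refl T order_refl]
 obtain s0 where s0: "s0 \<in> {0..T} \<and> (\<forall>d\<in>D. \<iota> (v s0) \<bullet> \<iota> d = cc d + integral {0..s0} (\<lambda>r. g r d))"
  by blast
 define c where "c = emb_dual \<iota> (\<iota> (v s0)) - fprim T g s0"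
 have "AE t in MT T. emb_dual \<iota> (\<iota> (v t)) = c + fprim T g t"
  using ae
 proof (rule eventually_mono)
  fix t assume t: "t \<in> {0..T} \<and> (\<forall>d\<in>D. \<iota> (v t) \<bullet> \<iota> d = cc d + integral {0..t} (\<lambda>r. g r d))"
  have "emb_dual \<iota> (\<iota> (v t)) - fprim T g t - c = 0"
  proof (rule functional_zero_if_zero_on_dense[OF D(2)])
   show "\<forall>d\<in>D. (emb_dual \<iota> (\<iota> (v t)) - fprim T g t - c) d = 0"
    using good[OF t] good[OF s0] by (simp add: blinfun.diff_left[of "emb_dual \<iota> (\<iota> (v t)) - fprim T g t"] c_def)
  qed
  then show "emb_dual \<iota> (\<iota> (v t)) = c + fprim T g t" by (simp add: algebra_simps)
 qed
 then show ?thesis by blast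
qed

lemma deriv_bounded_test:
 assumes \<psi>: "test_function T \<psi>"
 shows "\<exists>K\<ge>0. \<forall>t h. \<bar>\<psi> (t + h) - \<psi> t\<bar> \<le> K * \<bar>h\<bar>"
proof -
 obtain K where K: "0 \<le> K" "\<And>t. \<bar>deriv \<psi> t\<bar> \<le> K"
  using test_function_bounded[OF test_function_deriv[OF \<psi>]] by blast
 have "norm (\<psi> (t + h) - \<psi> t) \<le> K * norm (t + h - t)" for t h
  by (rule field_differentiable_bound[of UNIV \<psi> "deriv \<psi>"])
    (use K test_function_DERIV[OF \<psi>] in \<open>auto intro: has_field_derivative_at_within\<close>)
 then show ?thesis using K(1) by (intro exI[of _ K]) simp
qed

text \<open>
 Writing the increment of \<open>norm (\<iota> v)\<^sup>2\<close> over a step \<open>h\<close> by the symmetry of the inner product as the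
 sum of a forward and a backward difference quotient tested with \<open>v\<close> itself gives the weak
 derivative of \<open>norm (\<iota> v)\<^sup>2\<close> in the limit.
\<close>

lemma weak_product_rule:
 assumes \<psi>: "test_function T \<psi>"
 shows "(LINT t|MT T. deriv \<psi> t * (norm (\<iota> (v t)))\<^sup>2) = - (LINT t|MT T. \<psi> t * (2 * g t (v t)))"
proof -
 obtain c where c: "AE t in MT T. emb_dual \<iota> (\<iota> (v t)) = c + fprim T g t"
  using weak_path_primitive by blast
 define p where "p t = indicator {0..T} t * (norm (\<iota> (v t)))\<^sup>2" for t
 define \<Delta> where "\<Delta> h t = fprim T g (t + h) - fprim T g t" for h t
 have pM: "integrable (MT T) (\<lambda>t. (norm (\<iota> (v t)))\<^sup>2)"
  using emb_inner_integrable[OF v v] by (simp add: power2_norm_eq_inner)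
 have pM': "integrable (MT T) p"
  using pM by (rule Bochner_Integration.integrable_cong[THEN iffD1, rotated -1]) (auto simp: p_def)
 have pL: "integrable lebesgue p"
  using LINT_MT_eq_lebesgue(2)[of T p] pM' by (simp add: p_def)
 obtain a b where ab: "0 < a" "b < T" "\<And>t. t \<notin> {a..b} \<Longrightarrow> \<psi> t = 0" and sm: "smooth \<psi>"
  using \<psi> unfolding test_function_iff by blast
 define \<delta> where "\<delta> = min a (T - b) / 2"
 have d0: "0 < \<delta>" and d1: "2 * \<delta> \<le> a" "2 * \<delta> \<le> T - b" using ab by (auto simp: \<delta>_def)
 have d: "0 < \<delta>" "\<delta> < a" "b + \<delta> < T" using d0 d1 by linarith+
 obtain K where K: "0 \<le> K" "\<And>t h. \<bar>\<psi> (t + h) - \<psi> t\<bar> \<le> K * \<bar>h\<bar>" using deriv_bounded_test[OF \<psi>] by blast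
 define \<psi>h where "\<psi>h = (\<lambda>h t. \<psi> (t - h))"
 have th: "test_function T (\<psi>h h)" if h: "\<bar>h\<bar> \<le> \<delta>" for h
  unfolding test_function_iff
 proof (intro conjI exI allI impI)
  show "smooth (\<psi>h h)" using smooth_affine[OF sm, of 1 "- h"] by (simp add: \<psi>h_def)
  show "0 < a - \<delta>" "b + \<delta> < T" using d by auto
  show "\<psi>h h t = 0" if "t \<notin> {a - \<delta>..b + \<delta>}" for t
   unfolding \<psi>h_def by (rule ab(3)) (use that h in auto)
 qed
 have \<psi>v: "(\<lambda>t. \<psi> t *\<^sub>R v t) \<in> L2 T" by (rule test_function_L2[OF \<psi> v])
 have \<psi>hv: "(\<lambda>t. \<psi>h h t *\<^sub>R v t) \<in> L2 T" if "\<bar>h\<bar> \<le> \<delta>" for h by (rule test_function_L2[OF th[OF that] v])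
 have good: "AE t in lebesgue. t \<in> {0..T} \<longrightarrow> emb_dual \<iota> (\<iota> (v t)) = c + fprim T g t"
  using c by (simp add: AE_restrict_space_iff)
 have ident: "(LINT t|MT T. ((\<psi>h h t - \<psi> t) / h) * (norm (\<iota> (v t)))\<^sup>2)
   = L2_pair T (dquot T g h) (\<lambda>t. \<psi> t *\<^sub>R v t) + L2_pair T (dquot T g (- h)) (\<lambda>t. \<psi>h h t *\<^sub>R v t)"
  if h: "0 < h" "h \<le> \<delta>" for h
 proof -
  have hd: "\<bar>h\<bar> \<le> \<delta>" "h \<noteq> 0" "- h \<noteq> 0" using h by auto
  define A where "A t = \<psi> t * \<Delta> h t (v t)" for t
  define q where "q t = \<psi>h h t * (- \<Delta> (- h) t) (v t)" for t
  have dq: "\<Delta> k t = k *\<^sub>R dquot T g k t" if "k \<noteq> 0" for k t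
   using that by (simp add: \<Delta>_def dquot_def[OF T g])
  have A: "A t = h * dquot T g h t (\<psi> t *\<^sub>R v t)" for t
   using dq[of h t] h by (simp add: A_def blinfun.scaleR_left blinfun.scaleR_right)
  have q: "q t = h * dquot T g (- h) t (\<psi>h h t *\<^sub>R v t)" for t
   using dq[of "- h" t] h by (simp add: q_def blinfun.scaleR_left blinfun.scaleR_right blinfun.minus_left)
  have AM: "integrable (MT T) A"
   unfolding A by (intro integrable_mult_right integrable_L2_pair[OF dquot_L2(1)[OF T g] \<psi>v] hd)
  have qM: "integrable (MT T) q"
   unfolding q by (intro integrable_mult_right integrable_L2_pair[OF dquot_L2(1)[OF T g] \<psi>hv] hd)
  have A0: "A t = 0" and q0: "q t = 0" if "t \<notin> {0..T}" for t
   using test_function_outside[OF \<psi>, of t] test_function_outside[OF th[OF hd(1)], of t] that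
   by (auto simp: A_def q_def)
  note Al = LINT_MT_eq_lebesgue[of T A, OF A0] and ql = LINT_MT_eq_lebesgue[of T q, OF q0]
  have AL: "integrable lebesgue A" and qL: "integrable lebesgue q" using Al ql AM qM by auto
  have p1: "integrable lebesgue (\<lambda>t. \<psi> t * p t)" and p2: "integrable lebesgue (\<lambda>t. \<psi>h h t * p t)"
   using LINT_MT_eq_lebesgue(2)[of T "\<lambda>t. \<psi> t * p t"] test_function_mult_integrable[OF pM' \<psi>]
    LINT_MT_eq_lebesgue(2)[of T "\<lambda>t. \<psi>h h t * p t"] test_function_mult_integrable[OF pM' th[OF hd(1)]]
   by (auto simp: p_def)
  have p2': "integrable lebesgue (\<lambda>t. \<psi> t * p (t + h))" "(LINT t|lebesgue. \<psi> t * p (t + h)) = (LINT t|lebesgue. \<psi>h h t * p t)"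
   using LINT_shift(2)[OF p2, of h] LINT_shift(1)[of "\<lambda>t. \<psi>h h t * p t" h] by (simp_all add: \<psi>h_def)
  have "AE t in lebesgue. \<psi> t * p (t + h) - \<psi> t * p t = A t + q (t + h)"
   using good AE_lebesgue_shift[OF good, of h]
  proof eventually_elim
   case (elim t)
   show ?case
   proof (cases "\<psi> t = 0")
    case True
    then show ?thesis by (simp add: A_def q_def \<psi>h_def)
   next
    case False
    then have "t \<in> {a..b}" using ab(3) by blast
    then have t: "t \<in> {0..T}" "t + h \<in> {0..T}" using d h ab by auto
    let ?f = "fprim T g"
    have e1: "\<iota> (v t) \<bullet> \<iota> w = (c + ?f t) w" and e2: "\<iota> (v (t + h)) \<bullet> \<iota> w = (c + ?f (t + h)) w" for w
     using elim t by (metis emb_dual_apply)+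
    have s: "(c + ?f t) (v (t + h)) = (c + ?f (t + h)) (v t)"
     using e1[of "v (t + h)"] e2[of "v t"] by (simp add: inner_commute)
    have "p (t + h) - p t = (c + ?f (t + h)) (v (t + h)) - (c + ?f t) (v t)"
     using e1[of "v t"] e2[of "v (t + h)"] t by (simp add: p_def power2_norm_eq_inner)
    also have "\<dots> = \<Delta> h t (v t) + \<Delta> h t (v (t + h))"
     using s by (simp add: \<Delta>_def blinfun.add_left blinfun.diff_left)
    finally show ?thesis
     by (simp add: A_def q_def \<psi>h_def \<Delta>_def right_diff_distrib[symmetric] distrib_left[symmetric])
   qed
  qed
  then have "(LINT t|lebesgue. \<psi> t * p (t + h) - \<psi> t * p t) = (LINT t|lebesgue. A t + q (t + h))"
   using p1 p2'(1) AL LINT_shift(2)[OF qL, of h] by (intro integral_cong_AE) auto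
  then have "(LINT t|lebesgue. \<psi>h h t * p t) - (LINT t|lebesgue. \<psi> t * p t) = (LINT t|lebesgue. A t) + (LINT t|lebesgue. q t)"
   using p1 p2' AL LINT_shift(2)[OF qL, of h] LINT_shift(1)[of q h] by simp
  moreover have "(LINT t|lebesgue. A t) = h * L2_pair T (dquot T g h) (\<lambda>t. \<psi> t *\<^sub>R v t)"
  proof -
   have "(LINT t|lebesgue. A t) = (LINT t|MT T. A t)" by (rule Al(1)[symmetric])
   also have "\<dots> = h * L2_pair T (dquot T g (h)) (\<lambda>t. \<psi> t *\<^sub>R v t)"
    unfolding A L2_pair_def by simp
   finally show ?thesis .
  qed
  moreover have "(LINT t|lebesgue. q t) = h * L2_pair T (dquot T g (- h)) (\<lambda>t. \<psi>h h t *\<^sub>R v t)"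
  proof -
   have "(LINT t|lebesgue. q t) = (LINT t|MT T. q t)" by (rule ql(1)[symmetric])
   also have "\<dots> = h * L2_pair T (dquot T g (- h)) (\<lambda>t. \<psi>h h t *\<^sub>R v t)"
    unfolding q L2_pair_def by simp
   finally show ?thesis .
  qed
  moreover have "(LINT t|lebesgue. \<psi>h h t * p t) - (LINT t|lebesgue. \<psi> t * p t)
    = h * (LINT t|MT T. ((\<psi>h h t - \<psi> t) / h) * (norm (\<iota> (v t)))\<^sup>2)"
  proof -
   have "(LINT t|lebesgue. \<psi>h h t * p t) - (LINT t|lebesgue. \<psi> t * p t)
     = (LINT t|lebesgue. \<psi>h h t * p t - \<psi> t * p t)" using p1 p2 by simp
   also have "\<dots> = (LINT t|MT T. \<psi>h h t * p t - \<psi> t * p t)"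
    by (rule LINT_MT_eq_lebesgue(1)[symmetric]) (auto simp: p_def)
   also have "\<dots> = (LINT t|MT T. h * (((\<psi>h h t - \<psi> t) / h) * (norm (\<iota> (v t)))\<^sup>2))"
    using h by (intro Bochner_Integration.integral_cong) (auto simp: p_def field_simps)
   finally show ?thesis by simp
  qed
  ultimately have "h * (LINT t|MT T. ((\<psi>h h t - \<psi> t) / h) * (norm (\<iota> (v t)))\<^sup>2)
   = h * (L2_pair T (dquot T g h) (\<lambda>t. \<psi> t *\<^sub>R v t) + L2_pair T (dquot T g (- h)) (\<lambda>t. \<psi>h h t *\<^sub>R v t))"
   by (simp add: distrib_left)
  then show ?thesis using h by simp
 qed
 define H where "H n = \<delta> / real (Suc n)" for n
 have H: "0 < H n" "H n \<le> \<delta>" for n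
  using d by (auto simp: H_def divide_le_eq)
 have Hlim: "H \<longlonglongrightarrow> 0"
  using tendsto_mult_right[OF LIMSEQ_Suc[OF lim_1_over_n], of \<delta>] by (simp add: H_def[abs_def])
 have Hat: "filterlim H (at 0) sequentially"
  using Hlim H(1) by (auto simp: filterlim_at intro!: always_eventually) (metis less_irrefl)
 have Hat': "filterlim (\<lambda>n. - H n) (at 0) sequentially"
  using tendsto_minus[OF Hlim] H(1) by (auto simp: filterlim_at intro!: always_eventually) (metis less_irrefl)
 have lim1: "(\<lambda>n. L2_pair T (dquot T g (H n)) (\<lambda>t. \<psi> t *\<^sub>R v t)) \<longlonglongrightarrow> L2_pair T g (\<lambda>t. \<psi> t *\<^sub>R v t)"
  by (rule filterlim_compose[OF dquot_tendsto[OF T g \<psi>v] Hat])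
 have lim2: "(\<lambda>n. L2_pair T (dquot T g (- H n)) (\<lambda>t. \<psi>h (H n) t *\<^sub>R v t)) \<longlonglongrightarrow> L2_pair T g (\<lambda>t. \<psi> t *\<^sub>R v t)"
 proof -
  have 1: "(\<lambda>n. L2_pair T (dquot T g (- H n)) (\<lambda>t. \<psi> t *\<^sub>R v t)) \<longlonglongrightarrow> L2_pair T g (\<lambda>t. \<psi> t *\<^sub>R v t)"
   by (rule filterlim_compose[OF dquot_tendsto[OF T g \<psi>v] Hat'])
  have 2: "(\<lambda>n. L2_pair T (dquot T g (- H n)) (\<lambda>t. \<psi>h (H n) t *\<^sub>R v t)
    - L2_pair T (dquot T g (- H n)) (\<lambda>t. \<psi> t *\<^sub>R v t)) \<longlonglongrightarrow> 0"
  proof (rule Lim_null_comparison[OF always_eventually], rule allI)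
   fix n
   have Hn: "\<bar>H n\<bar> \<le> \<delta>" "- H n \<noteq> 0" using H[of n] by auto
   let ?k = "dquot T g (- H n)" and ?w = "\<lambda>t. (\<psi>h (H n) t - \<psi> t) *\<^sub>R v t"
   have w: "(\<lambda>t. \<psi>h (H n) t *\<^sub>R v t) - (\<lambda>t. \<psi> t *\<^sub>R v t) = ?w"
    by (simp add: fun_eq_iff scaleR_diff_left)
   have wL: "?w \<in> L2 T" using L2_diff[OF \<psi>hv[OF Hn(1)] \<psi>v] unfolding w .
   note kL = dquot_L2[OF T g Hn(2)]
   have wn: "L2norm T ?w \<le> (K * H n) * L2norm T v"
   proof (rule L2norm_mult[OF AE_I2 v])
    show "\<bar>\<psi>h (H n) t - \<psi> t\<bar> \<le> K * H n" for t
     using K(2)[of t "- H n"] H(1)[of n] by (simp add: \<psi>h_def)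
    show "0 \<le> K * H n" using K(1) H(1)[of n] by simp
   qed
   have "norm (L2_pair T ?k (\<lambda>t. \<psi>h (H n) t *\<^sub>R v t) - L2_pair T ?k (\<lambda>t. \<psi> t *\<^sub>R v t)) = \<bar>L2_pair T ?k ?w\<bar>"
    unfolding w[symmetric] L2_pair_diff_right[OF \<psi>hv[OF Hn(1)] \<psi>v kL(1)] by simp
   also have "\<dots> \<le> L2norm T ?k * L2norm T ?w" by (rule L2_pair_bound[OF kL(1) wL])
   also have "\<dots> \<le> L2norm T g * ((K * H n) * L2norm T v)"
    by (intro mult_mono kL(2) wn) auto
   finally show "norm (L2_pair T ?k (\<lambda>t. \<psi>h (H n) t *\<^sub>R v t) - L2_pair T ?k (\<lambda>t. \<psi> t *\<^sub>R v t))
     \<le> L2norm T g * ((K * H n) * L2norm T v)" .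
  next
   have "(\<lambda>n. L2norm T g * ((K * H n) * L2norm T v)) \<longlonglongrightarrow> L2norm T g * ((K * 0) * L2norm T v)"
    by (intro tendsto_intros Hlim)
   then show "(\<lambda>n. L2norm T g * ((K * H n) * L2norm T v)) \<longlonglongrightarrow> 0" by simp
  qed
  from tendsto_add[OF 1 2] show ?thesis by simp
 qed
 have lim3: "(\<lambda>n. LINT t|MT T. ((\<psi>h (H n) t - \<psi> t) / H n) * (norm (\<iota> (v t)))\<^sup>2)
   \<longlonglongrightarrow> (LINT t|MT T. - deriv \<psi> t * (norm (\<iota> (v t)))\<^sup>2)"
 proof (rule integral_dominated_convergence[where w = "\<lambda>t. K * (norm (\<iota> (v t)))\<^sup>2"])
  have pm: "(\<lambda>t. (norm (\<iota> (v t)))\<^sup>2) \<in> borel_measurable (MT T)" using pM by (rule borel_measurable_integrable)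
  have tm: "f \<in> borel_measurable (MT T)" if "test_function T f" for f
   using test_function_integrable(1)[OF that] by (intro measurable_restrict_space1 measurable_completion) simp
  have hn: "\<bar>H n\<bar> \<le> \<delta>" for n using H[of n] by simp
  show "(\<lambda>t. - deriv \<psi> t * (norm (\<iota> (v t)))\<^sup>2) \<in> borel_measurable (MT T)"
   by (intro borel_measurable_times borel_measurable_uminus pm tm[OF test_function_deriv[OF \<psi>]])
  show "(\<lambda>t. ((\<psi>h (H n) t - \<psi> t) / H n) * (norm (\<iota> (v t)))\<^sup>2) \<in> borel_measurable (MT T)" for n
   by (intro borel_measurable_times borel_measurable_divide borel_measurable_diff borel_measurable_const
     pm tm[OF \<psi>] tm[OF th[OF hn]])
  show "integrable (MT T) (\<lambda>t. K * (norm (\<iota> (v t)))\<^sup>2)" using pM by simp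
  show "AE t in MT T. norm (((\<psi>h (H n) t - \<psi> t) / H n) * (norm (\<iota> (v t)))\<^sup>2) \<le> K * (norm (\<iota> (v t)))\<^sup>2" for n
  proof (rule AE_I2)
   fix t
   have "\<bar>\<psi>h (H n) t - \<psi> t\<bar> / H n \<le> K"
    using K(2)[of t "- H n"] H(1)[of n] by (simp add: \<psi>h_def divide_le_eq)
   then have "\<bar>\<psi>h (H n) t - \<psi> t\<bar> / H n * (norm (\<iota> (v t)))\<^sup>2 \<le> K * (norm (\<iota> (v t)))\<^sup>2"
    by (rule mult_right_mono) simp
   then show "norm (((\<psi>h (H n) t - \<psi> t) / H n) * (norm (\<iota> (v t)))\<^sup>2) \<le> K * (norm (\<iota> (v t)))\<^sup>2"
    using H(1)[of n] by (simp add: abs_mult)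
  qed
  show "AE t in MT T. (\<lambda>n. ((\<psi>h (H n) t - \<psi> t) / H n) * (norm (\<iota> (v t)))\<^sup>2) \<longlonglongrightarrow> - deriv \<psi> t * (norm (\<iota> (v t)))\<^sup>2"
  proof (rule AE_I2, rule tendsto_mult_right)
   fix t
   have "((\<lambda>h. (\<psi> (t + h) - \<psi> t) / h) \<longlongrightarrow> deriv \<psi> t) (at 0)"
    using test_function_DERIV[OF \<psi>, of t] by (simp add: DERIV_def)
   from tendsto_minus[OF filterlim_compose[OF this Hat']]
   show "(\<lambda>n. (\<psi>h (H n) t - \<psi> t) / H n) \<longlonglongrightarrow> - deriv \<psi> t"
    by (simp add: \<psi>h_def)
  qed
 qed
 have "(LINT t|MT T. - deriv \<psi> t * (norm (\<iota> (v t)))\<^sup>2) = L2_pair T g (\<lambda>t. \<psi> t *\<^sub>R v t) + L2_pair T g (\<lambda>t. \<psi> t *\<^sub>R v t)"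
  using lim3 unfolding ident[OF H] by (rule LIMSEQ_unique[OF _ tendsto_add[OF lim1 lim2]])
 also have "\<dots> = (LINT t|MT T. \<psi> t * (2 * g t (v t)))"
 proof -
  have "(\<lambda>t. \<psi> t * (2 * g t (v t))) = (\<lambda>t. 2 * g t (\<psi> t *\<^sub>R v t))"
   by (simp add: fun_eq_iff blinfun.scaleR_right)
  then show ?thesis by (simp add: L2_pair_def)
 qed
 finally show ?thesis by simp
qed

lemma emb_norm_sq_primitive:
 "\<exists>k. AE t in MT T. (norm (\<iota> (v t)))\<^sup>2 = k + primitive T (\<lambda>r. 2 * g r (v r)) t"
proof -
 have i1: "integrable (MT T) (\<lambda>t. (norm (\<iota> (v t)))\<^sup>2)"
  using emb_inner_integrable[OF v v] by (simp add: power2_norm_eq_inner)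
 have i2: "integrable (MT T) (\<lambda>t. 2 * g t (v t))"
  by (intro integrable_mult_right integrable_L2_pair g v)
 obtain k where k: "AE t in MT T. (norm (\<iota> (v t)))\<^sup>2 = k + integral {0..t} (\<lambda>r. 2 * g r (v r))"
  using weak_derivative_primitive[OF T i1 i2 weak_product_rule] by blast
 have "AE t in MT T. (norm (\<iota> (v t)))\<^sup>2 = k + integral {0..t} (\<lambda>r. 2 * g r (v r)) \<and> t \<in> {0..T}"
  by (rule AE_conjI[OF k AE_I2]) simp
 then have "AE t in MT T. (norm (\<iota> (v t)))\<^sup>2 = k + primitive T (\<lambda>r. 2 * g r (v r)) t"
  by (rule eventually_mono) (use T in \<open>simp add: primitive_eq_integral[OF i2]\<close>)
 then show ?thesis by blast
qed

text \<open>
 On a set of full measure, the distance of two values is controlled by the increment of the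
 squared norm and by \<open>norm (v s) \<cdot> sqrt \<bar>t - s\<bar>\<close>. Since \<open>norm (v s)\<^sup>2\<close> is integrable, every interval of
 length \<open>\<rho>\<close> contains points \<open>s\<close> for which \<open>\<rho> \<cdot> norm (v s)\<^sup>2\<close> is small, so two nearby values
 are both close to the value at such a point.
\<close>

lemma emb_uniformly_continuous:
 "\<exists>N. N \<subseteq> {0..T} \<and> (AE t in MT T. t \<in> N) \<and> uniformly_continuous_on N (\<lambda>t. \<iota> (v t))"
proof -
 obtain c where c: "AE t in MT T. emb_dual \<iota> (\<iota> (v t)) = c + fprim T g t"
  using weak_path_primitive by blast
 obtain k where k: "AE t in MT T. (norm (\<iota> (v t)))\<^sup>2 = k + primitive T (\<lambda>r. 2 * g r (v r)) t"
  using emb_norm_sq_primitive by blast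
 define P where "P = primitive T (\<lambda>r. 2 * g r (v r))"
 define Mv where "Mv = primitive T (\<lambda>r. (norm (v r))\<^sup>2)"
 have i2: "integrable (MT T) (\<lambda>t. 2 * g t (v t))"
  by (intro integrable_mult_right integrable_L2_pair g v)
 define N where "N = {t \<in> {0..T}. emb_dual \<iota> (\<iota> (v t)) = c + fprim T g t \<and> (norm (\<iota> (v t)))\<^sup>2 = k + P t}"
 have NA: "AE t in MT T. t \<in> N"
 proof -
  have "AE t in MT T. t \<in> {0..T}" by (intro AE_I2) simp
  from AE_conjI[OF this AE_conjI[OF c k]] show ?thesis
   by (rule eventually_mono) (simp add: N_def P_def)
 qed
 have uP: "uniformly_continuous_on {0..T} P" and uM: "uniformly_continuous_on {0..T} Mv"
  unfolding P_def Mv_def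
  by (rule compact_uniformly_continuous[OF primitive_continuous[OF i2 less_imp_le[OF T]] compact_Icc],
    rule compact_uniformly_continuous[OF primitive_continuous[OF L2_integrable[OF v] less_imp_le[OF T]] compact_Icc])
 define B where "B = L2norm T g + 1"
 have B: "0 < B" by (simp add: B_def add_nonneg_pos)
 have fp: "norm (fprim T g t - fprim T g s) \<le> sqrt \<bar>t - s\<bar> * B" for s t
 proof -
  have *: "norm (fprim T g t - fprim T g s) \<le> sqrt (t - s) * B" if st: "s \<le> t" for s t
  proof -
   let ?M = "primitive T (\<lambda>r. (norm (g r))\<^sup>2)"
   have "?M t - ?M s = (LINT r|MT T. indicator {s<..t} r * (norm (g r))\<^sup>2)"
    by (rule primitive_diff[OF L2_integrable[OF g] st])
   also have "\<dots> \<le> (LINT r|MT T. (norm (g r))\<^sup>2)"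
    by (intro integral_mono indicator_mult_integrable L2_integrable[OF g]) (auto simp: indicator_def)
   also have "\<dots> = (L2norm T g)\<^sup>2" by (simp add: L2norm_sq)
   also have "\<dots> \<le> B\<^sup>2" by (intro power_mono) (simp_all add: B_def)
   finally have MB: "?M t - ?M s \<le> B\<^sup>2" .
   have "(t - s) * (?M t - ?M s) \<le> (t - s) * B\<^sup>2"
    by (rule mult_left_mono[OF MB]) (use st in simp)
   with fprim_sq_diff[OF T g st] have "(norm (fprim T g t - fprim T g s))\<^sup>2 \<le> (t - s) * B\<^sup>2"
    by (rule order_trans)
   also have "\<dots> = (sqrt (t - s) * B)\<^sup>2" using st by (simp add: power_mult_distrib)
   finally show ?thesis by (rule power2_le_imp_le) (use st B in simp)
  qed
  show ?thesis
  proof (cases "s \<le> t")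
   case True
   then show ?thesis using *[of s t] by simp
  next
   case False
   then show ?thesis using *[of t s] by (simp add: norm_minus_commute)
  qed
 qed
 have dist: "(norm (\<iota> (v t) - \<iota> (v s)))\<^sup>2 \<le> \<bar>P t - P s\<bar> + 2 * (sqrt \<bar>t - s\<bar> * B * norm (v s))"
  if s: "s \<in> N" and t: "t \<in> N" for s t
 proof -
  have e: "\<iota> (v r) \<bullet> \<iota> w = (c + fprim T g r) w" if "r \<in> N" for r w
  proof -
   have "emb_dual \<iota> (\<iota> (v r)) w = (c + fprim T g r) w" using that by (simp add: N_def)
   then show ?thesis by simp
  qed
  have "(norm (\<iota> (v t) - \<iota> (v s)))\<^sup>2 = (norm (\<iota> (v t)))\<^sup>2 - 2 * (\<iota> (v t) \<bullet> \<iota> (v s)) + (norm (\<iota> (v s)))\<^sup>2"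
   by (simp add: power2_norm_eq_inner inner_diff_left inner_diff_right inner_commute)
  also have "\<dots> = P t - P s - 2 * (\<iota> (v t) \<bullet> \<iota> (v s) - \<iota> (v s) \<bullet> \<iota> (v s))"
   using s t by (simp add: N_def power2_norm_eq_inner)
  also have "\<iota> (v t) \<bullet> \<iota> (v s) - \<iota> (v s) \<bullet> \<iota> (v s) = (fprim T g t - fprim T g s) (v s)"
   unfolding e[OF s] e[OF t] by (simp add: blinfun.add_left blinfun.diff_left)
  finally have "(norm (\<iota> (v t) - \<iota> (v s)))\<^sup>2 = P t - P s - 2 * (fprim T g t - fprim T g s) (v s)" .
  moreover have "\<bar>(fprim T g t - fprim T g s) (v s)\<bar> \<le> sqrt \<bar>t - s\<bar> * B * norm (v s)"
   using norm_blinfun[of "fprim T g t - fprim T g s" "v s"] mult_right_mono[OF fp[of t s], of "norm (v s)"] by simp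
  ultimately show ?thesis by linarith
 qed
 have "uniformly_continuous_on N (\<lambda>t. \<iota> (v t))"
  unfolding uniformly_continuous_on_def
 proof (intro allI impI)
  fix \<epsilon> :: real assume \<epsilon>: "0 < \<epsilon>"
  define \<sigma> where "\<sigma> = \<epsilon>\<^sup>2 / (32 * B)"
  have \<sigma>: "0 < \<sigma>" using \<epsilon> B by (simp add: \<sigma>_def)
  have \<epsilon>8: "0 < \<epsilon>\<^sup>2 / 8" using \<epsilon> by simp
  obtain \<rho>1 where \<rho>1: "0 < \<rho>1" "\<And>x y. x \<in> {0..T} \<Longrightarrow> y \<in> {0..T} \<Longrightarrow> dist y x < \<rho>1 \<Longrightarrow> dist (P y) (P x) < \<epsilon>\<^sup>2 / 8"
   using uP[unfolded uniformly_continuous_on_def, rule_format, OF \<epsilon>8] by blast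
  have \<sigma>2: "0 < \<sigma>\<^sup>2" using \<sigma> by simp
  obtain \<rho>2 where \<rho>2: "0 < \<rho>2" "\<And>x y. x \<in> {0..T} \<Longrightarrow> y \<in> {0..T} \<Longrightarrow> dist y x < \<rho>2 \<Longrightarrow> dist (Mv y) (Mv x) < \<sigma>\<^sup>2"
   using uM[unfolded uniformly_continuous_on_def, rule_format, OF \<sigma>2] by blast
  define \<rho> where "\<rho> = min (T / 2) (min (\<rho>1 / 3) (\<rho>2 / 2))"
  have \<rho>: "0 < \<rho>" "2 * \<rho> \<le> T" "2 * \<rho> < \<rho>1" "\<rho> < \<rho>2" using T \<rho>1(1) \<rho>2(1) by (auto simp: \<rho>_def min_def)
  have ex: "\<exists>s\<in>N. a \<le> s \<and> s \<le> a + \<rho> \<and> \<rho> * (norm (v s))\<^sup>2 \<le> \<sigma>\<^sup>2" if a: "0 \<le> a" "a + \<rho> \<le> T" for a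
  proof (rule ccontr)
   assume "\<not> ?thesis"
   then have big: "\<sigma>\<^sup>2 < \<rho> * (norm (v s))\<^sup>2" if "s \<in> N" "a \<le> s" "s \<le> a + \<rho>" for s
    using that by (meson not_le)
   have i: "integrable (MT T) (indicator {a<..a + \<rho>} :: real \<Rightarrow> real)"
    using indicator_mult_integrable[of T "\<lambda>_. 1" "{a<..a + \<rho>}"] finite_measure.integrable_const[OF finite_measure_MT] by simp
   have "\<sigma>\<^sup>2 = (\<sigma>\<^sup>2 / \<rho>) * measure lebesgue {a<..a + \<rho>}" using \<rho> by simp
   also have "\<dots> = (\<sigma>\<^sup>2 / \<rho>) * (LINT r|lebesgue. indicator {a<..a + \<rho>} r)" by simp
   also have "(LINT r|lebesgue. indicator {a<..a + \<rho>} r :: real) = (LINT r|MT T. indicator {a<..a + \<rho>} r)"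
    by (rule LINT_MT_eq_lebesgue(1)[symmetric]) (use a in \<open>auto simp: indicator_def\<close>)
   also have "(\<sigma>\<^sup>2 / \<rho>) * (LINT r|MT T. indicator {a<..a + \<rho>} r) = (LINT r|MT T. (\<sigma>\<^sup>2 / \<rho>) * indicator {a<..a + \<rho>} r)" by simp
   also have "\<dots> \<le> (LINT r|MT T. indicator {a<..a + \<rho>} r * (norm (v r))\<^sup>2)"
   proof (rule integral_mono_AE)
    show "integrable (MT T) (\<lambda>r. (\<sigma>\<^sup>2 / \<rho>) * indicator {a<..a + \<rho>} r)" using i by simp
    show "integrable (MT T) (\<lambda>r. indicator {a<..a + \<rho>} r * (norm (v r))\<^sup>2)"
     by (rule indicator_mult_integrable[OF L2_integrable[OF v]]) simp
    show "AE r in MT T. (\<sigma>\<^sup>2 / \<rho>) * indicator {a<..a + \<rho>} r \<le> indicator {a<..a + \<rho>} r * (norm (v r))\<^sup>2"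
     using NA
    proof (rule eventually_mono)
     fix r assume "r \<in> N"
     then show "(\<sigma>\<^sup>2 / \<rho>) * indicator {a<..a + \<rho>} r \<le> indicator {a<..a + \<rho>} r * (norm (v r))\<^sup>2"
      using big[of r] \<rho>(1) by (auto simp: indicator_def divide_le_eq mult.commute less_imp_le)
    qed
   qed
   also have "\<dots> = Mv (a + \<rho>) - Mv a"
    unfolding Mv_def by (rule primitive_diff[OF L2_integrable[OF v], symmetric]) (use \<rho> in simp)
   also have "\<dots> < \<sigma>\<^sup>2"
    using \<rho>2(2)[of a "a + \<rho>"] a \<rho> by (auto simp: dist_real_def)
   finally show False by simp
  qed
  show "\<exists>d>0. \<forall>x\<in>N. \<forall>x'\<in>N. dist x' x < d \<longrightarrow> dist (\<iota> (v x')) (\<iota> (v x)) < \<epsilon>"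
  proof (intro exI[of _ \<rho>] conjI ballI impI)
   fix x x' assume x: "x \<in> N" "x' \<in> N" "dist x' x < \<rho>"
   have x0: "0 \<le> x" "x \<le> T" using x(1) by (auto simp: N_def)
   define a where "a = (if x + \<rho> \<le> T then x else x - \<rho>)"
   have a: "0 \<le> a" "a + \<rho> \<le> T" "a \<le> x" "x \<le> a + \<rho>" using x0 \<rho> by (auto simp: a_def)
   obtain s where s: "s \<in> N" "a \<le> s" "s \<le> a + \<rho>" "\<rho> * (norm (v s))\<^sup>2 \<le> \<sigma>\<^sup>2" using ex[OF a(1,2)] by blast
   have sv: "sqrt \<rho> * norm (v s) \<le> \<sigma>"
   proof (rule power2_le_imp_le)
    show "(sqrt \<rho> * norm (v s))\<^sup>2 \<le> \<sigma>\<^sup>2" using s(4) \<rho>(1) by (simp add: power_mult_distrib)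
   qed (use \<sigma> in simp)
   have sT: "s \<in> {0..T}" using s(1) unfolding N_def by blast
   have near: "norm (\<iota> (v y) - \<iota> (v s)) < \<epsilon> / 2" if y: "y \<in> N" "\<bar>y - s\<bar> \<le> 2 * \<rho>" for y
   proof -
    have "\<bar>P y - P s\<bar> < \<epsilon>\<^sup>2 / 8"
    proof -
     have "y \<in> {0..T}" using y(1) unfolding N_def by blast
     moreover have "dist y s < \<rho>1" using y(2) \<rho>(3) by (simp add: dist_real_def)
     ultimately have "dist (P y) (P s) < \<epsilon>\<^sup>2 / 8" by (rule \<rho>1(2)[OF sT])
     then show ?thesis by (simp add: dist_real_def)
    qed
    moreover have "sqrt \<bar>y - s\<bar> * B * norm (v s) \<le> \<epsilon>\<^sup>2 / 16"
    proof -
     have "sqrt \<bar>y - s\<bar> \<le> sqrt (2\<^sup>2 * \<rho>)" using y(2) \<rho>(1) by (intro real_sqrt_le_mono) auto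
     also have "\<dots> = 2 * sqrt \<rho>" by (simp only: real_sqrt_mult real_sqrt_abs)
     finally have "sqrt \<bar>y - s\<bar> * (B * norm (v s)) \<le> (2 * sqrt \<rho>) * (B * norm (v s))"
      by (rule mult_right_mono) (use B in simp)
     also have "\<dots> = 2 * B * (sqrt \<rho> * norm (v s))" by simp
     also have "\<dots> \<le> 2 * B * \<sigma>" using sv B by (intro mult_left_mono) auto
     also have "\<dots> = \<epsilon>\<^sup>2 / 16" using B by (simp add: \<sigma>_def)
     finally show ?thesis by (simp add: mult.assoc)
    qed
    ultimately have "(norm (\<iota> (v y) - \<iota> (v s)))\<^sup>2 < (\<epsilon> / 2)\<^sup>2"
     using dist[OF s(1) y(1)] by (simp add: power_divide)
    then show ?thesis by (rule power_less_imp_less_base) (use \<epsilon> in simp)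
   qed
   have "norm (\<iota> (v x) - \<iota> (v s)) < \<epsilon> / 2"
    by (rule near[OF x(1)]) (use a s \<rho>(1) in auto)
   moreover have "norm (\<iota> (v x') - \<iota> (v s)) < \<epsilon> / 2"
    by (rule near[OF x(2)]) (use a s x(3) \<rho>(1) in \<open>auto simp: dist_real_def abs_le_iff abs_less_iff\<close>)
   ultimately show "dist (\<iota> (v x')) (\<iota> (v x)) < \<epsilon>"
    using norm_triangle_ineq4[of "\<iota> (v x') - \<iota> (v s)" "\<iota> (v x) - \<iota> (v s)"] by (simp add: dist_norm)
  qed (rule \<rho>(1))
 qed
 with NA show ?thesis by (intro exI[of _ N]) (auto simp: N_def)
qed

end

lemma continuous_eq_if_AE_eq:
 fixes w w' :: "real \<Rightarrow> 'h::real_normed_vector"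
 assumes T: "0 < T" and w: "continuous_on {0..T} w" and w': "continuous_on {0..T} w'"
  and ae: "AE t in MT T. w t = w' t" and t: "t \<in> {0..T}"
 shows "w t = w' t"
proof -
 let ?S = "{t \<in> {0..T}. w t = w' t}"
 have cl: "closure ?S = {0..T}"
 proof
  show "closure ?S \<subseteq> {0..T}" by (rule closure_minimal) auto
 qed (rule AE_MT_dense[OF ae T])
 have "w t - w' t = 0"
  by (rule continuous_constant_on_closure[of ?S "\<lambda>t. w t - w' t" 0])
    (use w w' t cl in \<open>auto intro!: continuous_intros\<close>)
 then show ?thesis by simp
qed

text \<open>A uniformly continuous function on a dense set extends to the closure; completeness of \<open>H\<close> is used
 here.\<close>

theorem W_continuous_representative:
 fixes \<iota> :: "'v::{real_normed_vector,second_countable_topology} \<Rightarrow>\<^sub>L 'h::{real_inner,banach}"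
 assumes T: "0 < T" and v: "v \<in> W \<iota> T"
 shows "continuous_on {0..T} (\<lambda>t. time_eval \<iota> T t v)"
  and "AE t in MT T. time_eval \<iota> T t v = \<iota> (v t)"
proof -
 obtain N where N: "N \<subseteq> {0..T}" "AE t in MT T. t \<in> N" "uniformly_continuous_on N (\<lambda>t. \<iota> (v t))"
  using emb_uniformly_continuous[OF T W_L2[OF v] wderiv_L2[OF v] wderiv_weak[OF v]] by blast
 obtain w where w: "uniformly_continuous_on (closure N) w" "\<And>x. x \<in> N \<Longrightarrow> \<iota> (v x) = w x"
  by (rule uniformly_continuous_on_extension_on_closure[OF N(3)]) blast
 have "{t \<in> {0..T}. t \<in> N} = N" using N(1) by auto
 then have "{0..T} \<subseteq> closure N" using AE_MT_dense[OF N(2) T] by simp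
 then have wc: "continuous_on {0..T} w"
  using uniformly_continuous_imp_continuous[OF w(1)] continuous_on_subset by blast
 have wa: "AE t in MT T. w t = \<iota> (v t)" using N(2) by (rule eventually_mono) (simp add: w(2))
 have te: "time_eval \<iota> T t v = w t" if t: "t \<in> {0..T}" for t
  unfolding time_eval_def
 proof (rule the_equality)
  show "\<exists>w'. continuous_on {0..T} w' \<and> (AE s in MT T. w' s = \<iota> (v s)) \<and> w' t = w t"
   using wc wa by blast
  fix h assume "\<exists>w'. continuous_on {0..T} w' \<and> (AE s in MT T. w' s = \<iota> (v s)) \<and> w' t = h"
  then obtain w' where w': "continuous_on {0..T} w'" "AE s in MT T. w' s = \<iota> (v s)" "w' t = h" by blast
  have "AE s in MT T. w' s = w s" using wa w'(2) by eventually_elim simp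
  from continuous_eq_if_AE_eq[OF T w'(1) wc this t] w'(3) show "h = w t" by simp
 qed
 show "continuous_on {0..T} (\<lambda>t. time_eval \<iota> T t v)"
  using continuous_on_cong[of "{0..T}" "{0..T}" "\<lambda>t. time_eval \<iota> T t v" w] te wc by simp
 have "AE t in MT T. t \<in> {0..T}" by (intro AE_I2) simp
 then show "AE t in MT T. time_eval \<iota> T t v = \<iota> (v t)"
  using wa by eventually_elim (simp add: te)
qed

section \<open>Traces and integration by parts\<close>

context
 fixes \<iota> :: "'v::{real_normed_vector,second_countable_topology} \<Rightarrow>\<^sub>L 'h::{real_inner,banach}"
  and T :: real
 assumes T: "0 < T"
begin

lemma time_eval_eqI:
 assumes v: "v \<in> W \<iota> T" and w: "continuous_on {0..T} w" "AE t in MT T. w t = \<iota> (v t)" and t: "t \<in> {0..T}"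
 shows "time_eval \<iota> T t v = w t"
proof -
 note r = W_continuous_representative[OF T v]
 have "AE t in MT T. time_eval \<iota> T t v = w t" using r(2) w(2) by eventually_elim simp
 from continuous_eq_if_AE_eq[OF T r(1) w(1) this t] show ?thesis .
qed

lemma time_eval_add:
 assumes v: "v \<in> W \<iota> T" and v': "v' \<in> W \<iota> T" and t: "t \<in> {0..T}"
 shows "time_eval \<iota> T t (v + v') = time_eval \<iota> T t v + time_eval \<iota> T t v'"
proof (rule time_eval_eqI[OF W_add[OF v v'] _ _ t])
 note r = W_continuous_representative[OF T v] W_continuous_representative[OF T v']
 show "continuous_on {0..T} (\<lambda>t. time_eval \<iota> T t v + time_eval \<iota> T t v')"
  by (intro continuous_on_add r)
 show "AE t in MT T. time_eval \<iota> T t v + time_eval \<iota> T t v' = \<iota> ((v + v') t)"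
  using r(2,4) by eventually_elim (simp add: blinfun.add_right)
qed

lemma time_eval_smooth_mult:
 assumes f: "smooth f" and v: "v \<in> W \<iota> T" and t: "t \<in> {0..T}"
 shows "time_eval \<iota> T t (\<lambda>t. f t *\<^sub>R v t) = f t *\<^sub>R time_eval \<iota> T t v"
proof (rule time_eval_eqI[OF W_smooth_mult(1)[OF f v] _ _ t])
 note r = W_continuous_representative[OF T v]
 show "continuous_on {0..T} (\<lambda>t. f t *\<^sub>R time_eval \<iota> T t v)"
  by (intro continuous_on_scaleR r smooth_continuous[OF f])
 show "AE t in MT T. f t *\<^sub>R time_eval \<iota> T t v = \<iota> (f t *\<^sub>R v t)"
  using r(2) by eventually_elim (simp add: blinfun.scaleR_right)
qed

lemma time_eval_scaleR:
 assumes v: "v \<in> W \<iota> T" and t: "t \<in> {0..T}"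
 shows "time_eval \<iota> T t (c *\<^sub>R v) = c *\<^sub>R time_eval \<iota> T t v"
 using time_eval_smooth_mult[OF smooth_const v t, of c] by (simp add: scaleR_fun_def)

lemma time_eval_const:
 assumes t: "t \<in> {0..T}"
 shows "time_eval \<iota> T t (\<lambda>_. e) = \<iota> e"
 by (rule time_eval_eqI[OF W_const(1) _ _ t, of "\<lambda>_. \<iota> e"]) auto

lemma W_smooth_scaled:
 assumes f: "smooth f"
 shows "(\<lambda>t. f t *\<^sub>R e) \<in> W \<iota> T"
  and "AE t in MT T. wderiv \<iota> T (\<lambda>t. f t *\<^sub>R e) t = deriv f t *\<^sub>R emb_dual \<iota> (\<iota> e)"
  and "t \<in> {0..T} \<Longrightarrow> time_eval \<iota> T t (\<lambda>t. f t *\<^sub>R e) = f t *\<^sub>R \<iota> e"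
proof -
 show "(\<lambda>t. f t *\<^sub>R e) \<in> W \<iota> T" by (rule W_smooth_mult(1)[OF f W_const(1)])
 show "AE t in MT T. wderiv \<iota> T (\<lambda>t. f t *\<^sub>R e) t = deriv f t *\<^sub>R emb_dual \<iota> (\<iota> e)"
  using W_smooth_mult(2)[OF f W_const(1)[where e = e and \<iota> = \<iota> and T = T]]
   W_const(2)[where e = e and \<iota> = \<iota> and T = T] by eventually_elim simp
 show "time_eval \<iota> T t (\<lambda>t. f t *\<^sub>R e) = f t *\<^sub>R \<iota> e" if "t \<in> {0..T}"
  using time_eval_smooth_mult[OF f W_const(1) that, of e] time_eval_const[OF that] by simp
qed

lemma time_eval_energy:
 assumes v: "v \<in> W \<iota> T" and t: "t \<in> {0..T}"
 shows "(norm (time_eval \<iota> T t v))\<^sup>2 = (norm (time_eval \<iota> T 0 v))\<^sup>2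
  + primitive T (\<lambda>r. 2 * wderiv \<iota> T v r (v r)) t"
proof -
 note v' = W_L2[OF v] wderiv_L2[OF v] wderiv_weak[OF v]
 note r = W_continuous_representative[OF T v]
 have i2: "integrable (MT T) (\<lambda>t. 2 * wderiv \<iota> T v t (v t))"
  by (intro integrable_mult_right integrable_L2_pair v')
 obtain k where k: "AE t in MT T. (norm (\<iota> (v t)))\<^sup>2 = k + primitive T (\<lambda>r. 2 * wderiv \<iota> T v r (v r)) t"
  using emb_norm_sq_primitive[OF T v'] by blast
 have "AE t in MT T. (norm (time_eval \<iota> T t v))\<^sup>2 = k + primitive T (\<lambda>r. 2 * wderiv \<iota> T v r (v r)) t"
  using k r(2) by eventually_elim simp
 then have all: "(norm (time_eval \<iota> T t v))\<^sup>2 = k + primitive T (\<lambda>r. 2 * wderiv \<iota> T v r (v r)) t" if "t \<in> {0..T}" for t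
  by (rule continuous_eq_if_AE_eq[OF T _ _ _ that, rotated 2])
    (intro continuous_intros r primitive_continuous[OF i2 less_imp_le[OF T]])+
 have "primitive T (\<lambda>r. 2 * wderiv \<iota> T v r (v r)) 0 = 0"
  using primitive_eq_integral[OF i2 less_imp_le[OF T], of 0] T by simp
 then show ?thesis using all[OF t] all[of 0] T by simp
qed

lemma energy_identity:
 assumes v: "v \<in> W \<iota> T"
 shows "(norm (time_eval \<iota> T T v))\<^sup>2 - (norm (time_eval \<iota> T 0 v))\<^sup>2 = 2 * L2_pair T (wderiv \<iota> T v) v"
 using time_eval_energy[OF v, of T] T by (simp add: primitive_total L2_pair_def)

text \<open>Polarization of the energy identity.\<close>

theorem W_integration_by_parts:
 assumes v: "v \<in> W \<iota> T" and z: "z \<in> W \<iota> T"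
 shows "L2_pair T (wderiv \<iota> T v) z + L2_pair T (wderiv \<iota> T z) v
  = time_eval \<iota> T T v \<bullet> time_eval \<iota> T T z - time_eval \<iota> T 0 v \<bullet> time_eval \<iota> T 0 z"
proof -
 note vz = W_add[OF v z]
 have T0: "0 \<in> {0..T}" "T \<in> {0..T}" using T by auto
 have "L2_pair T (wderiv \<iota> T (v + z)) (v + z) = L2_pair T (wderiv \<iota> T v + wderiv \<iota> T z) (v + z)"
  by (rule L2_pair_cong_AE[OF _ wderiv_L2[OF vz] W_L2[OF vz]]) (use wderiv_add[OF v z] in simp)
 also have "\<dots> = L2_pair T (wderiv \<iota> T v) v + L2_pair T (wderiv \<iota> T z) z
   + (L2_pair T (wderiv \<iota> T v) z + L2_pair T (wderiv \<iota> T z) v)"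
  using W_L2[OF v] W_L2[OF z] wderiv_L2[OF v] wderiv_L2[OF z]
  by (simp add: L2_pair_add_left L2_pair_add_right L2_add)
 finally have "2 * (L2_pair T (wderiv \<iota> T v) z + L2_pair T (wderiv \<iota> T z) v)
   = 2 * L2_pair T (wderiv \<iota> T (v + z)) (v + z) - 2 * L2_pair T (wderiv \<iota> T v) v - 2 * L2_pair T (wderiv \<iota> T z) z"
  by simp
 also have "\<dots> = 2 * (time_eval \<iota> T T v \<bullet> time_eval \<iota> T T z - time_eval \<iota> T 0 v \<bullet> time_eval \<iota> T 0 z)"
  unfolding energy_identity[OF vz, symmetric] energy_identity[OF v, symmetric] energy_identity[OF z, symmetric]
   time_eval_add[OF v z T0(1)] time_eval_add[OF v z T0(2)]
  by (simp add: power2_norm_eq_inner inner_add_left inner_add_right inner_commute)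
 finally show ?thesis by simp
qed

lemma Wnorm_bounds:
 "L2norm T v \<le> Wnorm \<iota> T v" "L2norm T (wderiv \<iota> T v) \<le> Wnorm \<iota> T v"
 "Wnorm \<iota> T v \<le> L2norm T v + L2norm T (wderiv \<iota> T v)" "0 \<le> Wnorm \<iota> T v"
 unfolding Wnorm_def
 by (auto intro!: real_le_rsqrt real_le_lsqrt simp: power2_sum)

text \<open>By the energy identity, the squared norm changes by at most a multiple of \<open>Wnorm\<^sup>2\<close> along the horizon,
 and somewhere it is at most its mean value. The constant depends on \<open>T\<close>, so it
 serves to show boundedness of the system operator, not to estimate its inverse.\<close>

lemma time_eval_bounded:
 "\<exists>c\<ge>0. \<forall>v\<in>W \<iota> T. \<forall>s\<in>{0..T}. norm (time_eval \<iota> T s v) \<le> c * Wnorm \<iota> T v"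
proof -
 define c where "c = sqrt ((norm \<iota>)\<^sup>2 / T + 4)"
 have c0: "0 \<le> c" using T by (simp add: c_def)
 have "norm (time_eval \<iota> T s v) \<le> c * Wnorm \<iota> T v" if v: "v \<in> W \<iota> T" and s: "s \<in> {0..T}" for v s
 proof -
  let ?g = "wderiv \<iota> T v" and ?n = "Wnorm \<iota> T v"
  note v' = W_L2[OF v] wderiv_L2[OF v]
  define Q where "Q = primitive T (\<lambda>r. 2 * ?g r (v r))"
  have i: "integrable (MT T) (\<lambda>t. ?g t (v t))" by (rule integrable_L2_pair[OF v'(2,1)])
  have i2: "integrable (MT T) (\<lambda>t. 2 * ?g t (v t))" using i by simp
  have Qb: "\<bar>Q t\<bar> \<le> 2 * ?n\<^sup>2" for t
  proof -
   have "\<bar>Q t\<bar> \<le> (LINT r|MT T. \<bar>indicator {..t} r * (2 * ?g r (v r))\<bar>)"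
    unfolding Q_def primitive_def
    using integral_norm_bound[of "MT T" "\<lambda>r. indicator {..t} r * (2 * ?g r (v r))"] by simp
   also have "\<dots> \<le> (LINT r|MT T. 2 * (norm (?g r) * norm (v r)))"
   proof (rule integral_mono)
    show "integrable (MT T) (\<lambda>r. \<bar>indicator {..t} r * (2 * ?g r (v r))\<bar>)"
     using indicator_mult_integrable[OF i2, of "{..t}"] by simp
    show "integrable (MT T) (\<lambda>r. 2 * (norm (?g r) * norm (v r)))"
     using L2_Cauchy_Schwarz_norm(1)[OF v'(2,1)] by simp
    show "\<bar>indicator {..t} r * (2 * ?g r (v r))\<bar> \<le> 2 * (norm (?g r) * norm (v r))" for r
     using norm_blinfun[of "?g r" "v r"] by (simp add: indicator_def abs_mult)
   qed
   also have "\<dots> = 2 * (LINT r|MT T. norm (?g r) * norm (v r))" by simp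
   also have "\<dots> \<le> 2 * (L2norm T ?g * L2norm T v)"
    using L2_Cauchy_Schwarz_norm(2)[OF v'(2,1)] by simp
   also have "\<dots> \<le> 2 * (?n * ?n)"
    using Wnorm_bounds[of v] by (intro mult_left_mono mult_mono) auto
   finally show ?thesis by (simp add: power2_eq_square)
  qed
  have ae: "AE t in MT T. (norm (time_eval \<iota> T s v))\<^sup>2 \<le> (norm \<iota>)\<^sup>2 * (norm (v t))\<^sup>2 + 4 * ?n\<^sup>2"
  proof -
   have "AE t in MT T. t \<in> {0..T}" by (intro AE_I2) simp
   then show ?thesis using W_continuous_representative(2)[OF T v]
   proof eventually_elim
    case (elim t)
    have "(norm (time_eval \<iota> T s v))\<^sup>2 = (norm (time_eval \<iota> T t v))\<^sup>2 + (Q s - Q t)"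
     using time_eval_energy[OF v s] time_eval_energy[OF v elim(1)] by (simp add: Q_def)
    moreover have "(norm (time_eval \<iota> T t v))\<^sup>2 \<le> (norm \<iota> * norm (v t))\<^sup>2"
     unfolding elim(2) by (intro power_mono norm_blinfun) auto
    moreover have "Q s - Q t \<le> 4 * ?n\<^sup>2" using Qb[of s] Qb[of t] by linarith
    ultimately show ?case by (simp add: power_mult_distrib)
   qed
  qed
  have fm: "finite_measure (MT T)" by simp
  have mT: "measure (MT T) (space (MT T)) = T"
   using T by (simp add: measure_restrict_space)
  have "T * (norm (time_eval \<iota> T s v))\<^sup>2 = (LINT t|MT T. (norm (time_eval \<iota> T s v))\<^sup>2)"
   using mT by simp
  also have "\<dots> \<le> (LINT t|MT T. (norm \<iota>)\<^sup>2 * (norm (v t))\<^sup>2 + 4 * ?n\<^sup>2)"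
  proof (rule integral_mono_AE[OF _ _ ae])
   show "integrable (MT T) (\<lambda>t. (norm (time_eval \<iota> T s v))\<^sup>2)" by (rule finite_measure.integrable_const[OF fm])
   show "integrable (MT T) (\<lambda>t. (norm \<iota>)\<^sup>2 * (norm (v t))\<^sup>2 + 4 * ?n\<^sup>2)"
    by (intro Bochner_Integration.integrable_add integrable_mult_right L2_integrable[OF v'(1)] finite_measure.integrable_const[OF fm])
  qed
  also have "\<dots> = (norm \<iota>)\<^sup>2 * (L2norm T v)\<^sup>2 + T * (4 * ?n\<^sup>2)"
   using L2_integrable[OF v'(1)] finite_measure.integrable_const[OF fm] mT by (simp add: L2norm_sq)
  also have "\<dots> \<le> (norm \<iota>)\<^sup>2 * ?n\<^sup>2 + T * (4 * ?n\<^sup>2)"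
   using Wnorm_bounds[of v] T by (intro add_mono mult_left_mono power_mono) auto
  also have "\<dots> = T * (c * ?n)\<^sup>2"
   using T by (simp add: c_def power_mult_distrib field_simps)
  finally have "(norm (time_eval \<iota> T s v))\<^sup>2 \<le> (c * ?n)\<^sup>2" using T by simp
  then show ?thesis
   by (rule power2_le_imp_le) (intro mult_nonneg_nonneg c0 Wnorm_bounds(4))
 qed
 with c0 show ?thesis by blast
qed

end

lemma smooth_affine_fun: "smooth (\<lambda>t. a * t + b)"
proof -
 have "deriv (\<lambda>t::real. a * t + b) = (\<lambda>_. a)"
  by (intro ext DERIV_imp_deriv) (auto intro!: derivative_eq_intros)
 moreover have "((\<lambda>t::real. a * t + b) has_real_derivative a) (at t)" for t
  by (auto intro!: derivative_eq_intros)
 ultimately show ?thesis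
  using smooth_iff[of "\<lambda>t. a * t + b"] smooth_const[of a] by (auto simp: real_differentiable_def)
qed

lemma has_weak_deriv_by_testing:
 assumes "\<And>\<phi> e. test_function T \<phi> \<Longrightarrow>
   L2_pair T (\<lambda>t. deriv \<phi> t *\<^sub>R emb_dual \<iota> (\<iota> e)) z = - L2_pair T g (\<lambda>t. \<phi> t *\<^sub>R e)"
 shows "has_weak_deriv \<iota> T z g"
 unfolding has_weak_deriv_def
proof (intro allI impI)
 fix \<phi> e assume "test_function T \<phi>"
 from assms[OF this, of e]
 show "(LINT t|MT T. deriv \<phi> t * emb_dual \<iota> (\<iota> (z t)) e) = - (LINT t|MT T. \<phi> t * g t e)"
  by (simp add: L2_pair_def blinfun.scaleR_left blinfun.scaleR_right inner_commute)
qed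

section \<open>Frechet derivatives on seminormed carriers\<close>

lemma bounded_linear_on_functional:
 assumes "bounded_linear_on S p UNIV norm \<phi>"
 shows "a \<in> S \<Longrightarrow> b \<in> S \<Longrightarrow> \<phi> (a + b) = (\<phi> a + \<phi> b :: real)"
  and "a \<in> S \<Longrightarrow> \<phi> (c *\<^sub>R a) = c * \<phi> a"
  and "\<exists>C\<ge>0. \<forall>a\<in>S. \<bar>\<phi> a\<bar> \<le> C * p a"
 using assms unfolding bounded_linear_on_def op_bounds_def by auto

lemma bounded_linear_on_functionalI:
 assumes "\<And>a b. a \<in> S \<Longrightarrow> b \<in> S \<Longrightarrow> \<phi> (a + b) = (\<phi> a + \<phi> b :: real)"
  and "\<And>c a. a \<in> S \<Longrightarrow> \<phi> (c *\<^sub>R a) = c * \<phi> a"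
  and "0 \<le> C" "\<And>a. a \<in> S \<Longrightarrow> \<bar>\<phi> a\<bar> \<le> C * p a"
 shows "bounded_linear_on S p UNIV norm \<phi>"
 using assms unfolding bounded_linear_on_def op_bounds_def by auto

lemma op_norm_bound:
 assumes ne: "op_bounds S p q F \<noteq> {}" and a: "a \<in> S" and p: "0 \<le> p a"
 shows "q (F a) \<le> op_norm S p q F * p a"
proof (cases "p a = 0")
 case True
 obtain c where "c \<in> op_bounds S p q F" using ne by blast
 then show ?thesis using a True by (auto simp: op_bounds_def)
next
 case False
 then have pa: "0 < p a" using p by simp
 have "q (F a) / p a \<le> Inf (op_bounds S p q F)"
  by (rule cInf_greatest[OF ne]) (use a pa in \<open>auto simp: op_bounds_def divide_le_eq\<close>)
 then show ?thesis using pa by (simp add: op_norm_def divide_le_eq)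
qed

lemma op_norm_le:
 assumes "c \<in> op_bounds S p q F"
 shows "op_norm S p q F \<le> c"
 unfolding op_norm_def using assms
 by (intro cInf_lower bdd_belowI[of _ 0]) (auto simp: op_bounds_def)

lemma op_norm_nonneg:
 assumes "op_bounds S p q F \<noteq> {}"
 shows "0 \<le> op_norm S p q F"
 unfolding op_norm_def using assms by (intro cInf_greatest) (auto simp: op_bounds_def)

lemma op_bounds_cong: "(\<And>a. a \<in> S \<Longrightarrow> F a = G a) \<Longrightarrow> op_bounds S p q F = op_bounds S p q G"
 unfolding op_bounds_def by auto

lemma dual_norm_cong: "(\<And>a. a \<in> S \<Longrightarrow> F a = G a) \<Longrightarrow> dual_norm S p F = dual_norm S p G"
 unfolding dual_norm_def op_norm_def using op_bounds_cong[of S F G] by simp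

locale seminormed =
 fixes S :: "'a::real_vector set" and p :: "'a \<Rightarrow> real"
 assumes S: "subspace S" and p_nonneg: "\<And>a. 0 \<le> p a"
  and p_scale: "\<And>c a. a \<in> S \<Longrightarrow> p (c *\<^sub>R a) = \<bar>c\<bar> * p a"
  and p_add: "\<And>a b. a \<in> S \<Longrightarrow> b \<in> S \<Longrightarrow> p (a + b) \<le> p a + p b"
begin

lemma Sc [simp]: "a \<in> S \<Longrightarrow> b \<in> S \<Longrightarrow> a + b \<in> S" "a \<in> S \<Longrightarrow> c *\<^sub>R a \<in> S" "a \<in> S \<Longrightarrow> b \<in> S \<Longrightarrow> a - b \<in> S"
 using S by (auto simp: subspace_add subspace_scale subspace_diff)

lemma dual_norm_bound:
 assumes "bounded_linear_on S p UNIV norm \<phi>" "a \<in> S"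
 shows "\<bar>\<phi> a\<bar> \<le> dual_norm S p \<phi> * p a"
 using op_norm_bound[of S p norm \<phi> a] assms p_nonneg unfolding bounded_linear_on_def dual_norm_def by simp

text \<open>A Frechet derivative is determined by the difference quotients along lines. So the derivatives that
 are defined by choice can be computed on the carrier.\<close>

lemma gateaux:
 assumes F: "has_frechet_on S p UNIV norm F D a" and a: "a \<in> S" and h: "h \<in> S"
 shows "((\<lambda>s. (F (a + s *\<^sub>R h) - F a) / s) \<longlongrightarrow> (D h :: real)) (at 0)"
proof (rule tendstoI)
 fix e :: real assume e: "0 < e"
 have D: "bounded_linear_on S p UNIV norm D" using F by (simp add: has_frechet_on_def)
 define \<epsilon> where "\<epsilon> = e / (2 * (p h + 1))"
 have \<epsilon>: "0 < \<epsilon>" using e p_nonneg[of h] by (simp add: \<epsilon>_def add_nonneg_pos)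
 have \<epsilon>h: "\<epsilon> * p h < e"
 proof -
  have "\<epsilon> * p h \<le> \<epsilon> * (p h + 1)" using \<epsilon> by simp
  also have "\<dots> = e / 2" using p_nonneg[of h] by (simp add: \<epsilon>_def field_simps add_nonneg_eq_0_iff)
  finally show ?thesis using e by simp
 qed
 obtain \<delta> where \<delta>: "0 < \<delta>" "\<And>k. k \<in> S \<Longrightarrow> p k < \<delta> \<Longrightarrow> norm (F (a + k) - F a - D k) \<le> \<epsilon> * p k"
  using F \<epsilon> unfolding has_frechet_on_def by blast
 show "\<forall>\<^sub>F s in at 0. dist ((F (a + s *\<^sub>R h) - F a) / s) (D h) < e"
  unfolding eventually_at
 proof (intro exI[of _ "\<delta> / (p h + 1)"] conjI ballI impI)
  show "0 < \<delta> / (p h + 1)" using \<delta>(1) p_nonneg[of h] by (simp add: add_nonneg_pos)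
  fix s :: real assume "s \<noteq> 0 \<and> dist s 0 < \<delta> / (p h + 1)"
  then have s: "s \<noteq> 0" "\<bar>s\<bar> * (p h + 1) < \<delta>"
   using p_nonneg[of h] by (auto simp: less_divide_eq add_nonneg_pos)
  then have ps: "p (s *\<^sub>R h) < \<delta>" by (simp add: p_scale[OF h] distrib_left)
  have "\<bar>F (a + s *\<^sub>R h) - F a - s * D h\<bar> \<le> \<epsilon> * (\<bar>s\<bar> * p h)"
   using \<delta>(2)[OF _ ps] h bounded_linear_on_functional(2)[OF D h, of s] by (simp add: p_scale[OF h])
  also have "\<dots> < e * \<bar>s\<bar>" using \<epsilon>h s(1) by (simp add: mult.left_commute mult.commute[of e])
  finally have "\<bar>(F (a + s *\<^sub>R h) - F a - s * D h) / s\<bar> < e" using s(1) by (simp add: divide_less_eq abs_divide)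
  then show "dist ((F (a + s *\<^sub>R h) - F a) / s) (D h) < e"
   using s(1) by (simp add: dist_real_def diff_divide_distrib)
 qed
qed

lemma deriv1_frechet:
 assumes "has_frechet_on S p UNIV norm F D a"
 shows "has_frechet_on S p UNIV norm F (deriv1 S p F a) a"
 unfolding deriv1_def by (rule someI[of "\<lambda>D. has_frechet_on S p UNIV norm F D a", OF assms])

lemma deriv1_eq:
 assumes F: "has_frechet_on S p UNIV norm F D a" and a: "a \<in> S" and h: "h \<in> S"
 shows "deriv1 S p F a h = D h"
 using tendsto_unique[OF _ gateaux[OF deriv1_frechet[OF F] a h] gateaux[OF F a h]] by simp

lemma C2_derivs:
 assumes C2: "C2_on S p F" and a: "a \<in> S"
 shows C2_deriv1: "has_frechet_on S p UNIV norm F (deriv1 S p F a) a"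
  and C2_deriv2: "has_frechet_on S p (dual_space S p) (dual_norm S p) (deriv1 S p F) (deriv2 S p F a) a"
proof -
 obtain D1 D2 where D: "\<And>a. a \<in> S \<Longrightarrow> has_frechet_on S p UNIV norm F (D1 a) a"
   "\<And>a. a \<in> S \<Longrightarrow> has_frechet_on S p (dual_space S p) (dual_norm S p) D1 (D2 a) a"
  using C2 unfolding C2_on_def by blast
 show "has_frechet_on S p UNIV norm F (deriv1 S p F a) a" by (rule deriv1_frechet[OF D(1)[OF a]])
 have "dual_norm S p (deriv1 S p F (a + h) - deriv1 S p F a - D2 a h) = dual_norm S p (D1 (a + h) - D1 a - D2 a h)"
  if h: "h \<in> S" for h
  by (rule dual_norm_cong) (simp add: deriv1_eq[OF D(1)] a h)
 then have w: "has_frechet_on S p (dual_space S p) (dual_norm S p) (deriv1 S p F) (D2 a) a"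
  using D(2)[OF a] unfolding has_frechet_on_def by simp
 show "has_frechet_on S p (dual_space S p) (dual_norm S p) (deriv1 S p F) (deriv2 S p F a) a"
  unfolding deriv2_def
  by (rule someI[of "\<lambda>D. has_frechet_on S p (dual_space S p) (dual_norm S p) (deriv1 S p F) D a", OF w])
qed

lemma dual_spaceD: "\<phi> \<in> dual_space S p \<Longrightarrow> bounded_linear_on S p UNIV norm \<phi>"
 by (simp add: dual_space_def)

lemma bounded_linear_on_combine:
 assumes f: "bounded_linear_on S p UNIV norm f" and g: "bounded_linear_on S p UNIV norm (g :: 'a \<Rightarrow> real)"
 shows "bounded_linear_on S p UNIV norm (\<lambda>k. f k + c * g k)"
proof -
 note f' = bounded_linear_on_functional[OF f] and g' = bounded_linear_on_functional[OF g]
 obtain C1 C2 where C: "0 \<le> C1" "\<And>a. a \<in> S \<Longrightarrow> \<bar>f a\<bar> \<le> C1 * p a" "0 \<le> C2" "\<And>a. a \<in> S \<Longrightarrow> \<bar>g a\<bar> \<le> C2 * p a"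
  using f'(3) g'(3) by blast
 show ?thesis
 proof (rule bounded_linear_on_functionalI[where C = "C1 + \<bar>c\<bar> * C2"])
  fix a assume a: "a \<in> S"
  have "\<bar>f a + c * g a\<bar> \<le> \<bar>f a\<bar> + \<bar>c\<bar> * \<bar>g a\<bar>"
   using abs_triangle_ineq[of "f a" "c * g a"] by (simp add: abs_mult)
  also have "\<dots> \<le> C1 * p a + \<bar>c\<bar> * (C2 * p a)" using C a by (intro add_mono mult_left_mono) auto
  finally show "\<bar>f a + c * g a\<bar> \<le> (C1 + \<bar>c\<bar> * C2) * p a" by (simp add: algebra_simps)
 qed (use f' g' C in \<open>auto simp: algebra_simps\<close>)
qed

lemma deriv2_bilinear:
 assumes C2: "C2_on S p F" and a: "a \<in> S" and h: "h \<in> S" and h': "h' \<in> S" and k: "k \<in> S"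
 shows deriv2_dual: "bounded_linear_on S p UNIV norm (deriv2 S p F a h)"
  and deriv2_add: "deriv2 S p F a (h + h') k = deriv2 S p F a h k + deriv2 S p F a h' k"
  and deriv2_scale: "deriv2 S p F a (c *\<^sub>R h) k = c * deriv2 S p F a h k"
proof -
 let ?D = "deriv2 S p F a"
 have D: "bounded_linear_on S p (dual_space S p) (dual_norm S p) ?D"
  using C2_deriv2[OF C2 a] by (simp add: has_frechet_on_def)
 have d: "bounded_linear_on S p UNIV norm (?D x)" if "x \<in> S" for x
  using D that by (intro dual_spaceD) (auto simp: bounded_linear_on_def)
 show "bounded_linear_on S p UNIV norm (?D h)" by (rule d[OF h])
 have "bounded_linear_on S p UNIV norm (?D (h + h') - (?D h + ?D h'))"
  using bounded_linear_on_combine[OF bounded_linear_on_combine[OF d d, of "h + h'" h "-1"] d, of h' "-1"] h h'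
  by (simp add: fun_diff_def plus_fun_def algebra_simps)
 from dual_norm_bound[OF this k] have "\<bar>(?D (h + h') - (?D h + ?D h')) k\<bar> \<le> 0"
  using D h h' by (simp add: bounded_linear_on_def)
 then show "?D (h + h') k = ?D h k + ?D h' k" by simp
 have "bounded_linear_on S p UNIV norm (?D (c *\<^sub>R h) - c *\<^sub>R ?D h)"
  using bounded_linear_on_combine[OF d d, of "c *\<^sub>R h" h "- c"] h
  by (simp add: fun_diff_def scaleR_fun_def)
 from dual_norm_bound[OF this k] have "\<bar>(?D (c *\<^sub>R h) - c *\<^sub>R ?D h) k\<bar> \<le> 0"
  using D h by (simp add: bounded_linear_on_def)
 then show "?D (c *\<^sub>R h) k = c * ?D h k" by (simp add: scaleR_fun_def)
qed

lemma deriv2_bounded: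
 assumes C2: "C2_on S p F" and a: "a \<in> S"
 shows "\<exists>C\<ge>0. \<forall>h\<in>S. \<forall>k\<in>S. \<bar>deriv2 S p F a h k\<bar> \<le> C * p h * p k"
proof -
 let ?D = "deriv2 S p F a"
 have D: "bounded_linear_on S p (dual_space S p) (dual_norm S p) ?D"
  using C2_deriv2[OF C2 a] by (simp add: has_frechet_on_def)
 then obtain C where C: "0 \<le> C" "\<And>h. h \<in> S \<Longrightarrow> dual_norm S p (?D h) \<le> C * p h"
  by (auto simp: bounded_linear_on_def op_bounds_def)
 have "\<bar>?D h k\<bar> \<le> C * p h * p k" if "h \<in> S" "k \<in> S" for h k
 proof -
  have "\<bar>?D h k\<bar> \<le> dual_norm S p (?D h) * p k"
   by (rule dual_norm_bound[OF deriv2_dual[OF C2 a that(1) that(1) that(2)] that(2)])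
  also have "\<dots> \<le> C * p h * p k" by (intro mult_right_mono C that p_nonneg)
  finally show ?thesis .
 qed
 with C(1) show ?thesis by blast
qed

text \<open>Evaluation at \<open>k\<close> is continuous on the dual space, so the second derivative is a derivative of the
 scalar function \<open>x \<mapsto> deriv1 S p F x k\<close>.\<close>

lemma deriv2_gateaux:
 assumes C2: "C2_on S p F" and a: "a \<in> S" and h: "h \<in> S" and k: "k \<in> S"
 shows "((\<lambda>s. (deriv1 S p F (a + s *\<^sub>R h) k - deriv1 S p F a k) / s) \<longlongrightarrow> deriv2 S p F a h k) (at 0)"
proof -
 let ?d = "deriv1 S p F" and ?D = "deriv2 S p F a"
 have D2: "has_frechet_on S p (dual_space S p) (dual_norm S p) ?d ?D a" by (rule C2_deriv2[OF C2 a])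
 have bl: "bounded_linear_on S p UNIV norm (?d x)" if "x \<in> S" for x
  using C2_deriv1[OF C2 that] by (simp add: has_frechet_on_def)
 have fr: "has_frechet_on S p UNIV norm (\<lambda>x. ?d x k) (\<lambda>x. ?D x k) a"
  unfolding has_frechet_on_def
 proof (intro conjI allI impI)
  obtain C where C: "0 \<le> C" "\<And>h. h \<in> S \<Longrightarrow> \<bar>?D h k\<bar> \<le> C * p h * p k"
   using deriv2_bounded[OF C2 a] k by blast
  show "bounded_linear_on S p UNIV norm (\<lambda>x. ?D x k)"
  proof (rule bounded_linear_on_functionalI[where C = "C * p k"])
   show "\<bar>?D x k\<bar> \<le> C * p k * p x" if "x \<in> S" for x using C(2)[OF that] by (simp add: ac_simps)
  qed (use C(1) p_nonneg deriv2_add[OF C2 a _ _ k] deriv2_scale[OF C2 a _ _ k] in auto)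
  fix \<epsilon> :: real assume \<epsilon>: "0 < \<epsilon>"
  define \<epsilon>' where "\<epsilon>' = \<epsilon> / (p k + 1)"
  have \<epsilon>': "0 < \<epsilon>'" using \<epsilon> p_nonneg[of k] by (simp add: \<epsilon>'_def add_nonneg_pos)
  have \<epsilon>k: "\<epsilon>' * p k \<le> \<epsilon>"
  proof -
   have "\<epsilon>' * p k \<le> \<epsilon>' * (p k + 1)" using \<epsilon>' by simp
   also have "\<dots> = \<epsilon>" using p_nonneg[of k] by (simp add: \<epsilon>'_def)
   finally show ?thesis .
  qed
  obtain \<delta> where \<delta>: "0 < \<delta>" "\<And>x. x \<in> S \<Longrightarrow> p x < \<delta> \<Longrightarrow> dual_norm S p (?d (a + x) - ?d a - ?D x) \<le> \<epsilon>' * p x"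
   using D2 \<epsilon>' unfolding has_frechet_on_def by blast
  have "norm (?d (a + x) k - ?d a k - ?D x k) \<le> \<epsilon> * p x" if x: "x \<in> S" "p x < \<delta>" for x
  proof -
   have "bounded_linear_on S p UNIV norm (?d (a + x) - ?d a - ?D x)"
    using bounded_linear_on_combine[OF bounded_linear_on_combine[OF bl bl, of "a + x" a "-1"]
      deriv2_dual[OF C2 a x(1) x(1) k], of "-1"] a x
    by (simp add: fun_diff_def)
   from dual_norm_bound[OF this k]
   have "\<bar>?d (a + x) k - ?d a k - ?D x k\<bar> \<le> dual_norm S p (?d (a + x) - ?d a - ?D x) * p k" by simp
   also have "\<dots> \<le> (\<epsilon>' * p x) * p k" by (intro mult_right_mono \<delta> x p_nonneg)
   also have "\<dots> = (\<epsilon>' * p k) * p x" by simp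
   also have "\<dots> \<le> \<epsilon> * p x" by (intro mult_right_mono \<epsilon>k p_nonneg)
   finally show ?thesis by simp
  qed
  with \<delta>(1) show "\<exists>\<delta>>0. \<forall>x\<in>S. p x < \<delta> \<longrightarrow> norm (?d (a + x) k - ?d a k - ?D x k) \<le> \<epsilon> * p x" by blast
 qed
 from gateaux[OF this a h] show ?thesis .
qed

text \<open>
 If \<open>F\<close> splits into contributions of two complementary projections, its first derivative in one
 component does not see the other one, and the mixed second derivative vanishes.
\<close>

lemma deriv2_split_zero:
 assumes C2: "C2_on S p F" and a: "a \<in> S"
  and Q: "\<And>h. h \<in> S \<Longrightarrow> Q h \<in> S" "\<And>c h. Q (c *\<^sub>R h) = c *\<^sub>R Q h"
  and Q': "\<And>h. h \<in> S \<Longrightarrow> Q' h \<in> S" "\<And>c h. Q' (c *\<^sub>R h) = c *\<^sub>R Q' h"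
  and split: "\<And>h k. h \<in> S \<Longrightarrow> k \<in> S \<Longrightarrow> F (a + Q h + Q' k) + F a = F (a + Q h) + F (a + Q' k)"
  and h: "h \<in> S" and k: "k \<in> S"
 shows "deriv2 S p F a (Q h) (Q' k) = 0"
proof -
 have first: "deriv1 S p F (a + Q h) (Q' k) = deriv1 S p F a (Q' k)" if h: "h \<in> S" for h
 proof -
  have "((\<lambda>s. (F (a + Q h + s *\<^sub>R Q' k) - F (a + Q h)) / s) \<longlongrightarrow> deriv1 S p F (a + Q h) (Q' k)) (at 0)"
   by (rule gateaux[OF C2_deriv1[OF C2]]) (use a h k Q Q' in auto)
  moreover have "(\<lambda>s. (F (a + Q h + s *\<^sub>R Q' k) - F (a + Q h)) / s) = (\<lambda>s. (F (a + s *\<^sub>R Q' k) - F a) / s)"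
  proof
   fix s
   have "F (a + Q h + Q' (s *\<^sub>R k)) + F a = F (a + Q h) + F (a + Q' (s *\<^sub>R k))"
    by (rule split) (use h k in auto)
   then have "F (a + Q h + s *\<^sub>R Q' k) - F (a + Q h) = F (a + s *\<^sub>R Q' k) - F a"
    unfolding Q'(2) by linarith
   then show "(F (a + Q h + s *\<^sub>R Q' k) - F (a + Q h)) / s = (F (a + s *\<^sub>R Q' k) - F a) / s" by simp
  qed
  moreover have "((\<lambda>s. (F (a + s *\<^sub>R Q' k) - F a) / s) \<longlongrightarrow> deriv1 S p F a (Q' k)) (at 0)"
   by (rule gateaux[OF C2_deriv1[OF C2]]) (use a k Q' in auto)
  ultimately show ?thesis using tendsto_unique[of "at (0::real)"] by auto
 qed
 have "((\<lambda>s. (deriv1 S p F (a + s *\<^sub>R Q h) (Q' k) - deriv1 S p F a (Q' k)) / s) \<longlongrightarrow> deriv2 S p F a (Q h) (Q' k)) (at 0)"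
  by (rule deriv2_gateaux[OF C2 a]) (use h k Q Q' in auto)
 moreover have "deriv1 S p F (a + s *\<^sub>R Q h) (Q' k) = deriv1 S p F a (Q' k)" for s
  using first[of "s *\<^sub>R h"] h by (simp add: Q(2))
 ultimately have "((\<lambda>s::real. 0::real) \<longlongrightarrow> deriv2 S p F a (Q h) (Q' k)) (at 0)" by simp
 then show ?thesis using tendsto_unique[of "at (0::real)", OF _ _ tendsto_const] by auto
qed

end

lemma L2_restrict: "A \<in> sets lebesgue \<Longrightarrow> w \<in> L2 T \<Longrightarrow> (\<lambda>t. indicator A t *\<^sub>R w t) \<in> L2 T"
 by (rule L2_mult[of _ _ 1]) (auto simp: indicator_def intro!: measurable_restrict_space1)

lemma L2norm_restrict_le:
 assumes "w \<in> L2 T"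
 shows "L2norm T (\<lambda>t. indicator A t *\<^sub>R w t) \<le> L2norm T w"
 using L2norm_mult[OF AE_I2 assms, of "indicator A" 1] by (auto simp: indicator_def)

text \<open>A bounded bilinear form on \<open>L\<^sub>2\<close> that is symmetric with respect to restriction to measurable
 sets is symmetric with respect to multiplication by bounded functions: these are uniform limits of
 finite combinations of indicators of their level sets.\<close>

lemma L2_local_form:
 fixes \<beta> :: "(real \<Rightarrow> 'a::real_normed_vector) \<Rightarrow> (real \<Rightarrow> 'b::real_normed_vector) \<Rightarrow> real"
 assumes add: "\<And>f g h. f \<in> L2 T \<Longrightarrow> g \<in> L2 T \<Longrightarrow> h \<in> L2 T \<Longrightarrow> \<beta> (f + g) h = \<beta> f h + \<beta> g h"
  and scale: "\<And>c f h. f \<in> L2 T \<Longrightarrow> h \<in> L2 T \<Longrightarrow> \<beta> (c *\<^sub>R f) h = c * \<beta> f h"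
  and add2: "\<And>f g h. f \<in> L2 T \<Longrightarrow> g \<in> L2 T \<Longrightarrow> h \<in> L2 T \<Longrightarrow> \<beta> h (f + g) = \<beta> h f + \<beta> h g"
  and scale2: "\<And>c f h. f \<in> L2 T \<Longrightarrow> h \<in> L2 T \<Longrightarrow> \<beta> h (c *\<^sub>R f) = c * \<beta> h f"
  and bound: "0 \<le> C" "\<And>f h. f \<in> L2 T \<Longrightarrow> h \<in> L2 T \<Longrightarrow> \<bar>\<beta> f h\<bar> \<le> C * L2norm T f * L2norm T h"
  and loc: "\<And>A f h. A \<in> sets lebesgue \<Longrightarrow> f \<in> L2 T \<Longrightarrow> h \<in> L2 T \<Longrightarrow>
   \<beta> (\<lambda>t. indicator A t *\<^sub>R f t) h = \<beta> f (\<lambda>t. indicator A t *\<^sub>R h t)"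
  and \<phi>: "smooth \<phi>" and f: "f \<in> L2 T" and h: "h \<in> L2 T"
 shows "\<beta> (\<lambda>t. \<phi> t *\<^sub>R f t) h = \<beta> f (\<lambda>t. \<phi> t *\<^sub>R h t)"
proof -
 \<comment> \<open>step functions with the values \<open>j / (n + 1)\<close> on the level sets of \<open>\<phi>\<close>\<close>
 define level where "level n j = {t. \<lfloor>real (Suc n) * \<phi> t\<rfloor> = j}" for n j
 define \<psi> where "\<psi> n J t = (\<Sum>j\<in>J. (of_int j / real (Suc n)) * indicator (level n j) t)" for n J t
 have \<phi>m[measurable]: "\<phi> \<in> borel_measurable borel"
  by (rule borel_measurable_continuous_onI[OF smooth_continuous[OF \<phi>]])
 have levels: "level n j \<in> sets lebesgue" for n j
 proof -
  have "{t \<in> space borel. \<lfloor>real (Suc n) * \<phi> t\<rfloor> = j} \<in> sets borel" by measurable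
  then show ?thesis by (simp add: level_def)
 qed
 have step_insert: "(\<lambda>t. \<psi> n (insert j J) t *\<^sub>R w t)
   = (\<lambda>t. \<psi> n J t *\<^sub>R w t) + (of_int j / real (Suc n)) *\<^sub>R (\<lambda>t. indicator (level n j) t *\<^sub>R w t)"
  if "finite J" "j \<notin> J" for n j J and w :: "real \<Rightarrow> 'c::real_normed_vector"
  unfolding \<psi>_def by (rule ext) (simp add: that scaleR_fun_def scaleR_add_left)
 have step_L2: "(\<lambda>t. \<psi> n J t *\<^sub>R w t) \<in> L2 T" if w: "w \<in> L2 T" and J: "finite J" for n J and w :: "real \<Rightarrow> 'c::real_normed_vector"
  using J
 proof induction
  case empty
  then show ?case using L2_zero[of T] by (simp add: \<psi>_def zero_fun_def)
 next
  case (insert j J)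
  show ?case unfolding step_insert[OF insert.hyps] by (intro L2_add insert.IH L2_scaleR L2_restrict levels w)
 qed
 have step: "\<beta> (\<lambda>t. \<psi> n J t *\<^sub>R f t) h = \<beta> f (\<lambda>t. \<psi> n J t *\<^sub>R h t)" if "finite J" for n J
  using that
 proof induction
  case empty
  have "\<beta> 0 h = 0" "\<beta> f 0 = 0" using scale[OF f h, of 0] scale2[OF h f, of 0] by simp_all
  then show ?case by (simp add: \<psi>_def scaleR_fun_def zero_fun_def)
 next
  case (insert j J)
  note r = L2_restrict[OF levels]
  show ?case unfolding step_insert[OF insert.hyps]
   by (simp only: add[OF step_L2[OF f insert.hyps(1)] L2_scaleR[OF r[OF f]] h] scale[OF r[OF f] h]
      add2[OF step_L2[OF h insert.hyps(1)] L2_scaleR[OF r[OF h]] f] scale2[OF r[OF h] f]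
      loc[OF levels f h] insert.IH)
 qed
 obtain K where K: "\<And>t. t \<in> {0..T} \<Longrightarrow> \<bar>\<phi> t\<bar> \<le> K" using smooth_bounded_measurable(2)[OF \<phi>] by blast
 define J where "J n = {- (\<lceil>real (Suc n) * K\<rceil> + 1)..\<lceil>real (Suc n) * K\<rceil> + 1}" for n
 have approx: "\<bar>\<psi> n (J n) t - \<phi> t\<bar> \<le> 1 / real (Suc n)" if t: "t \<in> {0..T}" for n t
 proof -
  define j where "j = \<lfloor>real (Suc n) * \<phi> t\<rfloor>"
  have "\<bar>real (Suc n) * \<phi> t\<bar> \<le> real (Suc n) * K"
   using mult_left_mono[OF K[OF t], of "real (Suc n)"] by (simp add: abs_mult)
  then have jJ: "j \<in> J n" unfolding j_def J_def atLeastAtMost_iff by linarith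
  have "\<psi> n (J n) t = (\<Sum>i\<in>J n. if i = j then of_int j / real (Suc n) else 0)"
   unfolding \<psi>_def by (intro sum.cong) (auto simp: indicator_def level_def j_def)
  also have "\<dots> = of_int j / real (Suc n)" using jJ by (simp add: sum.delta J_def)
  finally have e: "\<psi> n (J n) t = of_int j / real (Suc n)" .
  have "\<bar>of_int j - real (Suc n) * \<phi> t\<bar> \<le> 1" unfolding j_def by linarith
  then have "\<bar>of_int j - real (Suc n) * \<phi> t\<bar> / real (Suc n) \<le> 1 / real (Suc n)" by (intro divide_right_mono) simp_all
  moreover have "\<bar>of_int j / real (Suc n) - \<phi> t\<bar> = \<bar>(of_int j - real (Suc n) * \<phi> t) / real (Suc n)\<bar>"
   by (simp add: diff_divide_distrib)
  ultimately show ?thesis unfolding e by simp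
 qed
 have main: "\<bar>\<beta> (\<lambda>t. \<phi> t *\<^sub>R f t) h - \<beta> f (\<lambda>t. \<phi> t *\<^sub>R h t)\<bar>
   \<le> (2 * C * L2norm T f * L2norm T h) * (1 / real (Suc n))" for n
 proof -
  have Jf: "finite (J n)" by (simp add: J_def)
  have err: "(\<lambda>t. \<phi> t *\<^sub>R w t) - (\<lambda>t. \<psi> n (J n) t *\<^sub>R w t) \<in> L2 T \<and>
    L2norm T ((\<lambda>t. \<phi> t *\<^sub>R w t) - (\<lambda>t. \<psi> n (J n) t *\<^sub>R w t)) \<le> (1 / real (Suc n)) * L2norm T w"
   if w: "w \<in> L2 T" for w :: "real \<Rightarrow> 'c::real_normed_vector"
  proof
   show "(\<lambda>t. \<phi> t *\<^sub>R w t) - (\<lambda>t. \<psi> n (J n) t *\<^sub>R w t) \<in> L2 T"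
    by (intro L2_diff L2_smooth_mult[OF \<phi>] step_L2 w Jf)
   show "L2norm T ((\<lambda>t. \<phi> t *\<^sub>R w t) - (\<lambda>t. \<psi> n (J n) t *\<^sub>R w t)) \<le> (1 / real (Suc n)) * L2norm T w"
   proof (rule L2norm_mono_AE[OF w])
    show "AE t in MT T. norm (((\<lambda>t. \<phi> t *\<^sub>R w t) - (\<lambda>t. \<psi> n (J n) t *\<^sub>R w t)) t) \<le> (1 / real (Suc n)) * norm (w t)"
    proof (rule AE_I2)
     fix t assume "t \<in> space (MT T)"
     then have "\<bar>\<psi> n (J n) t - \<phi> t\<bar> \<le> 1 / real (Suc n)" by (intro approx) auto
     then have "\<bar>\<phi> t - \<psi> n (J n) t\<bar> * norm (w t) \<le> (1 / real (Suc n)) * norm (w t)"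
      by (intro mult_right_mono) (auto simp: abs_minus_commute)
     then show "norm (((\<lambda>t. \<phi> t *\<^sub>R w t) - (\<lambda>t. \<psi> n (J n) t *\<^sub>R w t)) t) \<le> (1 / real (Suc n)) * norm (w t)"
      by (simp add: scaleR_diff_left[symmetric] del: of_nat_Suc)
    qed
   qed simp
  qed
  note ef = conjunct1[OF err[OF f]] conjunct2[OF err[OF f]] and eh = conjunct1[OF err[OF h]] conjunct2[OF err[OF h]]
  note sf = step_L2[OF f Jf, of n] and sh = step_L2[OF h Jf, of n]
  have e1: "\<beta> (\<lambda>t. \<phi> t *\<^sub>R f t) h = \<beta> ((\<lambda>t. \<phi> t *\<^sub>R f t) - (\<lambda>t. \<psi> n (J n) t *\<^sub>R f t)) h + \<beta> (\<lambda>t. \<psi> n (J n) t *\<^sub>R f t) h"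
   using add[OF ef(1) sf h] by simp
  have e2: "\<beta> f (\<lambda>t. \<phi> t *\<^sub>R h t) = \<beta> f ((\<lambda>t. \<phi> t *\<^sub>R h t) - (\<lambda>t. \<psi> n (J n) t *\<^sub>R h t)) + \<beta> f (\<lambda>t. \<psi> n (J n) t *\<^sub>R h t)"
   using add2[OF eh(1) sh f] by simp
  have b1: "\<bar>\<beta> ((\<lambda>t. \<phi> t *\<^sub>R f t) - (\<lambda>t. \<psi> n (J n) t *\<^sub>R f t)) h\<bar> \<le> C * ((1 / real (Suc n)) * L2norm T f) * L2norm T h"
   by (rule order_trans[OF bound(2)[OF ef(1) h]]) (intro mult_right_mono mult_left_mono ef(2) bound(1) L2norm_nonneg)
  have b2: "\<bar>\<beta> f ((\<lambda>t. \<phi> t *\<^sub>R h t) - (\<lambda>t. \<psi> n (J n) t *\<^sub>R h t))\<bar> \<le> C * L2norm T f * ((1 / real (Suc n)) * L2norm T h)"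
   by (rule order_trans[OF bound(2)[OF f eh(1)]]) (intro mult_left_mono eh(2) mult_nonneg_nonneg bound(1) L2norm_nonneg)
  have "C * ((1 / real (Suc n)) * L2norm T f) * L2norm T h + C * L2norm T f * ((1 / real (Suc n)) * L2norm T h)
    = (2 * C * L2norm T f * L2norm T h) * (1 / real (Suc n))" by simp
  then show ?thesis using b1 b2 unfolding e1 e2 step[OF Jf] by linarith
 qed
 have "\<bar>\<beta> (\<lambda>t. \<phi> t *\<^sub>R f t) h - \<beta> f (\<lambda>t. \<phi> t *\<^sub>R h t)\<bar> \<le> (2 * C * L2norm T f * L2norm T h) * 0"
  by (rule tendsto_lowerbound[OF tendsto_mult_left[OF LIMSEQ_Suc[OF lim_1_over_n]] always_eventually]) (use main in auto)
 then show ?thesis by simp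
qed

section \<open>Locality of the derivatives of the cost\<close>

lemma seminormed_prod:
 assumes "seminormed S p" "seminormed S' q"
 shows "seminormed (S \<times> S') (\<lambda>(a, b). sqrt ((p a)\<^sup>2 + (q b)\<^sup>2))"
proof -
 interpret p: seminormed S p by fact
 interpret q: seminormed S' q by fact
 show ?thesis
 proof
  show "subspace (S \<times> S')" using p.S q.S by (auto simp: subspace_def zero_prod_def)
  show "0 \<le> (case a of (a, b) \<Rightarrow> sqrt ((p a)\<^sup>2 + (q b)\<^sup>2))" for a by (simp add: split_def)
  show "(case c *\<^sub>R a of (a, b) \<Rightarrow> sqrt ((p a)\<^sup>2 + (q b)\<^sup>2)) = \<bar>c\<bar> * (case a of (a, b) \<Rightarrow> sqrt ((p a)\<^sup>2 + (q b)\<^sup>2))"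
   if a: "a \<in> S \<times> S'" for c a
  proof -
   have "fst a \<in> S" "snd a \<in> S'" using a by auto
   then have "(p (c *\<^sub>R fst a))\<^sup>2 + (q (c *\<^sub>R snd a))\<^sup>2 = \<bar>c\<bar>\<^sup>2 * ((p (fst a))\<^sup>2 + (q (snd a))\<^sup>2)"
    by (simp add: p.p_scale q.p_scale power_mult_distrib distrib_left)
   then show ?thesis by (simp add: split_def real_sqrt_mult)
  qed
  show "(case a + b of (a, b) \<Rightarrow> sqrt ((p a)\<^sup>2 + (q b)\<^sup>2))
    \<le> (case a of (a, b) \<Rightarrow> sqrt ((p a)\<^sup>2 + (q b)\<^sup>2)) + (case b of (a, b) \<Rightarrow> sqrt ((p a)\<^sup>2 + (q b)\<^sup>2))"
   if a: "a \<in> S \<times> S'" and b: "b \<in> S \<times> S'" for a b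
  proof -
   have m: "fst a \<in> S" "snd a \<in> S'" "fst b \<in> S" "snd b \<in> S'" using a b by auto
   have "sqrt ((p (fst a + fst b))\<^sup>2 + (q (snd a + snd b))\<^sup>2)
     \<le> sqrt ((p (fst a) + p (fst b))\<^sup>2 + (q (snd a) + q (snd b))\<^sup>2)"
    using p.p_add[OF m(1,3)] q.p_add[OF m(2,4)] p.p_nonneg q.p_nonneg
    by (intro real_sqrt_le_mono add_mono power_mono) auto
   also have "\<dots> \<le> sqrt ((p (fst a))\<^sup>2 + (q (snd a))\<^sup>2) + sqrt ((p (fst b))\<^sup>2 + (q (snd b))\<^sup>2)"
    by (rule real_sqrt_sum_squares_triangle_ineq)
   finally show ?thesis by (simp add: split_def)
  qed
 qed
qed

lemma L2_seminormed: "seminormed (L2 T) (L2norm T)"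
 by standard (auto simp: subspace_def L2_add L2_scaleR L2norm_scaleR L2norm_add)

lemma norm_seminormed: "seminormed UNIV norm"
 by standard (auto simp: norm_triangle_ineq)

lemma XU_seminormed: "seminormed (XU T) (XUnorm T)"
 unfolding XU_def XUnorm_def by (rule seminormed_prod[OF L2_seminormed L2_seminormed])

text \<open>The values of \<open>inverse_on\<close> are chosen preimages. Linearity up to null elements follows from
 injectivity, and every \<open>a\<close> differs from the chosen preimage of \<open>F a\<close> by a null element only, so that the
 estimate for \<open>a\<close> holds with the exact norm of the inverse.\<close>

lemma inverse_on_bounded:
 assumes p: "seminormed S p" and q: "seminormed S' q" and inv: "invertible_on S p S' q F"
  and K: "0 \<le> K" "\<And>a. a \<in> S \<Longrightarrow> p a \<le> K * q (F a)"
 shows "bounded_linear_on S' q S p (inverse_on S q F)"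
  and "op_norm S' q p (inverse_on S q F) \<le> K"
  and "a \<in> S \<Longrightarrow> p a \<le> op_norm S' q p (inverse_on S q F) * q (F a)"
proof -
 interpret p: seminormed S p by fact
 interpret q: seminormed S' q by fact
 let ?G = "inverse_on S q F"
 have Fb: "bounded_linear_on S p S' q F" using inv by (simp add: invertible_on_def)
 have F: "F a \<in> S'" if "a \<in> S" for a using Fb that by (simp add: bounded_linear_on_def)
 have Fadd: "q (F (a + b) - (F a + F b)) = 0" if "a \<in> S" "b \<in> S" for a b using Fb that by (simp add: bounded_linear_on_def)
 have Fsc: "q (F (c *\<^sub>R a) - c *\<^sub>R F a) = 0" if "a \<in> S" for a c using Fb that by (simp add: bounded_linear_on_def)
 have G: "?G b \<in> S" "q (F (?G b) - b) = 0" if b: "b \<in> S'" for b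
 proof -
  have "\<exists>a. a \<in> S \<and> q (F a - b) = 0" using inv b unfolding invertible_on_def by blast
  from someI_ex[OF this] show "?G b \<in> S" "q (F (?G b) - b) = 0" by (simp_all add: inverse_on_def)
 qed
 have qadd: "q (a + b) \<le> 0" if "a \<in> S'" "b \<in> S'" "q a \<le> 0" "q b \<le> 0" for a b
  using q.p_add[OF that(1,2)] that(3,4) by linarith
 have qsc: "q (c *\<^sub>R a) \<le> 0" if "a \<in> S'" "q a \<le> 0" for c a
  using q.p_scale[OF that(1), of c] that(2) q.p_nonneg[of a] by simp
 have null: "p a = 0" if a: "a \<in> S" "q (F a) \<le> 0" for a
  using K(2)[OF a(1)] mult_left_mono[OF a(2) K(1)] p.p_nonneg[of a] by simp
 have Fsub: "q (F (a - b) - (F a - F b)) \<le> 0" if "a \<in> S" "b \<in> S" for a b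
 proof -
  define b' where "b' = (-1) *\<^sub>R b"
  have b': "b' \<in> S" unfolding b'_def by (rule p.Sc(2)[OF that(2)])
  have m1: "F (a + b') - (F a + F b') \<in> S'" by (intro q.Sc p.Sc F that b')
  have m2: "F b' - (-1) *\<^sub>R F b \<in> S'" by (intro q.Sc p.Sc F that b')
  have z1: "q (F (a + b') - (F a + F b')) \<le> 0" using Fadd[OF that(1) b'] by simp
  have z2: "q (F b' - (-1) *\<^sub>R F b) \<le> 0" unfolding b'_def using Fsc[OF that(2), of "-1"] by linarith
  have e: "(F (a + b') - (F a + F b')) + (F b' - (-1) *\<^sub>R F b) = F (a - b) - (F a - F b)"
   by (simp add: b'_def)
  show ?thesis using qadd[OF m1 m2 z1 z2] unfolding e .
 qed
 have eq: "p (a - b) = 0" if ab: "a \<in> S" "b \<in> S" and z: "q (F a - F b) \<le> 0" for a b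
 proof (rule null)
  show "a - b \<in> S" using ab by simp
  have "q ((F (a - b) - (F a - F b)) + (F a - F b)) \<le> 0"
   by (rule qadd[OF _ _ Fsub[OF ab] z]) (use ab F in \<open>auto intro!: q.Sc p.Sc\<close>)
  then show "q (F (a - b)) \<le> 0" by simp
 qed
 have dec: "q (a - b) \<le> 0" if "a \<in> S'" "b \<in> S'" "c \<in> S'" "q (a - c) \<le> 0" "q (b - c) \<le> 0" for a b c
 proof -
  have "q ((a - c) + (-1) *\<^sub>R (b - c)) \<le> 0"
   by (rule qadd) (use that qsc[of "b - c" "-1"] q.Sc(2)[OF q.Sc(3)[OF that(2,3)], of "-1"] in \<open>auto intro!: q.Sc\<close>)
  then show ?thesis by simp
 qed
 have bd: "p (?G b) \<le> K * q b" if b: "b \<in> S'" for b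
 proof -
  have "q ((F (?G b) - b) + b) \<le> q (F (?G b) - b) + q b" by (rule q.p_add) (use G b F in auto)
  then have "q (F (?G b)) \<le> q b" using G(2)[OF b] by simp
  from mult_left_mono[OF this K(1)] show ?thesis using K(2)[OF G(1)[OF b]] by linarith
 qed
 have bn: "K \<in> op_bounds S' q p ?G" using K(1) bd by (simp add: op_bounds_def)
 show "bounded_linear_on S' q S p ?G"
  unfolding bounded_linear_on_def
 proof (intro conjI ballI allI)
  show "?G b \<in> S" if "b \<in> S'" for b by (rule G(1)[OF that])
  show "p (?G (b + c) - (?G b + ?G c)) = 0" if bc: "b \<in> S'" "c \<in> S'" for b c
  proof (rule eq)
   note g = G(1)[OF bc(1)] G(1)[OF bc(2)] and bc' = q.Sc(1)[OF bc]
   show "?G (b + c) \<in> S" "?G b + ?G c \<in> S" using G(1)[OF bc'] g by auto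
   have e: "F (?G b + ?G c) - (b + c) = (F (?G b + ?G c) - (F (?G b) + F (?G c))) + ((F (?G b) - b) + (F (?G c) - c))"
    by simp
   have gs: "?G b + ?G c \<in> S" by (rule p.Sc(1)[OF g])
   note Fg = F[OF g(1)] F[OF g(2)] F[OF gs]
   have "q (F (?G b + ?G c) - (b + c)) \<le> 0" unfolding e
   proof (intro qadd)
    show "F (?G b + ?G c) - (F (?G b) + F (?G c)) \<in> S'" by (intro q.Sc Fg)
    show "F (?G b) - b \<in> S'" "F (?G c) - c \<in> S'" "F (?G b) - b + (F (?G c) - c) \<in> S'" by (intro q.Sc Fg bc)+
    show "q (F (?G b + ?G c) - (F (?G b) + F (?G c))) \<le> 0" using Fadd[OF g] by simp
    show "q (F (?G b) - b) \<le> 0" "q (F (?G c) - c) \<le> 0" using G(2)[OF bc(1)] G(2)[OF bc(2)] by simp_all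
   qed
   moreover have "q (F (?G (b + c)) - (b + c)) \<le> 0" using G(2)[OF bc'] by simp
   ultimately show "q (F (?G (b + c)) - F (?G b + ?G c)) \<le> 0"
    by (intro dec[OF F[OF G(1)[OF bc']] Fg(3) bc'])
  qed
  show "p (?G (k *\<^sub>R b) - k *\<^sub>R ?G b) = 0" if b: "b \<in> S'" for k b
  proof (rule eq)
   note g = G(1)[OF b] and kb = q.Sc(2)[OF b, of k]
   show "?G (k *\<^sub>R b) \<in> S" "k *\<^sub>R ?G b \<in> S" using G(1)[OF kb] g by auto
   have e: "F (k *\<^sub>R ?G b) - k *\<^sub>R b = (F (k *\<^sub>R ?G b) - k *\<^sub>R F (?G b)) + k *\<^sub>R (F (?G b) - b)"
    by (simp add: scaleR_diff_right)
   have gs: "k *\<^sub>R ?G b \<in> S" by (rule p.Sc(2)[OF g])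
   note Fg = F[OF g] F[OF gs]
   have d: "F (?G b) - b \<in> S'" by (intro q.Sc Fg b)
   have "q (F (k *\<^sub>R ?G b) - k *\<^sub>R b) \<le> 0" unfolding e
   proof (rule qadd)
    show "F (k *\<^sub>R ?G b) - k *\<^sub>R F (?G b) \<in> S'" by (intro q.Sc Fg)
    show "k *\<^sub>R (F (?G b) - b) \<in> S'" by (rule q.Sc(2)[OF d])
    show "q (F (k *\<^sub>R ?G b) - k *\<^sub>R F (?G b)) \<le> 0" using Fsc[OF g] by simp
    show "q (k *\<^sub>R (F (?G b) - b)) \<le> 0" using qsc[OF d] G(2)[OF b] by simp
   qed
   moreover have "q (F (?G (k *\<^sub>R b)) - k *\<^sub>R b) \<le> 0" using G(2)[OF kb] by simp
   ultimately show "q (F (?G (k *\<^sub>R b)) - F (k *\<^sub>R ?G b)) \<le> 0"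
    by (intro dec[OF F[OF G(1)[OF kb]] Fg(2) kb])
  qed
  show "op_bounds S' q p ?G \<noteq> {}" using bn by blast
 qed
 show "op_norm S' q p ?G \<le> K" by (rule op_norm_le[OF bn])
 show "p a \<le> op_norm S' q p ?G * q (F a)" if a: "a \<in> S"
 proof -
  note Fa = F[OF a]
  have "p (a - ?G (F a)) = 0"
  proof (rule eq[OF a G(1)[OF Fa]])
   show "q (F a - F (?G (F a))) \<le> 0"
   proof (rule dec[OF Fa F[OF G(1)[OF Fa]] Fa])
    show "q (F a - F a) \<le> 0" using q.p_scale[OF Fa, of 0] by simp
    show "q (F (?G (F a)) - F a) \<le> 0" using G(2)[OF Fa] by simp
   qed
  qed
  moreover have "p ((a - ?G (F a)) + ?G (F a)) \<le> p (a - ?G (F a)) + p (?G (F a))"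
   by (rule p.p_add) (use a G(1)[OF Fa] in auto)
  moreover have "p (?G (F a)) \<le> op_norm S' q p ?G * q (F a)"
   by (rule op_norm_bound[OF _ Fa q.p_nonneg]) (use bn in blast)
  ultimately show ?thesis by simp
 qed
qed

lemma XUnorm_simps [simp]: "XUnorm T (h, 0) = L2norm T h" "XUnorm T (0, k) = L2norm T k"
 by (simp_all add: XUnorm_def)

definition restr :: "real set \<Rightarrow> (real \<Rightarrow> 'a::real_vector) \<times> (real \<Rightarrow> 'b::real_vector) \<Rightarrow> (real \<Rightarrow> 'a) \<times> (real \<Rightarrow> 'b)"
 where "restr A h = ((\<lambda>t. indicator A t *\<^sub>R fst h t), (\<lambda>t. indicator A t *\<^sub>R snd h t))"

lemma restr_XU: "A \<in> sets lebesgue \<Longrightarrow> h \<in> XU T \<Longrightarrow> restr A h \<in> XU T"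
 by (auto simp: restr_def XU_def L2_restrict)

lemma restr_scale: "restr A (c *\<^sub>R h) = c *\<^sub>R restr A h"
 by (simp add: restr_def scaleR_prod_def scaleR_fun_def mult.commute)

lemma restr_add: "restr A (h + k) = restr A h + restr A k"
 by (simp add: restr_def plus_prod_def plus_fun_def scaleR_add_right)

lemma restr_decompose: "restr A h + restr (- A) h = h"
 by (auto simp: restr_def plus_prod_def prod_eq_iff fun_eq_iff indicator_def)

lemma cost_integrable:
 assumes "ocp_assms P T" "a \<in> XU T"
 shows "integrable (MT T) (\<lambda>t. Jbar P t (fst a t) (snd a t))"
proof -
 have "\<forall>(x, u)\<in>XU T. integrable (MT T) (\<lambda>t. Jbar P t (x t) (u t))"
  using assms(1) by (simp add: ocp_assms_def)
 from bspec[OF this assms(2)] show ?thesis by (simp add: split_def)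
qed

text \<open>The integrand at time \<open>t\<close> depends only on the values at time \<open>t\<close>: perturbations that are supported on
 disjoint sets of times contribute independently of each other.\<close>

lemma cost_split:
 fixes P :: "('v::{banach,second_countable_topology}, 'h::{real_inner,banach}, 'u::{real_inner,banach}) ocp"
 assumes P: "ocp_assms P T" and A: "A \<in> sets lebesgue" and a: "a \<in> XU T" and h: "h \<in> XU T" and k: "k \<in> XU T"
 shows "cost P T (a + restr A h + restr (- A) k) + cost P T a
  = cost P T (a + restr A h) + cost P T (a + restr (- A) k)"
proof -
 interpret seminormed "XU T" "XUnorm T" by (rule XU_seminormed)
 let ?f = "\<lambda>b t. Jbar P t (fst b t) (snd b t)"
 have c: "cost P T b = (LINT t|MT T. ?f b t)" for b by (simp add: cost_def split_def)
 have A': "- A \<in> sets lebesgue" using sets.compl_sets[OF A] by (simp add: Compl_eq_Diff_UNIV)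
 have m: "a + restr A h + restr (- A) k \<in> XU T" "a + restr A h \<in> XU T" "a + restr (- A) k \<in> XU T"
  using Sc(1)[OF Sc(1)[OF a restr_XU[OF A h]] restr_XU[OF A' k]] Sc(1)[OF a restr_XU[OF A h]] Sc(1)[OF a restr_XU[OF A' k]]
  by blast+
 note i = cost_integrable[OF P]
 have pt: "?f (a + restr A h + restr (- A) k) t + ?f a t = ?f (a + restr A h) t + ?f (a + restr (- A) k) t" for t
  by (cases "t \<in> A") (simp_all add: restr_def)
 have "cost P T (a + restr A h + restr (- A) k) + cost P T a = (LINT t|MT T. ?f (a + restr A h + restr (- A) k) t + ?f a t)"
  unfolding c by (rule Bochner_Integration.integral_add[OF i[OF m(1)] i[OF a], symmetric])
 also have "\<dots> = cost P T (a + restr A h) + cost P T (a + restr (- A) k)"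
  unfolding pt c by (rule Bochner_Integration.integral_add[OF i[OF m(2)] i[OF m(3)]])
 finally show ?thesis .
qed

lemma deriv2_cost_restr:
 fixes P :: "('v::{banach,second_countable_topology}, 'h::{real_inner,banach}, 'u::{real_inner,banach}) ocp"
 assumes P: "ocp_assms P T" and A: "A \<in> sets lebesgue" and a: "a \<in> XU T" and h: "h \<in> XU T" and k: "k \<in> XU T"
 shows "deriv2 (XU T) (XUnorm T) (cost P T) a (restr A h) k = deriv2 (XU T) (XUnorm T) (cost P T) a h (restr A k)"
proof -
 interpret seminormed "XU T" "XUnorm T" by (rule XU_seminormed)
 have C2: "C2_on (XU T) (XUnorm T) (cost P T)" using P by (simp add: ocp_assms_def)
 have A': "- A \<in> sets lebesgue" using A sets.compl_sets[OF A] by (simp add: Compl_eq_Diff_UNIV)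
 let ?D = "deriv2 (XU T) (XUnorm T) (cost P T) a"
 have z: "?D (restr B h) (restr (- B) k) = 0" if B: "B \<in> sets lebesgue" "- B \<in> sets lebesgue" for B
  by (rule deriv2_split_zero[where Q = "restr B" and Q' = "restr (- B)",
     OF C2 a restr_XU[OF B(1)] restr_scale restr_XU[OF B(2)] restr_scale cost_split[OF P B(1) a] h k])
 note r = restr_XU[OF A h] restr_XU[OF A' h] restr_XU[OF A k] restr_XU[OF A' k]
 have "?D (restr A h) k = ?D (restr A h) (restr A k + restr (- A) k)" by (simp only: restr_decompose)
 also have "\<dots> = ?D (restr A h) (restr A k)"
  using bounded_linear_on_functional(1)[OF deriv2_dual[OF C2 a r(1) r(1) k] r(3,4)] z[OF A A'] by simp
 also have "\<dots> = ?D (restr A h) (restr A k) + ?D (restr (- A) h) (restr A k)"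
  using z[OF A'] A by simp
 also have "\<dots> = ?D (restr A h + restr (- A) h) (restr A k)" by (rule deriv2_add[OF C2 a r(1,2,3), symmetric])
 finally show ?thesis by (simp only: restr_decompose)
qed

lemma deriv2_cost_local:
 fixes P :: "('v::{banach,second_countable_topology}, 'h::{real_inner,banach}, 'u::{real_inner,banach}) ocp"
 assumes P: "ocp_assms P T" and a: "a \<in> XU T"
  and \<phi>: "smooth \<phi>"
 shows deriv_xx_local: "h \<in> L2 T \<Longrightarrow> h' \<in> L2 T \<Longrightarrow>
   deriv_xx T (cost P T) a (\<lambda>t. \<phi> t *\<^sub>R h t) h' = deriv_xx T (cost P T) a h (\<lambda>t. \<phi> t *\<^sub>R h' t)"
  and deriv_uu_local: "k \<in> L2 T \<Longrightarrow> k' \<in> L2 T \<Longrightarrow>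
   deriv_uu T (cost P T) a (\<lambda>t. \<phi> t *\<^sub>R k t) k' = deriv_uu T (cost P T) a k (\<lambda>t. \<phi> t *\<^sub>R k' t)"
proof -
 interpret seminormed "XU T" "XUnorm T" by (rule XU_seminormed)
 have C2: "C2_on (XU T) (XUnorm T) (cost P T)" using P by (simp add: ocp_assms_def)
 let ?D = "deriv2 (XU T) (XUnorm T) (cost P T) a"
 obtain C where C: "0 \<le> C" "\<And>h k. h \<in> XU T \<Longrightarrow> k \<in> XU T \<Longrightarrow> \<bar>?D h k\<bar> \<le> C * XUnorm T h * XUnorm T k"
  using deriv2_bounded[OF C2 a] by blast
 have x: "(h, 0) \<in> XU T" if "h \<in> L2 T" for h :: "real \<Rightarrow> 'v" using that by (simp add: XU_def)
 have u: "(0, k) \<in> XU T" if "k \<in> L2 T" for k :: "real \<Rightarrow> 'u" using that by (simp add: XU_def)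
 have rx: "restr A (h, 0) = ((\<lambda>t. indicator A t *\<^sub>R h t), 0)" for A and h :: "real \<Rightarrow> 'v"
  by (simp add: restr_def zero_fun_def)
 have ru: "restr A (0, k) = (0, (\<lambda>t. indicator A t *\<^sub>R k t))" for A and k :: "real \<Rightarrow> 'u"
  by (simp add: restr_def zero_fun_def)
 have lin: "?D h (k + k') = ?D h k + ?D h k'" "?D h (c *\<^sub>R k) = c * ?D h k"
  if "h \<in> XU T" "k \<in> XU T" "k' \<in> XU T" for h k k' c
  using bounded_linear_on_functional[OF deriv2_dual[OF C2 a that(1) that(1) that(2)]] that by auto
 show "deriv_xx T (cost P T) a (\<lambda>t. \<phi> t *\<^sub>R h t) h' = deriv_xx T (cost P T) a h (\<lambda>t. \<phi> t *\<^sub>R h' t)"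
  if h: "h \<in> L2 T" "h' \<in> L2 T"
 proof (rule L2_local_form[where \<beta> = "deriv_xx T (cost P T) a", OF _ _ _ _ C(1) _ _ \<phi> h])
  fix f g w :: "real \<Rightarrow> 'v" and c A
  assume f: "f \<in> L2 T" and w: "w \<in> L2 T"
  show "deriv_xx T (cost P T) a (c *\<^sub>R f) w = c * deriv_xx T (cost P T) a f w"
   using deriv2_scale[OF C2 a x[OF f] x[OF f] x[OF w], of c] by (simp add: deriv_xx_def)
  show "deriv_xx T (cost P T) a w (c *\<^sub>R f) = c * deriv_xx T (cost P T) a w f"
   using lin(2)[OF x[OF w] x[OF f] x[OF f], of c] by (simp add: deriv_xx_def)
  show "\<bar>deriv_xx T (cost P T) a f w\<bar> \<le> C * L2norm T f * L2norm T w"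
   using C(2)[OF x[OF f] x[OF w]] by (simp add: deriv_xx_def)
  show "deriv_xx T (cost P T) a (\<lambda>t. indicator A t *\<^sub>R f t) w = deriv_xx T (cost P T) a f (\<lambda>t. indicator A t *\<^sub>R w t)"
   if "A \<in> sets lebesgue"
   using deriv2_cost_restr[OF P that a x[OF f] x[OF w]] by (simp add: deriv_xx_def rx)
  assume g: "g \<in> L2 T"
  show "deriv_xx T (cost P T) a (f + g) w = deriv_xx T (cost P T) a f w + deriv_xx T (cost P T) a g w"
   using deriv2_add[OF C2 a x[OF f] x[OF g] x[OF w]] by (simp add: deriv_xx_def)
  show "deriv_xx T (cost P T) a w (f + g) = deriv_xx T (cost P T) a w f + deriv_xx T (cost P T) a w g"
   using lin(1)[OF x[OF w] x[OF f] x[OF g]] by (simp add: deriv_xx_def)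
 qed
 show "deriv_uu T (cost P T) a (\<lambda>t. \<phi> t *\<^sub>R k t) k' = deriv_uu T (cost P T) a k (\<lambda>t. \<phi> t *\<^sub>R k' t)"
  if k: "k \<in> L2 T" "k' \<in> L2 T"
 proof (rule L2_local_form[where \<beta> = "deriv_uu T (cost P T) a", OF _ _ _ _ C(1) _ _ \<phi> k])
  fix f g w :: "real \<Rightarrow> 'u" and c A
  assume f: "f \<in> L2 T" and w: "w \<in> L2 T"
  show "deriv_uu T (cost P T) a (c *\<^sub>R f) w = c * deriv_uu T (cost P T) a f w"
   using deriv2_scale[OF C2 a u[OF f] u[OF f] u[OF w], of c] by (simp add: deriv_uu_def)
  show "deriv_uu T (cost P T) a w (c *\<^sub>R f) = c * deriv_uu T (cost P T) a w f"
   using lin(2)[OF u[OF w] u[OF f] u[OF f], of c] by (simp add: deriv_uu_def)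
  show "\<bar>deriv_uu T (cost P T) a f w\<bar> \<le> C * L2norm T f * L2norm T w"
   using C(2)[OF u[OF f] u[OF w]] by (simp add: deriv_uu_def)
  show "deriv_uu T (cost P T) a (\<lambda>t. indicator A t *\<^sub>R f t) w = deriv_uu T (cost P T) a f (\<lambda>t. indicator A t *\<^sub>R w t)"
   if "A \<in> sets lebesgue"
   using deriv2_cost_restr[OF P that a u[OF f] u[OF w]] by (simp add: deriv_uu_def ru)
  assume g: "g \<in> L2 T"
  show "deriv_uu T (cost P T) a (f + g) w = deriv_uu T (cost P T) a f w + deriv_uu T (cost P T) a g w"
   using deriv2_add[OF C2 a u[OF f] u[OF g] u[OF w]] by (simp add: deriv_uu_def)
  show "deriv_uu T (cost P T) a w (f + g) = deriv_uu T (cost P T) a w f + deriv_uu T (cost P T) a w g"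
   using lin(1)[OF u[OF w] u[OF f] u[OF g]] by (simp add: deriv_uu_def)
 qed
qed

text \<open>The perturbation functional \<open>cost P \<tau>\<close> is expressed by the derivative of the full cost, which is the
 only one that is known to exist: an increment up to time \<open>\<tau>\<close> is an increment of the full cost in the
 direction that is cut off at \<open>\<tau>\<close>.\<close>

lemma deriv_cost_truncated:
 fixes P :: "('v::{banach,second_countable_topology}, 'h::{real_inner,banach}, 'u::{real_inner,banach}) ocp"
 assumes P: "ocp_assms P T" and a: "a \<in> XU T" and \<tau>: "\<tau> \<le> T"
 shows "h \<in> L2 T \<Longrightarrow> deriv_x T (cost P \<tau>) a h = deriv_x T (cost P T) a (\<lambda>t. indicator {0..\<tau>} t *\<^sub>R h t)"
  and "k \<in> L2 T \<Longrightarrow> deriv_u T (cost P \<tau>) a k = deriv_u T (cost P T) a (\<lambda>t. indicator {0..\<tau>} t *\<^sub>R k t)"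
proof -
 interpret seminormed "XU T" "XUnorm T" by (rule XU_seminormed)
 have C2: "C2_on (XU T) (XUnorm T) (cost P T)" using P by (simp add: ocp_assms_def)
 let ?d = "deriv1 (XU T) (XUnorm T) (cost P T) a" and ?A = "{0..\<tau>}"
 have A: "?A \<in> sets lebesgue" by simp
 have F: "has_frechet_on (XU T) (XUnorm T) UNIV norm (cost P T) ?d a" by (rule C2_deriv1[OF C2 a])
 have rn: "XUnorm T (restr ?A h) \<le> XUnorm T h" if "h \<in> XU T" for h :: "('v, 'u) control_pair"
  using that L2norm_restrict_le[of "fst h" T ?A] L2norm_restrict_le[of "snd h" T ?A]
  by (auto simp: XUnorm_def restr_def XU_def intro!: add_mono power_mono)
 have diff: "cost P \<tau> (a + h) - cost P \<tau> a = cost P T (a + restr ?A h) - cost P T a" if h: "h \<in> XU T" for h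
 proof -
  let ?f = "\<lambda>b t. Jbar P t (fst b t) (snd b t)"
  have c: "cost P s b = (LINT t|MT s. ?f b t)" for b s by (simp add: cost_def split_def)
  note i = cost_integrable[OF P]
  have ah: "a + h \<in> XU T" "a + restr ?A h \<in> XU T" using a h restr_XU[OF A h] by auto
  have i\<tau>: "integrable (MT \<tau>) (?f b)" if "b \<in> XU T" for b
   by (rule integrable_subinterval[OF i[OF that]]) (use \<tau> in auto)
  have "cost P \<tau> (a + h) - cost P \<tau> a = (LINT t|MT \<tau>. ?f (a + h) t - ?f a t)"
   unfolding c by (rule Bochner_Integration.integral_diff[OF i\<tau>[OF ah(1)] i\<tau>[OF a], symmetric])
  also have "\<dots> = (LINT t|lebesgue. indicator {0..\<tau>} t *\<^sub>R (?f (a + h) t - ?f a t))"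
   by (rule integral_restrict_space) simp
  also have "\<dots> = (LINT t|lebesgue. indicator {0..T} t *\<^sub>R (?f (a + restr ?A h) t - ?f a t))"
  proof (intro Bochner_Integration.integral_cong refl)
   fix t
   show "indicator {0..\<tau>} t *\<^sub>R (?f (a + h) t - ?f a t) = indicator {0..T} t *\<^sub>R (?f (a + restr ?A h) t - ?f a t)"
    using \<tau> by (cases "t \<in> {0..\<tau>}") (auto simp: restr_def)
  qed
  also have "\<dots> = (LINT t|MT T. ?f (a + restr ?A h) t - ?f a t)"
   by (rule integral_restrict_space[symmetric]) simp
  also have "\<dots> = cost P T (a + restr ?A h) - cost P T a"
   unfolding c by (rule Bochner_Integration.integral_diff[OF i[OF ah(2)] i[OF a]])
  finally show ?thesis .
 qed
 have fr: "has_frechet_on (XU T) (XUnorm T) UNIV norm (cost P \<tau>) (\<lambda>h. ?d (restr ?A h)) a"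
  unfolding has_frechet_on_def
 proof (intro conjI allI impI)
  have bl: "bounded_linear_on (XU T) (XUnorm T) UNIV norm ?d" using F by (simp add: has_frechet_on_def)
  obtain C where C: "0 \<le> C" "\<And>h. h \<in> XU T \<Longrightarrow> \<bar>?d h\<bar> \<le> C * XUnorm T h"
   using bounded_linear_on_functional(3)[OF bl] by blast
  show "bounded_linear_on (XU T) (XUnorm T) UNIV norm (\<lambda>h. ?d (restr ?A h))"
  proof (rule bounded_linear_on_functionalI[OF _ _ C(1)])
   show "\<bar>?d (restr ?A h)\<bar> \<le> C * XUnorm T h" if "h \<in> XU T" for h
    using C(2)[OF restr_XU[OF A that]] mult_left_mono[OF rn[OF that] C(1)] by linarith
   show "?d (restr ?A (h + k)) = ?d (restr ?A h) + ?d (restr ?A k)" if "h \<in> XU T" "k \<in> XU T" for h k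
    unfolding restr_add by (rule bounded_linear_on_functional(1)[OF bl restr_XU[OF A that(1)] restr_XU[OF A that(2)]])
   show "?d (restr ?A (c *\<^sub>R h)) = c * ?d (restr ?A h)" if "h \<in> XU T" for c h
    unfolding restr_scale by (rule bounded_linear_on_functional(2)[OF bl restr_XU[OF A that]])
  qed
  fix \<epsilon> :: real assume \<epsilon>: "0 < \<epsilon>"
  obtain \<delta> where \<delta>: "0 < \<delta>" "\<And>h. h \<in> XU T \<Longrightarrow> XUnorm T h < \<delta> \<Longrightarrow> norm (cost P T (a + h) - cost P T a - ?d h) \<le> \<epsilon> * XUnorm T h"
   using F \<epsilon> unfolding has_frechet_on_def by blast
  have "norm (cost P \<tau> (a + h) - cost P \<tau> a - ?d (restr ?A h)) \<le> \<epsilon> * XUnorm T h" if h: "h \<in> XU T" "XUnorm T h < \<delta>" for h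
  proof -
   have "norm (cost P T (a + restr ?A h) - cost P T a - ?d (restr ?A h)) \<le> \<epsilon> * XUnorm T (restr ?A h)"
    by (rule \<delta>(2)[OF restr_XU[OF A h(1)]]) (use rn[OF h(1)] h(2) in simp)
   also have "\<dots> \<le> \<epsilon> * XUnorm T h" using rn[OF h(1)] \<epsilon> by simp
   finally show ?thesis unfolding diff[OF h(1)] .
  qed
  with \<delta>(1) show "\<exists>\<delta>>0. \<forall>h\<in>XU T. XUnorm T h < \<delta> \<longrightarrow> norm (cost P \<tau> (a + h) - cost P \<tau> a - ?d (restr ?A h)) \<le> \<epsilon> * XUnorm T h"
   by blast
 qed
 show "deriv_x T (cost P \<tau>) a h = deriv_x T (cost P T) a (\<lambda>t. indicator ?A t *\<^sub>R h t)" if "h \<in> L2 T"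
  using deriv1_eq[OF fr a, of "(h, 0)"] that by (simp add: deriv_x_def restr_def XU_def zero_fun_def)
 show "deriv_u T (cost P \<tau>) a k = deriv_u T (cost P T) a (\<lambda>t. indicator ?A t *\<^sub>R k t)" if "k \<in> L2 T"
  using deriv1_eq[OF fr a, of "(0, k)"] that by (simp add: deriv_u_def restr_def XU_def zero_fun_def)
qed

lemma deriv_cost_bounded:
 fixes P :: "('v::{banach,second_countable_topology}, 'h::{real_inner,banach}, 'u::{real_inner,banach}) ocp"
 assumes P: "ocp_assms P T" and a: "a \<in> XU T"
 shows "bounded_linear_on (L2 T) (L2norm T) UNIV norm (deriv_x T (cost P T) a)"
  and "bounded_linear_on (L2 T) (L2norm T) UNIV norm (deriv_u T (cost P T) a)"
proof -
 interpret seminormed "XU T" "XUnorm T" by (rule XU_seminormed)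
 have C2: "C2_on (XU T) (XUnorm T) (cost P T)" using P by (simp add: ocp_assms_def)
 have bl: "bounded_linear_on (XU T) (XUnorm T) UNIV norm (deriv1 (XU T) (XUnorm T) (cost P T) a)"
  using C2_deriv1[OF C2 a] by (simp add: has_frechet_on_def)
 note l = bounded_linear_on_functional[OF bl]
 obtain C where C: "0 \<le> C" "\<And>h. h \<in> XU T \<Longrightarrow> \<bar>deriv1 (XU T) (XUnorm T) (cost P T) a h\<bar> \<le> C * XUnorm T h"
  using l(3) by blast
 show "bounded_linear_on (L2 T) (L2norm T) UNIV norm (deriv_x T (cost P T) a)"
 proof (rule bounded_linear_on_functionalI[OF _ _ C(1)])
  fix f g :: "real \<Rightarrow> 'v" and c assume f: "f \<in> L2 T"
  show "deriv_x T (cost P T) a (c *\<^sub>R f) = c * deriv_x T (cost P T) a f"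
   using l(2)[of "(f, 0)" c] f by (simp add: deriv_x_def XU_def)
  show "\<bar>deriv_x T (cost P T) a f\<bar> \<le> C * L2norm T f"
   using C(2)[of "(f, 0)"] f by (simp add: deriv_x_def XU_def)
  assume "g \<in> L2 T"
  then show "deriv_x T (cost P T) a (f + g) = deriv_x T (cost P T) a f + deriv_x T (cost P T) a g"
   using l(1)[of "(f, 0)" "(g, 0)"] f by (simp add: deriv_x_def XU_def)
 qed
 show "bounded_linear_on (L2 T) (L2norm T) UNIV norm (deriv_u T (cost P T) a)"
 proof (rule bounded_linear_on_functionalI[OF _ _ C(1)])
  fix f g :: "real \<Rightarrow> 'u" and c assume f: "f \<in> L2 T"
  show "deriv_u T (cost P T) a (c *\<^sub>R f) = c * deriv_u T (cost P T) a f"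
   using l(2)[of "(0, f)" c] f by (simp add: deriv_u_def XU_def)
  show "\<bar>deriv_u T (cost P T) a f\<bar> \<le> C * L2norm T f"
   using C(2)[of "(0, f)"] f by (simp add: deriv_u_def XU_def)
  assume "g \<in> L2 T"
  then show "deriv_u T (cost P T) a (f + g) = deriv_u T (cost P T) a f + deriv_u T (cost P T) a g"
   using l(1)[of "(0, f)" "(0, g)"] f by (simp add: deriv_u_def XU_def)
 qed
qed

section \<open>Operators and coercive forms on \<open>L\<^sub>2\<close>\<close>

lemma L2_inner_cong_AE:
 assumes "AE t in MT T. f t = g t" "f \<in> L2 T" "h \<in> L2 T"
 shows "L2_inner T f h = L2_inner T g h"
 unfolding L2_inner_def
proof (rule integral_cong_AE)
 have "g \<in> L2 T" using assms by (blast intro: L2_cong_AE)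
 then show "(\<lambda>t. g t \<bullet> h t) \<in> borel_measurable (MT T)"
  using integrable_L2_inner assms(3) borel_measurable_integrable by blast
 show "(\<lambda>t. f t \<bullet> h t) \<in> borel_measurable (MT T)"
  using integrable_L2_inner assms(2,3) borel_measurable_integrable by blast
 show "AE t in MT T. f t \<bullet> h t = g t \<bullet> h t" using assms(1) by eventually_elim simp
qed

lemma subspace_L2: "subspace (L2 T)"
 by (simp add: subspace_def L2_add L2_scaleR)

lemma
 fixes F :: "(real \<Rightarrow> 'a::real_normed_vector) \<Rightarrow> (real \<Rightarrow> 'b::real_normed_vector)"
 assumes F: "L2_operator T F"
 shows L2_operator_L2: "f \<in> L2 T \<Longrightarrow> F f \<in> L2 T"
  and L2_operator_bound: "L2_opnorm T F \<le> \<kappa> \<Longrightarrow> f \<in> L2 T \<Longrightarrow> L2norm T (F f) \<le> \<kappa> * L2norm T f"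
  and L2_operator_add: "f \<in> L2 T \<Longrightarrow> g \<in> L2 T \<Longrightarrow> AE t in MT T. F (f + g) t = (F f + F g) t"
  and L2_operator_scaleR: "f \<in> L2 T \<Longrightarrow> AE t in MT T. F (c *\<^sub>R f) t = (c *\<^sub>R F f) t"
proof -
 show F': "F f \<in> L2 T" if "f \<in> L2 T" for f using F that by (simp add: bounded_linear_on_def)
 show "L2norm T (F f) \<le> \<kappa> * L2norm T f" if k: "L2_opnorm T F \<le> \<kappa>" and f: "f \<in> L2 T"
 proof -
  have "L2norm T (F f) \<le> L2_opnorm T F * L2norm T f"
   by (rule op_norm_bound) (use F f in \<open>auto simp: bounded_linear_on_def\<close>)
  also have "\<dots> \<le> \<kappa> * L2norm T f" by (rule mult_right_mono[OF k]) simp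
  finally show ?thesis .
 qed
 have z: "AE t in MT T. a t = b t" if "L2norm T (a - b) = 0" "a \<in> L2 T" "b \<in> L2 T" for a b :: "real \<Rightarrow> 'b"
  using that(1) L2norm_zero_iff[OF L2_diff[OF that(2,3)]] by simp
 show "AE t in MT T. F (f + g) t = (F f + F g) t" if "f \<in> L2 T" "g \<in> L2 T"
  by (rule z[OF _ F'[OF L2_add[OF that]] L2_add[OF F'[OF that(1)] F'[OF that(2)]]])
    (use F that in \<open>simp add: bounded_linear_on_def\<close>)
 show "AE t in MT T. F (c *\<^sub>R f) t = (c *\<^sub>R F f) t" if "f \<in> L2 T"
  by (rule z[OF _ F'[OF L2_scaleR[OF that]] L2_scaleR[OF F'[OF that]]])
    (use F that in \<open>simp add: bounded_linear_on_def\<close>)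
qed

lemma
 fixes F :: "(real \<Rightarrow> 'a::real_normed_vector) \<Rightarrow> (real \<Rightarrow> 'b::real_normed_vector \<Rightarrow>\<^sub>L real)"
 assumes F: "L2_operator T F" and z: "z \<in> L2 T"
 shows L2_operator_pair_add: "f \<in> L2 T \<Longrightarrow> g \<in> L2 T \<Longrightarrow> L2_pair T (F (f + g)) z = L2_pair T (F f) z + L2_pair T (F g) z"
  and L2_operator_pair_scaleR: "f \<in> L2 T \<Longrightarrow> L2_pair T (F (c *\<^sub>R f)) z = c * L2_pair T (F f) z"
  and L2_operator_pair_bound: "L2_opnorm T F \<le> \<kappa> \<Longrightarrow> f \<in> L2 T \<Longrightarrow> \<bar>L2_pair T (F f) z\<bar> \<le> \<kappa> * (L2norm T f * L2norm T z)"
proof -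
 note F' = L2_operator_L2[OF F]
 show "L2_pair T (F (f + g)) z = L2_pair T (F f) z + L2_pair T (F g) z" if fg: "f \<in> L2 T" "g \<in> L2 T"
  by (rule trans[OF L2_pair_cong_AE[OF L2_operator_add[OF F fg] F'[OF L2_add[OF fg]] z]
   L2_pair_add_left[OF F'[OF fg(1)] F'[OF fg(2)] z]])
 show "L2_pair T (F (c *\<^sub>R f)) z = c * L2_pair T (F f) z" if f: "f \<in> L2 T"
  by (rule trans[OF L2_pair_cong_AE[OF L2_operator_scaleR[OF F f] F'[OF L2_scaleR[OF f]] z] L2_pair_scaleR_left])
 show "\<bar>L2_pair T (F f) z\<bar> \<le> \<kappa> * (L2norm T f * L2norm T z)" if k: "L2_opnorm T F \<le> \<kappa>" and f: "f \<in> L2 T"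
 proof -
  have "\<bar>L2_pair T (F f) z\<bar> \<le> L2norm T (F f) * L2norm T z" by (rule L2_pair_bound[OF F'[OF f] z])
  also have "\<dots> \<le> (\<kappa> * L2norm T f) * L2norm T z" by (rule mult_right_mono[OF L2_operator_bound[OF F k f]]) simp
  finally show ?thesis by (simp add: mult.assoc)
 qed
qed

lemma
 fixes F :: "(real \<Rightarrow> 'a::real_normed_vector) \<Rightarrow> (real \<Rightarrow> 'b::real_inner)"
 assumes F: "L2_operator T F" and z: "z \<in> L2 T"
 shows L2_operator_inner_add: "f \<in> L2 T \<Longrightarrow> g \<in> L2 T \<Longrightarrow> L2_inner T (F (f + g)) z = L2_inner T (F f) z + L2_inner T (F g) z"
  and L2_operator_inner_scaleR: "f \<in> L2 T \<Longrightarrow> L2_inner T (F (c *\<^sub>R f)) z = c * L2_inner T (F f) z"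
  and L2_operator_inner_bound: "L2_opnorm T F \<le> \<kappa> \<Longrightarrow> f \<in> L2 T \<Longrightarrow> \<bar>L2_inner T (F f) z\<bar> \<le> \<kappa> * (L2norm T f * L2norm T z)"
proof -
 note F' = L2_operator_L2[OF F]
 show "L2_inner T (F (f + g)) z = L2_inner T (F f) z + L2_inner T (F g) z" if fg: "f \<in> L2 T" "g \<in> L2 T"
  by (rule trans[OF L2_inner_cong_AE[OF L2_operator_add[OF F fg] F'[OF L2_add[OF fg]] z]
   L2_inner_add_left[OF F'[OF fg(1)] F'[OF fg(2)] z]])
 show "L2_inner T (F (c *\<^sub>R f)) z = c * L2_inner T (F f) z" if f: "f \<in> L2 T"
  by (rule trans[OF L2_inner_cong_AE[OF L2_operator_scaleR[OF F f] F'[OF L2_scaleR[OF f]] z] L2_inner_scaleR_left])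
 show "\<bar>L2_inner T (F f) z\<bar> \<le> \<kappa> * (L2norm T f * L2norm T z)" if k: "L2_opnorm T F \<le> \<kappa>" and f: "f \<in> L2 T"
 proof -
  have "\<bar>L2_inner T (F f) z\<bar> \<le> L2norm T (F f) * L2norm T z" by (rule L2_inner_bound[OF F'[OF f] z])
  also have "\<dots> \<le> (\<kappa> * L2norm T f) * L2norm T z" by (rule mult_right_mono[OF L2_operator_bound[OF F k f]]) simp
  finally show ?thesis by (simp add: mult.assoc)
 qed
qed

text \<open>An operator that is additive and bounded up to functions of norm zero respects equality almost
 everywhere, as is needed to compose two of them.\<close>

lemma L2_operator_cong_AE:
 fixes F :: "(real \<Rightarrow> 'a::real_normed_vector) \<Rightarrow> (real \<Rightarrow> 'b::real_normed_vector)"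
 assumes F: "L2_operator T F" and f: "f \<in> L2 T" and g: "g \<in> L2 T" and ae: "AE t in MT T. f t = g t"
 shows "AE t in MT T. F f t = F g t"
proof -
 note d = L2_diff[OF f g]
 have "AE t in MT T. (f - g) t = 0" using ae by eventually_elim simp
 then have "L2norm T (f - g) = 0" using L2norm_zero_iff[OF d] by simp
 then have "L2norm T (F (f - g)) \<le> 0" using L2_operator_bound[OF F order_refl d] by simp
 then have "L2norm T (F (f - g)) = 0" using L2norm_nonneg[of T "F (f - g)"] by simp
 then have z: "AE t in MT T. F (f - g) t = 0" using L2norm_zero_iff[OF L2_operator_L2[OF F d]] by simp
 have "AE t in MT T. F ((f - g) + g) t = (F (f - g) + F g) t" by (rule L2_operator_add[OF F d g])
 then have "AE t in MT T. F f t = (F (f - g) + F g) t" by simp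
 then show ?thesis using z by eventually_elim simp
qed

lemma L2_operatorI:
 fixes F :: "(real \<Rightarrow> 'a::real_normed_vector) \<Rightarrow> (real \<Rightarrow> 'b::real_normed_vector)"
 assumes L: "\<And>f. f \<in> L2 T \<Longrightarrow> F f \<in> L2 T"
  and add: "\<And>f g. f \<in> L2 T \<Longrightarrow> g \<in> L2 T \<Longrightarrow> AE t in MT T. F (f + g) t = (F f + F g) t"
  and scale: "\<And>c f. f \<in> L2 T \<Longrightarrow> AE t in MT T. F (c *\<^sub>R f) t = (c *\<^sub>R F f) t"
  and K: "0 \<le> K" "\<And>f. f \<in> L2 T \<Longrightarrow> L2norm T (F f) \<le> K * L2norm T f"
 shows "L2_operator T F"
proof -
 have z: "L2norm T (a - b) = 0" if "AE t in MT T. a t = b t" "a \<in> L2 T" "b \<in> L2 T" for a b :: "real \<Rightarrow> 'b"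
 proof -
  have "AE t in MT T. (a - b) t = 0" using that(1) by eventually_elim simp
  then show ?thesis using L2norm_zero_iff[OF L2_diff[OF that(2,3)]] by simp
 qed
 have "K \<in> op_bounds (L2 T) (L2norm T) (L2norm T) F" using K by (simp add: op_bounds_def)
 then have ne: "op_bounds (L2 T) (L2norm T) (L2norm T) F \<noteq> {}" by blast
 show ?thesis unfolding bounded_linear_on_def
 proof (intro conjI ballI allI ne)
  show "F f \<in> L2 T" if "f \<in> L2 T" for f by (rule L[OF that])
  show "L2norm T (F (f + g) - (F f + F g)) = 0" if "f \<in> L2 T" "g \<in> L2 T" for f g
   by (rule z[OF add[OF that] L[OF L2_add[OF that]] L2_add[OF L[OF that(1)] L[OF that(2)]]])
  show "L2norm T (F (c *\<^sub>R f) - c *\<^sub>R F f) = 0" if "f \<in> L2 T" for f c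
   by (rule z[OF scale[OF that] L[OF L2_scaleR[OF that]] L2_scaleR[OF L[OF that]]])
 qed
qed

lemma L2_operator_compose:
 fixes F :: "(real \<Rightarrow> 'a::real_normed_vector) \<Rightarrow> (real \<Rightarrow> 'b::real_normed_vector)"
  and G :: "(real \<Rightarrow> 'b) \<Rightarrow> (real \<Rightarrow> 'c::real_normed_vector)"
 assumes F: "L2_operator T F" and G: "L2_operator T G"
 shows "L2_operator T (\<lambda>f. G (F f))"
proof (rule L2_operatorI)
 note F' = L2_operator_L2[OF F] and G' = L2_operator_L2[OF G]
 show "G (F f) \<in> L2 T" if "f \<in> L2 T" for f by (rule G'[OF F'[OF that]])
 show "AE t in MT T. G (F (f + g)) t = (G (F f) + G (F g)) t" if fg: "f \<in> L2 T" "g \<in> L2 T" for f g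
  using L2_operator_cong_AE[OF G F'[OF L2_add[OF fg]] L2_add[OF F'[OF fg(1)] F'[OF fg(2)]] L2_operator_add[OF F fg]]
   L2_operator_add[OF G F'[OF fg(1)] F'[OF fg(2)]] by eventually_elim (rule trans)
 show "AE t in MT T. G (F (c *\<^sub>R f)) t = (c *\<^sub>R G (F f)) t" if f: "f \<in> L2 T" for c f
  using L2_operator_cong_AE[OF G F'[OF L2_scaleR[OF f]] L2_scaleR[OF F'[OF f]] L2_operator_scaleR[OF F f]]
   L2_operator_scaleR[OF G F'[OF f]] by eventually_elim (rule trans)
 let ?F = "L2_opnorm T F" and ?G = "L2_opnorm T G"
 have nn: "0 \<le> ?F" "0 \<le> ?G" using F G by (auto intro!: op_norm_nonneg simp: bounded_linear_on_def)
 then show "0 \<le> ?G * ?F" by simp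
 show "L2norm T (G (F f)) \<le> ?G * ?F * L2norm T f" if f: "f \<in> L2 T" for f
  using L2_operator_bound[OF G order_refl F'[OF f]]
   mult_left_mono[OF L2_operator_bound[OF F order_refl f] nn(2)] by simp
qed

lemma semi_hilbert_L2:
 fixes b :: "(real \<Rightarrow> 'b::banach) \<Rightarrow> (real \<Rightarrow> 'b) \<Rightarrow> real"
 assumes add: "\<And>x y z. x \<in> L2 T \<Longrightarrow> y \<in> L2 T \<Longrightarrow> z \<in> L2 T \<Longrightarrow> b (x + y) z = b x z + b y z"
  and scale: "\<And>c x z. x \<in> L2 T \<Longrightarrow> z \<in> L2 T \<Longrightarrow> b (c *\<^sub>R x) z = c * b x z"
  and comm: "\<And>x z. x \<in> L2 T \<Longrightarrow> z \<in> L2 T \<Longrightarrow> b x z = b z x"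
  and m: "0 < m" "\<And>f. f \<in> L2 T \<Longrightarrow> m * (L2norm T f)\<^sup>2 \<le> b f f"
  and M: "\<And>f. f \<in> L2 T \<Longrightarrow> b f f \<le> M * (L2norm T f)\<^sup>2"
 shows "semi_hilbert (L2 T) b"
proof
 show "subspace (L2 T :: (real \<Rightarrow> 'b) set)" by (rule subspace_L2)
 have nonneg: "0 \<le> b x x" if "x \<in> L2 T" for x
 proof -
  have "0 \<le> m * (L2norm T x)\<^sup>2" using m(1) by simp
  then show ?thesis using m(2)[OF that] by linarith
 qed
 show "0 \<le> b x x" if "x \<in> L2 T" for x by (rule nonneg[OF that])
 fix f :: "nat \<Rightarrow> real \<Rightarrow> 'b"
 assume f: "\<And>n. f n \<in> L2 T"
  and cau: "\<And>e. 0 < e \<Longrightarrow> \<exists>N. \<forall>m\<ge>N. \<forall>n\<ge>N. b (f m - f n) (f m - f n) < e"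
 have "\<exists>g\<in>L2 T. (\<lambda>n. L2norm T (f n - g)) \<longlonglongrightarrow> 0"
 proof (rule L2_complete[OF f])
  fix e :: real assume e: "0 < e"
  obtain N where N: "\<forall>i\<ge>N. \<forall>j\<ge>N. b (f i - f j) (f i - f j) < m * e\<^sup>2"
   using cau[of "m * e\<^sup>2"] m(1) e by auto
  have "L2norm T (f i - f j) < e" if "i \<ge> N" "j \<ge> N" for i j
  proof -
   have "m * (L2norm T (f i - f j))\<^sup>2 < m * e\<^sup>2"
    using N[rule_format, OF that] m(2)[OF L2_diff[OF f[of i] f[of j]]] by linarith
   then have "(L2norm T (f i - f j))\<^sup>2 < e\<^sup>2" using m(1) by simp
   then show ?thesis using e by (simp add: power2_less_imp_less)
  qed
  then show "\<exists>N. \<forall>m\<ge>N. \<forall>n\<ge>N. L2norm T (f m - f n) < e" by blast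
 qed
 then obtain g where g: "g \<in> L2 T" "(\<lambda>n. L2norm T (f n - g)) \<longlonglongrightarrow> 0" by blast
 have "(\<lambda>n. b (f n - g) (f n - g)) \<longlonglongrightarrow> 0"
 proof (rule Lim_null_comparison)
  show "(\<lambda>n. M * (L2norm T (f n - g))\<^sup>2) \<longlonglongrightarrow> 0"
   using tendsto_mult_left[OF tendsto_power[OF g(2), of 2], of M] by simp
  show "\<forall>\<^sub>F n in sequentially. norm (b (f n - g) (f n - g)) \<le> M * (L2norm T (f n - g))\<^sup>2"
   using M[OF L2_diff[OF f g(1)]] nonneg[OF L2_diff[OF f g(1)]] by simp
 qed
 then show "\<exists>g\<in>L2 T. (\<lambda>n. b (f n - g) (f n - g)) \<longlonglongrightarrow> 0" using g(1) by blast
qed (use add scale comm in auto)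

text \<open>A bounded coercive form on \<open>L\<^sub>2(0,T;V)\<close>. Its symmetric part is an equivalent scalar product, so that
 \<open>L\<^sub>2(0,T;V)\<close> carries a Hilbert space structure although \<open>V\<close> is only a Banach space.\<close>

locale coercive_L2 =
 fixes T :: real and a :: "(real \<Rightarrow> 'b::banach) \<Rightarrow> (real \<Rightarrow> 'b) \<Rightarrow> real" and m M :: real
 assumes add: "x \<in> L2 T \<Longrightarrow> y \<in> L2 T \<Longrightarrow> z \<in> L2 T \<Longrightarrow> a (x + y) z = a x z + a y z"
  and scale: "x \<in> L2 T \<Longrightarrow> z \<in> L2 T \<Longrightarrow> a (c *\<^sub>R x) z = c * a x z"
  and add2: "x \<in> L2 T \<Longrightarrow> y \<in> L2 T \<Longrightarrow> z \<in> L2 T \<Longrightarrow> a z (x + y) = a z x + a z y"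
  and scale2: "x \<in> L2 T \<Longrightarrow> z \<in> L2 T \<Longrightarrow> a z (c *\<^sub>R x) = c * a z x"
  and m: "0 < m" "f \<in> L2 T \<Longrightarrow> m * (L2norm T f)\<^sup>2 \<le> a f f"
  and M: "0 \<le> M" "f \<in> L2 T \<Longrightarrow> g \<in> L2 T \<Longrightarrow> \<bar>a f g\<bar> \<le> M * (L2norm T f * L2norm T g)"
begin

definition sym where "sym f g = (a f g + a g f) / 2"

sublocale semi_hilbert "L2 T" sym
proof (rule semi_hilbert_L2[of _ _ m M])
 show "sym f f \<le> M * (L2norm T f)\<^sup>2" if "f \<in> L2 T" for f
  using M(2)[OF that that] by (simp add: power2_eq_square sym_def)
qed (use add add2 scale scale2 m in \<open>simp_all add: field_simps sym_def\<close>)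

lemma L2norm_le_nrm: "f \<in> L2 T \<Longrightarrow> L2norm T f \<le> nrm f / sqrt m"
proof -
 assume f: "f \<in> L2 T"
 have "sqrt (m * (L2norm T f)\<^sup>2) \<le> nrm f" using m(2)[OF f] by (intro real_sqrt_le_mono) (simp add: sym_def)
 then show ?thesis using m(1) by (simp add: real_sqrt_mult field_simps)
qed

lemma nrm_le_L2norm: "f \<in> L2 T \<Longrightarrow> nrm f \<le> sqrt M * L2norm T f"
proof -
 assume f: "f \<in> L2 T"
 have "sym f f \<le> M * (L2norm T f)\<^sup>2" using M(2)[OF f f] by (simp add: power2_eq_square sym_def)
 from real_sqrt_le_mono[OF this] show ?thesis by (simp add: real_sqrt_mult)
qed

text \<open>The Lax--Milgram theorem is Lions' theorem with the whole space as test space: coercivity is an inf-sup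
 bound.\<close>

lemma Lax_Milgram:
 assumes \<phi>: "bounded_linear_on (L2 T) (L2norm T) UNIV norm \<phi>"
 shows "\<exists>f\<in>L2 T. \<forall>h\<in>L2 T. a f h = \<phi> h"
proof -
 note l = bounded_linear_on_functional[OF \<phi>]
 obtain c where c: "0 \<le> c" "\<And>h. h \<in> L2 T \<Longrightarrow> \<bar>\<phi> h\<bar> \<le> c * L2norm T h" using l(3) by blast
 show ?thesis
 proof (rule lions[where K = "\<lambda>h. M * L2norm T h / sqrt m" and c = "c * sqrt M / m"])
  show "\<bar>a f h\<bar> \<le> M * L2norm T h / sqrt m * nrm f" if fh: "f \<in> L2 T" "h \<in> L2 T" for f h
  proof -
   have "\<bar>a f h\<bar> \<le> (M * L2norm T h) * L2norm T f" using M(2)[OF fh] by (simp add: mult_ac)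
   also have "\<dots> \<le> (M * L2norm T h) * (nrm f / sqrt m)"
    by (rule mult_left_mono[OF L2norm_le_nrm[OF fh(1)]]) (simp add: M(1))
   finally show ?thesis by simp
  qed
  show "\<bar>\<phi> h\<bar> \<le> c * sqrt M / m * N"
   if h: "h \<in> L2 T" and N: "0 \<le> N" "\<And>x. x \<in> L2 T \<Longrightarrow> \<bar>a x h\<bar> \<le> N * nrm x" for h N
  proof -
   have "m * (L2norm T h)\<^sup>2 \<le> N * nrm h" using m(2)[OF h] N(2)[OF h] by linarith
   also have "\<dots> \<le> N * (sqrt M * L2norm T h)" by (rule mult_left_mono[OF nrm_le_L2norm[OF h] N(1)])
   finally have "(m * L2norm T h) * L2norm T h \<le> (N * sqrt M) * L2norm T h"
    by (simp add: power2_eq_square mult.assoc)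
   then have "m * L2norm T h \<le> N * sqrt M" if "L2norm T h \<noteq> 0"
    using that L2norm_nonneg[of T h] by (simp add: mult_le_cancel_right)
   moreover have "m * L2norm T h \<le> N * sqrt M" if "L2norm T h = 0" using that N(1) M(1) by simp
   ultimately have "m * L2norm T h \<le> N * sqrt M" by blast
   then have "L2norm T h \<le> N * sqrt M / m" using m(1) by (simp add: field_simps)
   from mult_left_mono[OF this c(1)] show ?thesis using c(2)[OF h] by (simp add: mult_ac)
  qed
 qed (rule subspace_L2 add scale add2 scale2 l(1) l(2); assumption)+
qed

end

section \<open>The optimality system: uniform estimate\<close>

text \<open>The constants are defined explicitly as functions of \<open>\<alpha>\<close> and \<open>\<kappa>\<close>, as the whole argument rests on
 their independence of the horizon. \<open>output_const\<close> bounds the observed quantities, \<open>state_const\<close> the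
 solution in \<open>L\<^sub>2\<close> and at the endpoints, and \<open>solution_const\<close> the solution in \<open>W\<close>.\<close>

definition energy_const :: "real \<Rightarrow> real \<Rightarrow> real" where
 "energy_const \<alpha> \<kappa> = 1 + 1 / sqrt \<alpha> + 1 / \<alpha> + (1 / sqrt \<alpha> + 1 / \<alpha>) * (\<kappa> + \<kappa> / \<alpha> + \<kappa>\<^sup>2)"

definition output_const :: "real \<Rightarrow> real \<Rightarrow> real" where
 "output_const \<alpha> \<kappa> = 8 * energy_const \<alpha> \<kappa> + 1"

definition state_const :: "real \<Rightarrow> real \<Rightarrow> real" where
 "state_const \<alpha> \<kappa> = energy_const \<alpha> \<kappa> * (output_const \<alpha> \<kappa> + 1)"

definition solution_const :: "real \<Rightarrow> real \<Rightarrow> real" where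
 "solution_const \<alpha> \<kappa> = 2 * state_const \<alpha> \<kappa>
  + (\<kappa> + \<kappa>\<^sup>2) / \<alpha> * ((\<kappa>\<^sup>2 + 2 * \<kappa>) * state_const \<alpha> \<kappa> + \<kappa> * (output_const \<alpha> \<kappa> / \<alpha>) + 2)"

lemma energy_const_ge: "0 < \<alpha> \<Longrightarrow> 0 \<le> \<kappa> \<Longrightarrow> 1 \<le> energy_const \<alpha> \<kappa>"
 by (simp add: energy_const_def)

text \<open>Young's inequality absorbs the product \<open>w X\<close> into the coercive term.\<close>

lemma energy_absorb:
 fixes p w X r \<alpha> :: real
 assumes a: "0 < \<alpha>" and nn: "0 \<le> r" "0 \<le> X" and e: "p\<^sup>2 / 2 + \<alpha> * w\<^sup>2 \<le> r\<^sup>2 / 2 + w * X"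
 shows "w \<le> r / sqrt \<alpha> + X / \<alpha>" and "p \<le> r + X / sqrt \<alpha>"
proof -
 have pp: "0 \<le> p\<^sup>2" by simp
 have 1: "\<alpha> * w\<^sup>2 \<le> r\<^sup>2 / 2 + w * X" using e pp by linarith
 have "0 \<le> (\<alpha> * w - X)\<^sup>2 / (2 * \<alpha>)" using a by simp
 also have "\<dots> = \<alpha> * w\<^sup>2 / 2 - w * X + X\<^sup>2 / (2 * \<alpha>)"
  using a by (simp add: power2_eq_square field_simps)
 finally have 2: "w * X \<le> \<alpha> * w\<^sup>2 / 2 + X\<^sup>2 / (2 * \<alpha>)" by linarith
 have "\<alpha> * w\<^sup>2 \<le> r\<^sup>2 + X\<^sup>2 / \<alpha>" using 1 2 by (simp add: field_simps)
 then have "w\<^sup>2 \<le> r\<^sup>2 / \<alpha> + X\<^sup>2 / \<alpha>\<^sup>2" using a by (simp add: field_simps power2_eq_square)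
 also have "\<dots> \<le> (r / sqrt \<alpha> + X / \<alpha>)\<^sup>2"
  using a nn by (simp add: power2_sum power_divide)
 finally show "w \<le> r / sqrt \<alpha> + X / \<alpha>" by (rule power2_le_imp_le) (use a nn in simp)
 have 3: "0 \<le> (2 * \<alpha> * w - X)\<^sup>2 / (4 * \<alpha>)" using a by simp
 have 4: "(2 * \<alpha> * w - X)\<^sup>2 / (4 * \<alpha>) = \<alpha> * w\<^sup>2 - w * X + X\<^sup>2 / (4 * \<alpha>)"
  using a by (simp add: power2_eq_square field_simps)
 have 5: "0 \<le> X\<^sup>2 / (4 * \<alpha>)" using a by simp
 have 6: "X\<^sup>2 / \<alpha> = 4 * (X\<^sup>2 / (4 * \<alpha>))" by simp
 have "p\<^sup>2 \<le> r\<^sup>2 + X\<^sup>2 / \<alpha>" using e 3 4 5 6 by linarith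
 also have "\<dots> \<le> (r + X / sqrt \<alpha>)\<^sup>2"
  using a nn by (simp add: power2_sum power_divide)
 finally show "p \<le> r + X / sqrt \<alpha>" by (rule power2_le_imp_le) (use a nn in simp)
qed

text \<open>\<open>s\<close> is the size of the observed quantities \<open>(C v, R q)\<close>. The energy balances bound everything by
 \<open>r + s\<close>, and \<open>s\<^sup>2\<close> is at most \<open>r\<close> times the rest, so \<open>s\<close> is bounded by \<open>r\<close>.\<close>

lemma estimate_arithmetic:
 fixes w y p n r s \<alpha> \<kappa> :: real
 assumes a: "0 < \<alpha>" "0 \<le> \<kappa>" and nn: "0 \<le> r" "0 \<le> s"
  and s: "s\<^sup>2 \<le> r * (w + y + p + n)"
  and ev: "p\<^sup>2 / 2 + \<alpha> * w\<^sup>2 \<le> r\<^sup>2 / 2 + w * (r + (\<kappa> + \<kappa> / \<alpha> + \<kappa>\<^sup>2) * s)"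
  and ez: "n\<^sup>2 / 2 + \<alpha> * y\<^sup>2 \<le> r\<^sup>2 / 2 + y * (r + (\<kappa> + \<kappa> / \<alpha> + \<kappa>\<^sup>2) * s)"
 shows "w \<le> state_const \<alpha> \<kappa> * r" "y \<le> state_const \<alpha> \<kappa> * r" "p \<le> state_const \<alpha> \<kappa> * r" "n \<le> state_const \<alpha> \<kappa> * r"
  and "s \<le> output_const \<alpha> \<kappa> * r"
proof -
 define c where "c = \<kappa> + \<kappa> / \<alpha> + \<kappa>\<^sup>2"
 define X where "X = r + c * s"
 define E where "E = energy_const \<alpha> \<kappa>"
 have c: "0 \<le> c" using a by (simp add: c_def)
 have X: "0 \<le> X" using c nn by (simp add: X_def)
 have E1: "1 \<le> E" unfolding E_def by (rule energy_const_ge[OF a])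
 define b where "b = 1 / sqrt \<alpha>"
 define d where "d = 1 / \<alpha>"
 have bd: "0 \<le> b" "0 \<le> d" using a by (simp_all add: b_def d_def)
 have E: "E = 1 + b + d + (b + d) * c" by (simp add: E_def energy_const_def b_def d_def c_def)
 have bc: "0 \<le> b * c" "0 \<le> d * c" using bd c by simp_all
 have W: "r / sqrt \<alpha> + X / \<alpha> \<le> E * (r + s)"
 proof -
  have "r / sqrt \<alpha> + X / \<alpha> = (b + d) * r + (d * c) * s" by (simp add: b_def d_def X_def ring_distribs add_divide_distrib)
  also have "\<dots> \<le> E * r + E * s"
   by (intro add_mono mult_right_mono nn) (use bd bc in \<open>simp_all add: E algebra_simps\<close>)
  finally show ?thesis by (simp add: algebra_simps)
 qed
 have P: "r + X / sqrt \<alpha> \<le> E * (r + s)"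
 proof -
  have "r + X / sqrt \<alpha> = (1 + b) * r + (b * c) * s" by (simp add: b_def X_def ring_distribs add_divide_distrib)
  also have "\<dots> \<le> E * r + E * s"
   by (intro add_mono mult_right_mono nn) (use bd bc in \<open>simp_all add: E algebra_simps\<close>)
  finally show ?thesis by (simp add: algebra_simps)
 qed
 note ev' = energy_absorb[OF a(1) nn(1) X ev[folded c_def, folded X_def]]
 note ez' = energy_absorb[OF a(1) nn(1) X ez[folded c_def, folded X_def]]
 have b4: "w \<le> E * (r + s)" "y \<le> E * (r + s)" "p \<le> E * (r + s)" "n \<le> E * (r + s)"
  using ev' ez' W P by linarith+
 have "r * (w + y + p + n) \<le> r * (4 * (E * (r + s)))" by (rule mult_left_mono[OF _ nn(1)]) (use b4 in linarith)
 then have s2: "s\<^sup>2 \<le> 4 * E * r * (r + s)" using s by (simp add: algebra_simps)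
 have Er: "0 \<le> E * r" using E1 nn by simp
 have o: "s \<le> output_const \<alpha> \<kappa> * r"
 proof (cases "s \<le> r")
  case True then show ?thesis using Er by (simp add: output_const_def E_def[symmetric] algebra_simps)
 next
  case False
  then have s0: "0 < s" using nn(1) by linarith
  have "4 * (E * r) * (r + s) \<le> 4 * (E * r) * (2 * s)" by (rule mult_left_mono) (use False Er in auto)
  then have "s * s \<le> (8 * (E * r)) * s" using s2 by (simp add: power2_eq_square mult_ac)
  then have "s \<le> 8 * (E * r)" using s0 by (simp add: mult_le_cancel_right)
  then show ?thesis using nn(1) by (simp add: output_const_def E_def[symmetric] algebra_simps)
 qed
 then show "s \<le> output_const \<alpha> \<kappa> * r" .
 have "E * (r + s) \<le> E * (r + output_const \<alpha> \<kappa> * r)" by (rule mult_left_mono) (use o E1 in auto)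
 also have "\<dots> = state_const \<alpha> \<kappa> * r" by (simp add: state_const_def E_def algebra_simps)
 finally have F: "E * (r + s) \<le> state_const \<alpha> \<kappa> * r" .
 show "w \<le> state_const \<alpha> \<kappa> * r" "y \<le> state_const \<alpha> \<kappa> * r" "p \<le> state_const \<alpha> \<kappa> * r" "n \<le> state_const \<alpha> \<kappa> * r"
  using b4 F by linarith+
qed

text \<open>The linear-quadratic optimality system. Here \<open>A\<close> stands for \<open>A'(x)\<close>, and the second derivatives are
 present through their factors \<open>C\<close> and \<open>R\<close>.\<close>

locale lq_system =
 fixes \<iota> :: "'v::{banach,second_countable_topology} \<Rightarrow>\<^sub>L 'h::{real_inner,banach}" and T :: real
  and A :: "(real \<Rightarrow> 'v) \<Rightarrow> (real \<Rightarrow> 'v \<Rightarrow>\<^sub>L real)"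
  and B :: "(real \<Rightarrow> 'u::{real_inner,banach}) \<Rightarrow> (real \<Rightarrow> 'v \<Rightarrow>\<^sub>L real)"
  and C :: "(real \<Rightarrow> 'v) \<Rightarrow> (real \<Rightarrow> 'y::{real_inner,banach})"
  and R :: "(real \<Rightarrow> 'u) \<Rightarrow> (real \<Rightarrow> 'u)"
  and KC :: "(real \<Rightarrow> 'y) \<Rightarrow> (real \<Rightarrow> 'v \<Rightarrow>\<^sub>L real)"
  and KB :: "(real \<Rightarrow> 'v) \<Rightarrow> (real \<Rightarrow> 'u)"
  and \<alpha> \<kappa> :: real
 assumes T: "0 < T" and dense: "closure (range \<iota>) = UNIV" and \<alpha>: "0 < \<alpha>"
  and A: "L2_operator T A" "L2_opnorm T A \<le> \<kappa>"
  and B: "L2_operator T B" "L2_opnorm T B \<le> \<kappa>"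
  and C: "L2_operator T C" "L2_opnorm T C \<le> \<kappa>"
  and R: "L2_operator T R" "L2_opnorm T R \<le> \<kappa>"
  and KC: "L2_operator T KC" "L2_opnorm T KC \<le> \<kappa>"
  and KB: "L2_operator T KB" "L2_opnorm T KB \<le> \<kappa>"
  and coercive: "q \<in> L2 T \<Longrightarrow> \<alpha> * L2norm T q \<le> L2norm T (R q)"
  and detect: "v \<in> L2 T \<Longrightarrow> \<alpha> * (L2norm T v)\<^sup>2 \<le> - L2_pair T (A v + KC (C v)) v"
  and stab: "v \<in> L2 T \<Longrightarrow> \<alpha> * (L2norm T v)\<^sup>2 \<le> - L2_pair T (A v + B (KB v)) v"
begin

lemma \<kappa>: "0 \<le> \<kappa>"
 using A op_norm_nonneg[of "L2 T" "L2norm T" "L2norm T" A] by (auto simp: bounded_linear_on_def)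

lemma op_L2 [simp]:
 "f \<in> L2 T \<Longrightarrow> A f \<in> L2 T" "q \<in> L2 T \<Longrightarrow> B q \<in> L2 T" "f \<in> L2 T \<Longrightarrow> C f \<in> L2 T" "q \<in> L2 T \<Longrightarrow> R q \<in> L2 T"
 "w \<in> L2 T \<Longrightarrow> KC w \<in> L2 T" "f \<in> L2 T \<Longrightarrow> KB f \<in> L2 T"
 using A B C R KC KB by (auto intro: L2_operator_L2)

lemma op_le:
 "f \<in> L2 T \<Longrightarrow> L2norm T (A f) \<le> \<kappa> * L2norm T f" "q \<in> L2 T \<Longrightarrow> L2norm T (B q) \<le> \<kappa> * L2norm T q"
 "f \<in> L2 T \<Longrightarrow> L2norm T (C f) \<le> \<kappa> * L2norm T f" "q \<in> L2 T \<Longrightarrow> L2norm T (R q) \<le> \<kappa> * L2norm T q"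
 "w \<in> L2 T \<Longrightarrow> L2norm T (KC w) \<le> \<kappa> * L2norm T w" "f \<in> L2 T \<Longrightarrow> L2norm T (KB f) \<le> \<kappa> * L2norm T f"
 using L2_operator_bound[OF A] L2_operator_bound[OF B] L2_operator_bound[OF C]
  L2_operator_bound[OF R] L2_operator_bound[OF KC] L2_operator_bound[OF KB] by auto

definition detect_form where "detect_form f h = - L2_pair T (A f + KC (C f)) h"

lemma detect_form_eq: "f \<in> L2 T \<Longrightarrow> h \<in> L2 T \<Longrightarrow> detect_form f h = - L2_pair T (A f) h - L2_pair T (KC (C f)) h"
 by (simp add: detect_form_def L2_pair_add_left)

lemma L2norm_closed_loop: "f \<in> L2 T \<Longrightarrow> L2norm T (A f + KC (C f)) \<le> (\<kappa> + \<kappa>\<^sup>2) * L2norm T f"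
proof -
 assume f: "f \<in> L2 T"
 have "L2norm T (A f + KC (C f)) \<le> L2norm T (A f) + L2norm T (KC (C f))" using f by (intro L2norm_add) auto
 moreover have "L2norm T (KC (C f)) \<le> \<kappa> * (\<kappa> * L2norm T f)"
  using op_le(5)[OF op_L2(3)[OF f]] mult_left_mono[OF op_le(3)[OF f] \<kappa>] by linarith
 ultimately show ?thesis using op_le(1)[OF f] by (simp add: algebra_simps power2_eq_square)
qed

sublocale coercive_L2 T detect_form \<alpha> "\<kappa> + \<kappa>\<^sup>2"
proof
 fix x y z :: "real \<Rightarrow> 'v" and c :: real
 assume x: "x \<in> L2 T" and z: "z \<in> L2 T"
 show "\<bar>detect_form x z\<bar> \<le> (\<kappa> + \<kappa>\<^sup>2) * (L2norm T x * L2norm T z)"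
  using L2_pair_bound[of "A x + KC (C x)" T z] mult_right_mono[OF L2norm_closed_loop[OF x], of "L2norm T z"] x z
  by (simp add: detect_form_def L2_add mult.assoc)
 note KCC = L2_operator_compose[OF C(1) KC(1)]
 show "detect_form (c *\<^sub>R x) z = c * detect_form x z"
  using x z
  by (simp add: detect_form_eq L2_scaleR L2_operator_pair_scaleR[OF A(1)] L2_operator_pair_scaleR[OF KCC] algebra_simps)
 show "detect_form z (c *\<^sub>R x) = c * detect_form z x" by (simp add: detect_form_def)
 assume y: "y \<in> L2 T"
 show "detect_form z (x + y) = detect_form z x + detect_form z y"
  using x y z by (simp add: detect_form_def L2_add L2_pair_add_right)
 show "detect_form (x + y) z = detect_form x z + detect_form y z"
  using x y z
  by (simp add: detect_form_eq L2_add L2_operator_pair_add[OF A(1)] L2_operator_pair_add[OF KCC])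
qed (use \<alpha> detect \<kappa> in \<open>auto simp: detect_form_def\<close>)

lemma bounded_pair: "g \<in> L2 T \<Longrightarrow> bounded_linear_on (L2 T) (L2norm T) UNIV norm (\<lambda>h. L2_pair T g (h :: real \<Rightarrow> 'v))"
 by (rule bounded_linear_on_functionalI[of _ _ "L2norm T g"]) (auto simp: L2_pair_add_right L2_pair_bound)

text \<open>Detectability makes \<open>-(A + K\<^sub>C C)\<close> coercive, so by Lax--Milgram it maps onto the dual of
 \<open>L\<^sub>2(0,T;V)\<close>; its values are elements of \<open>L\<^sub>2(0,T;V*)\<close>. This identifies the two spaces.\<close>

lemma dual_rep:
 assumes "bounded_linear_on (L2 T) (L2norm T) UNIV norm \<phi>"
 shows "\<exists>g\<in>L2 T. \<forall>h\<in>L2 T. \<phi> h = L2_pair T g (h :: real \<Rightarrow> 'v)"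
proof -
 obtain f where f: "f \<in> L2 T" "\<And>h. h \<in> L2 T \<Longrightarrow> detect_form f h = \<phi> h" using Lax_Milgram[OF assms] by blast
 have "- (A f + KC (C f)) \<in> L2 T" using f(1) by (intro L2_uminus L2_add) auto
 moreover have "\<phi> h = L2_pair T (- (A f + KC (C f))) h" if "h \<in> L2 T" for h
  using f(2)[OF that] by (simp only: L2_pair_minus_left detect_form_def)
 ultimately show ?thesis by blast
qed

text \<open>The representation passes through a solution of the coercive problem, bounded by means of \<open>\<alpha>\<close>, and the
 closed-loop operator, bounded by means of \<open>\<kappa>\<close>; so the constant does not depend on \<open>T\<close>.\<close>

lemma L2norm_le_dual:
 assumes g: "g \<in> L2 T" and c: "0 \<le> c" "\<And>h. h \<in> L2 T \<Longrightarrow> \<bar>L2_pair T g (h :: real \<Rightarrow> 'v)\<bar> \<le> c * L2norm T h"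
 shows "L2norm T g \<le> (\<kappa> + \<kappa>\<^sup>2) / \<alpha> * c"
proof -
 obtain f where f: "f \<in> L2 T" "\<And>h. h \<in> L2 T \<Longrightarrow> detect_form f h = L2_pair T g h"
  using Lax_Milgram[OF bounded_pair[OF g]] by blast
 have "\<alpha> * (L2norm T f)\<^sup>2 \<le> detect_form f f" using detect[OF f(1)] by (simp add: detect_form_def)
 also have "\<dots> \<le> c * L2norm T f" using f(2)[OF f(1)] c(2)[OF f(1)] by linarith
 finally have "(\<alpha> * L2norm T f) * L2norm T f \<le> c * L2norm T f" by (simp add: power2_eq_square mult.assoc)
 then have "\<alpha> * L2norm T f \<le> c"
  using L2norm_nonneg[of T f] c(1) by (cases "L2norm T f = 0") (auto simp: mult_le_cancel_right)
 then have 1: "L2norm T f \<le> c / \<alpha>" using \<alpha> by (simp add: field_simps)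
 let ?g = "- (A f + KC (C f))"
 have g': "?g \<in> L2 T" using f(1) by (intro L2_uminus L2_add) auto
 have "AE t in MT T. g t = ?g t"
  by (rule L2_eq_if_pairs_eq[OF g g'])
    (use f(2) in \<open>simp only: L2_pair_minus_left detect_form_def\<close>)
 then have "AE t in MT T. norm (g t) = norm (?g t)" by eventually_elim (rule arg_cong[of _ _ norm])
 then have "L2norm T g = L2norm T ?g" by (rule L2norm_cong_AE)
 also have "\<dots> \<le> (\<kappa> + \<kappa>\<^sup>2) * L2norm T f" unfolding L2norm_minus by (rule L2norm_closed_loop[OF f(1)])
 also have "\<dots> \<le> (\<kappa> + \<kappa>\<^sup>2) * (c / \<alpha>)" by (rule mult_left_mono[OF 1]) (simp add: \<kappa>)
 finally show ?thesis by simp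
qed

subsection \<open>The control\<close>

text \<open>Coercivity of \<open>R\<close> makes \<open>R*R\<close> a scalar product on \<open>L\<^sub>2(0,T;U)\<close>; Riesz' theorem inverts it.\<close>

lemma control_ex:
 assumes \<phi>: "bounded_linear_on (L2 T) (L2norm T) UNIV norm \<phi>"
 shows "\<exists>q\<in>L2 T. \<forall>k\<in>L2 T. L2_inner T (R q) (R k) = \<phi> k"
proof -
 interpret U: semi_hilbert "L2 T" "\<lambda>q k. L2_inner T (R q) (R k)"
 proof (rule semi_hilbert_L2[of _ _ "\<alpha>\<^sup>2" "\<kappa>\<^sup>2"])
  fix q assume q: "q \<in> (L2 T :: (real \<Rightarrow> 'u) set)"
  show "\<alpha>\<^sup>2 * (L2norm T q)\<^sup>2 \<le> L2_inner T (R q) (R q)"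
   using power_mono[OF coercive[OF q], of 2] \<alpha> by (simp add: L2_inner_self power_mult_distrib)
  show "L2_inner T (R q) (R q) \<le> \<kappa>\<^sup>2 * (L2norm T q)\<^sup>2"
   using power_mono[OF op_le(4)[OF q], of 2] by (simp add: L2_inner_self power_mult_distrib)
  show "L2_inner T (R q) (R k) = L2_inner T (R k) (R q)" for k by (rule L2_inner_commute)
 qed (use \<alpha> in \<open>simp_all add: L2_operator_inner_add[OF R(1)] L2_operator_inner_scaleR[OF R(1)]\<close>)
 note l = bounded_linear_on_functional[OF \<phi>]
 obtain c where c: "0 \<le> c" "\<And>h. h \<in> L2 T \<Longrightarrow> \<bar>\<phi> h\<bar> \<le> c * L2norm T h" using l(3) by blast
 show ?thesis
 proof (rule U.riesz[OF l(1,2), of "c / \<alpha>"])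
  fix k assume k: "k \<in> (L2 T :: (real \<Rightarrow> 'u) set)"
  have "L2norm T k \<le> L2norm T (R k) / \<alpha>" using coercive[OF k] \<alpha> by (simp add: field_simps)
  from mult_left_mono[OF this c(1)] show "\<bar>\<phi> k\<bar> \<le> c / \<alpha> * sqrt (L2_inner T (R k) (R k))"
   using c(2)[OF k] by (simp add: L2_inner_self)
 qed
qed

lemma control_bound:
 assumes q: "q \<in> L2 T" "\<And>k. k \<in> L2 T \<Longrightarrow> L2_inner T (R q) (R k) = \<phi> k"
  and c: "0 \<le> c" "\<And>k. k \<in> L2 T \<Longrightarrow> \<bar>\<phi> k\<bar> \<le> c * L2norm T k"
 shows "L2norm T q \<le> c / \<alpha>\<^sup>2"
proof -
 have "\<alpha>\<^sup>2 * (L2norm T q)\<^sup>2 \<le> L2_inner T (R q) (R q)"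
  using power_mono[OF coercive[OF q(1)], of 2] \<alpha> by (simp add: L2_inner_self power_mult_distrib)
 also have "\<dots> \<le> c * L2norm T q" using q(2)[OF q(1)] c(2)[OF q(1)] by linarith
 finally have "(\<alpha>\<^sup>2 * L2norm T q) * L2norm T q \<le> c * L2norm T q" by (simp add: power2_eq_square mult.assoc)
 then have "\<alpha>\<^sup>2 * L2norm T q \<le> c"
  using L2norm_nonneg[of T q] c(1) by (cases "L2norm T q = 0") (auto simp: mult_le_cancel_right)
 then show ?thesis using \<alpha> by (simp add: field_simps)
qed

context
 fixes v z q and M1 M2 r :: real
 assumes v: "v \<in> W \<iota> T" and z: "z \<in> W \<iota> T" and q: "q \<in> L2 T"
  and Rq: "\<And>k. k \<in> L2 T \<Longrightarrow> L2_inner T (R q) (R k) = L2_pair T (B k) z"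
  and M1: "0 \<le> M1" "\<And>h. h \<in> L2 T \<Longrightarrow>
   \<bar>L2_inner T (C v) (C h) - L2_pair T (wderiv \<iota> T z) h - L2_pair T (A h) z\<bar> \<le> M1 * L2norm T h"
  and M2: "0 \<le> M2" "\<And>h. h \<in> L2 T \<Longrightarrow>
   \<bar>L2_pair T (wderiv \<iota> T v) h - L2_pair T (A v) h - L2_pair T (B q) h\<bar> \<le> M2 * L2norm T h"
  and r: "r = M1 + M2 + norm (time_eval \<iota> T T z) + norm (time_eval \<iota> T 0 v)"
begin

text \<open>The two sides of the optimality system are tested with \<open>v\<close> and \<open>z\<close>. Crosswise testing gives the
 observed quantities \<open>C v\<close> and \<open>R q\<close>; testing the state equation with \<open>v\<close> and using detectability, and
 the adjoint equation with \<open>z\<close> and using stabilizability, gives the two energy balances.\<close>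

lemma estimate:
 shows "L2norm T v \<le> state_const \<alpha> \<kappa> * r" "L2norm T z \<le> state_const \<alpha> \<kappa> * r"
  "norm (time_eval \<iota> T T v) \<le> state_const \<alpha> \<kappa> * r" "norm (time_eval \<iota> T 0 z) \<le> state_const \<alpha> \<kappa> * r"
  "L2norm T q \<le> output_const \<alpha> \<kappa> / \<alpha> * r"
proof -
 define s where "s = sqrt ((L2norm T (C v))\<^sup>2 + (L2norm T (R q))\<^sup>2)"
 let ?w = "L2norm T v" and ?y = "L2norm T z"
 let ?p = "norm (time_eval \<iota> T T v)" and ?n = "norm (time_eval \<iota> T 0 z)"
 let ?c = "\<kappa> + \<kappa> / \<alpha> + \<kappa>\<^sup>2"
 note vz = W_L2[OF v] W_L2[OF z] wderiv_L2[OF v] wderiv_L2[OF z]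
 have r0: "0 \<le> r" "M1 \<le> r" "M2 \<le> r" "norm (time_eval \<iota> T T z) \<le> r" "norm (time_eval \<iota> T 0 v) \<le> r"
  using M1(1) M2(1) norm_ge_zero[of "time_eval \<iota> T T z"] norm_ge_zero[of "time_eval \<iota> T 0 v"]
  unfolding r by linarith+
 have s0: "0 \<le> s" by (simp add: s_def)
 have s2: "s\<^sup>2 = L2_inner T (C v) (C v) + L2_inner T (R q) (R q)" by (simp add: s_def L2_inner_self)
 have Cs: "L2norm T (C v) \<le> s" and Rs: "L2norm T (R q) \<le> s"
  unfolding s_def by (auto intro!: real_le_rsqrt)
 have qs: "L2norm T q \<le> s / \<alpha>" using coercive[OF q] Rs \<alpha> by (simp add: field_simps)
 have Mw: "M1 * ?w \<le> r * ?w" "M1 * ?y \<le> r * ?y" "M2 * ?w \<le> r * ?w" "M2 * ?y \<le> r * ?y"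
  using r0 by (auto intro: mult_right_mono)
 have obs: "s\<^sup>2 \<le> r * (?w + ?y + ?p + ?n)"
 proof -
  have i: "L2_pair T (wderiv \<iota> T v) z + L2_pair T (wderiv \<iota> T z) v
    = time_eval \<iota> T T v \<bullet> time_eval \<iota> T T z - time_eval \<iota> T 0 v \<bullet> time_eval \<iota> T 0 z"
   by (rule W_integration_by_parts[OF T v z])
  have b1: "time_eval \<iota> T T v \<bullet> time_eval \<iota> T T z \<le> r * ?p"
   using Cauchy_Schwarz_ineq2[of "time_eval \<iota> T T v" "time_eval \<iota> T T z"] mult_left_mono[OF r0(4), of ?p]
   by (simp add: mult.commute)
  have b2: "- (time_eval \<iota> T 0 v \<bullet> time_eval \<iota> T 0 z) \<le> r * ?n"
   using Cauchy_Schwarz_ineq2[of "time_eval \<iota> T 0 v" "time_eval \<iota> T 0 z"] mult_right_mono[OF r0(5), of ?n]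
   by simp
  \<comment> \<open>in the sum of the row tested with \<open>v\<close> and the negative of the row tested with \<open>z\<close>, the operator \<open>A\<close> cancels\<close>
  show ?thesis unfolding s2 ring_distribs
   using i b1 b2 M1(2)[OF vz(1)] M2(2)[OF vz(2)] Mw Rq[OF q] by linarith
 qed
 have nn: "0 \<le> ?w" "0 \<le> ?y" by simp_all
 have sw: "\<kappa> * s * ?w \<ge> 0" "\<kappa> * s / \<alpha> * ?w \<ge> 0" "\<kappa>\<^sup>2 * s * ?w \<ge> 0"
    "\<kappa> * s * ?y \<ge> 0" "\<kappa> * s / \<alpha> * ?y \<ge> 0" "\<kappa>\<^sup>2 * s * ?y \<ge> 0"
  using s0 \<kappa> \<alpha> by simp_all
 have ev: "?p\<^sup>2 / 2 + \<alpha> * ?w\<^sup>2 \<le> r\<^sup>2 / 2 + ?w * (r + ?c * s)"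
 proof -
  have e: "?p\<^sup>2 - (norm (time_eval \<iota> T 0 v))\<^sup>2 = 2 * L2_pair T (wderiv \<iota> T v) v"
   by (rule energy_identity[OF T v])
  have e0: "(norm (time_eval \<iota> T 0 v))\<^sup>2 \<le> r\<^sup>2" using r0(5) by (intro power_mono) auto
  have d: "\<alpha> * ?w\<^sup>2 \<le> - L2_pair T (A v) v - L2_pair T (KC (C v)) v"
   using detect[OF vz(1)] detect_form_eq[OF vz(1,1)] by (simp add: detect_form_def)
  have k: "\<bar>L2_pair T (KC (C v)) v\<bar> \<le> \<kappa> * s * ?w"
  proof -
   have "L2norm T (KC (C v)) \<le> \<kappa> * s"
    using op_le(5)[OF op_L2(3)[OF vz(1)]] mult_left_mono[OF Cs \<kappa>] by linarith
   from mult_right_mono[OF this nn(1)] show ?thesis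
    using L2_pair_bound[OF op_L2(5)[OF op_L2(3)[OF vz(1)]] vz(1)] by linarith
  qed
  have b: "\<bar>L2_pair T (B q) v\<bar> \<le> \<kappa> * s / \<alpha> * ?w"
  proof -
   have "L2norm T (B q) \<le> \<kappa> * (s / \<alpha>)" using op_le(2)[OF q] mult_left_mono[OF qs \<kappa>] by linarith
   from mult_right_mono[OF this nn(1)] show ?thesis
    using L2_pair_bound[OF op_L2(2)[OF q] vz(1)] by simp
  qed
  have "?w * (r + ?c * s) = r * ?w + \<kappa> * s * ?w + \<kappa> * s / \<alpha> * ?w + \<kappa>\<^sup>2 * s * ?w"
   by (simp add: algebra_simps)
  then show ?thesis using e e0 d k b M2(2)[OF vz(1)] Mw(3) sw by linarith
 qed
 have ez: "?n\<^sup>2 / 2 + \<alpha> * ?y\<^sup>2 \<le> r\<^sup>2 / 2 + ?y * (r + ?c * s)"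
 proof -
  have e: "(norm (time_eval \<iota> T T z))\<^sup>2 - ?n\<^sup>2 = 2 * L2_pair T (wderiv \<iota> T z) z"
   by (rule energy_identity[OF T z])
  have e0: "(norm (time_eval \<iota> T T z))\<^sup>2 \<le> r\<^sup>2" using r0(4) by (intro power_mono) auto
  have d: "\<alpha> * ?y\<^sup>2 \<le> - L2_pair T (A z) z - L2_pair T (B (KB z)) z"
   using stab[OF vz(2)] vz(2) by (simp add: L2_pair_add_left)
  have k: "\<bar>L2_pair T (B (KB z)) z\<bar> \<le> \<kappa>\<^sup>2 * s * ?y"
  proof -
   have kz: "KB z \<in> L2 T" using vz(2) by simp
   have "L2norm T (R (KB z)) \<le> \<kappa> * (\<kappa> * ?y)"
    using op_le(4)[OF kz] mult_left_mono[OF op_le(6)[OF vz(2)] \<kappa>] by linarith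
   from mult_mono[OF Rs this s0] have "L2norm T (R q) * L2norm T (R (KB z)) \<le> \<kappa>\<^sup>2 * s * ?y"
    by (simp add: power2_eq_square mult_ac)
   then show ?thesis using L2_inner_bound[OF op_L2(4)[OF q] op_L2(4)[OF kz]] Rq[OF kz] by linarith
  qed
  have b: "\<bar>L2_inner T (C v) (C z)\<bar> \<le> \<kappa> * s * ?y"
  proof -
   from mult_mono[OF Cs op_le(3)[OF vz(2)] s0] show ?thesis
    using L2_inner_bound[OF op_L2(3)[OF vz(1)] op_L2(3)[OF vz(2)]] by (simp add: mult_ac)
  qed
  have "?y * (r + ?c * s) = r * ?y + \<kappa> * s * ?y + \<kappa> * s / \<alpha> * ?y + \<kappa>\<^sup>2 * s * ?y"
   by (simp add: algebra_simps)
  then show ?thesis using e e0 d k b M1(2)[OF vz(2)] Mw(2) sw by linarith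
 qed
 note f = estimate_arithmetic[OF \<alpha> \<kappa> r0(1) s0 obs ev ez]
 show "?w \<le> state_const \<alpha> \<kappa> * r" "?y \<le> state_const \<alpha> \<kappa> * r" "?p \<le> state_const \<alpha> \<kappa> * r" "?n \<le> state_const \<alpha> \<kappa> * r"
  by (fact f)+
 have "s / \<alpha> \<le> output_const \<alpha> \<kappa> * r / \<alpha>" using f(5) \<alpha> by (simp add: divide_right_mono)
 then show "L2norm T q \<le> output_const \<alpha> \<kappa> / \<alpha> * r" using qs by simp
qed

text \<open>The equations express the time derivatives by the quantities that \<open>estimate\<close> bounds.\<close>

lemma estimate_W:
 shows "Wnorm \<iota> T v + Wnorm \<iota> T z \<le> solution_const \<alpha> \<kappa> * r"
proof -
 note e = estimate
 note vz = W_L2[OF v] W_L2[OF z] wderiv_L2[OF v] wderiv_L2[OF z]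
 let ?s = "state_const \<alpha> \<kappa> * r" and ?o = "output_const \<alpha> \<kappa> / \<alpha> * r"
 have r0: "0 \<le> r" "M1 \<le> r" "M2 \<le> r"
  using M1(1) M2(1) norm_ge_zero[of "time_eval \<iota> T T z"] norm_ge_zero[of "time_eval \<iota> T 0 v"]
  unfolding r by linarith+
 have so: "0 \<le> ?s" "0 \<le> ?o"
  using e(1,5) L2norm_nonneg[of T v] L2norm_nonneg[of T q] by linarith+
 have D: "0 \<le> (\<kappa> + \<kappa>\<^sup>2) / \<alpha>" using \<kappa> \<alpha> by simp
 have dz: "L2norm T (wderiv \<iota> T z) \<le> (\<kappa> + \<kappa>\<^sup>2) / \<alpha> * (\<kappa>\<^sup>2 * ?s + \<kappa> * ?s + r)"
 proof (rule L2norm_le_dual[OF vz(4)])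
  show "0 \<le> \<kappa>\<^sup>2 * ?s + \<kappa> * ?s + r" using \<kappa> so r0 by (intro add_nonneg_nonneg mult_nonneg_nonneg[of _ ?s]) auto
  fix h assume h: "h \<in> (L2 T :: (real \<Rightarrow> 'v) set)"
  let ?h = "L2norm T h"
  have 1: "\<bar>L2_inner T (C v) (C h)\<bar> \<le> \<kappa>\<^sup>2 * ?s * ?h"
  proof -
   have "L2norm T (C v) \<le> \<kappa> * ?s" using op_le(3)[OF vz(1)] mult_left_mono[OF e(1) \<kappa>] by linarith
   from mult_mono[OF this op_le(3)[OF h]] have "L2norm T (C v) * L2norm T (C h) \<le> \<kappa> * ?s * (\<kappa> * ?h)"
    using \<kappa> so by simp
   then show ?thesis using L2_inner_bound[OF op_L2(3)[OF vz(1)] op_L2(3)[OF h]]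
    by (simp add: power2_eq_square mult_ac)
  qed
  have 2: "\<bar>L2_pair T (A h) z\<bar> \<le> \<kappa> * ?s * ?h"
  proof -
   have "\<bar>L2_pair T (A h) z\<bar> \<le> (\<kappa> * ?h) * L2norm T z"
    using L2_operator_pair_bound[OF A(1) vz(2) A(2) h] by (simp add: mult.assoc)
   also have "\<dots> \<le> (\<kappa> * ?h) * ?s" by (rule mult_left_mono[OF e(2) mult_nonneg_nonneg[OF \<kappa> L2norm_nonneg]])
   finally show ?thesis by (simp add: mult_ac)
  qed
  have 3: "M1 * ?h \<le> r * ?h" by (rule mult_right_mono[OF r0(2)]) simp
  show "\<bar>L2_pair T (wderiv \<iota> T z) h\<bar> \<le> (\<kappa>\<^sup>2 * ?s + \<kappa> * ?s + r) * ?h"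
   unfolding ring_distribs using 1 2 3 M1(2)[OF h] by linarith
 qed
 have dv: "L2norm T (wderiv \<iota> T v) \<le> (\<kappa> + \<kappa>\<^sup>2) / \<alpha> * (\<kappa> * ?s + \<kappa> * ?o + r)"
 proof (rule L2norm_le_dual[OF vz(3)])
  show "0 \<le> \<kappa> * ?s + \<kappa> * ?o + r" using \<kappa> so r0 by (intro add_nonneg_nonneg mult_nonneg_nonneg[OF \<kappa>]) auto
  fix h assume h: "h \<in> (L2 T :: (real \<Rightarrow> 'v) set)"
  let ?h = "L2norm T h"
  have 1: "\<bar>L2_pair T (A v) h\<bar> \<le> \<kappa> * ?s * ?h"
  proof -
   have "L2norm T (A v) \<le> \<kappa> * ?s" using op_le(1)[OF vz(1)] mult_left_mono[OF e(1) \<kappa>] by linarith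
   from mult_right_mono[OF this, of ?h] show ?thesis using L2_pair_bound[OF op_L2(1)[OF vz(1)] h] by simp
  qed
  have 2: "\<bar>L2_pair T (B q) h\<bar> \<le> \<kappa> * ?o * ?h"
  proof -
   have "L2norm T (B q) \<le> \<kappa> * ?o" using op_le(2)[OF q] mult_left_mono[OF e(5) \<kappa>] by linarith
   from mult_right_mono[OF this, of ?h] show ?thesis using L2_pair_bound[OF op_L2(2)[OF q] h] by simp
  qed
  have 3: "M2 * ?h \<le> r * ?h" by (rule mult_right_mono[OF r0(3)]) simp
  show "\<bar>L2_pair T (wderiv \<iota> T v) h\<bar> \<le> (\<kappa> * ?s + \<kappa> * ?o + r) * ?h"
   unfolding ring_distribs using 1 2 3 M2(2)[OF h] by linarith
 qed
 have "Wnorm \<iota> T v + Wnorm \<iota> T z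
   \<le> 2 * ?s + ((\<kappa> + \<kappa>\<^sup>2) / \<alpha> * (\<kappa> * ?s + \<kappa> * ?o + r) + (\<kappa> + \<kappa>\<^sup>2) / \<alpha> * (\<kappa>\<^sup>2 * ?s + \<kappa> * ?s + r))"
  using Wnorm_bounds(3)[OF T, of \<iota> v] Wnorm_bounds(3)[OF T, of \<iota> z] e(1,2) dz dv by linarith
 also have "\<dots> = solution_const \<alpha> \<kappa> * r" by (simp add: solution_const_def algebra_simps)
 finally show ?thesis .
qed

end

end

section \<open>The optimality system: existence\<close>

lemma inner_zero_dense:
 fixes \<iota> :: "'v::real_normed_vector \<Rightarrow>\<^sub>L 'h::real_inner"
 assumes d: "closure (range \<iota>) = UNIV" and z: "\<And>e. h \<bullet> \<iota> e = 0"
 shows "h = 0"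
proof -
 have "closed {y. h \<bullet> y = 0}" by (intro closed_Collect_eq continuous_intros)
 then have "closure (range \<iota>) \<subseteq> {y. h \<bullet> y = 0}" using z by (intro closure_minimal) auto
 moreover have "h \<in> closure (range \<iota>)" using d by simp
 ultimately show ?thesis by (auto simp: inner_eq_zero_iff)
qed

text \<open>Functions \<open>f\<close> with compact support identify the weak derivative; then \<open>f t = t - s'\<close> and integration
 by parts identify the trace at \<open>s\<close>, since the image of \<open>V\<close> is dense in \<open>H\<close>. The sign \<open>\<sigma>\<close> is that of the
 boundary term at \<open>s\<close>.\<close>

lemma very_weak_solution:
 fixes \<iota> :: "'v::{real_normed_vector,second_countable_topology} \<Rightarrow>\<^sub>L 'h::{real_inner,banach}"
 assumes T: "0 < T" and dense: "closure (range \<iota>) = UNIV" and v: "v \<in> L2 T" and g: "g \<in> L2 T"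
  and s: "s = T \<and> s' = 0 \<and> \<sigma> = 1 \<or> s = 0 \<and> s' = T \<and> \<sigma> = - 1"
  and eq: "\<And>f e. smooth f \<Longrightarrow> f s' = 0 \<Longrightarrow>
   L2_pair T (\<lambda>t. deriv f t *\<^sub>R emb_dual \<iota> (\<iota> e)) v + L2_pair T g (\<lambda>t. f t *\<^sub>R e) = \<sigma> * (f s * (h \<bullet> \<iota> e))"
 shows "v \<in> W \<iota> T" "AE t in MT T. wderiv \<iota> T v t = g t" "time_eval \<iota> T s v = h"
proof -
 have w: "has_weak_deriv \<iota> T v g"
 proof (rule has_weak_deriv_by_testing)
  fix \<phi> e assume \<phi>: "test_function T \<phi>"
  have "smooth \<phi>" using \<phi> by (simp add: test_function_iff)
  moreover have "\<phi> 0 = 0" "\<phi> T = 0" using test_function_outside[OF \<phi>] by auto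
  ultimately show "L2_pair T (\<lambda>t. deriv \<phi> t *\<^sub>R emb_dual \<iota> (\<iota> e)) v = - L2_pair T g (\<lambda>t. \<phi> t *\<^sub>R e)"
   using eq[of \<phi> e] s by auto
 qed
 show vW: "v \<in> W \<iota> T" by (rule W_I[OF v g w])
 show d: "AE t in MT T. wderiv \<iota> T v t = g t" by (rule wderiv_eq[OF v g w])
 define f where "f = (\<lambda>t::real. 1 * t + (- s'))"
 have f: "smooth f" unfolding f_def by (rule smooth_affine_fun)
 have fs: "f s' = 0" "f s \<noteq> 0" using s T by (auto simp: f_def)
 have "(time_eval \<iota> T s v - h) \<bullet> \<iota> e = 0" for e
 proof -
  note F = W_smooth_scaled[OF T f, where e = e and \<iota> = \<iota>]
  have "L2_pair T (wderiv \<iota> T (\<lambda>t. f t *\<^sub>R e)) v = L2_pair T (\<lambda>t. deriv f t *\<^sub>R emb_dual \<iota> (\<iota> e)) v"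
   by (rule L2_pair_cong_AE[OF F(2) wderiv_L2[OF F(1)] v])
  moreover have "L2_pair T (wderiv \<iota> T v) (\<lambda>t. f t *\<^sub>R e) = L2_pair T g (\<lambda>t. f t *\<^sub>R e)"
   by (rule L2_pair_cong_AE[OF d wderiv_L2[OF vW] W_L2[OF F(1)]])
  moreover have "L2_pair T (wderiv \<iota> T v) (\<lambda>t. f t *\<^sub>R e) + L2_pair T (wderiv \<iota> T (\<lambda>t. f t *\<^sub>R e)) v
   = time_eval \<iota> T T v \<bullet> (f T *\<^sub>R \<iota> e) - time_eval \<iota> T 0 v \<bullet> (f 0 *\<^sub>R \<iota> e)"
   using W_integration_by_parts[OF T vW F(1)] F(3)[of 0] F(3)[of T] T by simp
  ultimately have "time_eval \<iota> T T v \<bullet> (f T *\<^sub>R \<iota> e) - time_eval \<iota> T 0 v \<bullet> (f 0 *\<^sub>R \<iota> e) = \<sigma> * (f s * (h \<bullet> \<iota> e))"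
   using eq[OF f fs(1), of e] by linarith
  then have "f s * ((time_eval \<iota> T s v - h) \<bullet> \<iota> e) = 0" using s fs(1) by (auto simp: inner_diff_left algebra_simps)
  then show ?thesis using fs(2) by simp
 qed
 from inner_zero_dense[OF dense this] show "time_eval \<iota> T s v = h" by simp
qed

context lq_system begin

text \<open>\<open>(R*R)\<^sup>-\<^sup>1 B* z\<close>, the control that belongs to the adjoint state \<open>z\<close>.\<close>

definition control :: "(real \<Rightarrow> 'v) \<Rightarrow> (real \<Rightarrow> 'u)" where
 "control z = (SOME q. q \<in> L2 T \<and> (\<forall>k\<in>L2 T. L2_inner T (R q) (R k) = L2_pair T (B k) z))"

lemma bounded_B_pair: "z \<in> L2 T \<Longrightarrow> bounded_linear_on (L2 T) (L2norm T) UNIV norm (\<lambda>k. L2_pair T (B k) z)"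
proof (rule bounded_linear_on_functionalI[of _ _ "\<kappa> * L2norm T z"])
 assume z: "z \<in> L2 T"
 show "\<bar>L2_pair T (B k) z\<bar> \<le> \<kappa> * L2norm T z * L2norm T k" if "k \<in> L2 T" for k
  using L2_operator_pair_bound[OF B(1) z B(2) that] by (simp add: mult_ac)
qed (auto simp: \<kappa> L2_operator_pair_add[OF B(1)] L2_operator_pair_scaleR[OF B(1)])

lemma control:
 assumes z: "z \<in> L2 T"
 shows control_L2: "control z \<in> L2 T"
  and control_eq: "k \<in> L2 T \<Longrightarrow> L2_inner T (R (control z)) (R k) = L2_pair T (B k) z"
proof -
 have "\<exists>q. q \<in> L2 T \<and> (\<forall>k\<in>L2 T. L2_inner T (R q) (R k) = L2_pair T (B k) z)"
  using control_ex[OF bounded_B_pair[OF z]] by blast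
 from someI_ex[OF this] show "control z \<in> L2 T" "k \<in> L2 T \<Longrightarrow> L2_inner T (R (control z)) (R k) = L2_pair T (B k) z"
  unfolding control_def by blast+
qed

text \<open>The form \<open>(z, k) \<mapsto> \<langle>B (R*R)\<^sup>-\<^sup>1 B* z, k\<rangle>\<close>.\<close>

definition gram where "gram z k = L2_pair T (B (control z)) k"

lemma gram_commute: "z \<in> L2 T \<Longrightarrow> k \<in> L2 T \<Longrightarrow> gram z k = gram k z"
 using control_eq[of k "control z"] control_eq[of z "control k"] control_L2[of z] control_L2[of k]
 by (simp add: gram_def L2_inner_commute)

lemma gram_linear:
 "z \<in> L2 T \<Longrightarrow> k \<in> L2 T \<Longrightarrow> k' \<in> L2 T \<Longrightarrow> gram z (k + k') = gram z k + gram z k'"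
 "z \<in> L2 T \<Longrightarrow> k \<in> L2 T \<Longrightarrow> gram z (c *\<^sub>R k) = c * gram z k"
 by (simp_all add: gram_def L2_pair_add_right control_L2)

lemma gram_linear_left:
 "k \<in> L2 T \<Longrightarrow> k' \<in> L2 T \<Longrightarrow> z \<in> L2 T \<Longrightarrow> gram (k + k') z = gram k z + gram k' z"
 "z \<in> L2 T \<Longrightarrow> k \<in> L2 T \<Longrightarrow> gram (c *\<^sub>R k) z = c * gram k z"
 using gram_linear gram_commute by (simp_all add: L2_add L2_scaleR)

text \<open>The adjoint row and the state row after integration by parts: the time derivatives are on the test
 functions \<open>h\<close> and \<open>k\<close>, so that the rows make sense for \<open>v\<close> and \<open>z\<close> in \<open>L\<^sub>2\<close>.\<close>

definition row1 where "row1 v z h = L2_inner T (C v) (C h) + L2_pair T (wderiv \<iota> T h) z - L2_pair T (A h) z"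
definition row2 where "row2 v z k = - L2_pair T (wderiv \<iota> T k) v - L2_pair T (A v) k - gram z k"

lemma row_linear:
 assumes "v \<in> L2 T" "z \<in> L2 T" "v' \<in> L2 T" "z' \<in> L2 T" "h \<in> W \<iota> T"
 shows "row1 (v + v') (z + z') h = row1 v z h + row1 v' z' h" "row2 (v + v') (z + z') h = row2 v z h + row2 v' z' h"
  "row1 (c *\<^sub>R v) (c *\<^sub>R z) h = c * row1 v z h" "row2 (c *\<^sub>R v) (c *\<^sub>R z) h = c * row2 v z h"
 using assms W_L2[OF assms(5)] wderiv_L2[OF assms(5)]
 by (simp_all add: row1_def row2_def L2_operator_inner_add[OF C(1)] L2_operator_inner_scaleR[OF C(1)]
   L2_operator_pair_add[OF A(1)] L2_operator_pair_scaleR[OF A(1)] gram_linear_left L2_pair_add_right algebra_simps)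

lemma L2_pair_wderiv_linear:
 assumes v: "v \<in> L2 T"
 shows "h \<in> W \<iota> T \<Longrightarrow> h' \<in> W \<iota> T \<Longrightarrow> L2_pair T (wderiv \<iota> T (h + h')) v = L2_pair T (wderiv \<iota> T h) v + L2_pair T (wderiv \<iota> T h') v"
  and "h \<in> W \<iota> T \<Longrightarrow> L2_pair T (wderiv \<iota> T (c *\<^sub>R h)) v = c * L2_pair T (wderiv \<iota> T h) v"
proof -
 assume h: "h \<in> W \<iota> T"
 have "AE t in MT T. wderiv \<iota> T (c *\<^sub>R h) t = (c *\<^sub>R wderiv \<iota> T h) t"
  using wderiv_scaleR[OF h, of c] by (simp add: scaleR_fun_def)
 from trans[OF L2_pair_cong_AE[OF this wderiv_L2[OF W_scaleR[OF h]] v] L2_pair_scaleR_left]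
 show "L2_pair T (wderiv \<iota> T (c *\<^sub>R h)) v = c * L2_pair T (wderiv \<iota> T h) v" .
 assume h': "h' \<in> W \<iota> T"
 have "AE t in MT T. wderiv \<iota> T (h + h') t = (wderiv \<iota> T h + wderiv \<iota> T h') t"
  using wderiv_add[OF h h'] by simp
 from trans[OF L2_pair_cong_AE[OF this wderiv_L2[OF W_add[OF h h']] v] L2_pair_add_left[OF wderiv_L2[OF h] wderiv_L2[OF h'] v]]
 show "L2_pair T (wderiv \<iota> T (h + h')) v = L2_pair T (wderiv \<iota> T h) v + L2_pair T (wderiv \<iota> T h') v" .
qed

lemma row_linear_test:
 assumes v: "v \<in> L2 T" and z: "z \<in> L2 T" and h: "h \<in> W \<iota> T" and h': "h' \<in> W \<iota> T"
 shows "row1 v z (h + h') = row1 v z h + row1 v z h'" "row2 v z (h + h') = row2 v z h + row2 v z h'"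
  "row1 v z (c *\<^sub>R h) = c * row1 v z h" "row2 v z (c *\<^sub>R h) = c * row2 v z h"
 using v z W_L2[OF h] W_L2[OF h'] 
 by (simp_all add: row1_def row2_def L2_operator_inner_add[OF C(1)] L2_operator_inner_scaleR[OF C(1)]
   L2_inner_commute[of T "C v"]
   L2_operator_pair_add[OF A(1)] L2_operator_pair_scaleR[OF A(1)] gram_linear L2_pair_add_right
   L2_pair_wderiv_linear[OF v] L2_pair_wderiv_linear[OF z] h h' algebra_simps)

lemma L2_pair_zero [simp]: "L2_pair T g 0 = 0"
 using L2_pair_scaleR_right[of T g 0 0] by simp

lemma test_zero:
 "time_eval \<iota> T 0 0 = 0" "time_eval \<iota> T T 0 = 0"
 "v \<in> L2 T \<Longrightarrow> z \<in> L2 T \<Longrightarrow> row1 v z 0 = 0" "v \<in> L2 T \<Longrightarrow> z \<in> L2 T \<Longrightarrow> row2 v z 0 = 0"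
 using time_eval_scaleR[OF T W_zero, of 0 \<iota> 0] time_eval_scaleR[OF T W_zero, of T \<iota> 0] T
  row_linear_test(3,4)[OF _ _ W_zero W_zero, of v z 0] by auto

text \<open>Read as functionals of \<open>v\<close> and of \<open>z\<close>, the rows are the adjoint row and the state row of the test
 pair \<open>(h, k)\<close> in place of \<open>(v, z)\<close>.\<close>

lemma row_unit:
 assumes g: "g \<in> L2 T" and h: "h \<in> W \<iota> T" and k: "k \<in> W \<iota> T"
 shows "row1 g 0 h + row2 g 0 k = L2_inner T (C h) (C g) - L2_pair T (wderiv \<iota> T k) g - L2_pair T (A g) k"
  and "row1 0 g h + row2 0 g k = L2_pair T (wderiv \<iota> T h) g - L2_pair T (A h) g - L2_pair T (B (control k)) g"
proof -
 note hk = W_L2[OF h] W_L2[OF k]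
 have "gram 0 k = 0" using gram_linear_left(2)[of k 0 0] hk by simp
 then show "row1 g 0 h + row2 g 0 k = L2_inner T (C h) (C g) - L2_pair T (wderiv \<iota> T k) g - L2_pair T (A g) k"
  by (simp add: row1_def row2_def L2_inner_commute[of T "C g"])
 have "L2_inner T (C 0) (C h) = 0" using L2_operator_inner_scaleR[OF C(1) op_L2(3)[OF hk(1)], of 0 0] by simp
 moreover have "L2_pair T (A 0) k = 0" using L2_operator_pair_scaleR[OF A(1) hk(2), of 0 0] by simp
 ultimately show "row1 0 g h + row2 0 g k = L2_pair T (wderiv \<iota> T h) g - L2_pair T (A h) g - L2_pair T (B (control k)) g"
  using gram_commute[OF g hk(2)] by (simp add: row1_def row2_def gram_def)
qed

lemma row_bound:
 assumes v: "v \<in> L2 T" and z: "z \<in> L2 T" and h: "h \<in> W \<iota> T" and k: "k \<in> W \<iota> T"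
 shows "\<bar>row1 v z h + row2 v z k\<bar>
  \<le> (\<kappa> * L2norm T (C h) + L2norm T (wderiv \<iota> T k) + \<kappa> * L2norm T k) * L2norm T v
   + (L2norm T (wderiv \<iota> T h) + L2norm T (A h) + L2norm T (B (control k))) * L2norm T z"
proof -
 note hk = W_L2[OF h] W_L2[OF k] wderiv_L2[OF h] wderiv_L2[OF k]
 have "\<bar>L2_inner T (C v) (C h)\<bar> \<le> \<kappa> * L2norm T (C h) * L2norm T v"
  using L2_operator_inner_bound[OF C(1) op_L2(3)[OF hk(1)] C(2) v] by (simp add: mult_ac)
 moreover have "\<bar>L2_pair T (wderiv \<iota> T k) v\<bar> \<le> L2norm T (wderiv \<iota> T k) * L2norm T v"
  by (rule L2_pair_bound[OF hk(4) v])
 moreover have "\<bar>L2_pair T (A v) k\<bar> \<le> \<kappa> * L2norm T k * L2norm T v"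
  using L2_operator_pair_bound[OF A(1) hk(2) A(2) v] by (simp add: mult_ac)
 moreover have "\<bar>L2_pair T (wderiv \<iota> T h) z\<bar> \<le> L2norm T (wderiv \<iota> T h) * L2norm T z"
  by (rule L2_pair_bound[OF hk(3) z])
 moreover have "\<bar>L2_pair T (A h) z\<bar> \<le> L2norm T (A h) * L2norm T z"
  by (rule L2_pair_bound[OF op_L2(1)[OF hk(1)] z])
 moreover have "\<bar>gram z k\<bar> \<le> L2norm T (B (control k)) * L2norm T z"
  using L2_pair_bound[OF op_L2(2)[OF control_L2[OF hk(2)]] z] gram_commute[OF z hk(2)] by (simp add: gram_def)
 ultimately show ?thesis unfolding row1_def row2_def ring_distribs by linarith
qed

text \<open>The system is self-adjoint: testing with \<open>(h, k)\<close>, where \<open>h 0 = 0\<close> and \<open>k T = 0\<close>, the adjoint of the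
 very weak problem is the problem itself. So the a-priori estimate, applied to the test pair, is
 the inf-sup condition of Lions' theorem.\<close>

theorem very_weak_existence:
 assumes l1: "l1 \<in> L2 T" and l2: "l2 \<in> L2 T"
 shows "\<exists>v\<in>L2 T. \<exists>z\<in>L2 T.
  (\<forall>h\<in>W \<iota> T. time_eval \<iota> T 0 h = 0 \<longrightarrow> row1 v z h = L2_pair T l1 h + h1 \<bullet> time_eval \<iota> T T h) \<and>
  (\<forall>k\<in>W \<iota> T. time_eval \<iota> T T k = 0 \<longrightarrow> row2 v z k = L2_pair T l2 k + h2 \<bullet> time_eval \<iota> T 0 k)"
proof -
 define \<Phi> where "\<Phi> = {y. fst y \<in> W \<iota> T \<and> snd y \<in> W \<iota> T \<and> time_eval \<iota> T 0 (fst y) = 0 \<and> time_eval \<iota> T T (snd y) = 0}"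
 define E where "E x y = row1 (fst x) (snd x) (fst y) + row2 (fst x) (snd x) (snd y)"
  for x y :: "(real \<Rightarrow> 'v) \<times> (real \<Rightarrow> 'v)"
 define L where "L y = L2_pair T l1 (fst y) + h1 \<bullet> time_eval \<iota> T T (fst y)
  + (L2_pair T l2 (snd y) + h2 \<bullet> time_eval \<iota> T 0 (snd y))" for y :: "(real \<Rightarrow> 'v) \<times> (real \<Rightarrow> 'v)"
 define m where "m = sqrt (\<kappa> + \<kappa>\<^sup>2)"
 define D where "D = L2norm T l1 + norm h1 + L2norm T l2 + norm h2"
 have T0: "0 \<in> {0..T}" "T \<in> {0..T}" using T by auto
 have D0: "0 \<le> D" by (simp add: D_def)
 have sh: "semi_hilbert (L2 T) sym" by unfold_locales
 interpret P: semi_hilbert "L2 T \<times> L2 T" "\<lambda>x y. sym (fst x) (fst y) + sym (snd x) (snd y)"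
  by (rule semi_hilbert_prod[OF sh])
 have \<Phi>D: "fst y \<in> W \<iota> T" "snd y \<in> W \<iota> T" "time_eval \<iota> T 0 (fst y) = 0" "time_eval \<iota> T T (snd y) = 0"
  if "y \<in> \<Phi>" for y using that by (simp_all add: \<Phi>_def)
 have SD: "fst x \<in> L2 T" "snd x \<in> L2 T" if "x \<in> L2 T \<times> L2 T" for x :: "(real \<Rightarrow> 'v) \<times> (real \<Rightarrow> 'v)"
  using that by auto
 have parts: "L2norm T (fst x) \<le> P.nrm x / sqrt \<alpha>" "L2norm T (snd x) \<le> P.nrm x / sqrt \<alpha>"
  if x: "x \<in> L2 T \<times> L2 T" for x
 proof -
  have "nrm (fst x) \<le> P.nrm x" "nrm (snd x) \<le> P.nrm x"
   using b_nonneg[OF SD(1)[OF x]] b_nonneg[OF SD(2)[OF x]] by (auto intro: real_sqrt_le_mono)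
  then have "nrm (fst x) / sqrt \<alpha> \<le> P.nrm x / sqrt \<alpha>" "nrm (snd x) / sqrt \<alpha> \<le> P.nrm x / sqrt \<alpha>"
   using \<alpha> by (simp_all add: divide_right_mono)
  then show "L2norm T (fst x) \<le> P.nrm x / sqrt \<alpha>" "L2norm T (snd x) \<le> P.nrm x / sqrt \<alpha>"
   using L2norm_le_nrm[OF SD(1)[OF x]] L2norm_le_nrm[OF SD(2)[OF x]] by linarith+
 qed
 have sym0: "sym 0 0 = 0" by (simp add: sym_def detect_form_def)
 have unit: "P.nrm (g, 0) \<le> m * L2norm T g" "P.nrm (0, g) \<le> m * L2norm T g" if "g \<in> L2 T" for g
  using nrm_le_L2norm[OF that] by (simp_all add: sym0 m_def)
 define K where "K y = ((\<kappa> * L2norm T (C (fst y)) + L2norm T (wderiv \<iota> T (snd y)) + \<kappa> * L2norm T (snd y))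
   + (L2norm T (wderiv \<iota> T (fst y)) + L2norm T (A (fst y)) + L2norm T (B (control (snd y))))) / sqrt \<alpha>" for y
 have "\<exists>x\<in>L2 T \<times> L2 T. \<forall>y\<in>\<Phi>. E x y = L y"
 proof (rule P.lions[where K = K and c = "D * state_const \<alpha> \<kappa> * (2 * m)"])
  show "subspace \<Phi>"
   unfolding \<Phi>_def subspace_def
   using T0 by (auto simp: W_zero W_add W_scaleR time_eval_add[OF T] time_eval_scaleR[OF T] test_zero)
  show "E (x + x') y = E x y + E x' y" if "x \<in> L2 T \<times> L2 T" "x' \<in> L2 T \<times> L2 T" "y \<in> \<Phi>" for x x' y
   using row_linear(1)[OF SD[OF that(1)] SD[OF that(2)] \<Phi>D(1)[OF that(3)]]
    row_linear(2)[OF SD[OF that(1)] SD[OF that(2)] \<Phi>D(2)[OF that(3)]] by (simp add: E_def)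
  show "E (c *\<^sub>R x) y = c * E x y" if "x \<in> L2 T \<times> L2 T" "y \<in> \<Phi>" for c x y
   using row_linear(3)[OF SD[OF that(1)] SD[OF that(1)] \<Phi>D(1)[OF that(2)]]
    row_linear(4)[OF SD[OF that(1)] SD[OF that(1)] \<Phi>D(2)[OF that(2)]] by (simp add: E_def algebra_simps)
  show "E x (y + y') = E x y + E x y'" if "x \<in> L2 T \<times> L2 T" "y \<in> \<Phi>" "y' \<in> \<Phi>" for x y y'
   using row_linear_test(1)[OF SD[OF that(1)] \<Phi>D(1)[OF that(2)] \<Phi>D(1)[OF that(3)]]
    row_linear_test(2)[OF SD[OF that(1)] \<Phi>D(2)[OF that(2)] \<Phi>D(2)[OF that(3)]] by (simp add: E_def)
  show "E x (c *\<^sub>R y) = c * E x y" if "x \<in> L2 T \<times> L2 T" "y \<in> \<Phi>" for c x y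
   using row_linear_test(3)[OF SD[OF that(1)] \<Phi>D(1)[OF that(2)] \<Phi>D(1)[OF that(2)]]
    row_linear_test(4)[OF SD[OF that(1)] \<Phi>D(2)[OF that(2)] \<Phi>D(2)[OF that(2)]] by (simp add: E_def algebra_simps)
  show "L (y + y') = L y + L y'" if "y \<in> \<Phi>" "y' \<in> \<Phi>" for y y'
   using \<Phi>D[OF that(1)] \<Phi>D[OF that(2)] T0
   by (simp add: L_def time_eval_add[OF T] L2_pair_add_right l1 l2 W_L2 inner_add_right)
  show "L (c *\<^sub>R y) = c * L y" if "y \<in> \<Phi>" for c y
   using \<Phi>D[OF that] T0 by (simp add: L_def time_eval_scaleR[OF T] algebra_simps)
  show "\<bar>E x y\<bar> \<le> K y * P.nrm x" if x: "x \<in> L2 T \<times> L2 T" and y: "y \<in> \<Phi>" for x y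
  proof -
   let ?a = "\<kappa> * L2norm T (C (fst y)) + L2norm T (wderiv \<iota> T (snd y)) + \<kappa> * L2norm T (snd y)"
   let ?b = "L2norm T (wderiv \<iota> T (fst y)) + L2norm T (A (fst y)) + L2norm T (B (control (snd y)))"
   have ab: "0 \<le> ?a" "0 \<le> ?b"
    using mult_nonneg_nonneg[OF \<kappa> L2norm_nonneg[of T "C (fst y)"]] mult_nonneg_nonneg[OF \<kappa> L2norm_nonneg[of T "snd y"]]
     L2norm_nonneg[of T "wderiv \<iota> T (snd y)"] by simp_all
   have "\<bar>E x y\<bar> \<le> ?a * L2norm T (fst x) + ?b * L2norm T (snd x)"
    unfolding E_def by (rule row_bound[OF SD[OF x] \<Phi>D(1,2)[OF y]])
   also have "\<dots> \<le> ?a * (P.nrm x / sqrt \<alpha>) + ?b * (P.nrm x / sqrt \<alpha>)"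
    by (rule add_mono[OF mult_left_mono[OF parts(1)[OF x] ab(1)] mult_left_mono[OF parts(2)[OF x] ab(2)]])
   also have "\<dots> = K y * P.nrm x" unfolding K_def by (simp only: add_divide_distrib ring_distribs times_divide_eq_right times_divide_eq_left)
   finally show ?thesis .
  qed
  show "\<bar>L y\<bar> \<le> D * state_const \<alpha> \<kappa> * (2 * m) * N"
   if y: "y \<in> \<Phi>" and N: "0 \<le> N" "\<And>x. x \<in> L2 T \<times> L2 T \<Longrightarrow> \<bar>E x y\<bar> \<le> N * P.nrm x" for y N
  proof -
   obtain h k where hk: "y = (h, k)" by (cases y)
   have h: "h \<in> W \<iota> T" "time_eval \<iota> T 0 h = 0" and k: "k \<in> W \<iota> T" "time_eval \<iota> T T k = 0"
    using \<Phi>D[OF y] by (simp_all add: hk)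
   have Nm: "0 \<le> N * m" using N(1) \<kappa> by (simp add: m_def)
   have b: "\<bar>row1 g 0 h + row2 g 0 k\<bar> \<le> N * m * L2norm T g" "\<bar>row1 0 g h + row2 0 g k\<bar> \<le> N * m * L2norm T g"
    if g: "g \<in> L2 T" for g
    using N(2)[of "(g, 0)"] N(2)[of "(0, g)"] mult_left_mono[OF unit(1)[OF g] N(1)] mult_left_mono[OF unit(2)[OF g] N(1)] g
    by (simp_all add: E_def hk mult.assoc)
   have b1: "\<bar>L2_inner T (C h) (C g) - L2_pair T (wderiv \<iota> T k) g - L2_pair T (A g) k\<bar> \<le> N * m * L2norm T g"
    and b2: "\<bar>L2_pair T (wderiv \<iota> T h) g - L2_pair T (A h) g - L2_pair T (B (control k)) g\<bar> \<le> N * m * L2norm T g"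
    if g: "g \<in> L2 T" for g
    using b[OF g] unfolding row_unit[OF g h(1) k(1)] by auto
   note e = estimate[OF h(1) k(1) control_L2[OF W_L2[OF k(1)]] control_eq[OF W_L2[OF k(1)]]
     Nm b1 Nm b2 refl]
   let ?r = "state_const \<alpha> \<kappa> * (2 * m * N)"
   have r: "N * m + N * m + norm (time_eval \<iota> T T k) + norm (time_eval \<iota> T 0 h) = 2 * m * N"
    using h(2) k(2) by simp
   note e = e(1-4)[unfolded r]
   have "\<bar>L y\<bar> \<le> L2norm T l1 * L2norm T h + norm h1 * norm (time_eval \<iota> T T h)
     + (L2norm T l2 * L2norm T k + norm h2 * norm (time_eval \<iota> T 0 k))"
    using L2_pair_bound[OF l1 W_L2[OF h(1)]] L2_pair_bound[OF l2 W_L2[OF k(1)]]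
     Cauchy_Schwarz_ineq2[of h1 "time_eval \<iota> T T h"] Cauchy_Schwarz_ineq2[of h2 "time_eval \<iota> T 0 k"]
    by (simp add: L_def hk)
   also have "\<dots> \<le> L2norm T l1 * ?r + norm h1 * ?r + (L2norm T l2 * ?r + norm h2 * ?r)"
    by (intro add_mono mult_left_mono e) simp_all
   finally show ?thesis by (simp add: D_def algebra_simps)
  qed
 qed
 then obtain v z where vz: "v \<in> L2 T" "z \<in> L2 T" "\<And>y. y \<in> \<Phi> \<Longrightarrow> E (v, z) y = L y" by auto
 have "row1 v z h = L2_pair T l1 h + h1 \<bullet> time_eval \<iota> T T h" if "h \<in> W \<iota> T" "time_eval \<iota> T 0 h = 0" for h
  using vz(3)[of "(h, 0)"] that test_zero vz(1,2) by (simp add: \<Phi>_def E_def L_def W_zero)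
 moreover have "row2 v z k = L2_pair T l2 k + h2 \<bullet> time_eval \<iota> T 0 k" if "k \<in> W \<iota> T" "time_eval \<iota> T T k = 0" for k
  using vz(3)[of "(0, k)"] that test_zero vz(1,2) by (simp add: \<Phi>_def E_def L_def W_zero)
 ultimately show ?thesis using vz(1,2) by blast
qed

text \<open>The very weak solution is regular: row by row, the equation identifies the time derivative as an
 element of \<open>L\<^sub>2(0,T;V*)\<close>.\<close>

theorem existence:
 assumes l1: "l1 \<in> L2 T" and l2: "l2 \<in> L2 T"
 obtains v z where "v \<in> W \<iota> T" "z \<in> W \<iota> T"
  "\<And>h. h \<in> L2 T \<Longrightarrow> L2_inner T (C v) (C h) - L2_pair T (wderiv \<iota> T z) h - L2_pair T (A h) z = L2_pair T l1 h"
  "time_eval \<iota> T T z = h1"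
  "AE t in MT T. wderiv \<iota> T v t = (A v + B (control z) + l2) t" "time_eval \<iota> T 0 v = h2"
proof -
 obtain v z where v: "v \<in> L2 T" and z: "z \<in> L2 T"
  and r1: "\<And>h. h \<in> W \<iota> T \<Longrightarrow> time_eval \<iota> T 0 h = 0 \<Longrightarrow> row1 v z h = L2_pair T l1 h + h1 \<bullet> time_eval \<iota> T T h"
  and r2: "\<And>k. k \<in> W \<iota> T \<Longrightarrow> time_eval \<iota> T T k = 0 \<Longrightarrow> row2 v z k = L2_pair T l2 k + h2 \<bullet> time_eval \<iota> T 0 k"
  using very_weak_existence[OF l1 l2] by blast
 have T0: "0 \<in> {0..T}" "T \<in> {0..T}" using T by auto
 let ?\<phi> = "\<lambda>h. L2_inner T (C v) (C h) - L2_pair T (A h) z - L2_pair T l1 h"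
 have "bounded_linear_on (L2 T) (L2norm T) UNIV norm ?\<phi>"
 proof (rule bounded_linear_on_functionalI)
  show "?\<phi> (a + b) = ?\<phi> a + ?\<phi> b" if "a \<in> L2 T" "b \<in> L2 T" for a b
   using that v z l1 by (simp add: L2_inner_commute[of T "C v"] L2_operator_inner_add[OF C(1)]
     L2_operator_pair_add[OF A(1)] L2_pair_add_right)
  show "?\<phi> (c *\<^sub>R a) = c * ?\<phi> a" if "a \<in> L2 T" for c a
   using that v z l1 by (simp add: L2_inner_commute[of T "C v"] L2_operator_inner_scaleR[OF C(1)]
     L2_operator_pair_scaleR[OF A(1)] algebra_simps)
  let ?c = "\<kappa> * L2norm T (C v) + \<kappa> * L2norm T z + L2norm T l1"
  show "0 \<le> ?c" by (intro add_nonneg_nonneg mult_nonneg_nonneg \<kappa> L2norm_nonneg)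
  show "\<bar>?\<phi> h\<bar> \<le> ?c * L2norm T h" if h: "h \<in> L2 T" for h
  proof -
   have "\<bar>L2_inner T (C v) (C h)\<bar> \<le> \<kappa> * L2norm T (C v) * L2norm T h"
    using L2_operator_inner_bound[OF C(1) op_L2(3)[OF v] C(2) h] by (simp add: L2_inner_commute[of T "C v"] mult_ac)
   moreover have "\<bar>L2_pair T (A h) z\<bar> \<le> \<kappa> * L2norm T z * L2norm T h"
    using L2_operator_pair_bound[OF A(1) z A(2) h] by (simp add: mult_ac)
   moreover have "\<bar>L2_pair T l1 h\<bar> \<le> L2norm T l1 * L2norm T h" by (rule L2_pair_bound[OF l1 h])
   ultimately show ?thesis unfolding ring_distribs by linarith
  qed
 qed
 from dual_rep[OF this] obtain g where g: "g \<in> L2 T" "\<And>h. h \<in> L2 T \<Longrightarrow> ?\<phi> h = L2_pair T g h" by blast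
 have wd: "L2_pair T (wderiv \<iota> T (\<lambda>t. f t *\<^sub>R e)) y = L2_pair T (\<lambda>t. deriv f t *\<^sub>R emb_dual \<iota> (\<iota> e)) y"
  if f: "smooth f" and y: "y \<in> L2 T" for f e y
  by (rule L2_pair_cong_AE[OF W_smooth_scaled(2)[OF T f] wderiv_L2[OF W_smooth_scaled(1)[OF T f]] y])
 have Z: "z \<in> W \<iota> T" "AE t in MT T. wderiv \<iota> T z t = g t" "time_eval \<iota> T T z = h1"
 proof -
  have eq: "L2_pair T (\<lambda>t. deriv f t *\<^sub>R emb_dual \<iota> (\<iota> e)) z + L2_pair T g (\<lambda>t. f t *\<^sub>R e) = 1 * (f T * (h1 \<bullet> \<iota> e))"
   if f: "smooth f" and f0: "f 0 = 0" for f e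
  proof -
   note F = W_smooth_scaled[OF T f, where e = e and \<iota> = \<iota>]
   have "row1 v z (\<lambda>t. f t *\<^sub>R e) = L2_pair T l1 (\<lambda>t. f t *\<^sub>R e) + h1 \<bullet> (f T *\<^sub>R \<iota> e)"
    using r1[OF F(1)] F(3)[OF T0(1)] F(3)[OF T0(2)] f0 by simp
   then show ?thesis using g(2)[OF W_L2[OF F(1)]] wd[OF f z, of e] by (simp add: row1_def)
  qed
  note V = very_weak_solution[OF T dense z g(1), of T 0 1 h1, OF _ eq]
  show "z \<in> W \<iota> T" "AE t in MT T. wderiv \<iota> T z t = g t" "time_eval \<iota> T T z = h1" by (rule V; simp)+
 qed
 let ?g = "A v + B (control z) + l2"
 have g2: "?g \<in> L2 T" by (intro L2_add op_L2 v l2 control_L2[OF z])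
 have V: "v \<in> W \<iota> T" "AE t in MT T. wderiv \<iota> T v t = ?g t" "time_eval \<iota> T 0 v = h2"
 proof -
  have eq: "L2_pair T (\<lambda>t. deriv f t *\<^sub>R emb_dual \<iota> (\<iota> e)) v + L2_pair T ?g (\<lambda>t. f t *\<^sub>R e) = - 1 * (f 0 * (h2 \<bullet> \<iota> e))"
   if f: "smooth f" and f0: "f T = 0" for f e
  proof -
   note F = W_smooth_scaled[OF T f, where e = e and \<iota> = \<iota>]
   have "row2 v z (\<lambda>t. f t *\<^sub>R e) = L2_pair T l2 (\<lambda>t. f t *\<^sub>R e) + h2 \<bullet> (f 0 *\<^sub>R \<iota> e)"
    using r2[OF F(1)] F(3)[OF T0(1)] F(3)[OF T0(2)] f0 by simp
   moreover have "L2_pair T ?g (\<lambda>t. f t *\<^sub>R e)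
     = L2_pair T (A v) (\<lambda>t. f t *\<^sub>R e) + gram z (\<lambda>t. f t *\<^sub>R e) + L2_pair T l2 (\<lambda>t. f t *\<^sub>R e)"
    using L2_pair_add_left[OF L2_add[OF op_L2(1)[OF v] op_L2(2)[OF control_L2[OF z]]] l2 W_L2[OF F(1)]]
     L2_pair_add_left[OF op_L2(1)[OF v] op_L2(2)[OF control_L2[OF z]] W_L2[OF F(1)]] unfolding gram_def by linarith
   ultimately show ?thesis using wd[OF f v, of e] by (simp add: row2_def)
  qed
  note V = very_weak_solution[OF T dense v g2, of 0 T "- 1" h2, OF _ eq]
  show "v \<in> W \<iota> T" "AE t in MT T. wderiv \<iota> T v t = ?g t" "time_eval \<iota> T 0 v = h2" by (rule V; simp)+
 qed
 show ?thesis
 proof (rule that[OF V(1) Z(1) _ Z(3) V(2,3)])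
  fix h assume h: "h \<in> (L2 T :: (real \<Rightarrow> 'v) set)"
  show "L2_inner T (C v) (C h) - L2_pair T (wderiv \<iota> T z) h - L2_pair T (A h) z = L2_pair T l1 h"
   using g(2)[OF h] L2_pair_cong_AE[OF Z(2) wderiv_L2[OF Z(1)] h] by simp
 qed
qed

end

section \<open>The system operator\<close>

lemma Wnorm_seminormed:
 fixes \<iota> :: "'v::{real_normed_vector,second_countable_topology} \<Rightarrow>\<^sub>L 'h::real_inner"
 shows "seminormed (W \<iota> T) (Wnorm \<iota> T)"
proof
 show "subspace (W \<iota> T)" by (rule subspace_W)
 show "0 \<le> Wnorm \<iota> T a" for a by (simp add: Wnorm_def)
 show "Wnorm \<iota> T (c *\<^sub>R a) = \<bar>c\<bar> * Wnorm \<iota> T a" if a: "a \<in> W \<iota> T" for c a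
 proof -
  have "AE t in MT T. norm (wderiv \<iota> T (c *\<^sub>R a) t) = norm ((c *\<^sub>R wderiv \<iota> T a) t)"
   using wderiv_scaleR[OF a, of c] by eventually_elim (simp add: scaleR_fun_def)
  then have "L2norm T (wderiv \<iota> T (c *\<^sub>R a)) = L2norm T (c *\<^sub>R wderiv \<iota> T a)" by (rule L2norm_cong_AE)
  then have e: "Wnorm \<iota> T (c *\<^sub>R a) = sqrt ((\<bar>c\<bar> * L2norm T a)\<^sup>2 + (\<bar>c\<bar> * L2norm T (wderiv \<iota> T a))\<^sup>2)"
   by (simp add: Wnorm_def L2norm_scaleR)
  have "(\<bar>c\<bar> * L2norm T a)\<^sup>2 + (\<bar>c\<bar> * L2norm T (wderiv \<iota> T a))\<^sup>2
    = \<bar>c\<bar>\<^sup>2 * ((L2norm T a)\<^sup>2 + (L2norm T (wderiv \<iota> T a))\<^sup>2)"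
   by (simp only: power_mult_distrib distrib_left)
  then show ?thesis unfolding e by (simp add: real_sqrt_mult Wnorm_def)
 qed
 show "Wnorm \<iota> T (a + b) \<le> Wnorm \<iota> T a + Wnorm \<iota> T b" if a: "a \<in> W \<iota> T" and b: "b \<in> W \<iota> T" for a b
 proof -
  have "AE t in MT T. wderiv \<iota> T (a + b) t = (wderiv \<iota> T a + wderiv \<iota> T b) t"
   using wderiv_add[OF a b] by simp
  then have "AE t in MT T. norm (wderiv \<iota> T (a + b) t) = norm ((wderiv \<iota> T a + wderiv \<iota> T b) t)"
   by eventually_elim (rule arg_cong[of _ _ norm])
  then have "L2norm T (wderiv \<iota> T (a + b)) = L2norm T (wderiv \<iota> T a + wderiv \<iota> T b)"
   by (rule L2norm_cong_AE)
  then have d: "L2norm T (wderiv \<iota> T (a + b)) \<le> L2norm T (wderiv \<iota> T a) + L2norm T (wderiv \<iota> T b)"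
   using L2norm_add[OF wderiv_L2[OF a] wderiv_L2[OF b]] by linarith
  have "Wnorm \<iota> T (a + b) \<le> sqrt ((L2norm T a + L2norm T b)\<^sup>2 + (L2norm T (wderiv \<iota> T a) + L2norm T (wderiv \<iota> T b))\<^sup>2)"
   unfolding Wnorm_def
   by (intro real_sqrt_le_mono add_mono power_mono d L2norm_add[OF W_L2[OF a] W_L2[OF b]]) simp_all
  also have "\<dots> \<le> Wnorm \<iota> T a + Wnorm \<iota> T b"
   unfolding Wnorm_def by (rule real_sqrt_sum_squares_triangle_ineq)
  finally show ?thesis .
 qed
qed

lemma WW_seminormed:
 fixes \<iota> :: "'v::{real_normed_vector,second_countable_topology} \<Rightarrow>\<^sub>L 'h::real_inner"
 shows "seminormed (WW \<iota> T) (WWnorm \<iota> T)"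
 unfolding WW_def WWnorm_def by (rule seminormed_prod[OF Wnorm_seminormed Wnorm_seminormed])

lemma RHS_seminormed: "seminormed (RHS T) (RHSnorm T)"
proof -
 have e: "RHSnorm T = (\<lambda>(l1, y). sqrt ((L2norm T l1)\<^sup>2 + ((\<lambda>(h1, w). sqrt ((norm h1)\<^sup>2
   + ((\<lambda>(l2, h2). sqrt ((L2norm T l2)\<^sup>2 + (norm h2)\<^sup>2)) w)\<^sup>2)) y)\<^sup>2))"
  by (simp add: RHSnorm_def split_def fun_eq_iff)
 show ?thesis unfolding RHS_def e
  by (rule seminormed_prod[OF L2_seminormed seminormed_prod[OF norm_seminormed seminormed_prod[OF L2_seminormed norm_seminormed]]])
qed

lemma RHSnorm_bounds:
 "L2norm T l1 \<le> RHSnorm T (l1, h1, l2, h2)" "norm h1 \<le> RHSnorm T (l1, h1, l2, h2)"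
 "L2norm T l2 \<le> RHSnorm T (l1, h1, l2, h2)" "norm h2 \<le> RHSnorm T (l1, h1, l2, h2)"
 by (simp_all add: RHSnorm_def real_le_rsqrt)

lemma RHSnorm_le_sum:
 "RHSnorm T (l1, h1, l2, h2) \<le> L2norm T l1 + norm h1 + L2norm T l2 + norm h2"
proof -
 have "(a::real)\<^sup>2 + b\<^sup>2 + c\<^sup>2 + d\<^sup>2 \<le> (a + b + c + d)\<^sup>2" if "0 \<le> a" "0 \<le> b" "0 \<le> c" "0 \<le> d" for a b c d
  using that by (simp add: power2_eq_square algebra_simps)
 then show ?thesis unfolding RHSnorm_def by (auto intro!: real_le_lsqrt)
qed

lemma RHSnorm_zeroI:
 "L2norm T l1 = 0 \<Longrightarrow> h1 = 0 \<Longrightarrow> L2norm T l2 = 0 \<Longrightarrow> h2 = 0 \<Longrightarrow> RHSnorm T (l1, h1, l2, h2) = 0"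
 by (simp add: RHSnorm_def)

lemma WWnorm_bounds:
 "WWnorm \<iota> T (v, z) \<le> Wnorm \<iota> T v + Wnorm \<iota> T z" "Wnorm \<iota> T v \<le> WWnorm \<iota> T (v, z)" "Wnorm \<iota> T z \<le> WWnorm \<iota> T (v, z)"
 by (auto simp: WWnorm_def Wnorm_def intro!: real_le_lsqrt real_le_rsqrt simp: power2_sum)

lemma solution_const_nonneg: "0 < \<alpha> \<Longrightarrow> 0 \<le> \<kappa> \<Longrightarrow> 0 \<le> solution_const \<alpha> \<kappa>"
proof -
 assume a: "0 < \<alpha>" "0 \<le> \<kappa>"
 have "0 \<le> energy_const \<alpha> \<kappa>" using energy_const_ge[OF a] by linarith
 then show ?thesis using a by (simp add: solution_const_def state_const_def output_const_def)
qed

context lq_system begin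

text \<open>The components of \<open>M\<close> in \<open>L\<^sub>2(0,T;V*)\<close>, each together with the form that it represents. Linearity and
 bounds are transferred from the forms, which determine the components up to null sets.\<close>

definition adj_form where
 "adj_form v z h = L2_inner T (C v) (C h) - L2_pair T (wderiv \<iota> T z) h - L2_pair T (A h) z"
definition adj_row where "adj_row v z = L2_dual_rep T (adj_form v z)"
definition state_row where "state_row v z = wderiv \<iota> T v - A v - B (control z)"
definition state_form where "state_form v z h = L2_pair T (wderiv \<iota> T v) h - L2_pair T (A v) h - gram z h"

definition system_op where
 "system_op = (\<lambda>(v, z). (adj_row v z, time_eval \<iota> T T z, state_row v z, time_eval \<iota> T 0 v))"

lemma adj_form_bounded:
 assumes v: "v \<in> L2 T" and z: "z \<in> W \<iota> T"
 shows "bounded_linear_on (L2 T) (L2norm T) UNIV norm (adj_form v z)"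
  and "h \<in> L2 T \<Longrightarrow> \<bar>adj_form v z h\<bar> \<le> (\<kappa> * (\<kappa> * L2norm T v) + L2norm T (wderiv \<iota> T z) + \<kappa> * L2norm T z) * L2norm T h"
proof -
 note z' = W_L2[OF z] wderiv_L2[OF z]
 let ?c = "\<kappa> * (\<kappa> * L2norm T v) + L2norm T (wderiv \<iota> T z) + \<kappa> * L2norm T z"
 have c: "0 \<le> ?c" by (intro add_nonneg_nonneg mult_nonneg_nonneg \<kappa> L2norm_nonneg)
 show b: "\<bar>adj_form v z h\<bar> \<le> ?c * L2norm T h" if h: "h \<in> L2 T" for h
 proof -
  have "\<bar>L2_inner T (C v) (C h)\<bar> \<le> \<kappa> * L2norm T (C v) * L2norm T h"
   using L2_operator_inner_bound[OF C(1) op_L2(3)[OF v] C(2) h] by (simp add: L2_inner_commute[of T "C v"] mult_ac)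
  moreover have "\<kappa> * L2norm T (C v) * L2norm T h \<le> \<kappa> * (\<kappa> * L2norm T v) * L2norm T h"
   by (intro mult_right_mono mult_left_mono op_le(3)[OF v] \<kappa> L2norm_nonneg)
  moreover have "\<bar>L2_pair T (A h) z\<bar> \<le> \<kappa> * L2norm T z * L2norm T h"
   using L2_operator_pair_bound[OF A(1) z'(1) A(2) h] by (simp add: mult_ac)
  moreover have "\<bar>L2_pair T (wderiv \<iota> T z) h\<bar> \<le> L2norm T (wderiv \<iota> T z) * L2norm T h"
   by (rule L2_pair_bound[OF z'(2) h])
  ultimately show ?thesis unfolding ring_distribs adj_form_def by linarith
 qed
 show "bounded_linear_on (L2 T) (L2norm T) UNIV norm (adj_form v z)"
 proof (rule bounded_linear_on_functionalI[OF _ _ c b])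
  show "adj_form v z (a + b) = adj_form v z a + adj_form v z b" if "a \<in> L2 T" "b \<in> L2 T" for a b
   using that v z' by (simp add: adj_form_def L2_inner_commute[of T "C v"] L2_operator_inner_add[OF C(1)]
     L2_operator_pair_add[OF A(1)] L2_pair_add_right)
  show "adj_form v z (c *\<^sub>R a) = c * adj_form v z a" if "a \<in> L2 T" for c a
   using that v z' by (simp add: adj_form_def L2_inner_commute[of T "C v"] L2_operator_inner_scaleR[OF C(1)]
     L2_operator_pair_scaleR[OF A(1)] algebra_simps)
 qed
qed

lemma dual_rep_some:
 assumes "bounded_linear_on (L2 T) (L2norm T) UNIV norm \<phi>"
 shows "L2_dual_rep T \<phi> \<in> (L2 T :: (real \<Rightarrow> 'v \<Rightarrow>\<^sub>L real) set)"
  and "h \<in> L2 T \<Longrightarrow> L2_pair T (L2_dual_rep T \<phi>) (h :: real \<Rightarrow> 'v) = \<phi> h"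
proof -
 have "\<exists>g. g \<in> L2 T \<and> (\<forall>h\<in>L2 T. \<phi> h = L2_pair T g (h :: real \<Rightarrow> 'v))" using dual_rep[OF assms] by blast
 from someI_ex[OF this] show "L2_dual_rep T \<phi> \<in> (L2 T :: (real \<Rightarrow> 'v \<Rightarrow>\<^sub>L real) set)"
  "h \<in> L2 T \<Longrightarrow> L2_pair T (L2_dual_rep T \<phi>) (h :: real \<Rightarrow> 'v) = \<phi> h"
  unfolding L2_dual_rep_def by auto
qed

lemma adj_row:
 assumes "v \<in> W \<iota> T" "z \<in> W \<iota> T"
 shows "adj_row v z \<in> L2 T" "h \<in> L2 T \<Longrightarrow> L2_pair T (adj_row v z) h = adj_form v z h"
 unfolding adj_row_def by (rule dual_rep_some[OF adj_form_bounded(1)[OF W_L2[OF assms(1)] assms(2)]]; assumption)+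

lemma state_row:
 assumes v: "v \<in> W \<iota> T" and z: "z \<in> W \<iota> T"
 shows "state_row v z \<in> L2 T" "h \<in> L2 T \<Longrightarrow> L2_pair T (state_row v z) h = state_form v z h"
proof -
 note m = wderiv_L2[OF v] op_L2(1)[OF W_L2[OF v]] op_L2(2)[OF control_L2[OF W_L2[OF z]]]
 show "state_row v z \<in> L2 T" unfolding state_row_def by (intro L2_diff m)
 show "L2_pair T (state_row v z) h = state_form v z h" if "h \<in> L2 T"
  using L2_pair_diff_left[OF L2_diff[OF m(1,2)] m(3) that] L2_pair_diff_left[OF m(1,2) that]
  by (simp add: state_row_def state_form_def gram_def)
qed

lemma form_linear:
 assumes v: "v \<in> W \<iota> T" and z: "z \<in> W \<iota> T" and v': "v' \<in> W \<iota> T" and z': "z' \<in> W \<iota> T" and h: "h \<in> L2 T"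
 shows "adj_form (v + v') (z + z') h = adj_form v z h + adj_form v' z' h"
  "adj_form (c *\<^sub>R v) (c *\<^sub>R z) h = c * adj_form v z h"
  "state_form (v + v') (z + z') h = state_form v z h + state_form v' z' h"
  "state_form (c *\<^sub>R v) (c *\<^sub>R z) h = c * state_form v z h"
 using v z v' z' h W_L2[OF v] W_L2[OF z] W_L2[OF v'] W_L2[OF z']
 by (simp_all add: adj_form_def state_form_def L2_operator_inner_add[OF C(1)] L2_operator_inner_scaleR[OF C(1)]
   L2_operator_pair_add[OF A(1)] L2_operator_pair_scaleR[OF A(1)] gram_linear_left L2_pair_add_right
   L2_pair_wderiv_linear algebra_simps)

lemma L2norm_diff_zero:
 assumes f: "f \<in> L2 T" and g: "g \<in> L2 T" and eq: "\<And>h. h \<in> L2 T \<Longrightarrow> L2_pair T f h = L2_pair T g (h :: real \<Rightarrow> 'v)"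
 shows "L2norm T (f - g) = 0"
proof -
 have "AE t in MT T. f t = g t" by (rule L2_eq_if_pairs_eq[OF f g eq])
 then have "AE t in MT T. (f - g) t = 0" by eventually_elim simp
 then show ?thesis using L2norm_zero_iff[OF L2_diff[OF f g]] by simp
qed

lemma control_norm: "z \<in> L2 T \<Longrightarrow> L2norm T (control z) \<le> \<kappa> * L2norm T z / \<alpha>\<^sup>2"
proof (rule control_bound[OF control_L2 control_eq])
 assume z: "z \<in> L2 T"
 show "0 \<le> \<kappa> * L2norm T z" by (rule mult_nonneg_nonneg[OF \<kappa> L2norm_nonneg])
 show "\<bar>L2_pair T (B k) z\<bar> \<le> \<kappa> * L2norm T z * L2norm T k" if "k \<in> L2 T" for k
  using L2_operator_pair_bound[OF B(1) z B(2) that] by (simp add: mult_ac)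
qed

lemma state_row_norm:
 assumes v: "v \<in> W \<iota> T" and z: "z \<in> W \<iota> T"
 shows "L2norm T (state_row v z) \<le> L2norm T (wderiv \<iota> T v) + \<kappa> * L2norm T v + \<kappa> * (\<kappa> * L2norm T z / \<alpha>\<^sup>2)"
proof -
 note m = wderiv_L2[OF v] op_L2(1)[OF W_L2[OF v]] op_L2(2)[OF control_L2[OF W_L2[OF z]]]
 have "L2norm T (B (control z)) \<le> \<kappa> * (\<kappa> * L2norm T z / \<alpha>\<^sup>2)"
  using op_le(2)[OF control_L2[OF W_L2[OF z]]] mult_left_mono[OF control_norm[OF W_L2[OF z]] \<kappa>] by linarith
 then show ?thesis unfolding state_row_def
  using L2norm_diff[OF L2_diff[OF m(1,2)] m(3)] L2norm_diff[OF m(1,2)] op_le(1)[OF W_L2[OF v]] by linarith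
qed

lemma system_op_bounded: "bounded_linear_on (WW \<iota> T) (WWnorm \<iota> T) (RHS T) (RHSnorm T) system_op"
 unfolding bounded_linear_on_def
proof (intro conjI ballI allI)
 have T0: "0 \<in> {0..T}" "T \<in> {0..T}" using T by auto
 show "system_op a \<in> RHS T" if "a \<in> WW \<iota> T" for a
  using that adj_row(1) state_row(1) by (auto simp: WW_def RHS_def system_op_def)
 show "RHSnorm T (system_op (a + b) - (system_op a + system_op b)) = 0" if a: "a \<in> WW \<iota> T" and b: "b \<in> WW \<iota> T" for a b
 proof -
  obtain v z v' z' where ab: "a = (v, z)" "b = (v', z')" by (cases a; cases b)
  have m: "v \<in> W \<iota> T" "z \<in> W \<iota> T" "v' \<in> W \<iota> T" "z' \<in> W \<iota> T" using a b by (auto simp: ab WW_def)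
  note s = W_add[OF m(1,3)] W_add[OF m(2,4)]
  have e: "system_op (a + b) - (system_op a + system_op b) =
   (adj_row (v + v') (z + z') - (adj_row v z + adj_row v' z'), time_eval \<iota> T T (z + z') - (time_eval \<iota> T T z + time_eval \<iota> T T z'),
    state_row (v + v') (z + z') - (state_row v z + state_row v' z'), time_eval \<iota> T 0 (v + v') - (time_eval \<iota> T 0 v + time_eval \<iota> T 0 v'))"
   by (simp add: ab system_op_def)
  show ?thesis unfolding e
  proof (rule RHSnorm_zeroI)
   show "L2norm T (adj_row (v + v') (z + z') - (adj_row v z + adj_row v' z')) = 0"
    by (rule L2norm_diff_zero[OF adj_row(1)[OF s] L2_add[OF adj_row(1)[OF m(1,2)] adj_row(1)[OF m(3,4)]]])
      (simp add: adj_row s m L2_pair_add_left form_linear)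
   show "L2norm T (state_row (v + v') (z + z') - (state_row v z + state_row v' z')) = 0"
    by (rule L2norm_diff_zero[OF state_row(1)[OF s] L2_add[OF state_row(1)[OF m(1,2)] state_row(1)[OF m(3,4)]]])
      (simp add: state_row s m L2_pair_add_left form_linear)
  qed (simp_all add: time_eval_add[OF T] m less_imp_le[OF T])
 qed
 show "RHSnorm T (system_op (c *\<^sub>R a) - c *\<^sub>R system_op a) = 0" if a: "a \<in> WW \<iota> T" for c a
 proof -
  obtain v z where ab: "a = (v, z)" by (cases a)
  have m: "v \<in> W \<iota> T" "z \<in> W \<iota> T" using a by (auto simp: ab WW_def)
  note s = W_scaleR[OF m(1), of c] W_scaleR[OF m(2), of c]
  have e: "system_op (c *\<^sub>R a) - c *\<^sub>R system_op a =
   (adj_row (c *\<^sub>R v) (c *\<^sub>R z) - c *\<^sub>R adj_row v z, time_eval \<iota> T T (c *\<^sub>R z) - c *\<^sub>R time_eval \<iota> T T z,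
    state_row (c *\<^sub>R v) (c *\<^sub>R z) - c *\<^sub>R state_row v z, time_eval \<iota> T 0 (c *\<^sub>R v) - c *\<^sub>R time_eval \<iota> T 0 v)"
   by (simp add: ab system_op_def)
  show ?thesis unfolding e
  proof (rule RHSnorm_zeroI)
   show "L2norm T (adj_row (c *\<^sub>R v) (c *\<^sub>R z) - c *\<^sub>R adj_row v z) = 0"
    by (rule L2norm_diff_zero[OF adj_row(1)[OF s] L2_scaleR[OF adj_row(1)[OF m]]])
      (simp add: adj_row s m form_linear(2)[OF m m])
   show "L2norm T (state_row (c *\<^sub>R v) (c *\<^sub>R z) - c *\<^sub>R state_row v z) = 0"
    by (rule L2norm_diff_zero[OF state_row(1)[OF s] L2_scaleR[OF state_row(1)[OF m]]])
      (simp add: state_row s m form_linear(4)[OF m m])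
  qed (simp_all add: time_eval_scaleR[OF T] m less_imp_le[OF T])
 qed
 obtain c where c: "0 \<le> c" "\<And>v s. v \<in> W \<iota> T \<Longrightarrow> s \<in> {0..T} \<Longrightarrow> norm (time_eval \<iota> T s v) \<le> c * Wnorm \<iota> T v"
  using time_eval_bounded[OF T, of \<iota>] by blast
 let ?D = "(\<kappa> + \<kappa>\<^sup>2) / \<alpha>"
 let ?K = "?D * (\<kappa> * \<kappa> + 1 + \<kappa>) + c + (1 + \<kappa> + \<kappa> * (\<kappa> / \<alpha>\<^sup>2)) + c"
 have D: "0 \<le> ?D" using \<kappa> \<alpha> by simp
 have "?K \<in> op_bounds (WW \<iota> T) (WWnorm \<iota> T) (RHSnorm T) system_op"
  unfolding op_bounds_def
 proof (intro CollectI conjI ballI)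
  show "0 \<le> ?K" using D \<kappa> c(1) by (intro add_nonneg_nonneg mult_nonneg_nonneg) auto
  fix a assume a: "a \<in> WW \<iota> T"
  obtain v z where ab: "a = (v, z)" by (cases a)
  have m: "v \<in> W \<iota> T" "z \<in> W \<iota> T" using a by (auto simp: ab WW_def)
  let ?n = "WWnorm \<iota> T (v, z)"
  have n: "L2norm T v \<le> ?n" "L2norm T z \<le> ?n" "L2norm T (wderiv \<iota> T v) \<le> ?n" "L2norm T (wderiv \<iota> T z) \<le> ?n"
   using Wnorm_bounds(1,2)[OF T, where v = v and \<iota> = \<iota>] Wnorm_bounds(1,2)[OF T, where v = z and \<iota> = \<iota>] WWnorm_bounds(2)[of \<iota> T v z] WWnorm_bounds(3)[of \<iota> T z v]
   by linarith+
  have a1: "L2norm T (adj_row v z) \<le> ?D * (\<kappa> * (\<kappa> * ?n) + ?n + \<kappa> * ?n)"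
  proof -
   let ?c = "\<kappa> * (\<kappa> * L2norm T v) + L2norm T (wderiv \<iota> T z) + \<kappa> * L2norm T z"
   have "L2norm T (adj_row v z) \<le> ?D * ?c"
   proof (rule L2norm_le_dual[OF adj_row(1)[OF m]])
    show "0 \<le> ?c" by (intro add_nonneg_nonneg mult_nonneg_nonneg \<kappa> L2norm_nonneg)
    show "\<bar>L2_pair T (adj_row v z) h\<bar> \<le> ?c * L2norm T h" if "h \<in> L2 T" for h
     using adj_form_bounded(2)[OF W_L2[OF m(1)] m(2) that] adj_row(2)[OF m that] by simp
   qed
   also have "\<dots> \<le> ?D * (\<kappa> * (\<kappa> * ?n) + ?n + \<kappa> * ?n)"
    by (intro mult_left_mono[OF _ D] add_mono mult_left_mono[OF _ \<kappa>] n)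
   finally show ?thesis .
  qed
  have a3: "L2norm T (state_row v z) \<le> ?n + \<kappa> * ?n + \<kappa> * (\<kappa> * ?n / \<alpha>\<^sup>2)"
  proof -
   have "L2norm T (wderiv \<iota> T v) + \<kappa> * L2norm T v + \<kappa> * (\<kappa> * L2norm T z / \<alpha>\<^sup>2) \<le> ?n + \<kappa> * ?n + \<kappa> * (\<kappa> * ?n / \<alpha>\<^sup>2)"
    by (intro add_mono mult_left_mono[OF _ \<kappa>] divide_right_mono n) simp
   then show ?thesis using state_row_norm[OF m] by linarith
  qed
  have a2: "norm (time_eval \<iota> T T z) \<le> c * ?n" "norm (time_eval \<iota> T 0 v) \<le> c * ?n"
   using c(2)[OF m(2) T0(2)] c(2)[OF m(1) T0(1)]
    mult_left_mono[OF WWnorm_bounds(3)[of \<iota> T z v] c(1)] mult_left_mono[OF WWnorm_bounds(2)[of \<iota> T v z] c(1)] by linarith+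
  have "RHSnorm T (system_op a) \<le> L2norm T (adj_row v z) + norm (time_eval \<iota> T T z) + L2norm T (state_row v z) + norm (time_eval \<iota> T 0 v)"
   unfolding ab system_op_def by (simp add: RHSnorm_le_sum)
  also have "\<dots> \<le> ?D * (\<kappa> * (\<kappa> * ?n) + ?n + \<kappa> * ?n) + c * ?n + (?n + \<kappa> * ?n + \<kappa> * (\<kappa> * ?n / \<alpha>\<^sup>2)) + c * ?n"
   using a1 a2 a3 by linarith
  also have "\<dots> = ?K * WWnorm \<iota> T a"
  proof -
   have "d * (\<kappa> * (\<kappa> * n) + n + \<kappa> * n) + c * n + (n + \<kappa> * n + \<kappa> * (\<kappa> * n / e)) + c * n
    = (d * (\<kappa> * \<kappa> + 1 + \<kappa>) + c + (1 + \<kappa> + \<kappa> * (\<kappa> / e)) + c) * n" for d n e :: real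
    by (simp add: algebra_simps)
   then show ?thesis unfolding ab .
  qed
  finally show "RHSnorm T (system_op a) \<le> ?K * WWnorm \<iota> T a" .
 qed
 then show "op_bounds (WW \<iota> T) (WWnorm \<iota> T) (RHSnorm T) system_op \<noteq> {}" by blast
qed

text \<open>The factor \<open>4\<close> comes from the passage from the sum of the norms of the four components to \<open>RHSnorm\<close>.\<close>

lemma system_op_estimate:
 assumes a: "a \<in> WW \<iota> T"
 shows "WWnorm \<iota> T a \<le> 4 * solution_const \<alpha> \<kappa> * RHSnorm T (system_op a)"
proof -
 obtain v z where ab: "a = (v, z)" by (cases a)
 have m: "v \<in> W \<iota> T" "z \<in> W \<iota> T" using a by (auto simp: ab WW_def)
 have b1: "\<bar>L2_inner T (C v) (C h) - L2_pair T (wderiv \<iota> T z) h - L2_pair T (A h) z\<bar> \<le> L2norm T (adj_row v z) * L2norm T h"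
  if "h \<in> L2 T" for h
  using L2_pair_bound[OF adj_row(1)[OF m] that] adj_row(2)[OF m that] by (simp add: adj_form_def)
 have b2: "\<bar>L2_pair T (wderiv \<iota> T v) h - L2_pair T (A v) h - L2_pair T (B (control z)) h\<bar> \<le> L2norm T (state_row v z) * L2norm T h"
  if "h \<in> L2 T" for h
  using L2_pair_bound[OF state_row(1)[OF m] that] state_row(2)[OF m that] by (simp add: state_form_def gram_def)
 let ?r = "L2norm T (adj_row v z) + L2norm T (state_row v z) + norm (time_eval \<iota> T T z) + norm (time_eval \<iota> T 0 v)"
 have 1: "Wnorm \<iota> T v + Wnorm \<iota> T z \<le> solution_const \<alpha> \<kappa> * ?r"
  by (rule estimate_W[OF m control_L2[OF W_L2[OF m(2)]] control_eq[OF W_L2[OF m(2)]] L2norm_nonneg b1 L2norm_nonneg b2 refl])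
 have "?r \<le> 4 * RHSnorm T (system_op a)"
  using RHSnorm_bounds[where ?l1.0 = "adj_row v z" and ?h1.0 = "time_eval \<iota> T T z" and ?l2.0 = "state_row v z"
    and ?h2.0 = "time_eval \<iota> T 0 v" and T = T]
  by (simp add: ab system_op_def)
 from mult_left_mono[OF this solution_const_nonneg[OF \<alpha> \<kappa>]] show ?thesis
  using 1 WWnorm_bounds(1)[of \<iota> T v z] by (simp add: ab)
qed

theorem system_op_invertible: "invertible_on (WW \<iota> T) (WWnorm \<iota> T) (RHS T) (RHSnorm T) system_op"
 unfolding invertible_on_def
proof (intro conjI ballI system_op_bounded impI)
 show "WWnorm \<iota> T a = 0" if "a \<in> WW \<iota> T" "RHSnorm T (system_op a) = 0" for a
  using system_op_estimate[OF that(1)] that(2) seminormed.p_nonneg[OF WW_seminormed, of \<iota> T a] by simp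
 fix b assume "b \<in> (RHS T :: ((real \<Rightarrow> 'v \<Rightarrow>\<^sub>L real) \<times> 'h \<times> (real \<Rightarrow> 'v \<Rightarrow>\<^sub>L real) \<times> 'h) set)"
 then obtain l1 h1 l2 h2 where b: "b = (l1, h1, l2, h2)" "l1 \<in> L2 T" "l2 \<in> L2 T" by (auto simp: RHS_def)
 obtain v z where vz: "v \<in> W \<iota> T" "z \<in> W \<iota> T"
  "\<And>h. h \<in> L2 T \<Longrightarrow> L2_inner T (C v) (C h) - L2_pair T (wderiv \<iota> T z) h - L2_pair T (A h) z = L2_pair T l1 h"
  "time_eval \<iota> T T z = h1"
  "AE t in MT T. wderiv \<iota> T v t = (A v + B (control z) + l2) t" "time_eval \<iota> T 0 v = h2"
  using existence[OF b(2,3)] by blast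
 have "RHSnorm T (system_op (v, z) - b) = RHSnorm T (adj_row v z - l1, time_eval \<iota> T T z - h1, state_row v z - l2, time_eval \<iota> T 0 v - h2)"
  by (simp add: system_op_def b(1))
 also have "\<dots> = 0"
 proof (rule RHSnorm_zeroI)
  show "L2norm T (adj_row v z - l1) = 0"
   by (rule L2norm_diff_zero[OF adj_row(1)[OF vz(1,2)] b(2)]) (simp add: adj_row(2)[OF vz(1,2)] adj_form_def vz(3))
  have "AE t in MT T. (state_row v z - l2) t = 0"
   using vz(5) by eventually_elim (simp add: state_row_def)
  then show "L2norm T (state_row v z - l2) = 0"
   using L2norm_zero_iff[OF L2_diff[OF state_row(1)[OF vz(1,2)] b(3)]] by simp
 qed (simp_all add: vz)
 finally show "\<exists>a\<in>WW \<iota> T. RHSnorm T (system_op a - b) = 0" using vz(1,2) by (intro bexI[of _ "(v, z)"]) (auto simp: WW_def)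
qed

end

section \<open>The optimal control problem\<close>

lemma frechet_derivatives:
 fixes F :: "'a::real_normed_vector \<Rightarrow> 'b::real_normed_vector"
 assumes "C2_frechet F"
 obtains D1 :: "'a \<Rightarrow> 'a \<Rightarrow>\<^sub>L 'b" and D2 :: "'a \<Rightarrow> 'a \<Rightarrow>\<^sub>L ('a \<Rightarrow>\<^sub>L 'b)"
 where "\<And>y h. frechet_derivative F (at y) h = D1 y h"
  "\<And>y h k. frechet_derivative (\<lambda>y. frechet_derivative F (at y) h) (at y) k = D2 y k h"
proof -
 obtain D1 :: "'a \<Rightarrow> 'a \<Rightarrow>\<^sub>L 'b" and D2 :: "'a \<Rightarrow> 'a \<Rightarrow>\<^sub>L ('a \<Rightarrow>\<^sub>L 'b)"
  where D: "\<And>a. (F has_derivative blinfun_apply (D1 a)) (at a)" "\<And>a. (D1 has_derivative blinfun_apply (D2 a)) (at a)"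
  using assms unfolding C2_frechet_def by blast
 have 1: "frechet_derivative F (at y) = blinfun_apply (D1 y)" for y
  by (rule frechet_derivative_at[OF D(1), symmetric])
 have 2: "frechet_derivative (\<lambda>y. D1 y h) (at y) = (\<lambda>k. D2 y k h)" for y h
  by (rule frechet_derivative_at[symmetric])
    (rule bounded_linear.has_derivative[OF blinfun.bounded_linear_left D(2)])
 show ?thesis by (rule that) (simp_all add: 1 2)
qed

text \<open>The operators induced by \<open>Abar\<close> act pointwise in time, so scalar weights pass through them.\<close>

lemma
 assumes "C2_frechet (Abar P)"
 shows A_deriv_local: "A_deriv P x (\<lambda>t. \<phi> t *\<^sub>R h t) = (\<lambda>t. \<phi> t *\<^sub>R A_deriv P x h t)"
  and A_deriv2_local: "A_deriv2 P x (\<lambda>t. \<phi> t *\<^sub>R h t) h' = A_deriv2 P x h (\<lambda>t. \<phi> t *\<^sub>R h' t)"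
proof -
 obtain D1 D2 where D: "\<And>y h. frechet_derivative (Abar P) (at y) h = blinfun_apply (D1 y) h"
  "\<And>y h k. frechet_derivative (\<lambda>y. frechet_derivative (Abar P) (at y) h) (at y) k = blinfun_apply (blinfun_apply (D2 y) k) h"
  using frechet_derivatives[OF assms] by blast
 show "A_deriv P x (\<lambda>t. \<phi> t *\<^sub>R h t) = (\<lambda>t. \<phi> t *\<^sub>R A_deriv P x h t)"
  by (simp add: A_deriv_def D(1) blinfun.scaleR_right)
 show "A_deriv2 P x (\<lambda>t. \<phi> t *\<^sub>R h t) h' = A_deriv2 P x h (\<lambda>t. \<phi> t *\<^sub>R h' t)"
  by (simp only: A_deriv2_def D(2) blinfun.scaleR_right blinfun.scaleR_left)
qed

lemma B_op_operator: "L2_operator T (B_op P)"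
proof (rule L2_operatorI)
 show "B_op P f \<in> L2 T" if "f \<in> L2 T" for f unfolding B_op_def by (rule L2_blinfun[OF that])
 show "L2norm T (B_op P f) \<le> norm (Bbar P) * L2norm T f" if "f \<in> L2 T" for f
  unfolding B_op_def by (rule L2norm_blinfun[OF that])
qed (simp_all add: B_op_def blinfun.add_right blinfun.scaleR_right scaleR_fun_def)

lemma norm_emb_dual_le:
 assumes "norm \<iota> \<le> 1"
 shows "norm (emb_dual \<iota> (blinfun_apply \<iota> y)) \<le> norm y"
proof (rule norm_blinfun_bound)
 have c: "norm (\<iota> w) \<le> norm w" for w
  using norm_blinfun[of \<iota> w] mult_right_mono[OF assms norm_ge_zero[of w]] by simp
 fix w
 have "\<bar>\<iota> y \<bullet> \<iota> w\<bar> \<le> norm (\<iota> y) * norm (\<iota> w)" by (rule Cauchy_Schwarz_ineq2)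
 also have "\<dots> \<le> norm y * norm w" by (intro mult_mono c) simp_all
 finally show "norm (emb_dual \<iota> (\<iota> y) w) \<le> norm y * norm w" by simp
qed simp

lemma L2norm_indicator:
 assumes "\<tau> \<le> T"
 shows "L2norm T (\<lambda>t. indicator {0..\<tau>} t *\<^sub>R g t) = L2norm \<tau> g"
proof -
 have "(LINT t|MT T. (norm (indicator {0..\<tau>} t *\<^sub>R g t))\<^sup>2)
   = (LINT t|lebesgue. indicator {0..T} t *\<^sub>R (norm (indicator {0..\<tau>} t *\<^sub>R g t))\<^sup>2)"
  by (rule integral_restrict_space) simp
 also have "\<dots> = (LINT t|lebesgue. indicator {0..\<tau>} t *\<^sub>R (norm (g t))\<^sup>2)"
  by (rule Bochner_Integration.integral_cong) (use assms in \<open>auto simp: indicator_def\<close>)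
 also have "\<dots> = (LINT t|MT \<tau>. (norm (g t))\<^sup>2)"
  by (rule integral_restrict_space[symmetric]) simp
 finally show ?thesis by (simp add: L2norm_def)
qed

lemma riesz_rep_some:
 fixes \<phi> :: "(real \<Rightarrow> 'u::{real_inner,banach}) \<Rightarrow> real"
 assumes \<phi>: "bounded_linear_on (L2 T) (L2norm T) UNIV norm \<phi>"
 shows "L2_riesz_rep T \<phi> \<in> L2 T" and "h \<in> L2 T \<Longrightarrow> L2_inner T (L2_riesz_rep T \<phi>) h = \<phi> h"
proof -
 interpret U: semi_hilbert "L2 T :: (real \<Rightarrow> 'u) set" "L2_inner T"
  by (rule semi_hilbert_L2[of _ _ 1 1])
    (simp_all add: L2_inner_add_left L2_inner_self, rule L2_inner_commute)
 note l = bounded_linear_on_functional[OF \<phi>]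
 obtain c where c: "0 \<le> c" "\<And>h. h \<in> L2 T \<Longrightarrow> \<bar>\<phi> h\<bar> \<le> c * L2norm T h" using l(3) by blast
 have "\<exists>g\<in>L2 T. \<forall>h\<in>L2 T. L2_inner T g h = \<phi> h"
  by (rule U.riesz[OF l(1,2), of c]) (use c(2) in \<open>simp_all add: L2_inner_self\<close>)
 then have "\<exists>g. g \<in> L2 T \<and> (\<forall>h\<in>L2 T. \<phi> h = L2_inner T g h)" by auto
 from someI_ex[OF this] show "L2_riesz_rep T \<phi> \<in> L2 T" "h \<in> L2 T \<Longrightarrow> L2_inner T (L2_riesz_rep T \<phi>) h = \<phi> h"
  unfolding L2_riesz_rep_def by auto
qed

locale ocp_solution =
 fixes P :: "('v::{banach,second_countable_topology}, 'h::{real_inner,banach}, 'u::{real_inner,banach}) ocp"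
  and T :: real and x :: "real \<Rightarrow> 'v" and u :: "real \<Rightarrow> 'u" and lam :: "real \<Rightarrow> 'v"
  and C :: "(real \<Rightarrow> 'v) \<Rightarrow> (real \<Rightarrow> 'y::{real_inner,banach})"
  and R :: "(real \<Rightarrow> 'u) \<Rightarrow> (real \<Rightarrow> 'u)"
  and KC :: "(real \<Rightarrow> 'y) \<Rightarrow> (real \<Rightarrow> 'v \<Rightarrow>\<^sub>L real)"
  and KB :: "(real \<Rightarrow> 'v) \<Rightarrow> (real \<Rightarrow> 'u)"
  and \<alpha> \<kappa> :: real
 assumes horizon: "0 < T" and coercivity: "0 < \<alpha>" and normalized: "norm (emb P) \<le> 1"
  and problem: "ocp_assms P T" and optimal: "optimal_solution P T x u"
  and factorized: "assumption_S P T \<alpha> \<kappa> x u lam C R KC KB"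
begin

sublocale lq_system "emb P" T "A_deriv P x" "B_op P" C R KC KB \<alpha> \<kappa>
proof
 show "closure (range (blinfun_apply (emb P))) = UNIV" using problem by (simp add: ocp_assms_def gelfand_triple_def)
 show "L2_operator T (B_op P)" by (rule B_op_operator)
qed (use horizon coercivity factorized in \<open>simp_all add: assumption_S_def\<close>)

lemma xu: "(x, u) \<in> XU T"
 using optimal by (auto simp: optimal_solution_def admissible_def XU_def intro: W_L2)

lemma M_op_eq: "M_op P T x u C = system_op"
proof -
 have uu: "deriv_uu T (cost P T) (x, u) q k = L2_inner T (R q) (R k)" if "q \<in> L2 T" "k \<in> L2 T" for q k
  using factorized that by (simp add: assumption_S_def)
 have "Juu_inv P T x u (\<lambda>k. L2_pair T (B_op P k) z) = control z" for z
 proof -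
  have "(q \<in> L2 T \<and> (\<forall>k\<in>L2 T. deriv_uu T (cost P T) (x, u) q k = L2_pair T (B_op P k) z))
   \<longleftrightarrow> (q \<in> L2 T \<and> (\<forall>k\<in>L2 T. L2_inner T (R q) (R k) = L2_pair T (B_op P k) z))" for q
   using uu by auto
  then show ?thesis unfolding Juu_inv_def control_def by simp
 qed
 moreover have "adj_form v z = (\<lambda>h. L2_inner T (C v) (C h) - L2_pair T (wderiv (emb P) T z) h - L2_pair T (A_deriv P x h) z)" for v z
  by (rule ext) (rule adj_form_def)
 ultimately show ?thesis
  by (simp add: M_op_def system_op_def adj_row_def state_row_def)
qed

lemma M_inverse:
 shows "invertible_on (WW (emb P) T) (WWnorm (emb P) T) (RHS T) (RHSnorm T) (M_op P T x u C)"
  and "bounded_linear_on (RHS T) (RHSnorm T) (WW (emb P) T) (WWnorm (emb P) T) (M_inv P T x u C)"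
  and "M_inv_norm P T x u C \<le> 4 * solution_const \<alpha> \<kappa>"
  and "a \<in> WW (emb P) T \<Longrightarrow> WWnorm (emb P) T a \<le> M_inv_norm P T x u C * RHSnorm T (system_op a)"
proof -
 have K: "0 \<le> 4 * solution_const \<alpha> \<kappa>" using solution_const_nonneg[OF \<alpha> \<kappa>] by simp
 note i = inverse_on_bounded[OF WW_seminormed RHS_seminormed system_op_invertible K system_op_estimate]
 show "invertible_on (WW (emb P) T) (WWnorm (emb P) T) (RHS T) (RHSnorm T) (M_op P T x u C)"
  unfolding M_op_eq by (rule system_op_invertible)
 show "bounded_linear_on (RHS T) (RHSnorm T) (WW (emb P) T) (WWnorm (emb P) T) (M_inv P T x u C)"
  unfolding M_inv_def M_op_eq by (rule i(1))
 show "M_inv_norm P T x u C \<le> 4 * solution_const \<alpha> \<kappa>"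
  unfolding M_inv_norm_def M_inv_def M_op_eq by (rule i(2))
 show "WWnorm (emb P) T a \<le> M_inv_norm P T x u C * RHSnorm T (system_op a)" if "a \<in> WW (emb P) T"
  unfolding M_inv_norm_def M_inv_def M_op_eq by (rule i(3)[OF _ that])
qed

lemma L2norm_eq_if_pairs_eq:
 assumes f: "f \<in> L2 T" and g: "g \<in> L2 T" and eq: "\<And>h. h \<in> L2 T \<Longrightarrow> L2_pair T f h = L2_pair T g (h :: real \<Rightarrow> 'v)"
 shows "L2norm T f = L2norm T g"
proof -
 have "AE t in MT T. f t = g t" by (rule L2_eq_if_pairs_eq[OF f g eq])
 then have "AE t in MT T. norm (f t) = norm (g t)" by eventually_elim simp
 then show ?thesis by (rule L2norm_cong_AE)
qed

abbreviation grad_x where "grad_x \<equiv> L2_dual_rep T (deriv_x T (cost P T) (x, u))"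
abbreviation grad_u where "grad_u \<equiv> L2_riesz_rep T (deriv_u T (cost P T) (x, u))"

lemmas grad_x = dual_rep_some[OF deriv_cost_bounded(1)[OF problem xu]]
lemmas grad_u = riesz_rep_some[OF deriv_cost_bounded(2)[OF problem xu]]

end

locale weighted_solution = ocp_solution +
 fixes \<tau> \<mu> :: real and v q z
 assumes \<tau>: "\<tau> \<le> T" and \<mu>: "0 < \<mu>" and sol: "solves_system P T \<tau> x u lam v q z"
begin

abbreviation w :: "real \<Rightarrow> real" where "w \<equiv> \<lambda>t. exp (\<mu> * t)"
abbreviation wv where "wv \<equiv> exp_weight \<mu> v"
abbreviation wq where "wq \<equiv> exp_weight \<mu> q"
abbreviation wz where "wz \<equiv> exp_weight \<mu> z"
definition cut :: "real \<Rightarrow> real" where "cut t = exp (\<mu> * t) * indicator {0..\<tau>} t"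

lemma wdef: "wv = (\<lambda>t. w t *\<^sub>R v t)" "wq = (\<lambda>t. w t *\<^sub>R q t)" "wz = (\<lambda>t. w t *\<^sub>R z t)"
 by (simp_all add: exp_weight_def)

lemma sol_mem: "v \<in> W (emb P) T" "z \<in> W (emb P) T" "q \<in> L2 T" "time_eval (emb P) T T z = 0" "time_eval (emb P) T 0 v = 0"
 using sol by (simp_all add: solves_system_def)

lemma weighted_mem: "wv \<in> W (emb P) T" "wz \<in> W (emb P) T" "wq \<in> L2 T"
 unfolding wdef by (rule W_smooth_mult(1)[OF smooth_exp sol_mem(1)] W_smooth_mult(1)[OF smooth_exp sol_mem(2)]
   L2_smooth_mult[OF smooth_exp sol_mem(3)])+

lemma test_mem: "h \<in> L2 T \<Longrightarrow> (\<lambda>t. w t *\<^sub>R h t) \<in> L2 T"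
 by (rule L2_smooth_mult[OF smooth_exp])

lemma cut_L2: "g \<in> L2 T \<Longrightarrow> (\<lambda>t. cut t *\<^sub>R g t) \<in> L2 T"
 using test_mem[OF L2_restrict[of "{0..\<tau>}" g T]] by (simp add: cut_def)

lemma cut_norm:
 assumes "g \<in> L2 T"
 shows "L2norm T (\<lambda>t. cut t *\<^sub>R g t) \<le> exp (\<mu> * \<tau>) * L2norm \<tau> g"
proof -
 have "L2norm T (\<lambda>t. cut t *\<^sub>R g t) \<le> exp (\<mu> * \<tau>) * L2norm T (\<lambda>t. indicator {0..\<tau>} t *\<^sub>R g t)"
 proof (rule L2norm_mono_AE)
  show "(\<lambda>t. indicator {0..\<tau>} t *\<^sub>R g t) \<in> L2 T" by (rule L2_restrict[OF _ assms]) simp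
  show "AE t in MT T. norm (cut t *\<^sub>R g t) \<le> exp (\<mu> * \<tau>) * norm (indicator {0..\<tau>} t *\<^sub>R g t)"
   using \<mu> by (intro AE_I2) (auto simp: cut_def indicator_def intro!: mult_right_mono)
 qed simp
 then show ?thesis by (simp add: L2norm_indicator[OF \<tau>])
qed

lemma wderiv_weighted:
 assumes "y \<in> W (emb P) T"
 shows "AE t in MT T. wderiv (emb P) T (exp_weight \<mu> y) t
  = w t *\<^sub>R wderiv (emb P) T y t + \<mu> *\<^sub>R emb_dual (emb P) (emb P (exp_weight \<mu> y t))"
proof -
 have d: "deriv w t = \<mu> * w t" for t
  by (rule DERIV_imp_deriv) (auto intro!: derivative_eq_intros)
 have e: "emb_dual (emb P) (emb P (exp_weight \<mu> y t)) = w t *\<^sub>R emb_dual (emb P) (emb P (y t))" for t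
  by (simp add: exp_weight_def blinfun.scaleR_right linear_scale[OF bounded_linear.linear[OF bounded_linear_emb_dual]])
 show ?thesis
  using W_smooth_mult(2)[OF smooth_exp[of \<mu>] assms] unfolding exp_weight_def[symmetric] d e
  by eventually_elim (simp add: exp_weight_def)
qed

lemma emb_L2: "y \<in> L2 T \<Longrightarrow> (\<lambda>t. emb_dual (emb P) (emb P (y t))) \<in> L2 T"
 by (rule L2_emb_dual)

lemma emb_norm: "y \<in> L2 T \<Longrightarrow> L2norm T (\<lambda>t. emb_dual (emb P) (emb P (y t))) \<le> L2norm T y"
 using L2norm_mono_AE[of y T "\<lambda>t. emb_dual (emb P) (emb P (y t))" 1] norm_emb_dual_le[OF normalized] by simp

text \<open>Testing the adjoint row with \<open>e\<^sup>\<mu>\<^sup>t h\<close> moves the weight onto the solution: the forms \<open>L\<^sub>x\<^sub>x\<close>, \<open>A'(x)\<close> are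
 local in time. Only the time derivative does not commute with the weight.\<close>

lemma weighted_adj_row:
 "L2norm T (adj_row wv wz) = L2norm T ((- 1) *\<^sub>R (\<lambda>t. cut t *\<^sub>R grad_x t)
  + (- \<mu>) *\<^sub>R (\<lambda>t. emb_dual (emb P) (emb P (wz t))))"
proof (rule L2norm_eq_if_pairs_eq[OF adj_row(1)[OF weighted_mem(1,2)]])
 let ?e = "\<lambda>t. emb_dual (emb P) (emb P (wz t))" and ?g = "\<lambda>t. cut t *\<^sub>R grad_x t"
 have C2: "C2_frechet (Abar P)" using problem by (simp add: ocp_assms_def)
 note g = cut_L2[OF grad_x(1)] and e = emb_L2[OF W_L2[OF weighted_mem(2)]]
 show "(- 1) *\<^sub>R ?g + (- \<mu>) *\<^sub>R ?e \<in> L2 T" by (intro L2_add L2_scaleR g e)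
 fix h assume h: "h \<in> (L2 T :: (real \<Rightarrow> 'a) set)"
 let ?h = "\<lambda>t. w t *\<^sub>R h t"
 have h': "?h \<in> L2 T" by (rule test_mem[OF h])
 have Lxx: "L_xx P T x u lam a b = L2_inner T (C a) (C b)" if "a \<in> L2 T" "b \<in> L2 T" for a b
  using factorized that by (simp add: assumption_S_def)
 have 1: "L2_inner T (C wv) (C h) = L2_inner T (C v) (C ?h)"
  using deriv_xx_local[OF problem xu smooth_exp W_L2[OF sol_mem(1)] h]
   Lxx[OF W_L2[OF weighted_mem(1)] h] Lxx[OF W_L2[OF sol_mem(1)] h']
  by (simp add: L_xx_def wdef A_deriv2_local[OF C2])
 have 2: "L2_pair T (A_deriv P x ?h) z = L2_pair T (A_deriv P x h) wz"
  by (simp add: A_deriv_local[OF C2] L2_pair_def wdef blinfun.scaleR_left blinfun.scaleR_right)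
 have 3: "L2_pair T (wderiv (emb P) T wz) h = L2_pair T (wderiv (emb P) T z) ?h + \<mu> * L2_pair T ?e h"
 proof -
  let ?d = "\<lambda>t. w t *\<^sub>R wderiv (emb P) T z t"
  have d: "?d \<in> L2 T" by (rule L2_smooth_mult[OF smooth_exp wderiv_L2[OF sol_mem(2)]])
  have "AE t in MT T. wderiv (emb P) T wz t = (?d + \<mu> *\<^sub>R ?e) t"
   using wderiv_weighted[OF sol_mem(2)] by (simp add: scaleR_fun_def)
  then have "L2_pair T (wderiv (emb P) T wz) h = L2_pair T (?d + \<mu> *\<^sub>R ?e) h"
   by (rule L2_pair_cong_AE[OF _ wderiv_L2[OF weighted_mem(2)] h])
  also have "\<dots> = L2_pair T ?d h + L2_pair T (\<mu> *\<^sub>R ?e) h"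
   by (rule L2_pair_add_left[OF d L2_scaleR[OF e] h])
  also have "L2_pair T ?d h = L2_pair T (wderiv (emb P) T z) ?h"
   by (simp add: L2_pair_def blinfun.scaleR_left blinfun.scaleR_right)
  finally show ?thesis by simp
 qed
 have 4: "L2_inner T (C v) (C ?h) - L2_pair T (wderiv (emb P) T z) ?h - L2_pair T (A_deriv P x ?h) z
   = - L2_pair T ?g h"
 proof -
  have ih: "(\<lambda>t. indicator {0..\<tau>} t *\<^sub>R ?h t) \<in> L2 T" by (rule L2_restrict[OF _ h']) simp
  have "L_xx P T x u lam v ?h - L2_pair T (wderiv (emb P) T z) ?h - L2_pair T (A_deriv P x ?h) z
    = - deriv_x T (cost P \<tau>) (x, u) ?h"
   using sol h' by (simp add: solves_system_def)
  also have "deriv_x T (cost P \<tau>) (x, u) ?h = L2_pair T grad_x (\<lambda>t. indicator {0..\<tau>} t *\<^sub>R ?h t)"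
   using deriv_cost_truncated(1)[OF problem xu \<tau> h'] grad_x(2)[OF ih] by simp
  also have "\<dots> = L2_pair T ?g h"
   by (simp add: L2_pair_def cut_def blinfun.scaleR_left blinfun.scaleR_right mult_ac)
  finally show ?thesis using Lxx[OF W_L2[OF sol_mem(1)] h'] by simp
 qed
 have "L2_pair T ((- 1) *\<^sub>R ?g + (- \<mu>) *\<^sub>R ?e) h = L2_pair T ((- 1) *\<^sub>R ?g) h + L2_pair T ((- \<mu>) *\<^sub>R ?e) h"
  by (rule L2_pair_add_left[OF L2_scaleR[OF g] L2_scaleR[OF e] h])
 also have "\<dots> = - L2_pair T ?g h - \<mu> * L2_pair T ?e h" by (simp only: L2_pair_scaleR_left)
 finally show "L2_pair T (adj_row wv wz) h = L2_pair T ((- 1) *\<^sub>R ?g + (- \<mu>) *\<^sub>R ?e) h"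
  unfolding adj_row(2)[OF weighted_mem(1,2) h] adj_form_def using 1 2 3 4 by linarith
qed

text \<open>The weighted control differs from the control that belongs to the weighted adjoint state because of
 the perturbation in the control row only: \<open>J\<^sub>u\<^sub>u\<close> and \<open>B\<close> commute with the weight.\<close>

definition defect where "defect = wq + (- 1) *\<^sub>R control wz"

lemma defect_L2: "defect \<in> L2 T"
 unfolding defect_def by (intro L2_add weighted_mem L2_scaleR control_L2[OF W_L2[OF weighted_mem(2)]])

lemma defect_norm: "L2norm T defect \<le> exp (\<mu> * \<tau>) / \<alpha>\<^sup>2 * L2norm \<tau> grad_u"
proof -
 let ?g = "\<lambda>t. cut t *\<^sub>R grad_u t"
 note g = cut_L2[OF grad_u(1)] and c = control_L2[OF W_L2[OF weighted_mem(2)]]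
 have uu: "deriv_uu T (cost P T) (x, u) a b = L2_inner T (R a) (R b)" if "a \<in> L2 T" "b \<in> L2 T" for a b
  using factorized that by (simp add: assumption_S_def)
 have "L2_inner T (R defect) (R k) = - L2_inner T ?g k" if k: "k \<in> L2 T" for k
 proof -
  let ?k = "\<lambda>t. w t *\<^sub>R k t"
  have k': "?k \<in> L2 T" by (rule test_mem[OF k])
  have ik: "(\<lambda>t. indicator {0..\<tau>} t *\<^sub>R ?k t) \<in> L2 T" by (rule L2_restrict[OF _ k']) simp
  have 1: "L2_inner T (R wq) (R k) = deriv_uu T (cost P T) (x, u) q ?k"
   using deriv_uu_local[OF problem xu smooth_exp sol_mem(3) k] uu[OF weighted_mem(3) k]
   by (simp add: wdef)
  have 2: "deriv_uu T (cost P T) (x, u) q ?k - L2_pair T (B_op P ?k) z = - deriv_u T (cost P \<tau>) (x, u) ?k"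
   using sol k' by (simp add: solves_system_def)
  have 3: "deriv_u T (cost P \<tau>) (x, u) ?k = L2_inner T grad_u (\<lambda>t. indicator {0..\<tau>} t *\<^sub>R ?k t)"
   using deriv_cost_truncated(2)[OF problem xu \<tau> k'] grad_u(2)[OF ik] by simp
  have 4: "L2_inner T grad_u (\<lambda>t. indicator {0..\<tau>} t *\<^sub>R ?k t) = L2_inner T ?g k"
   by (simp add: L2_inner_def cut_def mult_ac)
  have 5: "L2_pair T (B_op P ?k) z = L2_pair T (B_op P k) wz"
   by (simp add: L2_pair_def B_op_def wdef blinfun.scaleR_left blinfun.scaleR_right)
  have "L2_inner T (R defect) (R k) = L2_inner T (R wq) (R k) + L2_inner T (R ((- 1) *\<^sub>R control wz)) (R k)"
   unfolding defect_def by (rule L2_operator_inner_add[OF R(1) op_L2(4)[OF k] weighted_mem(3) L2_scaleR[OF c]])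
  moreover have "L2_inner T (R ((- 1) *\<^sub>R control wz)) (R k) = - 1 * L2_inner T (R (control wz)) (R k)"
   by (rule L2_operator_inner_scaleR[OF R(1) op_L2(4)[OF k] c])
  ultimately show ?thesis using 1 2 3 4 5 control_eq[OF W_L2[OF weighted_mem(2)] k] by linarith
 qed
 then have "L2norm T defect \<le> L2norm T ?g / \<alpha>\<^sup>2"
  by (rule control_bound[OF defect_L2]) (use L2_inner_bound[OF g] in simp_all)
 also have "\<dots> \<le> exp (\<mu> * \<tau>) * L2norm \<tau> grad_u / \<alpha>\<^sup>2"
  by (rule divide_right_mono[OF cut_norm[OF grad_u(1)]]) simp
 finally show ?thesis by simp
qed

lemma weighted_state_row:
 "L2norm T (state_row wv wz) = L2norm T (B_op P defect + \<mu> *\<^sub>R (\<lambda>t. emb_dual (emb P) (emb P (wv t))))"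
proof (rule L2norm_cong_AE)
 have C2: "C2_frechet (Abar P)" using problem by (simp add: ocp_assms_def)
 have "AE t in MT T. wderiv (emb P) T v t - A_deriv P x v t - B_op P q t = 0"
  using sol by (simp add: solves_system_def)
 then show "AE t in MT T. norm (state_row wv wz t)
   = norm ((B_op P defect + \<mu> *\<^sub>R (\<lambda>t. emb_dual (emb P) (emb P (wv t)))) t)"
  using wderiv_weighted[OF sol_mem(1)]
 proof eventually_elim
  case (elim t)
  have 1: "wderiv (emb P) T v t = A_deriv P x v t + B_op P q t" using elim(1) by (simp add: algebra_simps)
  have 2: "A_deriv P x wv t = w t *\<^sub>R A_deriv P x v t" unfolding wdef by (simp add: A_deriv_local[OF C2])
  have 3: "B_op P defect t = w t *\<^sub>R B_op P q t - B_op P (control wz) t"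
   by (simp add: B_op_def defect_def wdef blinfun.scaleR_right blinfun.diff_right)
  have "state_row wv wz t = (B_op P defect + \<mu> *\<^sub>R (\<lambda>t. emb_dual (emb P) (emb P (wv t)))) t"
   by (simp add: state_row_def elim(2) 1 2 3 scaleR_fun_def scaleR_add_right)
  then show ?case by simp
 qed
qed

text \<open>The right-hand side that belongs to the weighted solution is \<open>r + \<mu> F (wv, wz)\<close>. The part \<open>r\<close> comes from
 the gradients on \<open>[0,\<tau>]\<close>, where the weight is at most \<open>e\<^sup>\<mu>\<^sup>\<tau>\<close>. The operator
 \<open>F (v, z) = (-z, 0, v, 0)\<close> has norm at most one because the embedding of \<open>V\<close> into \<open>H\<close> does.\<close>

lemma weighted_residual:
 "RHSnorm T (system_op (wv, wz))
  \<le> exp (\<mu> * \<tau>) * (1 + \<kappa> / \<alpha>\<^sup>2) * (L2norm \<tau> grad_x + L2norm \<tau> grad_u) + \<mu> * WWnorm (emb P) T (wv, wz)"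
proof -
 interpret rhs: seminormed "RHS T :: ((real \<Rightarrow> 'a \<Rightarrow>\<^sub>L real) \<times> 'b \<times> (real \<Rightarrow> 'a \<Rightarrow>\<^sub>L real) \<times> 'b) set" "RHSnorm T"
  by (rule RHS_seminormed)
 let ?g = "\<lambda>t. cut t *\<^sub>R grad_x t"
 let ?ev = "\<lambda>t. emb_dual (emb P) (emb P (wv t))" and ?ez = "\<lambda>t. emb_dual (emb P) (emb P (wz t))"
 note g = cut_L2[OF grad_x(1)]
 note ev = emb_L2[OF W_L2[OF weighted_mem(1)]] and ez = emb_L2[OF W_L2[OF weighted_mem(2)]]
 have T0: "0 \<in> {0..T}" "T \<in> {0..T}" using T by auto
 have bd: "time_eval (emb P) T T wz = 0" "time_eval (emb P) T 0 wv = 0"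
  unfolding wdef using time_eval_smooth_mult[OF T smooth_exp sol_mem(2) T0(2)]
   time_eval_smooth_mult[OF T smooth_exp sol_mem(1) T0(1)] by (simp_all add: sol_mem)
 let ?a = "((- 1) *\<^sub>R ?g, 0 :: 'b, B_op P defect, 0 :: 'b)" and ?b = "((- \<mu>) *\<^sub>R ?ez, 0 :: 'b, \<mu> *\<^sub>R ?ev, 0 :: 'b)"
 have m: "?a \<in> RHS T" "?b \<in> RHS T"
  using L2_scaleR[OF g, of "- 1"] L2_scaleR[OF ez, of "- \<mu>"] L2_scaleR[OF ev, of \<mu>] defect_L2 by (simp_all add: RHS_def)
 have "RHSnorm T (system_op (wv, wz)) = RHSnorm T (?a + ?b)"
  using weighted_adj_row weighted_state_row by (simp add: RHSnorm_def system_op_def bd)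
 also have "\<dots> \<le> RHSnorm T ?a + RHSnorm T ?b" by (rule rhs.p_add[OF m])
 also have "RHSnorm T ?a \<le> exp (\<mu> * \<tau>) * (1 + \<kappa> / \<alpha>\<^sup>2) * (L2norm \<tau> grad_x + L2norm \<tau> grad_u)"
 proof -
  have "L2norm T (B_op P defect) \<le> \<kappa> * (exp (\<mu> * \<tau>) / \<alpha>\<^sup>2 * L2norm \<tau> grad_u)"
   using op_le(2)[OF defect_L2] mult_left_mono[OF defect_norm \<kappa>] by linarith
  moreover have "L2norm T ((- 1) *\<^sub>R ?g) \<le> exp (\<mu> * \<tau>) * L2norm \<tau> grad_x"
   unfolding L2norm_scaleR using cut_norm[OF grad_x(1)] by simp
  moreover have "RHSnorm T ?a \<le> L2norm T ((- 1) *\<^sub>R ?g) + L2norm T (B_op P defect)"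
   using RHSnorm_le_sum[of T "(- 1) *\<^sub>R ?g" "0 :: 'b" "B_op P defect" "0 :: 'b"] by simp
  moreover have "exp (\<mu> * \<tau>) * L2norm \<tau> grad_x + \<kappa> * (exp (\<mu> * \<tau>) / \<alpha>\<^sup>2 * L2norm \<tau> grad_u)
    + (exp (\<mu> * \<tau>) * (\<kappa> / \<alpha>\<^sup>2) * L2norm \<tau> grad_x + exp (\<mu> * \<tau>) * L2norm \<tau> grad_u)
   = exp (\<mu> * \<tau>) * (1 + \<kappa> / \<alpha>\<^sup>2) * (L2norm \<tau> grad_x + L2norm \<tau> grad_u)"
   by (simp add: algebra_simps)
  moreover have "0 \<le> exp (\<mu> * \<tau>) * (\<kappa> / \<alpha>\<^sup>2) * L2norm \<tau> grad_x" "0 \<le> exp (\<mu> * \<tau>) * L2norm \<tau> grad_u"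
   using \<kappa> by simp_all
  ultimately show ?thesis by linarith
 qed
 also have "RHSnorm T ?b \<le> \<mu> * WWnorm (emb P) T (wv, wz)"
 proof -
  have e: "L2norm T ?ez \<le> Wnorm (emb P) T wz" "L2norm T ?ev \<le> Wnorm (emb P) T wv"
   using emb_norm[OF W_L2[OF weighted_mem(2)]] emb_norm[OF W_L2[OF weighted_mem(1)]]
    Wnorm_bounds(1)[OF T, where v = wz and \<iota> = "emb P"] Wnorm_bounds(1)[OF T, where v = wv and \<iota> = "emb P"] by linarith+
  have "RHSnorm T ?b = sqrt (\<mu>\<^sup>2 * ((L2norm T ?ev)\<^sup>2 + (L2norm T ?ez)\<^sup>2))"
   by (simp add: RHSnorm_def L2norm_scaleR power_mult_distrib distrib_left add.commute del: scaleR_minus_left)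
  also have "\<dots> = \<mu> * sqrt ((L2norm T ?ev)\<^sup>2 + (L2norm T ?ez)\<^sup>2)" using \<mu> by (simp add: real_sqrt_mult)
  also have "\<dots> \<le> \<mu> * sqrt ((Wnorm (emb P) T wv)\<^sup>2 + (Wnorm (emb P) T wz)\<^sup>2)"
   using \<mu> by (intro mult_left_mono real_sqrt_le_mono add_mono power_mono e) simp_all
  finally show ?thesis by (simp add: WWnorm_def)
 qed
 finally show ?thesis by simp
qed

lemma weighted_control_norm:
 "L2norm T wq \<le> \<kappa> / \<alpha>\<^sup>2 * WWnorm (emb P) T (wv, wz) + exp (\<mu> * \<tau>) / \<alpha>\<^sup>2 * L2norm \<tau> grad_u"
proof -
 note c = control_L2[OF W_L2[OF weighted_mem(2)]]
 have "wq = defect + control wz" by (simp add: defect_def)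
 then have "L2norm T wq \<le> L2norm T defect + L2norm T (control wz)" using L2norm_add[OF defect_L2 c] by simp
 moreover have "L2norm T wz \<le> WWnorm (emb P) T (wv, wz)"
  using Wnorm_bounds(1)[OF T, where v = wz and \<iota> = "emb P"] WWnorm_bounds(3)[of "emb P" T wz wv] by linarith
 then have "\<kappa> / \<alpha>\<^sup>2 * L2norm T wz \<le> \<kappa> / \<alpha>\<^sup>2 * WWnorm (emb P) T (wv, wz)" by (rule mult_left_mono) (simp add: \<kappa>)
 ultimately show ?thesis using defect_norm control_norm[OF W_L2[OF weighted_mem(2)]] by simp
qed

text \<open>As \<open>\<mu> K < 1\<close>, the term \<open>\<mu> F (wv, wz)\<close> can be absorbed into the left-hand side.\<close>

lemma weighted_estimate:
 assumes K: "M_inv_norm P T x u C \<le> K" and \<mu>K: "\<mu> * K < 1"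
 shows "WUWnorm (emb P) T (wv, wq, wz)
  \<le> ((1 + \<bar>\<kappa>\<bar> / \<alpha>\<^sup>2) * (K * (exp (\<mu> * \<tau>) * (1 + \<bar>\<kappa>\<bar> / \<alpha>\<^sup>2)) / (1 - \<mu> * K)) + exp (\<mu> * \<tau>) / \<alpha>\<^sup>2)
   * (L2norm \<tau> grad_x + L2norm \<tau> grad_u)"
proof -
 let ?X = "WWnorm (emb P) T (wv, wz)" and ?G = "L2norm \<tau> grad_x + L2norm \<tau> grad_u"
 let ?k = "1 + \<kappa> / \<alpha>\<^sup>2" and ?e = "exp (\<mu> * \<tau>)"
 let ?rho = "?e * ?k * ?G"
 have k: "0 \<le> ?k" using \<kappa> by simp
 have X: "0 \<le> ?X" by (rule seminormed.p_nonneg[OF WW_seminormed])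
 have r: "0 \<le> RHSnorm T (system_op (wv, wz))" by (rule seminormed.p_nonneg[OF RHS_seminormed])
 have mem: "(wv, wz) \<in> WW (emb P) T" using weighted_mem by (simp add: WW_def)
 have "M_inv_norm P T x u C * RHSnorm T (system_op (wv, wz)) \<le> K * RHSnorm T (system_op (wv, wz))"
  by (rule mult_right_mono[OF K r])
 moreover have K0: "0 \<le> K"
 proof -
  have "0 \<le> M_inv_norm P T x u C"
   unfolding M_inv_norm_def by (rule op_norm_nonneg) (use M_inverse(2) in \<open>simp add: bounded_linear_on_def\<close>)
  then show ?thesis using K by linarith
 qed
 moreover have "K * RHSnorm T (system_op (wv, wz)) \<le> K * (?rho + \<mu> * ?X)"
  by (rule mult_left_mono[OF weighted_residual K0])
 ultimately have "?X \<le> K * (?rho + \<mu> * ?X)" using M_inverse(4)[OF mem] by linarith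
 then have "(1 - \<mu> * K) * ?X \<le> K * ?rho" by (simp add: algebra_simps)
 then have X1: "?X \<le> K * (?e * ?k) / (1 - \<mu> * K) * ?G" using \<mu>K by (simp add: field_simps)
 have "WUWnorm (emb P) T (wv, wq, wz) \<le> ?X + L2norm T wq"
 proof -
  have "(L2norm T wq)\<^sup>2 \<le> 2 * ?X * L2norm T wq + (L2norm T wq)\<^sup>2" using X by simp
  moreover have "?X\<^sup>2 = (Wnorm (emb P) T wv)\<^sup>2 + (Wnorm (emb P) T wz)\<^sup>2" by (simp add: WWnorm_def)
  ultimately show ?thesis unfolding WUWnorm_def using X
   by (auto intro!: real_le_lsqrt simp: power2_sum)
 qed
 also have "\<dots> \<le> ?k * ?X + ?e / \<alpha>\<^sup>2 * L2norm \<tau> grad_u" using weighted_control_norm by (simp add: algebra_simps)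
 also have "\<dots> \<le> ?k * (K * (?e * ?k) / (1 - \<mu> * K) * ?G) + ?e / \<alpha>\<^sup>2 * ?G"
  by (intro add_mono mult_left_mono[OF X1 k] mult_left_mono) simp_all
 also have "\<dots> = (?k * (K * (?e * ?k) / (1 - \<mu> * K)) + ?e / \<alpha>\<^sup>2) * ?G"
  by (simp only: distrib_right[of _ _ ?G] mult.assoc)
 finally show ?thesis unfolding abs_of_nonneg[OF \<kappa>] .
qed

end

theorem theorem2:
 fixes P :: "('v::{banach,second_countable_topology}, 'h::{real_inner,banach},
        'u::{real_inner,banach}) ocp"
  and Ts :: "real set"
  and x lam :: "real \<Rightarrow> real \<Rightarrow> 'v"
  and u :: "real \<Rightarrow> real \<Rightarrow> 'u"
  and C :: "real \<Rightarrow> (real \<Rightarrow> 'v) \<Rightarrow> (real \<Rightarrow> 'y::{real_inner,banach})"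
  and R :: "real \<Rightarrow> (real \<Rightarrow> 'u) \<Rightarrow> (real \<Rightarrow> 'u)"
  and KC :: "real \<Rightarrow> (real \<Rightarrow> 'y) \<Rightarrow> (real \<Rightarrow> 'v \<Rightarrow>\<^sub>L real)"
  and KB :: "real \<Rightarrow> (real \<Rightarrow> 'v) \<Rightarrow> (real \<Rightarrow> 'u)"
  and \<alpha> \<kappa> :: real
 assumes horizons: "Ts \<subseteq> {0<..}"
  and embedding_normalized: "norm (emb P) \<le> 1"
  and problem: "\<And>T. T \<in> Ts \<Longrightarrow> ocp_assms P T"
  and optimal: "\<And>T. T \<in> Ts \<Longrightarrow> optimal_solution P T (x T) (u T)"
  and adjoint: "\<And>T. T \<in> Ts \<Longrightarrow> adjoint_state P T (x T) (u T) (lam T)"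
  and alpha: "\<alpha> > 0"
  and S: "\<And>T. T \<in> Ts \<Longrightarrow>
   assumption_S P T \<alpha> \<kappa> (x T) (u T) (lam T) (C T) (R T) (KC T) (KB T)"
 shows "(\<exists>K. \<forall>T\<in>Ts.
      invertible_on (WW (emb P) T) (WWnorm (emb P) T) (RHS T) (RHSnorm T)
       (M_op P T (x T) (u T) (C T)) \<and>
      bounded_linear_on (RHS T) (RHSnorm T) (WW (emb P) T) (WWnorm (emb P) T)
       (M_inv P T (x T) (u T) (C T)) \<and>
      M_inv_norm P T (x T) (u T) (C T) \<le> K) \<and>
     (\<forall>\<tau>>0. \<forall>\<mu>>0. \<mu> < 1 / (SUP T\<in>Ts. M_inv_norm P T (x T) (u T) (C T)) \<longrightarrow>
      (\<exists>c>0. \<forall>T\<in>Ts. \<tau> \<le> T \<longrightarrow> (\<forall>v q z.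
        solves_system P T \<tau> (x T) (u T) (lam T) v q z \<longrightarrow>
        WUWnorm (emb P) T (exp_weight \<mu> v, exp_weight \<mu> q, exp_weight \<mu> z)
         \<le> c * (L2norm \<tau> (L2_dual_rep T (deriv_x T (cost P T) (x T, u T)))
            + L2norm \<tau> (L2_riesz_rep T (deriv_u T (cost P T) (x T, u T)))))))"
proof -
 have sol: "ocp_solution P T (x T) (u T) (lam T) (C T) (R T) (KC T) (KB T) \<alpha> \<kappa>" if T: "T \<in> Ts" for T
  by (rule ocp_solution.intro) (use horizons alpha embedding_normalized problem optimal S T in auto)
 let ?N = "\<lambda>T. M_inv_norm P T (x T) (u T) (C T)"
 define K where "K = (SUP T\<in>Ts. ?N T)"
 have bdd: "bdd_above (?N ` Ts)"
  using ocp_solution.M_inverse(3)[OF sol] by (intro bdd_aboveI2[of _ _ "4 * solution_const \<alpha> \<kappa>"])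
 have NK: "?N T \<le> K" if "T \<in> Ts" for T
  unfolding K_def by (rule cSUP_upper[OF that bdd])
 show ?thesis
 proof (rule conjI, goal_cases)
  case 1
  show ?case
   using ocp_solution.M_inverse(1-3)[OF sol] by (intro exI[of _ "4 * solution_const \<alpha> \<kappa>"] ballI conjI)
 next
  case 2
  show ?case
  proof (intro allI impI, goal_cases)
   case (1 \<tau> \<mu>)
   note \<mu> = 1(2)
   have \<mu>K: "\<mu> < 1 / K" using 1(3) by (simp add: K_def)
   (* if the supremum vanished, then 1 / 0 = 0 would contradict the bound on \<mu> *)
   then have "0 < 1 / K" using \<mu> by linarith
   then have K0: "0 < K" by simp
   have \<mu>K1: "\<mu> * K < 1" using \<mu>K K0 by (simp add: field_simps)
   let ?c = "(1 + \<bar>\<kappa>\<bar> / \<alpha>\<^sup>2) * (K * (exp (\<mu> * \<tau>) * (1 + \<bar>\<kappa>\<bar> / \<alpha>\<^sup>2)) / (1 - \<mu> * K)) + exp (\<mu> * \<tau>) / \<alpha>\<^sup>2"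
   have "0 \<le> (1 + \<bar>\<kappa>\<bar> / \<alpha>\<^sup>2) * (K * (exp (\<mu> * \<tau>) * (1 + \<bar>\<kappa>\<bar> / \<alpha>\<^sup>2)) / (1 - \<mu> * K))"
    using K0 \<mu>K1 by (intro mult_nonneg_nonneg divide_nonneg_nonneg add_nonneg_nonneg) simp_all
   moreover have "0 < exp (\<mu> * \<tau>) / \<alpha>\<^sup>2" using alpha by simp
   ultimately have c: "0 < ?c" by linarith
   show ?case
   proof (intro exI[of _ ?c] conjI c ballI impI allI, goal_cases)
    case (1 T v q z)
    have "weighted_solution P T (x T) (u T) (lam T) (C T) (R T) (KC T) (KB T) \<alpha> \<kappa> \<tau> \<mu> v q z"
     by (intro weighted_solution.intro weighted_solution_axioms.intro sol 1 \<mu>)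
    from weighted_solution.weighted_estimate[OF this NK[OF 1(1)] \<mu>K1] show ?case .
   qed
  qed
 qed
qed

end
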